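(* Let $n\ge 2$, let $Q\in GL_n(\mathbb{C})$ be such that $Q\bar Q\in\mathbb{C} I_n$ and $Q^*Q\notin\mathbb{R} I_2$ (a condition which only excludes matrices of size $n=2$), and consider the quantum Cayley graph of $\mathcal{A}_o(Q)$, taken with the set of directions $\mathcal{D}=\{u\}$ consisting of the fundamental corepresentation. Then the operator $E_2 : K_g\to H$ is invertible. As a result there exists a unique path cocycle $c_g : \mathcal{S}\to\mathcal{K}'_g$, and it is trivial.
   Context: $\mathcal{A}_o(Q)$: the unital $*$-algebra generated by $n^2$ elements $u_{ij}$ subject to the relations making $u=(u_{ij})$ unitary and $u=Q(u_{ij}^* )_{ij}Q^{-1}$, with coproduct $\delta(u_{ij})=\sum_k u_{ik}\otimes u_{kj}$. It is a Hopf $*$-algebra (the dense Hopf algebra of a compact quantum group, or "discrete quantum group") and $u$ is its fundamental corepresentation, irreducible and self-dual. General notation. Let $\mathcal{S}$ be the Hopf $*$-algebra spanned by the coefficients of finite-dimensional unitary corepresentations of a compact quantum group (here $\mathcal{S}=\mathcal{A}_o(Q)$), with coproduct $\delta$, counit $\epsilon$, Haar state $h$. Let $\Lambda_h:\mathcal{S}\to H$ be the GNS map of $h$, $\lambda:\mathcal{S}\to B(H)$ the GNS representation (left multiplication), $\mathcal{H}=\Lambda_h(\mathcal{S})$. Let $V\in B(H\otimes H)$ be the unitary $V(\Lambda_h\otimes\Lambda_h)(x\otimes y)=(\Lambda_h\otimes\Lambda_h)(\delta(x)(1\otimes y))$, let $\Sigma$ be the flip of $H\otimes H$, and let $U=J\hat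 J\in B(H)$ be the unitary of the associated Kac system $(H,V,U)$: $J$ is the modular conjugation of $h$ and $\hat J\Lambda_h(x)=\Lambda_h(R(x)^* )$ with $R$ the unitary antipode (in the unimodular case, i.e. $h$ tracial, $U\Lambda_h(x)=\Lambda_h(\kappa(x))$ with $\kappa$ the antipode). For an irreducible finite-dimensional corepresentation $\alpha$, $p_\alpha\in B(H)$ is the orthogonal projection onto the (finite-dimensional) image by $\Lambda_h$ of the span of the coefficients of $\alpha$. Quantum Cayley graph. Let $\mathcal{D}$ be a finite set of irreducible corepresentations with $\bar{\mathcal{D}}=\mathcal{D}$ not containing the trivial one, and $p_1=\sum_{\gamma\in\mathcal{D}}p_\gamma$. Put $K=H\otimes p_1H$, on which $\mathcal{S}$ acts by $\lambda\otimes\mathrm{id}$; the reversing operator is $\Theta=\Sigma(1\otimes U)V(U\otimes U)\Sigma\in B(K)$; the bounded target and source maps $E_2,E_1:K\to H$ are given by $E_2(\Lambda_h(x)\otimes\Lambda_h(y))=\Lambda_h(xy)$ and $E_1(\Lambda_h(x)\otimes\Lambda_h(y))=\epsilon(y)\Lambda_h(x)$. Put $K_g=\ker(\Theta+\mathrm{id})\subset K$, let $p_g\in B(K)$ be the orthogonal projection onto $K_g$, $\mathcal{K}=\mathcal{H}\otimes p_1H$ (algebraic tensor product) and $\mathcal{K}'_g=p_g(\mathcal{K})$. Cocycles. A cocycle $c:\mathcal{S}\to K$ is a linear map with $c(xy)=x\cdot c(y)+c(x)\epsilon(y)$ for all $x,y\in\mathcal{S}$; it is trivial if there is $\xi\in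 K$ with $c(x)=x\cdot\xi-\xi\epsilon(x)$ for all $x$ (such $\xi$ is called a fixed vector of $c$). A path cocycle is a cocycle $c_g:\mathcal{S}\to K$ such that $c_g(\mathcal{S})\subset\mathcal{K}'_g$ and $E_2(c_g(x))=\Lambda_h(x)-\epsilon(x)\Lambda_h(1)$ for all $x\in\mathcal{S}$. *)

theory Defs
  imports "HOL-Analysis.Analysis" "HOL-Library.Poly_Mapping"
begin

section \<open>Complex vector spaces, unital *-algebras and Hilbert spaces\<close>

class scaleC =
  fixes scaleC :: "complex \<Rightarrow> 'a \<Rightarrow> 'a" (infixr "*\<^sub>C" 75)

class complex_vector = scaleC + ab_group_add +
  assumes scaleC_add_right: "c *\<^sub>C (x + y) = c *\<^sub>C x + c *\<^sub>C y"
    and scaleC_add_left: "(c + d) *\<^sub>C x = c *\<^sub>C x + d *\<^sub>C x"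
    and scaleC_scaleC: "c *\<^sub>C d *\<^sub>C x = (c * d) *\<^sub>C x"
    and scaleC_one: "1 *\<^sub>C x = x"

global_interpretation complex_vector: vector_space "scaleC :: complex \<Rightarrow> 'a \<Rightarrow> 'a::complex_vector"
  defines cspan = complex_vector.span
  by unfold_locales (simp_all add: scaleC_add_right scaleC_add_left scaleC_scaleC scaleC_one)

abbreviation clinear :: "('a::complex_vector \<Rightarrow> 'b::complex_vector) \<Rightarrow> bool" where
  "clinear \<equiv> Vector_Spaces.linear scaleC scaleC"

definition cbilinear :: "('a::complex_vector \<Rightarrow> 'b::complex_vector \<Rightarrow> 'c::complex_vector) \<Rightarrow> bool" where
  "cbilinear f \<longleftrightarrow> (\<forall>x. clinear (f x)) \<and> (\<forall>y. clinear (\<lambda>x. f x y))"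

lemma clinear_iff:
  "clinear f \<longleftrightarrow> (\<forall>x y. f (x + y) = f x + f y) \<and> (\<forall>c x. f (c *\<^sub>C x) = c *\<^sub>C f x)"
  by (simp add: Vector_Spaces.linear_iff complex_vector.vector_space_axioms)

text \<open>The distribution's \<^class>\<open>ring_1\<close> demands \<open>0 \<noteq> 1\<close>, which is not part of the notion of a unital
  algebra; hence the superclasses below.\<close>

class complex_star_algebra = complex_vector + ring + monoid_mult +
  fixes star :: "'a \<Rightarrow> 'a"
  assumes scaleC_mult_left: "(c *\<^sub>C x) * y = c *\<^sub>C (x * y)"
    and scaleC_mult_right: "x * (c *\<^sub>C y) = c *\<^sub>C (x * y)"
    and star_add: "star (x + y) = star x + star y"
    and star_scaleC: "star (c *\<^sub>C x) = cnj c *\<^sub>C star x"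
    and star_mult: "star (x * y) = star y * star x"
    and star_star: "star (star x) = x"

instantiation complex :: complex_star_algebra
begin

definition scaleC_complex :: "complex \<Rightarrow> complex \<Rightarrow> complex" where
  "scaleC_complex = (*)"

definition star_complex :: "complex \<Rightarrow> complex" where
  "star_complex = cnj"

instance
  by standard (simp_all add: scaleC_complex_def star_complex_def algebra_simps)

end

definition star_hom :: "('a::complex_star_algebra \<Rightarrow> 'b::complex_star_algebra) \<Rightarrow> bool" where
  "star_hom f \<longleftrightarrow> clinear f \<and> f 1 = 1 \<and> (\<forall>x y. f (x * y) = f x * f y) \<and> (\<forall>x. f (star x) = star (f x))"

text \<open>Inner products are linear in the second variable. Norm, metric and topology are those of the
  underlying real inner product space.\<close>

class complex_inner = complex_vector + real_inner +
  fixes cinner :: "'a \<Rightarrow> 'a \<Rightarrow> complex"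
  assumes scaleR_scaleC: "r *\<^sub>R x = complex_of_real r *\<^sub>C x"
    and cinner_add_right: "cinner x (y + z) = cinner x y + cinner x z"
    and cinner_scaleC_right: "cinner x (c *\<^sub>C y) = c * cinner x y"
    and cinner_commute: "cinner x y = cnj (cinner y x)"
    and inner_eq_Re_cinner: "inner x y = Re (cinner x y)"

class chilbert_space = complex_inner + complete_space

definition bounded_clinear :: "('h::complex_inner \<Rightarrow> 'k::complex_inner) \<Rightarrow> bool" where
  "bounded_clinear f \<longleftrightarrow> bounded_linear f \<and> clinear f"

definition orth_proj :: "'h::complex_inner set \<Rightarrow> 'h \<Rightarrow> 'h" where
  "orth_proj M x = (THE y. y \<in> M \<and> (\<forall>z\<in>M. cinner z (x - y) = 0))"

text \<open>Invertibility, with bounded inverse, of the restriction of \<open>A\<close> to an operator from \<open>M\<close> to \<open>N\<close>.\<close>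

definition invertible_op ::
    "'h::complex_inner set \<Rightarrow> 'k::complex_inner set \<Rightarrow> ('h \<Rightarrow> 'k) \<Rightarrow> bool" where
  "invertible_op M N A \<longleftrightarrow> bounded_clinear A \<and> A ` M \<subseteq> N \<and>
     (\<exists>B. bounded_clinear B \<and> B ` N \<subseteq> M \<and> (\<forall>x\<in>M. B (A x) = x) \<and> (\<forall>y\<in>N. A (B y) = y))"


section \<open>The algebraic tensor product\<close>

text \<open>The quotient of the free complex vector space on \<open>'a \<times> 'b\<close> by the bilinearity relations.\<close>

type_synonym ('a, 'b) free_pairs = "('a \<times> 'b) \<Rightarrow>\<^sub>0 complex"

inductive_set tensor_null :: "('a::complex_vector, 'b::complex_vector) free_pairs set" where
  null_zero: "0 \<in> tensor_null"
| null_add: "p \<in> tensor_null \<Longrightarrow> q \<in> tensor_null \<Longrightarrow> p + q \<in> tensor_null"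
| null_scale: "p \<in> tensor_null \<Longrightarrow> Poly_Mapping.map ((*) d) p \<in> tensor_null"
| null_left: "Poly_Mapping.single (c *\<^sub>C x + x', y) 1
    - (Poly_Mapping.single (x, y) c + Poly_Mapping.single (x', y) 1) \<in> tensor_null"
| null_right: "Poly_Mapping.single (x, c *\<^sub>C y + y') 1
    - (Poly_Mapping.single (x, y) c + Poly_Mapping.single (x, y') 1) \<in> tensor_null"

definition tensor_rel :: "('a::complex_vector, 'b::complex_vector) free_pairs \<Rightarrow> ('a, 'b) free_pairs \<Rightarrow> bool" where
  "tensor_rel p q \<longleftrightarrow> p - q \<in> tensor_null"

lemma lookup_map_times [simp]: "Poly_Mapping.lookup (Poly_Mapping.map ((*) (d::complex)) p) k = d * Poly_Mapping.lookup p k"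
  by (simp add: Poly_Mapping.map.rep_eq when_def)

lemma map_times_single: "Poly_Mapping.map ((*) (d::complex)) (Poly_Mapping.single k c) = Poly_Mapping.single k (d * c)"
  by (rule poly_mapping_eqI) (simp add: lookup_single when_def)

lemma map_times_minus1: "Poly_Mapping.map ((*) (-1::complex)) p = - p"
  by (rule poly_mapping_eqI) simp

lemma map_times_add: "Poly_Mapping.map ((*) (d::complex)) (p + q) = Poly_Mapping.map ((*) d) p + Poly_Mapping.map ((*) d) q"
  by (rule poly_mapping_eqI) (simp add: lookup_add algebra_simps)

lemma map_times_diff: "Poly_Mapping.map ((*) (d::complex)) (p - q) = Poly_Mapping.map ((*) d) p - Poly_Mapping.map ((*) d) q"
  by (rule poly_mapping_eqI) (simp add: lookup_minus algebra_simps)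

lemma null_uminus: "p \<in> tensor_null \<Longrightarrow> - p \<in> tensor_null"
  using null_scale[of p "-1"] by (simp add: map_times_minus1)

lemma null_diff: "p \<in> tensor_null \<Longrightarrow> q \<in> tensor_null \<Longrightarrow> p - q \<in> tensor_null"
  using null_add[OF _ null_uminus, of p q] by simp

lemma equivp_tensor_rel:
  "equivp (tensor_rel :: ('a::complex_vector, 'b::complex_vector) free_pairs \<Rightarrow> _)"
proof (rule equivpI)
  show "reflp tensor_rel" by (simp add: reflp_def tensor_rel_def null_zero)
  show "symp tensor_rel"
    unfolding symp_def tensor_rel_def using null_uminus by fastforce
  show "transp (tensor_rel :: ('a, 'b) free_pairs \<Rightarrow> _)"
  proof (rule transpI)
    fix p q r :: "('a, 'b) free_pairs"
    assume "tensor_rel p q" "tensor_rel q r"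
    then have "(p - q) + (q - r) \<in> tensor_null"
      unfolding tensor_rel_def by (rule null_add)
    then show "tensor_rel p r"
      by (simp add: tensor_rel_def)
  qed
qed

quotient_type (overloaded) ('a, 'b) tensor_prod =
  "('a::complex_vector, 'b::complex_vector) free_pairs" / tensor_rel
  by (rule equivp_tensor_rel)

instantiation tensor_prod :: (complex_vector, complex_vector) complex_vector
begin

lift_definition zero_tensor_prod :: "('a, 'b) tensor_prod" is 0 .

lift_definition plus_tensor_prod :: "('a, 'b) tensor_prod \<Rightarrow> ('a, 'b) tensor_prod \<Rightarrow> ('a, 'b) tensor_prod"
  is "(+)"
  unfolding tensor_rel_def using null_add by (metis add_diff_add)

lift_definition minus_tensor_prod :: "('a, 'b) tensor_prod \<Rightarrow> ('a, 'b) tensor_prod \<Rightarrow> ('a, 'b) tensor_prod"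
  is "(-)"
proof -
  fix p p' q q' :: "('a, 'b) free_pairs"
  assume "tensor_rel p p'" "tensor_rel q q'"
  then have "(p - p') - (q - q') \<in> tensor_null" by (simp add: tensor_rel_def null_diff)
  then show "tensor_rel (p - q) (p' - q')" by (simp add: tensor_rel_def algebra_simps)
qed

lift_definition uminus_tensor_prod :: "('a, 'b) tensor_prod \<Rightarrow> ('a, 'b) tensor_prod" is "uminus"
  using null_uminus by (fastforce simp: tensor_rel_def)

lift_definition scaleC_tensor_prod :: "complex \<Rightarrow> ('a, 'b) tensor_prod \<Rightarrow> ('a, 'b) tensor_prod"
  is "\<lambda>c. Poly_Mapping.map ((*) c)"
  by (simp add: tensor_rel_def null_scale flip: map_times_diff)

instance
proof
  fix a b c :: "('a, 'b) tensor_prod" and s t :: complex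
  have eq: "tensor_rel p q" if "p = q" for p q :: "('a, 'b) free_pairs"
    using that by (simp add: tensor_rel_def null_zero)
  show "a + b + c = a + (b + c)" by transfer (simp add: eq algebra_simps)
  show "a + b = b + a" by transfer (simp add: eq algebra_simps)
  show "0 + a = a" by transfer (simp add: eq)
  show "- a + a = 0" by transfer (simp add: eq)
  show "a - b = a + - b" by transfer (simp add: eq)
  show "s *\<^sub>C (a + b) = s *\<^sub>C a + s *\<^sub>C b" by transfer (simp add: eq map_times_add)
  show "(s + t) *\<^sub>C a = s *\<^sub>C a + t *\<^sub>C a"
    by transfer (rule eq, rule poly_mapping_eqI, simp add: lookup_add algebra_simps)
  show "s *\<^sub>C t *\<^sub>C a = (s * t) *\<^sub>C a"
    by transfer (rule eq, rule poly_mapping_eqI, simp add: algebra_simps)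
  show "1 *\<^sub>C a = a"
    by transfer (rule eq, rule poly_mapping_eqI, simp)
qed

end

lift_definition tensor :: "'a::complex_vector \<Rightarrow> 'b::complex_vector \<Rightarrow> ('a, 'b) tensor_prod" (infixr "\<otimes>\<^sub>a" 76)
  is "\<lambda>x y. Poly_Mapping.single (x, y) 1" .

lemma tensor_left_lin: "(c *\<^sub>C x + x') \<otimes>\<^sub>a y = c *\<^sub>C (x \<otimes>\<^sub>a y) + x' \<otimes>\<^sub>a y"
  by transfer (use null_left in \<open>simp add: tensor_rel_def map_times_single\<close>)

lemma tensor_right_lin: "x \<otimes>\<^sub>a (c *\<^sub>C y + y') = c *\<^sub>C (x \<otimes>\<^sub>a y) + x \<otimes>\<^sub>a y'"
  by transfer (use null_right in \<open>simp add: tensor_rel_def map_times_single\<close>)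

lemma tensor_add_left: "(x + x') \<otimes>\<^sub>a y = x \<otimes>\<^sub>a y + x' \<otimes>\<^sub>a y"
  using tensor_left_lin[of 1 x x' y] by (simp add: scaleC_one)

lemma tensor_add_right: "x \<otimes>\<^sub>a (y + y') = x \<otimes>\<^sub>a y + x \<otimes>\<^sub>a y'"
  using tensor_right_lin[of x 1 y y'] by (simp add: scaleC_one)

lemma tensor_zero_left [simp]: "0 \<otimes>\<^sub>a y = 0"
  using tensor_add_left[of 0 0 y] by simp

lemma tensor_zero_right [simp]: "x \<otimes>\<^sub>a 0 = 0"
  using tensor_add_right[of x 0 0] by simp

lemma tensor_scale_left: "(c *\<^sub>C x) \<otimes>\<^sub>a y = c *\<^sub>C (x \<otimes>\<^sub>a y)"
  using tensor_left_lin[of c x 0 y] by simp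

lemma tensor_scale_right: "x \<otimes>\<^sub>a (c *\<^sub>C y) = c *\<^sub>C (x \<otimes>\<^sub>a y)"
  using tensor_right_lin[of x c y 0] by simp

lemma tensor_induct [case_names tensor add, induct type: tensor_prod]:
  assumes t: "\<And>x y. P (x \<otimes>\<^sub>a y)" and a: "\<And>s t. P s \<Longrightarrow> P t \<Longrightarrow> P (s + t)"
  shows "P t"
proof -
  have "P (abs_tensor_prod p)" for p
  proof (induction p rule: Poly_Mapping.update_induct)
    case const
    have "abs_tensor_prod 0 = (0 :: 'a) \<otimes>\<^sub>a (0 :: 'b)"
      by (simp add: zero_tensor_prod_def)
    then show ?case using t by metis
  next
    case (update p k v)
    obtain x y where k: "k = (x, y)" by (cases k)
    have "abs_tensor_prod (Poly_Mapping.single k v) = v *\<^sub>C (x \<otimes>\<^sub>a y)"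
      by (simp add: k tensor.abs_eq scaleC_tensor_prod.abs_eq map_times_single)
    also have "\<dots> = (v *\<^sub>C x) \<otimes>\<^sub>a y" by (simp add: tensor_scale_left)
    finally have "P (abs_tensor_prod (Poly_Mapping.single k v))" using t by simp
    moreover have "Poly_Mapping.update k v p = Poly_Mapping.single k v + p"
      using update.hyps
      by (intro poly_mapping_eqI)
        (auto simp: Poly_Mapping.update.rep_eq lookup_add lookup_single when_def in_keys_iff)
    ultimately show ?case using a update.IH by (simp flip: plus_tensor_prod.abs_eq)
  qed
  then show ?thesis by (metis Quotient3_abs_rep Quotient3_tensor_prod)
qed

text \<open>The extension to the tensor product of a bilinear map (\<open>\<sigma> = id\<close>) or of a biantilinear map
  (\<open>\<sigma> = cnj\<close>).\<close>

definition tensor_ext ::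
    "(complex \<Rightarrow> complex) \<Rightarrow> ('a \<Rightarrow> 'b \<Rightarrow> 'c) \<Rightarrow> ('a::complex_vector, 'b::complex_vector) tensor_prod \<Rightarrow> 'c::complex_vector" where
  "tensor_ext \<sigma> f t = (let p = rep_tensor_prod t in
     \<Sum>(x, y)\<in>Poly_Mapping.keys p. \<sigma> (Poly_Mapping.lookup p (x, y)) *\<^sub>C f x y)"

abbreviation tensor_lift ::
    "('a \<Rightarrow> 'b \<Rightarrow> 'c) \<Rightarrow> ('a::complex_vector, 'b::complex_vector) tensor_prod \<Rightarrow> 'c::complex_vector" where
  "tensor_lift \<equiv> tensor_ext id"

locale tensor_extension =
  fixes \<sigma> :: "complex \<Rightarrow> complex"
    and f :: "'a::complex_vector \<Rightarrow> 'b::complex_vector \<Rightarrow> 'c::complex_vector"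
  assumes \<sigma>: "\<sigma> = id \<or> \<sigma> = cnj"
    and f_add_left: "f (x + x') y = f x y + f x' y"
    and f_add_right: "f x (y + y') = f x y + f x y'"
    and f_scale_left: "f (c *\<^sub>C x) y = \<sigma> c *\<^sub>C f x y"
    and f_scale_right: "f x (c *\<^sub>C y) = \<sigma> c *\<^sub>C f x y"
begin

lemma \<sigma>_simps [simp]: "\<sigma> 0 = 0" "\<sigma> 1 = 1" "\<sigma> (a + b) = \<sigma> a + \<sigma> b" "\<sigma> (a * b) = \<sigma> a * \<sigma> b"
    "\<sigma> (a - b) = \<sigma> a - \<sigma> b"
  using \<sigma> by auto

definition ev :: "('a, 'b) free_pairs \<Rightarrow> 'c" where
  "ev p = (\<Sum>k\<in>Poly_Mapping.keys p. \<sigma> (Poly_Mapping.lookup p k) *\<^sub>C f (fst k) (snd k))"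

lemma ev_superset:
  assumes "finite A" "Poly_Mapping.keys p \<subseteq> A"
  shows "ev p = (\<Sum>k\<in>A. \<sigma> (Poly_Mapping.lookup p k) *\<^sub>C f (fst k) (snd k))"
  unfolding ev_def using assms
  by (intro sum.mono_neutral_left) (auto simp: in_keys_iff)

lemma ev_add: "ev (p + q) = ev p + ev q"
proof -
  let ?A = "Poly_Mapping.keys p \<union> Poly_Mapping.keys q"
  have "Poly_Mapping.keys (p + q) \<subseteq> ?A" by (rule keys_add)
  then show ?thesis
    by (subst (1 2 3) ev_superset[of ?A])
      (auto simp: lookup_add scaleC_add_left sum.distrib)
qed

lemma ev_scale: "ev (Poly_Mapping.map ((*) d) p) = \<sigma> d *\<^sub>C ev p"
proof -
  have "Poly_Mapping.keys (Poly_Mapping.map ((*) d) p) \<subseteq> Poly_Mapping.keys p"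
    by (auto simp: in_keys_iff)
  then show ?thesis
    by (subst (1 2) ev_superset[of "Poly_Mapping.keys p"])
      (auto simp: scaleC_scaleC complex_vector.scale_sum_right)
qed

lemma ev_diff: "ev (p - q) = ev p - ev q"
  using ev_add[of "p - q" q] by (simp add: algebra_simps)

lemma ev_single: "ev (Poly_Mapping.single (x, y) c) = \<sigma> c *\<^sub>C f x y"
  by (subst ev_superset[of "{(x, y)}"]) (auto simp: lookup_single)

lemma ev_null: "p \<in> tensor_null \<Longrightarrow> ev p = 0"
proof (induction rule: tensor_null.induct)
  case null_zero
  show ?case by (simp add: ev_def)
next
  case (null_add p q)
  then show ?case by (simp add: ev_add)
next
  case (null_scale p d)
  then show ?case by (simp add: ev_scale)
next
  case (null_left c x x' y)
  then show ?case by (simp add: ev_diff ev_add ev_single f_add_left f_scale_left scaleC_one)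
next
  case (null_right x c y y')
  then show ?case by (simp add: ev_diff ev_add ev_single f_add_right f_scale_right scaleC_one)
qed

lemma ext_abs: "tensor_ext \<sigma> f (abs_tensor_prod p) = ev p"
proof -
  have "tensor_rel (rep_tensor_prod (abs_tensor_prod p)) p"
    using Quotient3_tensor_prod by (metis Quotient3_rep_abs equivp_reflp equivp_tensor_rel)
  then have "ev (rep_tensor_prod (abs_tensor_prod p)) = ev p"
    unfolding tensor_rel_def using ev_null ev_diff by fastforce
  then show ?thesis by (simp add: tensor_ext_def ev_def Let_def case_prod_unfold)
qed

lemma ext_tensor [simp]: "tensor_ext \<sigma> f (x \<otimes>\<^sub>a y) = f x y"
  by (simp add: tensor.abs_eq ext_abs ev_single scaleC_one)

lemma ext_add: "tensor_ext \<sigma> f (s + t) = tensor_ext \<sigma> f s + tensor_ext \<sigma> f t"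
proof -
  obtain p q where "s = abs_tensor_prod p" "t = abs_tensor_prod q"
    by (metis Quotient3_abs_rep Quotient3_tensor_prod)
  then show ?thesis by (simp add: plus_tensor_prod.abs_eq ext_abs ev_add)
qed

lemma ext_scale: "tensor_ext \<sigma> f (c *\<^sub>C t) = \<sigma> c *\<^sub>C tensor_ext \<sigma> f t"
proof -
  obtain p where "t = abs_tensor_prod p"
    by (metis Quotient3_abs_rep Quotient3_tensor_prod)
  then show ?thesis by (simp add: scaleC_tensor_prod.abs_eq ext_abs ev_scale)
qed

end

lemma tensor_extension_bilinear: "cbilinear f \<Longrightarrow> tensor_extension id f"
  by (auto simp: cbilinear_def clinear_iff tensor_extension_def)

lemma tensor_lift_tensor: "cbilinear f \<Longrightarrow> tensor_lift f (x \<otimes>\<^sub>a y) = f x y"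
  by (rule tensor_extension.ext_tensor[OF tensor_extension_bilinear])

lemma tensor_lift_clinear: "cbilinear f \<Longrightarrow> clinear (tensor_lift f)"
  unfolding clinear_iff
  using tensor_extension.ext_add[OF tensor_extension_bilinear]
    tensor_extension.ext_scale[OF tensor_extension_bilinear] by auto

lemma cbilinear_mult_tensor:
  fixes a :: "'a::complex_star_algebra" and b :: "'b::complex_star_algebra"
  shows "cbilinear (\<lambda>c d. (a * c) \<otimes>\<^sub>a (b * d))"
  by (simp add: cbilinear_def clinear_iff algebra_simps scaleC_mult_right tensor_add_left
      tensor_add_right tensor_scale_left tensor_scale_right)

lemma cbilinear_mult_tensor':
  fixes s :: "('a::complex_star_algebra, 'b::complex_star_algebra) tensor_prod"
  shows "cbilinear (\<lambda>a b. tensor_lift (\<lambda>c d. (a * c) \<otimes>\<^sub>a (b * d)) s)"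
proof -
  define F where "F = (\<lambda>(a::'a) (b::'b). tensor_lift (\<lambda>c d. (a * c) \<otimes>\<^sub>a (b * d)))"
  have F_tensor: "F a b (c \<otimes>\<^sub>a d) = (a * c) \<otimes>\<^sub>a (b * d)" for a b c d
    unfolding F_def by (rule tensor_lift_tensor[OF cbilinear_mult_tensor])
  have F_add: "F a b (t + t') = F a b t + F a b t'" for a b t t'
    unfolding F_def using tensor_lift_clinear[OF cbilinear_mult_tensor] unfolding clinear_iff by blast
  have "F x (b + b') s = F x b s + F x b' s" for x b b'
    by (induction s) (simp_all add: F_tensor F_add distrib_right tensor_add_right)
  moreover have "F (x + y) b s = F x b s + F y b s" for x y b
    by (induction s) (simp_all add: F_tensor F_add distrib_right tensor_add_left)
  moreover have "F x (c *\<^sub>C b) s = c *\<^sub>C F x b s" for x c b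
    by (induction s) (simp_all add: F_tensor F_add scaleC_mult_left tensor_scale_right scaleC_add_right)
  moreover have "F (c *\<^sub>C x) b s = c *\<^sub>C F x b s" for x c b
    by (induction s) (simp_all add: F_tensor F_add scaleC_mult_left tensor_scale_left scaleC_add_right)
  ultimately have "cbilinear (\<lambda>a b. F a b s)"
    by (simp add: cbilinear_def clinear_iff)
  then show ?thesis by (simp add: F_def)
qed

instantiation tensor_prod :: (complex_star_algebra, complex_star_algebra) complex_star_algebra
begin

definition one_tensor_prod :: "('a, 'b) tensor_prod" where
  "one_tensor_prod = 1 \<otimes>\<^sub>a 1"

definition times_tensor_prod :: "('a, 'b) tensor_prod \<Rightarrow> ('a, 'b) tensor_prod \<Rightarrow> ('a, 'b) tensor_prod" where
  "times_tensor_prod s t = tensor_lift (\<lambda>a b. tensor_lift (\<lambda>c d. (a * c) \<otimes>\<^sub>a (b * d)) t) s"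

definition star_tensor_prod :: "('a, 'b) tensor_prod \<Rightarrow> ('a, 'b) tensor_prod" where
  "star_tensor_prod = tensor_ext cnj (\<lambda>a b. star a \<otimes>\<^sub>a star b)"

instance
proof
  fix x y z :: "('a, 'b) tensor_prod" and c :: complex
  have tens: "(a \<otimes>\<^sub>a b) * z = tensor_lift (\<lambda>c d. (a * c) \<otimes>\<^sub>a (b * d)) z" for a :: 'a and b :: 'b and z
    unfolding times_tensor_prod_def by (rule tensor_lift_tensor[OF cbilinear_mult_tensor'])
  have times [simp]: "(a \<otimes>\<^sub>a b) * (a' \<otimes>\<^sub>a b') = (a * a') \<otimes>\<^sub>a (b * b')" for a a' :: 'a and b b' :: 'b
    unfolding tens by (rule tensor_lift_tensor[OF cbilinear_mult_tensor])
  have dl: "(x + y) * z = x * z + y * z" for x y z :: "('a, 'b) tensor_prod"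
    using tensor_lift_clinear[OF cbilinear_mult_tensor'] unfolding clinear_iff times_tensor_prod_def
    by blast
  have dr: "x * (y + z) = x * y + x * z" for x y z :: "('a, 'b) tensor_prod"
  proof (induction x)
    case (tensor a b)
    then show ?case
      using tensor_lift_clinear[OF cbilinear_mult_tensor] unfolding clinear_iff tens by blast
  qed (simp add: dl algebra_simps)
  interpret st: tensor_extension cnj "\<lambda>(a::'a) (b::'b). star a \<otimes>\<^sub>a star b"
    by unfold_locales (simp_all add: star_add star_scaleC tensor_add_left tensor_add_right
        tensor_scale_left tensor_scale_right)
  have star [simp]: "star (a \<otimes>\<^sub>a b) = star a \<otimes>\<^sub>a star b" for a :: 'a and b :: 'b
    by (simp add: star_tensor_prod_def)
  have sadd: "star (s + t) = star s + star t" for s t :: "('a, 'b) tensor_prod"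
    by (simp add: star_tensor_prod_def st.ext_add)
  show "(x + y) * z = x * z + y * z" by (rule dl)
  show "x * (y + z) = x * y + x * z" by (rule dr)
  have 1: "(a \<otimes>\<^sub>a b) * (a' \<otimes>\<^sub>a b') * z = (a \<otimes>\<^sub>a b) * ((a' \<otimes>\<^sub>a b') * z)"
    for a a' :: 'a and b b' :: 'b and z
    by (induction z) (simp_all add: dr mult.assoc)
  have 2: "(a \<otimes>\<^sub>a b) * y * z = (a \<otimes>\<^sub>a b) * (y * z)" for a :: 'a and b :: 'b and y z
    by (induction y) (simp_all only: 1 dr dl)
  show "x * y * z = x * (y * z)"
    by (induction x) (simp_all only: 2 dl)
  show "1 * x = x" by (induction x) (simp_all add: one_tensor_prod_def dr)
  show "x * 1 = x" by (induction x) (simp_all add: one_tensor_prod_def dl)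
  show "(c *\<^sub>C x) * y = c *\<^sub>C (x * y)"
    using tensor_lift_clinear[OF cbilinear_mult_tensor'] unfolding clinear_iff times_tensor_prod_def
    by blast
  show "x * (c *\<^sub>C y) = c *\<^sub>C (x * y)"
  proof (induction x)
    case (tensor a b)
    then show ?case
      using tensor_lift_clinear[OF cbilinear_mult_tensor] unfolding clinear_iff tens by blast
  qed (simp add: dl scaleC_add_right)
  show "star (x + y) = star x + star y" by (rule sadd)
  show "star (c *\<^sub>C x) = cnj c *\<^sub>C star x"
    by (simp add: star_tensor_prod_def st.ext_scale)
  have 3: "star ((a \<otimes>\<^sub>a b) * y) = star y * star (a \<otimes>\<^sub>a b)" for a :: 'a and b :: 'b and y
    by (induction y) (simp_all add: star_mult sadd dr dl del: star, simp add: star_mult)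
  show "star (x * y) = star y * star x"
    by (induction x) (simp_all only: 3 sadd dl dr)
  show "star (star x) = x" by (induction x) (simp_all add: star_star sadd)
qed

end


section \<open>Hopf *-algebras with Haar state and their GNS construction\<close>

text \<open>\<open>gns\<close> is the GNS map of the Haar state and \<open>tens\<close> the canonical map into the Hilbert space
  tensor product \<open>'k\<close> of \<open>'h\<close> with itself.\<close>

record (overloaded) ('a::complex_star_algebra, 'h, 'k) quantum_group =
  comult :: "'a \<Rightarrow> ('a, 'a) tensor_prod"
  counit :: "'a \<Rightarrow> complex"
  antipode :: "'a \<Rightarrow> 'a"
  haar :: "'a \<Rightarrow> complex"
  gns :: "'a \<Rightarrow> 'h"
  tens :: "'h \<Rightarrow> 'h \<Rightarrow> 'k"

definition hopf_star_algebra :: "('a::complex_star_algebra, 'h, 'k) quantum_group \<Rightarrow> bool" where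
  "hopf_star_algebra G \<longleftrightarrow>
     star_hom (comult G) \<and>
     (\<forall>x. tensor_lift (\<lambda>a b. tensor_lift (\<lambda>c d. c \<otimes>\<^sub>a (d \<otimes>\<^sub>a b)) (comult G a)) (comult G x)
        = tensor_lift (\<lambda>a b. a \<otimes>\<^sub>a comult G b) (comult G x)) \<and>
     star_hom (counit G) \<and>
     (\<forall>x. tensor_lift (\<lambda>a b. counit G a *\<^sub>C b) (comult G x) = x) \<and>
     (\<forall>x. tensor_lift (\<lambda>a b. counit G b *\<^sub>C a) (comult G x) = x) \<and>
     clinear (antipode G) \<and>
     (\<forall>x. tensor_lift (\<lambda>a b. antipode G a * b) (comult G x) = counit G x *\<^sub>C 1) \<and>
     (\<forall>x. tensor_lift (\<lambda>a b. a * antipode G b) (comult G x) = counit G x *\<^sub>C 1)"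

definition haar_state :: "('a::complex_star_algebra, 'h, 'k) quantum_group \<Rightarrow> bool" where
  "haar_state G \<longleftrightarrow>
     clinear (haar G) \<and> haar G 1 = 1 \<and> (\<forall>x. haar G (star x * x) \<in> \<real>\<^sub>\<ge>\<^sub>0) \<and>
     (\<forall>x. tensor_lift (\<lambda>a b. haar G a *\<^sub>C b) (comult G x) = haar G x *\<^sub>C 1) \<and>
     (\<forall>x. tensor_lift (\<lambda>a b. haar G b *\<^sub>C a) (comult G x) = haar G x *\<^sub>C 1)"

definition gns_map :: "('a::complex_star_algebra, 'h::chilbert_space, 'k) quantum_group \<Rightarrow> bool" where
  "gns_map G \<longleftrightarrow>
     clinear (gns G) \<and> (\<forall>x y. cinner (gns G x) (gns G y) = haar G (star x * y)) \<and>
     closure (range (gns G)) = UNIV"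

definition hilbert_tensor ::
    "('a::complex_star_algebra, 'h::chilbert_space, 'k::chilbert_space) quantum_group \<Rightarrow> bool" where
  "hilbert_tensor G \<longleftrightarrow>
     cbilinear (tens G) \<and>
     (\<forall>\<xi> \<eta> \<xi>' \<eta>'. cinner (tens G \<xi> \<eta>) (tens G \<xi>' \<eta>') = cinner \<xi> \<xi>' * cinner \<eta> \<eta>') \<and>
     closure (span {tens G \<xi> \<eta> | \<xi> \<eta>. True}) = UNIV"


subsection \<open>Bounded operators attached to the quantum group\<close>

text \<open>Bounded operators are specified by their values on total subsets.\<close>

context
  fixes G :: "('a::complex_star_algebra, 'h::chilbert_space, 'k::chilbert_space) quantum_group"
begin

definition lmult :: "'a \<Rightarrow> 'h \<Rightarrow> 'h" where
  "lmult x = (THE A. bounded_clinear A \<and> (\<forall>y. A (gns G y) = gns G (x * y)))"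

definition op_tensor :: "('h \<Rightarrow> 'h) \<Rightarrow> ('h \<Rightarrow> 'h) \<Rightarrow> 'k \<Rightarrow> 'k" where
  "op_tensor A B = (THE C. bounded_clinear C \<and> (\<forall>\<xi> \<eta>. C (tens G \<xi> \<eta>) = tens G (A \<xi>) (B \<eta>)))"

definition flip :: "'k \<Rightarrow> 'k" where
  "flip = (THE C. bounded_clinear C \<and> (\<forall>\<xi> \<eta>. C (tens G \<xi> \<eta>) = tens G \<eta> \<xi>))"

definition mult_unitary :: "'k \<Rightarrow> 'k" where
  "mult_unitary = (THE V. bounded_clinear V \<and>
     (\<forall>x y. V (tens G (gns G x) (gns G y))
        = tensor_lift (\<lambda>a b. tens G (gns G a) (gns G b)) (comult G x * (1 \<otimes>\<^sub>a y))))"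

end


subsection \<open>Modular conjugation\<close>

text \<open>Unbounded operators are given by their graphs. The closure of
  \<open>\<Lambda>(x) \<mapsto> \<Lambda>(x\<^sup>*)\<close> has polar decomposition \<open>J P\<close> with \<open>J\<close> antiunitary and
  \<open>P = \<Delta>\<^bsup>1/2\<^esup>\<close> positive self-adjoint.\<close>

definition pos_self_adjoint :: "('h::complex_inner \<times> 'h) set \<Rightarrow> bool" where
  "pos_self_adjoint P \<longleftrightarrow>
     P = {(v, w). \<forall>(x, y)\<in>P. cinner y v = cinner x w} \<and>
     (\<forall>(x, y)\<in>P. cinner x y \<in> \<real>\<^sub>\<ge>\<^sub>0)"

definition antiunitary :: "('h::complex_inner \<Rightarrow> 'h) \<Rightarrow> bool" where
  "antiunitary J \<longleftrightarrow> surj J \<and> (\<forall>x y. J (x + y) = J x + J y) \<and> (\<forall>c x. J (c *\<^sub>C x) = cnj c *\<^sub>C J x) \<and>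
     (\<forall>x y. cinner (J x) (J y) = cinner y x)"

definition tomita_graph :: "('a::complex_star_algebra, 'h::chilbert_space, 'k) quantum_group \<Rightarrow> ('h \<times> 'h) set" where
  "tomita_graph G = closure {(gns G x, gns G (star x)) | x. True}"

definition modular_conj :: "('a::complex_star_algebra, 'h::chilbert_space, 'k) quantum_group \<Rightarrow> 'h \<Rightarrow> 'h" where
  "modular_conj G = (THE J. antiunitary J \<and> pos_self_adjoint {(\<xi>, \<eta>). (\<xi>, J \<eta>) \<in> tomita_graph G})"


subsection \<open>Unitary antipode\<close>

text \<open>\<open>conv_left f a = (id \<otimes> f)\<delta>(a)\<close> and \<open>conv_right a f = (f \<otimes> id)\<delta>(a)\<close>, written
  \<open>f * a\<close> and \<open>a * f\<close> by Woronowicz.\<close>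

definition conv_left :: "('a::complex_star_algebra, 'h, 'k) quantum_group \<Rightarrow> ('a \<Rightarrow> complex) \<Rightarrow> 'a \<Rightarrow> 'a" where
  "conv_left G f a = tensor_lift (\<lambda>b c. f c *\<^sub>C b) (comult G a)"

definition conv_right :: "('a::complex_star_algebra, 'h, 'k) quantum_group \<Rightarrow> 'a \<Rightarrow> ('a \<Rightarrow> complex) \<Rightarrow> 'a" where
  "conv_right G a f = tensor_lift (\<lambda>b c. f b *\<^sub>C c) (comult G a)"

text \<open>The family \<open>(f\<^sub>z)\<close> of Woronowicz characters, in the normalisation
  \<open>\<kappa>\<^sup>2(a) = f\<^bsub>-1\<^esub> * a * f\<^bsub>1\<^esub>\<close>, \<open>h(ab) = h(b (f\<^bsub>1\<^esub> * a * f\<^bsub>1\<^esub>))\<close>.\<close>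

definition is_woronowicz_characters ::
    "('a::complex_star_algebra, 'h, 'k) quantum_group \<Rightarrow> (complex \<Rightarrow> 'a \<Rightarrow> complex) \<Rightarrow> bool" where
  "is_woronowicz_characters G f \<longleftrightarrow>
     (\<forall>z. clinear (f z) \<and> f z 1 = 1 \<and> (\<forall>a b. f z (a * b) = f z a * f z b)) \<and>
     (\<forall>a. (\<lambda>z. f z a) holomorphic_on UNIV) \<and>
     f 0 = counit G \<and>
     (\<forall>z w a. tensor_lift (\<lambda>b c. f z b * f w c) (comult G a) = f (z + w) a) \<and>
     (\<forall>z a. f z (star a) = cnj (f (- cnj z) a)) \<and>
     (\<forall>a. antipode G (antipode G a) = conv_left G (f (-1)) (conv_right G a (f 1))) \<and>
     (\<forall>a b. haar G (a * b) = haar G (b * conv_left G (f 1) (conv_right G a (f 1))))"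

definition woronowicz_char :: "('a::complex_star_algebra, 'h, 'k) quantum_group \<Rightarrow> complex \<Rightarrow> 'a \<Rightarrow> complex" where
  "woronowicz_char G = (THE f. is_woronowicz_characters G f)"

text \<open>With the scaling group \<open>\<tau>\<^sub>t(a) = f\<^bsub>it\<^esub> * a * f\<^bsub>-it\<^esub>\<close>, the polar decomposition of the antipode
  is \<open>\<kappa> = R \<circ> \<tau>\<^bsub>i/2\<^esub>\<close>, so that \<open>R = \<kappa> \<circ> \<tau>\<^bsub>-i/2\<^esub>\<close>.\<close>

definition unitary_antipode :: "('a::complex_star_algebra, 'h, 'k) quantum_group \<Rightarrow> 'a \<Rightarrow> 'a" where
  "unitary_antipode G a =
     antipode G (conv_left G (woronowicz_char G (1/2)) (conv_right G a (woronowicz_char G (-1/2))))"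

definition modular_conj_hat :: "('a::complex_star_algebra, 'h::chilbert_space, 'k) quantum_group \<Rightarrow> 'h \<Rightarrow> 'h" where
  "modular_conj_hat G = (THE A. bounded_linear A \<and> (\<forall>x. A (gns G x) = gns G (star (unitary_antipode G x))))"

definition kac_unitary :: "('a::complex_star_algebra, 'h::chilbert_space, 'k) quantum_group \<Rightarrow> 'h \<Rightarrow> 'h" where
  "kac_unitary G = modular_conj G \<circ> modular_conj_hat G"


section \<open>Quantum Cayley graphs and path cocycles\<close>

text \<open>A corepresentation is given by its matrix of coefficients, and a set \<open>D\<close> of directions by
  matrices of representatives.\<close>

context
  fixes G :: "('a::complex_star_algebra, 'h::chilbert_space, 'k::chilbert_space) quantum_group"
begin

definition corep_proj :: "('n::finite \<Rightarrow> 'n \<Rightarrow> 'a) \<Rightarrow> 'h \<Rightarrow> 'h" where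
  "corep_proj v = orth_proj (gns G ` cspan {v i j | i j. True})"

definition dir_proj :: "('n::finite \<Rightarrow> 'n \<Rightarrow> 'a) set \<Rightarrow> 'h \<Rightarrow> 'h" where
  "dir_proj D \<xi> = (\<Sum>v\<in>D. corep_proj v \<xi>)"

definition edge_space :: "('n::finite \<Rightarrow> 'n \<Rightarrow> 'a) set \<Rightarrow> 'k set" where
  "edge_space D = closure (span {tens G \<xi> \<eta> | \<xi> \<eta>. \<eta> \<in> range (dir_proj D)})"

definition alg_edge_space :: "('n::finite \<Rightarrow> 'n \<Rightarrow> 'a) set \<Rightarrow> 'k set" where
  "alg_edge_space D = span {tens G (gns G x) \<eta> | x \<eta>. \<eta> \<in> range (dir_proj D)}"

text \<open>The reversing operator, as an operator on \<open>H \<otimes> H\<close> leaving \<^term>\<open>edge_space\<close> invariant.\<close>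

definition reversing :: "'k \<Rightarrow> 'k" where
  "reversing = flip G \<circ> op_tensor G id (kac_unitary G) \<circ> mult_unitary G
     \<circ> op_tensor G (kac_unitary G) (kac_unitary G) \<circ> flip G"

text \<open>The target map \<open>E\<^sub>2\<close>, extended by zero on the orthogonal complement of \<^term>\<open>edge_space\<close>.\<close>

definition target :: "('n::finite \<Rightarrow> 'n \<Rightarrow> 'a) set \<Rightarrow> 'k \<Rightarrow> 'h" where
  "target D = (THE E. bounded_clinear E \<and>
     (\<forall>x y. gns G y \<in> range (dir_proj D) \<longrightarrow> E (tens G (gns G x) (gns G y)) = gns G (x * y)) \<and>
     (\<forall>\<zeta>. (\<forall>\<xi>\<in>edge_space D. cinner \<xi> \<zeta> = 0) \<longrightarrow> E \<zeta> = 0))"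

definition geom_edge_space :: "('n::finite \<Rightarrow> 'n \<Rightarrow> 'a) set \<Rightarrow> 'k set" where
  "geom_edge_space D = {\<xi> \<in> edge_space D. reversing \<xi> + \<xi> = 0}"

definition alg_geom_edge_space :: "('n::finite \<Rightarrow> 'n \<Rightarrow> 'a) set \<Rightarrow> 'k set" where
  "alg_geom_edge_space D = orth_proj (geom_edge_space D) ` alg_edge_space D"

definition edge_action :: "'a \<Rightarrow> 'k \<Rightarrow> 'k" where
  "edge_action x = op_tensor G (lmult G x) id"

definition cocycle :: "('n::finite \<Rightarrow> 'n \<Rightarrow> 'a) set \<Rightarrow> ('a \<Rightarrow> 'k) \<Rightarrow> bool" where
  "cocycle D c \<longleftrightarrow> clinear c \<and> range c \<subseteq> edge_space D \<and>
     (\<forall>x y. c (x * y) = edge_action x (c y) + counit G y *\<^sub>C c x)"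

definition trivial_cocycle :: "('n::finite \<Rightarrow> 'n \<Rightarrow> 'a) set \<Rightarrow> ('a \<Rightarrow> 'k) \<Rightarrow> bool" where
  "trivial_cocycle D c \<longleftrightarrow>
     (\<exists>\<xi>\<in>edge_space D. \<forall>x. c x = edge_action x \<xi> - counit G x *\<^sub>C \<xi>)"

definition path_cocycle :: "('n::finite \<Rightarrow> 'n \<Rightarrow> 'a) set \<Rightarrow> ('a \<Rightarrow> 'k) \<Rightarrow> bool" where
  "path_cocycle D c \<longleftrightarrow> cocycle D c \<and> range c \<subseteq> alg_geom_edge_space D \<and>
     (\<forall>x. target D (c x) = gns G x - counit G x *\<^sub>C gns G 1)"

end


section \<open>The free orthogonal quantum groups\<close>

text \<open>The free unital *-algebra on generators \<open>u\<^sub>i\<^sub>j\<close>: complex linear combinations of words in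
  the \<open>u\<^sub>i\<^sub>j\<close> and their adjoints. The wrapper around lists carries the monoid structure, written
  additively as required by the convolution product on \<open>\<Rightarrow>\<^sub>0\<close>.\<close>

datatype 'n generator = Gen 'n 'n | Adj 'n 'n

datatype 'n monomial = Monomial (letters: "'n generator list")

instantiation monomial :: (type) monoid_add
begin

definition zero_monomial :: "'a monomial" where
  "zero_monomial = Monomial []"

definition plus_monomial :: "'a monomial \<Rightarrow> 'a monomial \<Rightarrow> 'a monomial" where
  "plus_monomial v w = Monomial (letters v @ letters w)"

instance
  by standard (simp_all add: zero_monomial_def plus_monomial_def)

end

type_synonym 'n free_star_algebra = "'n monomial \<Rightarrow>\<^sub>0 complex"

fun adj_generator :: "'n generator \<Rightarrow> 'n generator" where
  "adj_generator (Gen i j) = Adj i j"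
| "adj_generator (Adj i j) = Gen i j"

definition adj_monomial :: "'n monomial \<Rightarrow> 'n monomial" where
  "adj_monomial w = Monomial (rev (map adj_generator (letters w)))"

definition free_star :: "'n free_star_algebra \<Rightarrow> 'n free_star_algebra" where
  "free_star p = (\<Sum>w\<in>Poly_Mapping.keys p. Poly_Mapping.single (adj_monomial w) (cnj (Poly_Mapping.lookup p w)))"

definition free_gen :: "'n \<Rightarrow> 'n \<Rightarrow> 'n free_star_algebra" where
  "free_gen i j = Poly_Mapping.single (Monomial [Gen i j]) 1"

definition free_const :: "complex \<Rightarrow> 'n free_star_algebra" where
  "free_const c = Poly_Mapping.single 0 c"

inductive_set star_ideal :: "'n free_star_algebra set \<Rightarrow> 'n free_star_algebra set"
  for X :: "'n free_star_algebra set" where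
  ideal_gen: "p \<in> X \<Longrightarrow> p \<in> star_ideal X"
| ideal_zero: "0 \<in> star_ideal X"
| ideal_add: "p \<in> star_ideal X \<Longrightarrow> q \<in> star_ideal X \<Longrightarrow> p + q \<in> star_ideal X"
| ideal_mult_left: "p \<in> star_ideal X \<Longrightarrow> r * p \<in> star_ideal X"
| ideal_mult_right: "p \<in> star_ideal X \<Longrightarrow> p * r \<in> star_ideal X"
| ideal_star: "p \<in> star_ideal X \<Longrightarrow> free_star p \<in> star_ideal X"

text \<open>The entries of \<open>u u\<^sup>* - 1\<close>, \<open>u\<^sup>* u - 1\<close> and \<open>u - Q (u\<^sub>i\<^sub>j\<^sup>*)\<^sub>i\<^sub>j Q\<^bsup>-1\<^esup>\<close>.\<close>

definition Ao_relators :: "complex^'n^'n \<Rightarrow> 'n::finite free_star_algebra set" where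
  "Ao_relators Q =
     {(\<Sum>k\<in>UNIV. free_gen i k * free_star (free_gen j k)) - (if i = j then 1 else 0) | i j. True} \<union>
     {(\<Sum>k\<in>UNIV. free_star (free_gen k i) * free_gen k j) - (if i = j then 1 else 0) | i j. True} \<union>
     {free_gen i j - (\<Sum>k\<in>UNIV. \<Sum>l\<in>UNIV.
        free_const (Q $ i $ k) * free_star (free_gen k l) * free_const (matrix_inv Q $ l $ j)) | i j. True}"

fun generator_value :: "('n \<Rightarrow> 'n \<Rightarrow> 'a::complex_star_algebra) \<Rightarrow> 'n generator \<Rightarrow> 'a" where
  "generator_value u (Gen i j) = u i j"
| "generator_value u (Adj i j) = star (u i j)"

definition evaluate :: "('n \<Rightarrow> 'n \<Rightarrow> 'a::complex_star_algebra) \<Rightarrow> 'n free_star_algebra \<Rightarrow> 'a" where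
  "evaluate u p =
     (\<Sum>w\<in>Poly_Mapping.keys p. Poly_Mapping.lookup p w *\<^sub>C prod_list (map (generator_value u) (letters w)))"

text \<open>The *-algebra \<open>'a\<close> is \<open>A\<^sub>o(Q)\<close> with canonical generators \<open>u\<^sub>i\<^sub>j\<close>: it is the quotient of
  the free *-algebra by the *-ideal of the relations, via \<open>evaluate u\<close>.\<close>

definition Ao_algebra :: "complex^'n^'n \<Rightarrow> ('n::finite \<Rightarrow> 'n \<Rightarrow> 'a::complex_star_algebra) \<Rightarrow> bool" where
  "Ao_algebra Q u \<longleftrightarrow> surj (evaluate u) \<and> (\<forall>p. evaluate u p = 0 \<longleftrightarrow> p \<in> star_ideal (Ao_relators Q))"

definition Ao_quantum_group ::
    "complex^'n^'n \<Rightarrow> ('n::finite \<Rightarrow> 'n \<Rightarrow> 'a::complex_star_algebra)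
      \<Rightarrow> ('a, 'h::chilbert_space, 'k::chilbert_space) quantum_group \<Rightarrow> bool" where
  "Ao_quantum_group Q u G \<longleftrightarrow>
     Ao_algebra Q u \<and> hopf_star_algebra G \<and>
     (\<forall>i j. comult G (u i j) = (\<Sum>k\<in>UNIV. u i k \<otimes>\<^sub>a u k j)) \<and>
     haar_state G \<and> gns_map G \<and> hilbert_tensor G"

end

(* A unitary change of basis turns Q into a multiple of a matrix F with F (conj F) = s = 1 or -1 and F
   F^* diagonal with entries lam_i. Put D = sum lam_i = sum 1/lam_i, the quantum dimension of u; the
   hypotheses on n and Q say exactly that D > 2. The coefficients of the irreducible u_k are the matrix
   coefficients of u^k between vectors of the range V_k of the Jones-Wenzl projection. In these terms the
   Haar state, the modular conjugation and the unitary antipode are explicit, and the reversing operator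
   is Theta (x (x) u_ij) = sum_k x u_ik (x) u_jk^*.

   The splitting of C^n (x) V_k into copies of V_(k+1) and V_(k-1), on both sides of the coefficients,
   decomposes K into blocks. E_2 kills the mixed blocks and multiplies squared norms by D / y_k on the
   block (+,+) of level k and by D y_k on the block (-,-) of level k+1, where y_k = [k+2] / [k+1] > 1 in
   quantum integers with [2] = D, while Theta maps rows of blocks to columns of blocks. If Theta xi = -
   xi and E_2 xi = 0, let a_k, b_k, c_k, d_k be the squared norms of the components of xi in the blocks
   (+,+), (+,-), (-,+), (-,-). Then a_k + b_k = b_(k+1) + d_(k+1) and d_(k+2) = a_k / (y_k y_(k+1)) <=
   a_k. Hence the b_k sum up the nonnegative numbers a_k - d_(k+2), and they tend to 0, so that all
   components vanish and E_2 is injective on K_g.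

   For surjectivity, Theta^2 = 1 on the range of E_1^* and E_2 Theta E_1^* = D^2, so E_2 (Theta - 1)
   E_1^* = D^2 - A with A = E_2 E_1^* self-adjoint. The operator A is tridiagonal for the decomposition
   of H by the u_k, with zero diagonal and entries of norm at most D; so A <= 2 D < D^2, and D^2 - A is
   invertible.

   The path cocycle is therefore x |-> E_2^(-1) (x - eps(x) 1), with fixed vector E_2^(-1) 1. It takes
   its values in K'_g because E_2 p_g = (E_2 - E_2 Theta) / 2 on K, and every element of the augmentation
   ideal is of the form sum x_ij (u_ij - delta_ij). *)

theory Submission
  imports Defs "HOL-Complex_Analysis.Complex_Analysis"
begin

text \<open>Nearly every object of the statement is given by a description (\<open>THE\<close>): the
  modular conjugation, the Woronowicz characters, the operators on the tensor square. Each must be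
  shown to exist and to be unique before it can be computed with. Two facts carry these proofs.
  First, the absence of further relations in the algebra enters only through linear functionals with
  prescribed values on words; they yield the vanishing of the Haar state on nontrivial irreducible
  coefficients, and the characters. Second, the orthogonality relations are derived for the product
  and for its opposite; comparing the two gives the KMS property, from which the modular conjugation
  and the boundedness of right multiplication follow. The opposite product is also the one adapted
  to E_2, which multiplies from the right. The condition D > 2 acts twice: it makes every y_k exceed
  1, and it is the positivity of D^2 - 2 D.\<close>

abbreviation (input) sum_UNIV :: "('i \<Rightarrow> 'b::comm_monoid_add) \<Rightarrow> 'b" (binder "\<Oplus>" 10) where
  "sum_UNIV f \<equiv> sum f UNIV"

section \<open>Complex Hilbert spaces\<close>

lemma scaleC_zero_left [simp]: "0 *\<^sub>C x = (0::'a::complex_vector)"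
  by (rule complex_vector.scale_zero_left)

lemma scaleC_zero_right [simp]: "c *\<^sub>C 0 = (0::'a::complex_vector)"
  by (rule complex_vector.scale_zero_right)

declare scaleC_one [simp]

lemma scaleC_minus_left: "(- c) *\<^sub>C x = - (c *\<^sub>C (x::'a::complex_vector))"
  by (rule complex_vector.scale_minus_left)

lemma scaleC_diff_right: "c *\<^sub>C (x - y) = c *\<^sub>C x - c *\<^sub>C (y::'a::complex_vector)"
  by (rule complex_vector.scale_right_diff_distrib)

lemma scaleC_sum_right: "c *\<^sub>C (\<Sum>i\<in>A. f i) = (\<Sum>i\<in>A. c *\<^sub>C (f i::'a::complex_vector))"
  by (rule complex_vector.scale_sum_right)

lemma scaleC_sum_left: "(\<Sum>i\<in>A. c i) *\<^sub>C x = (\<Sum>i\<in>A. c i *\<^sub>C (x::'a::complex_vector))"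
  by (rule complex_vector.scale_sum_left)

lemma cinner_add_left: "cinner (x + y) z = cinner x z + cinner y z"
  by (subst (1 2 3) cinner_commute) (simp add: cinner_add_right)

lemma cinner_scaleC_left: "cinner (c *\<^sub>C x) y = cnj c * cinner x y"
  by (subst (1 2) cinner_commute) (simp add: cinner_scaleC_right)

lemma cinner_zero_right [simp]: "cinner x 0 = 0"
  using cinner_scaleC_right[of x 0 0] by simp

lemma cinner_zero_left [simp]: "cinner 0 x = 0"
  by (subst cinner_commute) simp

lemma cinner_minus_right: "cinner x (- y) = - cinner x y"
  using cinner_scaleC_right[of x "-1" y] by (simp add: scaleC_minus_left)

lemma cinner_minus_left: "cinner (- x) y = - cinner x y"
  using cinner_scaleC_left[of "-1" x y] by (simp add: scaleC_minus_left)

lemma cinner_diff_right: "cinner x (y - z) = cinner x y - cinner x z"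
  using cinner_add_right[of x y "- z"] by (simp add: cinner_minus_right)

lemma cinner_diff_left: "cinner (x - y) z = cinner x z - cinner y z"
  using cinner_add_left[of x "- y" z] by (simp add: cinner_minus_left)

lemma cinner_sum_right: "cinner x (\<Sum>i\<in>A. f i) = (\<Sum>i\<in>A. cinner x (f i))"
  by (induction A rule: infinite_finite_induct) (simp_all add: cinner_add_right)

lemma cinner_sum_left: "cinner (\<Sum>i\<in>A. f i) x = (\<Sum>i\<in>A. cinner (f i) x)"
  by (induction A rule: infinite_finite_induct) (simp_all add: cinner_add_left)

lemmas cinner_simps = cinner_add_left cinner_add_right cinner_diff_left cinner_diff_right
  cinner_scaleC_left cinner_scaleC_right cinner_minus_left cinner_minus_right

lemma cinner_self: "cinner x x = complex_of_real ((norm x)\<^sup>2)"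
proof -
  have "cinner x x = cnj (cinner x x)" by (rule cinner_commute)
  then have "Im (cinner x x) = 0" by (metis cnj.simps(2) neg_equal_zero)
  then show ?thesis
    by (simp add: complex_eq_iff power2_norm_eq_inner inner_eq_Re_cinner)
qed

lemma norm_scaleC: "norm (c *\<^sub>C x) = cmod c * norm (x::'a::complex_inner)"
proof -
  have "complex_of_real ((norm (c *\<^sub>C x))\<^sup>2) = cnj c * c * complex_of_real ((norm x)\<^sup>2)"
    unfolding cinner_self[symmetric] by (simp add: cinner_simps)
  also have "\<dots> = complex_of_real ((cmod c * norm x)\<^sup>2)"
    by (simp add: power_mult_distrib complex_norm_square[symmetric] mult.commute[of "cnj c"])
  finally show ?thesis by (simp add: power2_eq_iff_nonneg del: of_real_power)
qed

lemma cmod_cinner_le: "cmod (cinner x y) \<le> norm x * norm y"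
proof -
  \<comment> \<open>The phase that makes \<open>c * cinner x y\<close> real and nonnegative, so that
    the real Cauchy-Schwarz inequality applies.\<close>
  define c where "c = (if cinner x y = 0 then 1 else cnj (cinner x y) / cmod (cinner x y))"
  have c: "cmod c = 1" by (simp add: c_def norm_divide)
  have "c * cinner x y = cmod (cinner x y)"
    by (simp add: c_def power2_eq_square complex_norm_square[symmetric] mult.commute[of "cnj _"])
  then have "cmod (cinner x y) = inner x (c *\<^sub>C y)"
    by (simp add: inner_eq_Re_cinner cinner_simps)
  also have "\<dots> \<le> norm x * norm (c *\<^sub>C y)" by (rule norm_cauchy_schwarz)
  finally show ?thesis by (simp add: norm_scaleC c)
qed

lemma Re_cinner_le: "Re (cinner x y) \<le> norm x * norm y"
  using complex_Re_le_cmod cmod_cinner_le by (rule order_trans)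

lemma bounded_bilinear_cinner: "bounded_bilinear (cinner :: 'a::complex_inner \<Rightarrow> 'a \<Rightarrow> complex)"
proof
  show "\<exists>K. \<forall>x y::'a. cmod (cinner x y) \<le> norm x * norm y * K"
    by (rule exI[of _ 1]) (simp add: cmod_cinner_le)
qed (simp_all add: cinner_simps scaleR_scaleC scaleR_conv_of_real)

lemma bounded_linear_scaleC: "bounded_linear (\<lambda>x::'a::complex_inner. c *\<^sub>C x)"
  by (rule bounded_linear_intro[where K = "cmod c"])
    (simp_all add: scaleC_add_right scaleR_scaleC scaleC_scaleC norm_scaleC mult.commute)

lemmas tendsto_cinner = bounded_bilinear.tendsto[OF bounded_bilinear_cinner]
lemmas continuous_on_cinner = bounded_bilinear.continuous_on[OF bounded_bilinear_cinner]

lemma norm_add_orthogonal: "cinner x y = 0 \<Longrightarrow> (norm (x + y))\<^sup>2 = (norm x)\<^sup>2 + (norm y)\<^sup>2"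
  by (rule norm_add_Pythagorean) (simp add: inner_eq_Re_cinner orthogonal_def)

lemma cinner_eq_zero_iff [simp]: "cinner x x = 0 \<longleftrightarrow> x = 0"
  by (simp add: cinner_self)

lemma bounded_clinearI:
  assumes "bounded_linear f" "\<And>c x. f (c *\<^sub>C x) = c *\<^sub>C f x"
  shows "bounded_clinear f"
  using assms bounded_linear.linear[OF assms(1)] by (auto simp: bounded_clinear_def clinear_iff linear_add)

lemma bounded_clinearD:
  assumes "bounded_clinear f"
  shows "bounded_linear f" "f (x + y) = f x + f y" "f (c *\<^sub>C x) = c *\<^sub>C f x" "f 0 = 0"
    "f (x - y) = f x - f y" "f (- x) = - f x" "f (sum g A) = (\<Sum>i\<in>A. f (g i))" "continuous_on S f"
proof -
  show 1: "bounded_linear f" using assms by (simp add: bounded_clinear_def)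
  note l = bounded_linear.linear[OF 1]
  show "f (x + y) = f x + f y" "f 0 = 0" "f (x - y) = f x - f y" "f (- x) = - f x"
    "f (sum g A) = (\<Sum>i\<in>A. f (g i))"
    by (simp_all add: linear_add[OF l] linear_0[OF l] linear_diff[OF l] linear_neg[OF l] linear_sum[OF l])
  show "f (c *\<^sub>C x) = c *\<^sub>C f x" using assms by (simp add: bounded_clinear_def clinear_iff)
  show "continuous_on S f" using 1 by (rule linear_continuous_on)
qed

lemma bounded_clinear_compose:
  "bounded_clinear f \<Longrightarrow> bounded_clinear g \<Longrightarrow> bounded_clinear (\<lambda>x. f (g x))"
  using bounded_linear_compose[OF bounded_clinearD(1) bounded_clinearD(1), of f g]
  by (intro bounded_clinearI) (simp_all add: bounded_clinearD(3))

lemma bounded_clinear_ident: "bounded_clinear (\<lambda>x. x)"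
  by (rule bounded_clinearI) (simp_all add: bounded_linear_ident)

lemma bounded_clinear_zero: "bounded_clinear (\<lambda>x. 0)"
  by (rule bounded_clinearI) (simp_all add: bounded_linear_zero)

lemma bounded_clinear_add:
  "bounded_clinear f \<Longrightarrow> bounded_clinear g \<Longrightarrow> bounded_clinear (\<lambda>x. f x + g x)"
  by (auto intro!: bounded_clinearI bounded_linear_add dest: bounded_clinearD(1)
      simp: bounded_clinearD(3) scaleC_add_right)

lemma bounded_clinear_scaleC:
  "bounded_clinear f \<Longrightarrow> bounded_clinear (\<lambda>x. c *\<^sub>C f x)"
  by (auto intro!: bounded_clinearI bounded_linear_compose[OF bounded_linear_scaleC]
      dest: bounded_clinearD(1) simp: bounded_clinearD(3) scaleC_scaleC mult.commute)

lemma bounded_clinear_minus: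
  "bounded_clinear f \<Longrightarrow> bounded_clinear (\<lambda>x. - f x)"
  using bounded_clinear_scaleC[of f "-1"] by (simp add: scaleC_minus_left)

lemma bounded_clinear_diff:
  "bounded_clinear f \<Longrightarrow> bounded_clinear g \<Longrightarrow> bounded_clinear (\<lambda>x. f x - g x)"
  using bounded_clinear_add[of f "\<lambda>x. - g x"] bounded_clinear_minus[of g] by simp

lemma bounded_clinear_sum:
  "(\<And>i. i \<in> A \<Longrightarrow> bounded_clinear (f i)) \<Longrightarrow> bounded_clinear (\<lambda>x. \<Sum>i\<in>A. f i x)"
  by (induction A rule: infinite_finite_induct) (simp_all add: bounded_clinear_zero bounded_clinear_add)

subsection \<open>Closed subspaces and total sets\<close>

lemma csubspace_iff:
  "complex_vector.subspace S \<longleftrightarrow> 0 \<in> S \<and> (\<forall>x\<in>S. \<forall>y\<in>S. x + y \<in> S) \<and> (\<forall>c. \<forall>x\<in>S. c *\<^sub>C x \<in> S)"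
  by (auto simp: complex_vector.subspace_def)

lemma closure_map:
  assumes "continuous_on UNIV f" "\<And>x. x \<in> S \<Longrightarrow> f x \<in> closure S" "x \<in> closure S"
  shows "f x \<in> closure S"
  using image_closure_subset[of S f "closure S"] assms by (auto intro: continuous_on_subset)

lemma closure_add:
  fixes S :: "'a::real_normed_vector set"
  assumes "\<And>x y. x \<in> S \<Longrightarrow> y \<in> S \<Longrightarrow> x + y \<in> S" "x \<in> closure S" "y \<in> closure S"
  shows "x + y \<in> closure S"
proof -
  have "(\<lambda>p. fst p + snd p) ` closure (S \<times> S) \<subseteq> closure S"
    by (intro image_closure_subset continuous_intros) (use assms(1) closure_subset in fastforce)+
  then show ?thesis using assms(2,3) by (force simp: closure_Times)
qed

lemma closure_csubspace:
  fixes S :: "'a::complex_inner set"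
  assumes "complex_vector.subspace S"
  shows "complex_vector.subspace (closure S)"
  unfolding csubspace_iff
proof (intro conjI ballI allI)
  note s = assms[unfolded csubspace_iff]
  show "0 \<in> closure S" using s closure_subset[of S] by auto
  show "x + y \<in> closure S" if "x \<in> closure S" "y \<in> closure S" for x y
    using closure_add[OF _ that] s by blast
  show "c *\<^sub>C x \<in> closure S" if "x \<in> closure S" for c x
    using that by (rule closure_map[rotated 2]) (use s closure_subset in \<open>blast intro: linear_continuous_on bounded_linear_scaleC\<close>)+
qed

definition ccspan :: "'a::complex_inner set \<Rightarrow> 'a set" where
  "ccspan X = closure (cspan X)"

lemma csubspace_ccspan [simp]: "complex_vector.subspace (ccspan X)"
  unfolding ccspan_def by (intro closure_csubspace) simp

lemma closed_ccspan [simp]: "closed (ccspan X)"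
  by (simp add: ccspan_def)

lemma ccspan_superset: "X \<subseteq> ccspan X"
  unfolding ccspan_def using complex_vector.span_superset closure_subset by (rule order_trans)

lemma ccspan_minimal: "X \<subseteq> S \<Longrightarrow> complex_vector.subspace S \<Longrightarrow> closed S \<Longrightarrow> ccspan X \<subseteq> S"
  unfolding ccspan_def by (intro closure_minimal complex_vector.span_minimal)

lemma ccspan_mono: "X \<subseteq> Y \<Longrightarrow> ccspan X \<subseteq> ccspan Y"
  using ccspan_superset[of Y] by (intro ccspan_minimal) auto

lemma csubspaceD:
  assumes "complex_vector.subspace S"
  shows "0 \<in> S" "x \<in> S \<Longrightarrow> y \<in> S \<Longrightarrow> x + y \<in> S" "x \<in> S \<Longrightarrow> c *\<^sub>C x \<in> S"
    "x \<in> S \<Longrightarrow> y \<in> S \<Longrightarrow> x - y \<in> S" "x \<in> S \<Longrightarrow> - x \<in> S"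
    "(\<And>i. i \<in> A \<Longrightarrow> f i \<in> S) \<Longrightarrow> sum f A \<in> S"
  using assms by (auto intro: complex_vector.subspace_0 complex_vector.subspace_add
      complex_vector.subspace_scale complex_vector.subspace_diff complex_vector.subspace_neg
      complex_vector.subspace_sum)

lemma span_le_cspan: "span X \<subseteq> cspan (X :: 'a::complex_inner set)"
proof (rule span_minimal[OF complex_vector.span_superset])
  show "subspace (cspan X)"
    unfolding subspace_def
    by (auto simp: scaleR_scaleC intro: complex_vector.span_zero complex_vector.span_add complex_vector.span_scale)
qed

text \<open>The edge spaces are defined with the real span; their generators are stable under
  complex scalars, so the two spans can be exchanged.\<close>

lemma span_eq_cspan:
  fixes X :: "'a::complex_inner set"
  assumes "\<And>c x. x \<in> X \<Longrightarrow> c *\<^sub>C x \<in> X"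
  shows "span X = cspan X"
proof (rule antisym[OF span_le_cspan])
  have "c *\<^sub>C x \<in> span X" if "x \<in> span X" for c x
    using that
  proof (induction rule: span_induct_alt)
    case base then show ?case by (simp add: span_zero)
  next
    case (step r x y)
    then have "r *\<^sub>R (c *\<^sub>C x) \<in> span X" by (intro span_scale span_base assms)
    then show ?case using step
      by (simp add: scaleC_add_right scaleR_scaleC scaleC_scaleC mult.commute span_add)
  qed
  then have "complex_vector.subspace (span X)"
    by (auto simp: csubspace_iff span_zero span_add)
  then show "cspan X \<subseteq> span X"
    by (intro complex_vector.span_minimal span_superset)
qed

lemma csubspace_orth: "complex_vector.subspace {x. cinner z x = 0}"
  by (auto simp: csubspace_iff cinner_simps)

lemma closed_orth: "closed {x. cinner z x = 0}"
  by (intro closed_Collect_eq continuous_on_cinner continuous_intros)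

lemma orth_ccspan:
  assumes "x \<in> ccspan X" "\<And>z. z \<in> X \<Longrightarrow> cinner y z = 0"
  shows "cinner y x = 0"
proof -
  have "ccspan X \<subseteq> {x. cinner y x = 0}"
    using assms(2) by (intro ccspan_minimal csubspace_orth closed_orth) auto
  then show ?thesis using assms(1) by auto
qed

lemma orth_commute: "cinner x y = 0 \<longleftrightarrow> cinner y x = 0"
  by (subst cinner_commute) simp

lemma orth_ccspan2:
  assumes "x \<in> ccspan X" "y \<in> ccspan Y" "\<And>x y. x \<in> X \<Longrightarrow> y \<in> Y \<Longrightarrow> cinner x y = 0"
  shows "cinner x y = 0"
  using assms(2)
proof (rule orth_ccspan)
  fix z assume z: "z \<in> Y"
  have "cinner z x = 0"
    using assms(1) by (rule orth_ccspan) (use assms(3) z orth_commute in blast)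
  then show "cinner x z = 0" by (simp add: orth_commute)
qed

text \<open>The scalar map \<open>\<sigma>\<close> is left open, so that linear operators and
  antilinear conjugations are treated alike.\<close>

lemma eq_on_ccspan:
  assumes "bounded_linear S" "bounded_linear T"
    and "\<And>c x. S (c *\<^sub>C x) = \<sigma> c *\<^sub>C S x" "\<And>c x. T (c *\<^sub>C x) = \<sigma> c *\<^sub>C T x"
    and "\<And>x. x \<in> X \<Longrightarrow> S x = T x" "x \<in> ccspan X"
  shows "S x = T x"
proof -
  note l = bounded_linear.linear[OF assms(1)] bounded_linear.linear[OF assms(2)]
  have "complex_vector.subspace {x. S x = T x}"
    by (auto simp: csubspace_iff assms(3,4) linear_0[OF l(1)] linear_0[OF l(2)] linear_add[OF l(1)] linear_add[OF l(2)])
  moreover have "closed {x. S x = T x}"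
    by (intro closed_Collect_eq linear_continuous_on assms(1,2))
  ultimately have "ccspan X \<subseteq> {x. S x = T x}"
    using assms(5) by (intro ccspan_minimal) auto
  then show ?thesis using assms(6) by auto
qed

lemma bounded_clinear_eq_on:
  assumes "bounded_clinear S" "bounded_clinear T" "\<And>x. x \<in> X \<Longrightarrow> S x = T x" "x \<in> ccspan X"
  shows "S x = T x"
  by (rule eq_on_ccspan[where \<sigma> = id and X = X]) (use assms in \<open>simp_all add: bounded_clinearD\<close>)

lemma bounded_clinear_maps_ccspan:
  assumes "bounded_clinear T" "\<And>x. x \<in> X \<Longrightarrow> T x \<in> ccspan Y" "x \<in> ccspan X"
  shows "T x \<in> ccspan Y"
proof -
  have "complex_vector.subspace {x. T x \<in> ccspan Y}"
    using csubspaceD[OF csubspace_ccspan[of Y]] bounded_clinearD[OF assms(1)]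
    by (auto simp: csubspace_iff)
  moreover have "closed (T -` ccspan Y)"
    by (intro closed_vimage closed_ccspan bounded_clinearD(8)[OF assms(1)])
  ultimately have "ccspan X \<subseteq> {x. T x \<in> ccspan Y}"
    using assms(2) by (intro ccspan_minimal) (auto simp: vimage_def)
  then show ?thesis using assms(3) by auto
qed

text \<open>The identity extends in one variable at a time, as it defines a closed subspace in the
  second one; conjugate symmetry exchanges the variables in between.\<close>

lemma sesqui_scaling:
  assumes T: "bounded_linear T" "\<And>c x. T (c *\<^sub>C x) = \<sigma> c *\<^sub>C T x" and \<sigma>: "\<sigma> = id \<or> \<sigma> = cnj"
    and gram: "\<And>x y. x \<in> X \<Longrightarrow> y \<in> X \<Longrightarrow> cinner (T x) (T y) = complex_of_real r * \<sigma> (cinner x y)"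
    and xy: "x \<in> ccspan X" "y \<in> ccspan X"
  shows "cinner (T x) (T y) = complex_of_real r * \<sigma> (cinner x y)"
proof -
  have \<sigma>s [simp]: "\<sigma> (a * b) = \<sigma> a * \<sigma> b" "\<sigma> (a + b) = \<sigma> a + \<sigma> b" "\<sigma> 0 = 0" "cnj (\<sigma> a) = \<sigma> (cnj a)" for a b
    using \<sigma> by auto
  have c\<sigma>: "continuous_on UNIV \<sigma>" using \<sigma> by (auto intro!: continuous_intros simp: id_def)
  note l = bounded_linear.linear[OF T(1)]
  let ?S = "\<lambda>x. {y. cinner (T x) (T y) = complex_of_real r * \<sigma> (cinner x y)}"
  have cl: "closed (?S x)" for x
    by (intro closed_Collect_eq continuous_on_cinner continuous_intros linear_continuous_on T(1)
        continuous_on_compose2[OF c\<sigma>]) auto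
  have sb: "complex_vector.subspace (?S x)" for x
    by (auto simp: csubspace_iff linear_0[OF l] linear_add[OF l] T(2) cinner_simps algebra_simps)
  have "X \<subseteq> ?S x"
  proof
    fix y assume y: "y \<in> X"
    then have "ccspan X \<subseteq> ?S y" using gram by (intro ccspan_minimal sb cl) auto
    then have "cnj (cinner (T y) (T x)) = complex_of_real r * \<sigma> (cnj (cinner y x))" using xy(1) by auto
    then show "y \<in> ?S x" by (simp flip: cinner_commute)
  qed
  then show ?thesis using ccspan_minimal[OF _ sb cl] xy(2) by blast
qed

lemma gram_scaling:
  assumes "bounded_clinear T" "\<And>x y. x \<in> X \<Longrightarrow> y \<in> X \<Longrightarrow> cinner (T x) (T y) = complex_of_real r * cinner x y"
    and "x \<in> ccspan X"
  shows "(norm (T x))\<^sup>2 = r * (norm x)\<^sup>2"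
proof -
  have "complex_of_real ((norm (T x))\<^sup>2) = complex_of_real (r * (norm x)\<^sup>2)"
    using sesqui_scaling[of T id X r x x] assms by (simp add: bounded_clinearD[OF assms(1)] cinner_self)
  then show ?thesis by (simp only: of_real_eq_iff)
qed

subsection \<open>Orthogonal projections\<close>

text \<open>The midpoint of two almost minimising points lies in \<open>M\<close>, so the
  parallelogram law bounds their squared distance by their excess over the infimum; a minimising
  sequence is therefore Cauchy.\<close>

lemma closest_point_exists:
  fixes M :: "'a::chilbert_space set"
  assumes M: "complex_vector.subspace M" "closed M"
  obtains y where "y \<in> M" "\<And>z. z \<in> M \<Longrightarrow> norm (x - y) \<le> norm (x - z)"
proof -
  define d where "d = (INF z\<in>M. (norm (x - z))\<^sup>2)"
  have ne: "M \<noteq> {}" using csubspaceD(1)[OF M(1)] by auto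
  have bdd: "bdd_below ((\<lambda>z. (norm (x - z))\<^sup>2) ` M)" by (rule bdd_belowI[of _ 0]) auto
  have d: "d \<le> (norm (x - z))\<^sup>2" if "z \<in> M" for z
    unfolding d_def using bdd that by (rule cINF_lower)
  have "\<exists>z\<in>M. (norm (x - z))\<^sup>2 < d + 1 / Suc n" for n
  proof -
    have "d < d + 1 / Suc n" by simp
    then show ?thesis
      unfolding d_def by (subst (asm) cINF_less_iff[OF ne bdd]) (auto simp: d_def)
  qed
  then obtain f where f: "\<And>n. f n \<in> M" "\<And>n. (norm (x - f n))\<^sup>2 < d + 1 / Suc n" by metis
  have diff: "(norm (f m - f n))\<^sup>2 \<le> 2 * (1 / Suc m + 1 / Suc n)" for m n
  proof -
    have "(1/2) *\<^sub>C (f m + f n) \<in> M" using f M by (intro csubspaceD)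
    then have "d \<le> (norm (x - (1/2) *\<^sub>C (f m + f n)))\<^sup>2" by (rule d)
    moreover have "2 *\<^sub>R (x - (1/2) *\<^sub>C (f m + f n)) = (x - f m) + (x - f n)"
      by (simp add: scaleR_scaleC scaleC_diff_right scaleC_add_right scaleC_scaleC)
         (metis add_diff_add complex_vector.scale_one one_add_one scaleC_add_left)
    then have "(norm ((x - f m) + (x - f n)))\<^sup>2 = 4 * (norm (x - (1/2) *\<^sub>C (f m + f n)))\<^sup>2"
      by (metis norm_scaleR power_mult_distrib abs_numeral power2_eq_square numeral_times_numeral num_double semiring_norm(11))
    moreover have "(norm ((x - f m) + (x - f n)))\<^sup>2 + (norm ((x - f m) - (x - f n)))\<^sup>2
       = 2 * (norm (x - f m))\<^sup>2 + 2 * (norm (x - f n))\<^sup>2"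
      by (simp add: power2_norm_eq_inner inner_simps inner_commute)
    moreover have "norm ((x - f m) - (x - f n)) = norm (f m - f n)"
      by (simp add: norm_minus_commute)
    ultimately show ?thesis using f(2)[of m] f(2)[of n] by simp
  qed
  have "Cauchy f"
  proof (rule CauchyI)
    fix e :: real assume e: "0 < e"
    then obtain N where N: "4 / e\<^sup>2 < real N" using reals_Archimedean2 by blast
    have "norm (f m - f n) < e" if "N \<le> m" "N \<le> n" for m n
    proof -
      have N0: "0 < real N" using N e by (smt (verit) divide_pos_pos zero_less_power)
      have "1 / Suc m < 1 / N" "1 / Suc n < 1 / N" using that N0 by (auto intro!: divide_strict_left_mono)
      then have "(norm (f m - f n))\<^sup>2 < 4 / N" using diff[of m n] by simp
      also have "\<dots> < e\<^sup>2" using N e N0 by (simp add: field_simps)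
      finally show ?thesis using e by (simp add: power_less_imp_less_base)
    qed
    then show "\<exists>N. \<forall>m\<ge>N. \<forall>n\<ge>N. norm (f m - f n) < e" by blast
  qed
  then obtain y where y: "f \<longlonglongrightarrow> y" using Cauchy_convergent convergent_def by blast
  have "y \<in> M" using f(1) y M(2) closed_sequentially by blast
  moreover have "norm (x - y) \<le> norm (x - z)" if "z \<in> M" for z
  proof -
    have "(\<lambda>n. (norm (x - f n))\<^sup>2) \<longlonglongrightarrow> (norm (x - y))\<^sup>2" using y by (intro tendsto_intros)
    moreover have "(\<lambda>n. d + 1 / Suc n) \<longlonglongrightarrow> d + 0" by (intro tendsto_intros LIMSEQ_Suc[OF lim_1_over_n])
    ultimately have "(norm (x - y))\<^sup>2 \<le> d + 0"
      by (rule LIMSEQ_le) (use f(2) less_imp_le in blast)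
    then have "(norm (x - y))\<^sup>2 \<le> (norm (x - z))\<^sup>2" using d[OF \<open>z \<in> M\<close>] by linarith
    then show ?thesis by (rule power2_le_imp_le) (rule norm_ge_zero)
  qed
  ultimately show ?thesis using that by blast
qed

lemma orth_proj_exists:
  fixes M :: "'a::chilbert_space set"
  assumes M: "complex_vector.subspace M" "closed M"
  obtains y where "y \<in> M" "\<And>z. z \<in> M \<Longrightarrow> cinner z (x - y) = 0"
proof -
  obtain y where y: "y \<in> M" "\<And>z. z \<in> M \<Longrightarrow> norm (x - y) \<le> norm (x - z)"
    using closest_point_exists[OF M] by blast
  have "cinner z (x - y) = 0" if z: "z \<in> M" for z
  proof (cases "z = 0")
    case False
    \<comment> \<open>If \<open>cinner z (x - y)\<close> were nonzero, moving \<open>y\<close> by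
      this multiple of \<open>z\<close> would bring it closer to \<open>x\<close>.\<close>
    define c where "c = cinner z (x - y) / cinner z z"
    have "y + c *\<^sub>C z \<in> M" using y z M by (intro csubspaceD)
    then have "(norm (x - y))\<^sup>2 \<le> (norm (x - (y + c *\<^sub>C z)))\<^sup>2"
      using y(2) by (intro power_mono) auto
    then have 1: "Re (cinner (x - y) (x - y)) \<le> Re (cinner (x - (y + c *\<^sub>C z)) (x - (y + c *\<^sub>C z)))"
      by (simp add: cinner_self)
    have "x - (y + c *\<^sub>C z) = (x - y) - c *\<^sub>C z" by simp
    then have "cinner (x - (y + c *\<^sub>C z)) (x - (y + c *\<^sub>C z))
       = cinner (x - y) (x - y) - c * cinner (x - y) z - cnj c * cinner z (x - y) + cnj c * (c * cinner z z)"
      by (simp only: cinner_simps) (simp add: algebra_simps)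
    also have "c * cinner z z = cinner z (x - y)" using False by (simp add: c_def)
    also have "cinner (x - y) z = cnj (cinner z (x - y))" by (rule cinner_commute)
    finally have "0 \<le> - Re (c * cnj (cinner z (x - y)))" using 1 by simp
    moreover have "c * cnj (cinner z (x - y)) = complex_of_real ((cmod (cinner z (x - y)))\<^sup>2 / (norm z)\<^sup>2)"
      using complex_norm_square[of "cinner z (x - y)"] by (simp add: c_def cinner_self)
    then have "Re (c * cnj (cinner z (x - y))) = (cmod (cinner z (x - y)))\<^sup>2 / (norm z)\<^sup>2" by simp
    ultimately have "(cmod (cinner z (x - y)))\<^sup>2 / (norm z)\<^sup>2 \<le> 0" by simp
    then show ?thesis using False by (simp add: divide_le_0_iff)
  qed simp
  then show ?thesis using y(1) that by blast
qed

lemma orth_proj_eqI: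
  assumes "complex_vector.subspace M" "y \<in> M" "\<And>z. z \<in> M \<Longrightarrow> cinner z (x - y) = 0"
  shows "orth_proj M x = y"
  unfolding orth_proj_def
proof (rule the_equality)
  fix y' assume y': "y' \<in> M \<and> (\<forall>z\<in>M. cinner z (x - y') = 0)"
  then have "y' - y \<in> M" using csubspaceD(4)[OF assms(1)] assms(2) by auto
  then have "cinner (y' - y) (x - y) - cinner (y' - y) (x - y') = 0" using assms(3) y' by simp
  then have "cinner (y' - y) (y' - y) = 0" by (simp add: cinner_simps algebra_simps)
  then show "y' = y" by simp
qed (use assms in auto)

lemma
  fixes M :: "'a::chilbert_space set"
  assumes M: "complex_vector.subspace M" "closed M"
  shows orth_proj_in: "orth_proj M x \<in> M"
    and orth_proj_orth: "z \<in> M \<Longrightarrow> cinner z (x - orth_proj M x) = 0"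
proof -
  obtain y where y: "y \<in> M" "\<And>z. z \<in> M \<Longrightarrow> cinner z (x - y) = 0"
    using orth_proj_exists[OF M] by blast
  then have "orth_proj M x = y" using M by (intro orth_proj_eqI)
  then show "orth_proj M x \<in> M" "z \<in> M \<Longrightarrow> cinner z (x - orth_proj M x) = 0" using y by auto
qed

text \<open>Indexed by a generating set instead of a closed subspace: membership and orthogonality
  are then checked on generators, and no closedness hypothesis has to be carried along.\<close>

definition pr :: "'a::chilbert_space set \<Rightarrow> 'a \<Rightarrow> 'a" where
  "pr X = orth_proj (ccspan X)"

lemma pr_in [simp]: "pr X x \<in> ccspan X"
  by (simp add: pr_def orth_proj_in)

lemma pr_orth: "z \<in> ccspan X \<Longrightarrow> cinner z (x - pr X x) = 0"
  by (simp add: pr_def orth_proj_orth)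

lemma pr_eqI:
  assumes "y \<in> ccspan X" "\<And>z. z \<in> X \<Longrightarrow> cinner z (x - y) = 0"
  shows "pr X x = y"
  unfolding pr_def
proof (rule orth_proj_eqI)
  fix z assume z: "z \<in> ccspan X"
  show "cinner z (x - y) = 0"
    using orth_ccspan[OF z, of "x - y"] assms(2) orth_commute by blast
qed (use assms in auto)

lemma pr_cinner: "z \<in> ccspan X \<Longrightarrow> cinner z (pr X x) = cinner z x"
  using pr_orth[of z X x] by (simp add: cinner_simps)

lemma pr_norm_sq: "(norm (pr X x))\<^sup>2 + (norm (x - pr X x))\<^sup>2 = (norm x)\<^sup>2"
  using norm_add_orthogonal[OF pr_orth[OF pr_in], of X x x] by simp

lemma pr_norm_le: "norm (pr X x) \<le> norm x"
proof (rule power2_le_imp_le)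
  show "(norm (pr X x))\<^sup>2 \<le> (norm x)\<^sup>2" using pr_norm_sq[of X x] zero_le_power2[of "norm (x - pr X x)"] by linarith
qed simp

lemma pr_ident: "x \<in> ccspan X \<Longrightarrow> pr X x = x"
  by (rule pr_eqI) auto

lemma pr_zero: "(\<And>z. z \<in> X \<Longrightarrow> cinner z x = 0) \<Longrightarrow> pr X x = 0"
  using csubspaceD(1)[OF csubspace_ccspan] by (intro pr_eqI) auto

lemma pr_add: "pr X (x + y) = pr X x + pr X y"
proof (rule pr_eqI)
  show "pr X x + pr X y \<in> ccspan X" by (intro csubspaceD(2)) auto
  fix z assume "z \<in> X"
  then have z: "z \<in> ccspan X" using ccspan_superset by blast
  show "cinner z (x + y - (pr X x + pr X y)) = 0"
    using pr_orth[OF z, of x] pr_orth[OF z, of y] by (simp add: cinner_simps)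
qed

lemma pr_scaleC: "pr X (c *\<^sub>C x) = c *\<^sub>C pr X x"
proof (rule pr_eqI)
  show "c *\<^sub>C pr X x \<in> ccspan X" by (intro csubspaceD(3)) auto
  fix z assume "z \<in> X"
  then have z: "z \<in> ccspan X" using ccspan_superset by blast
  show "cinner z (c *\<^sub>C x - c *\<^sub>C pr X x) = 0"
    using pr_orth[OF z, of x] by (simp add: cinner_simps)
qed

lemma bounded_clinear_pr: "bounded_clinear (pr X)"
proof (rule bounded_clinearI)
  show "bounded_linear (pr X)"
    by (rule bounded_linear_intro[where K = 1])
      (simp_all add: pr_add pr_scaleC scaleR_scaleC pr_norm_le)
qed (rule pr_scaleC)

lemma pr_minus: "pr X (- x) = - pr X x"
  by (rule bounded_clinearD(6)[OF bounded_clinear_pr])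

lemma pr_Un:
  assumes "\<And>x y. x \<in> X \<Longrightarrow> y \<in> Y \<Longrightarrow> cinner x y = 0"
  shows "pr (X \<union> Y) x = pr X x + pr Y x"
proof (rule pr_eqI)
  have "pr X x \<in> ccspan (X \<union> Y)" "pr Y x \<in> ccspan (X \<union> Y)"
    using ccspan_mono[of X "X \<union> Y"] ccspan_mono[of Y "X \<union> Y"] pr_in by blast+
  then show "pr X x + pr Y x \<in> ccspan (X \<union> Y)" by (intro csubspaceD(2)) auto
  fix z assume "z \<in> X \<union> Y"
  then show "cinner z (x - (pr X x + pr Y x)) = 0"
  proof
    assume z: "z \<in> X"
    then have "cinner z (x - pr X x) = 0" using pr_orth ccspan_superset by blast
    moreover have "cinner z (pr Y x) = 0" using orth_ccspan[OF pr_in] assms z by blast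
    ultimately show ?thesis by (simp add: cinner_simps)
  next
    assume z: "z \<in> Y"
    then have "cinner z (x - pr Y x) = 0" using pr_orth ccspan_superset by blast
    moreover have "cinner z (pr X x) = 0" using orth_ccspan[OF pr_in] assms z orth_commute by blast
    ultimately show ?thesis by (simp add: cinner_simps)
  qed
qed

lemma pr_Un_norm:
  assumes "\<And>x y. x \<in> X \<Longrightarrow> y \<in> Y \<Longrightarrow> cinner x y = 0"
  shows "(norm (pr (X \<union> Y) x))\<^sup>2 = (norm (pr X x))\<^sup>2 + (norm (pr Y x))\<^sup>2"
  using norm_add_orthogonal[OF orth_ccspan2[OF pr_in pr_in assms]] pr_Un[OF assms] by metis

text \<open>Split \<open>x\<close> into its components along \<open>X\<close> and \<open>Y\<close>:
  \<open>T\<close> keeps the first inside the span of \<open>X'\<close> and makes the second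
  orthogonal to it. In this form block statements about generators pass to arbitrary
  vectors.\<close>

lemma pr_intertwine:
  assumes T: "bounded_clinear T" and Z: "x \<in> ccspan (X \<union> Y)"
    and XY: "\<And>x y. x \<in> X \<Longrightarrow> y \<in> Y \<Longrightarrow> cinner x y = 0"
    and TX: "\<And>x. x \<in> X \<Longrightarrow> T x \<in> ccspan X'"
    and TY: "\<And>y z. y \<in> Y \<Longrightarrow> z \<in> X' \<Longrightarrow> cinner z (T y) = 0"
  shows "pr X' (T x) = T (pr X x)"
proof -
  have x: "x = pr X x + pr Y x" using pr_ident[OF Z] pr_Un[OF XY] by metis
  have "pr X' (T (pr X x)) = T (pr X x)"
    by (rule pr_ident) (rule bounded_clinear_maps_ccspan[OF T TX pr_in])
  moreover have "pr X' (T (pr Y x)) = 0"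
  proof (rule pr_zero)
    fix z assume z: "z \<in> X'"
    have "complex_vector.subspace {y. cinner z (T y) = 0}"
      by (auto simp: csubspace_iff bounded_clinearD[OF T] cinner_simps)
    moreover have "closed {y. cinner z (T y) = 0}"
      by (intro closed_Collect_eq continuous_on_cinner continuous_intros bounded_clinearD(8)[OF T])
    ultimately have "ccspan Y \<subseteq> {y. cinner z (T y) = 0}"
      using TY z by (intro ccspan_minimal) auto
    then show "cinner z (T (pr Y x)) = 0" using pr_in by blast
  qed
  ultimately show ?thesis by (subst x) (simp add: bounded_clinearD(2)[OF T] pr_add)
qed

subsection \<open>Extension of operators from total families\<close>

text \<open>The closure of the graph of the densely defined operator is again the graph of an operator.\<close>

lemma extension_exists:
  fixes g :: "'i \<Rightarrow> 'x::chilbert_space" and f :: "'i \<Rightarrow> 'y::chilbert_space"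
  assumes \<sigma>: "\<sigma> = id \<or> \<sigma> = cnj"
    and bd: "\<And>ps. norm (\<Sum>(c, i)\<leftarrow>ps. \<sigma> c *\<^sub>C f i) \<le> C * norm (\<Sum>(c, i)\<leftarrow>ps. c *\<^sub>C g i)"
    and tot: "ccspan (range g) = UNIV"
  obtains T where "bounded_linear T" "\<And>c x. T (c *\<^sub>C x) = \<sigma> c *\<^sub>C T x" "\<And>i. T (g i) = f i"
    "\<And>x. norm (T x) \<le> C * norm x"
proof -
  have \<sigma>s [simp]: "\<sigma> 1 = 1" "\<sigma> (a * b) = \<sigma> a * \<sigma> b" "\<sigma> (- a) = - \<sigma> a" "\<sigma> (complex_of_real r) = complex_of_real r" for a b r
    using \<sigma> by auto
  define P where "P ps = (\<Sum>(c, i)\<leftarrow>ps. c *\<^sub>C g i, \<Sum>(c, i)\<leftarrow>ps. \<sigma> c *\<^sub>C f i)" for ps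
  define \<Gamma> where "\<Gamma> = closure (range P)"
  have add: "p + q \<in> \<Gamma>" if "p \<in> \<Gamma>" "q \<in> \<Gamma>" for p q
    using that unfolding \<Gamma>_def
  proof (rule closure_add[rotated])
    have "P ps + P qs = P (ps @ qs)" for ps qs by (simp add: P_def)
    then show "x \<in> range P \<Longrightarrow> y \<in> range P \<Longrightarrow> x + y \<in> range P" for x y by auto
  qed
  have scale': "(c *\<^sub>C fst p, \<sigma> c *\<^sub>C snd p) \<in> \<Gamma>" if p: "p \<in> \<Gamma>" for p c
    unfolding \<Gamma>_def
  proof (rule closure_map[where x = p])
    show "continuous_on UNIV (\<lambda>p. (c *\<^sub>C fst p, \<sigma> c *\<^sub>C snd p) :: 'x \<times> 'y)"
      by (intro continuous_on_Pair bounded_linear.continuous_on[OF bounded_linear_scaleC] continuous_intros)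
    have "(c *\<^sub>C fst (P ps), \<sigma> c *\<^sub>C snd (P ps)) = P (map (\<lambda>(d, i). (c * d, i)) ps)" for ps
      unfolding P_def by (induction ps) (auto simp: scaleC_add_right scaleC_scaleC)
    then show "(c *\<^sub>C fst q, \<sigma> c *\<^sub>C snd q) \<in> closure (range P)" if "q \<in> range P" for q
      using that closure_subset[of "range P"] by auto
  qed (use p in \<open>simp add: \<Gamma>_def\<close>)
  have scale: "(c *\<^sub>C x, \<sigma> c *\<^sub>C y) \<in> \<Gamma>" if "(x, y) \<in> \<Gamma>" for c x y using scale'[OF that] by simp
  have P: "P ps \<in> \<Gamma>" for ps unfolding \<Gamma>_def using closure_subset[of "range P"] by auto
  have g: "(g i, f i) \<in> \<Gamma>" for i using P[of "[(1, i)]"] by (simp add: P_def)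
  have bdc: "norm y \<le> C * norm x" if "(x, y) \<in> \<Gamma>" for x y
  proof -
    have "\<Gamma> \<subseteq> {p. norm (snd p) \<le> C * norm (fst p)}"
      unfolding \<Gamma>_def by (intro closure_minimal closed_Collect_le continuous_intros) (use bd in \<open>auto simp: P_def\<close>)
    then show ?thesis using that by auto
  qed
  \<comment> \<open>On the closed graph the first coordinate controls the norm of the pair, so its
    image is complete, hence closed; it contains the total family \<open>g\<close> and is the whole
    space.\<close>
  have "complete (fst ` \<Gamma>)"
  proof (rule complete_isometric_image[of "1 / (1 + \<bar>C\<bar>)"])
    have "r *\<^sub>R p \<in> \<Gamma>" if "p \<in> \<Gamma>" for r p
      using scale'[OF that, of "complex_of_real r"] by (simp add: scaleR_prod_def scaleR_scaleC)
    then show "subspace \<Gamma>" using add P[of "[]"] by (auto simp: subspace_def P_def zero_prod_def)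
    have "norm p \<le> (1 + \<bar>C\<bar>) * norm (fst p)" if "p \<in> \<Gamma>" for p
    proof -
      have "norm (snd p) \<le> C * norm (fst p)" using bdc[of "fst p" "snd p"] that by simp
      also have "\<dots> \<le> \<bar>C\<bar> * norm (fst p)" by (intro mult_right_mono) auto
      finally show ?thesis using norm_Pair_le[of "fst p" "snd p"] by (simp add: algebra_simps)
    qed
    then show "\<forall>p\<in>\<Gamma>. 1 / (1 + \<bar>C\<bar>) * norm p \<le> norm (fst p)" by (auto simp: field_simps)
    show "complete \<Gamma>" unfolding \<Gamma>_def by (simp add: complete_eq_closed)
  qed (auto intro: bounded_linear_fst)
  moreover have "fst ` \<Gamma> = {x. \<exists>y. (x, y) \<in> \<Gamma>}" by force
  moreover have "complex_vector.subspace {x. \<exists>y. (x, y) \<in> \<Gamma>}"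
    using P[of "[]"] add[of "(_, _)" "(_, _)"] scale unfolding csubspace_iff add_Pair P_def list.map sum_list.Nil by blast
  moreover have "range g \<subseteq> {x. \<exists>y. (x, y) \<in> \<Gamma>}" using g by blast
  ultimately have "ccspan (range g) \<subseteq> {x. \<exists>y. (x, y) \<in> \<Gamma>}"
    by (intro ccspan_minimal) (simp_all add: complete_eq_closed)
  then have ex: "\<exists>y. (x, y) \<in> \<Gamma>" for x using tot by auto
  have uniq: "y = y'" if y: "(x, y) \<in> \<Gamma>" "(x, y') \<in> \<Gamma>" for x y y'
    using bdc[OF add[OF y(1) scale[OF y(2), of "-1"], unfolded add_Pair]] by (simp add: scaleC_minus_left)
  define T where "T x = (THE y. (x, y) \<in> \<Gamma>)" for x
  have TI: "T x = y" if "(x, y) \<in> \<Gamma>" for x y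
    unfolding T_def using that uniq by blast
  have TG: "(x, T x) \<in> \<Gamma>" for x using ex[of x] TI by auto
  have Tadd: "T (x + y) = T x + T y" for x y using add[OF TG[of x] TG[of y]] by (intro TI) simp
  have Tsc: "T (c *\<^sub>C x) = \<sigma> c *\<^sub>C T x" for c x by (intro TI scale TG)
  have Tbd: "norm (T x) \<le> C * norm x" for x by (rule bdc[OF TG])
  have "bounded_linear T"
    by (rule bounded_linear_intro[where K = C])
      (simp_all add: Tadd Tsc Tbd scaleR_scaleC mult.commute[of _ C])
  then show ?thesis using Tsc Tbd TI[OF g] that by blast
qed

text \<open>The maps \<open>f k\<close>, weighted by the square roots of \<open>w k\<close>, form
  together an isometry into a finite direct sum, so each component is bounded. Unitarity relations
  have this shape: they control a whole row or column of multiplications, not a single one.\<close>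

lemma extension_exists_gram:
  fixes g :: "'i \<Rightarrow> 'x::chilbert_space" and f :: "'k \<Rightarrow> 'i \<Rightarrow> 'y::chilbert_space"
  assumes \<sigma>: "\<sigma> = id \<or> \<sigma> = cnj" and F: "finite F" "k \<in> F" and w: "\<And>k. k \<in> F \<Longrightarrow> 0 < w k"
    and gram: "\<And>i j. (\<Sum>k\<in>F. complex_of_real (w k) * cinner (f k i) (f k j)) = \<sigma> (cinner (g i) (g j))"
    and tot: "ccspan (range g) = UNIV"
  obtains T where "bounded_linear T" "\<And>c x. T (c *\<^sub>C x) = \<sigma> c *\<^sub>C T x" "\<And>i. T (g i) = f k i"
    "\<And>x. norm (T x) \<le> sqrt (1 / w k) * norm x"
proof -
  have \<sigma>s [simp]: "\<sigma> (a * b) = \<sigma> a * \<sigma> b" "\<sigma> (a + b) = \<sigma> a + \<sigma> b" "\<sigma> 0 = 0" "cnj (\<sigma> a) = \<sigma> (cnj a)" "\<sigma> (complex_of_real r) = complex_of_real r"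
    for a b r using \<sigma> by auto
  let ?G = "\<lambda>ps. \<Sum>(c, i)\<leftarrow>ps. c *\<^sub>C g i" and ?F = "\<lambda>k ps. \<Sum>(c, i)\<leftarrow>ps. \<sigma> c *\<^sub>C f k i"
  have 1: "(\<Sum>k\<in>F. w k * cinner (f k i) (?F k ps)) = \<sigma> (cinner (g i) (?G ps))" for i ps
    by (induction ps) (auto simp: cinner_simps distrib_left sum.distrib mult.left_commute simp flip: sum_distrib_left gram)
  have 2: "(\<Sum>k\<in>F. w k * cinner (?F k ps) (?F k qs)) = \<sigma> (cinner (?G ps) (?G qs))" for ps qs
    by (induction ps) (auto simp: cinner_simps distrib_left sum.distrib sum_distrib_left mult_ac simp flip: 1)
  have "norm (?F k ps) \<le> sqrt (1 / w k) * norm (?G ps)" for ps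
  proof -
    have "complex_of_real (\<Sum>k\<in>F. w k * (norm (?F k ps))\<^sup>2) = complex_of_real ((norm (?G ps))\<^sup>2)"
      using 2[of ps ps] by (simp only: cinner_self of_real_sum of_real_mult \<sigma>s)
    then have "(\<Sum>k\<in>F. w k * (norm (?F k ps))\<^sup>2) = (norm (?G ps))\<^sup>2" by (simp only: of_real_eq_iff)
    moreover have "w k * (norm (?F k ps))\<^sup>2 \<le> (\<Sum>k\<in>F. w k * (norm (?F k ps))\<^sup>2)"
      using F w by (intro member_le_sum) (auto simp: less_imp_le)
    ultimately have "(norm (?F k ps))\<^sup>2 \<le> (1 / w k) * (norm (?G ps))\<^sup>2"
      using w[OF F(2)] by (simp add: field_simps)
    then have "sqrt ((norm (?F k ps))\<^sup>2) \<le> sqrt ((1 / w k) * (norm (?G ps))\<^sup>2)"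
      by (rule real_sqrt_le_mono)
    then show ?thesis by (simp only: real_sqrt_mult real_sqrt_abs abs_norm_cancel)
  qed
  then show ?thesis using extension_exists[OF \<sigma>, of "f k" "sqrt (1 / w k)" g] tot that by blast
qed

lemma isometry_extension:
  fixes g :: "'i \<Rightarrow> 'x::chilbert_space" and f :: "'i \<Rightarrow> 'y::chilbert_space"
  assumes \<sigma>: "\<sigma> = id \<or> \<sigma> = cnj"
    and gram: "\<And>i j. cinner (f i) (f j) = \<sigma> (cinner (g i) (g j))"
    and tot: "ccspan (range g) = UNIV"
  obtains T where "bounded_linear T" "\<And>c x. T (c *\<^sub>C x) = \<sigma> c *\<^sub>C T x" "\<And>i. T (g i) = f i"
proof -
  obtain T where "bounded_linear T" "\<And>c x. T (c *\<^sub>C x) = \<sigma> c *\<^sub>C T x" "\<And>i. T (g i) = f i"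
    "\<And>x. norm (T x) \<le> sqrt (1 / 1) * norm x"
    by (rule extension_exists_gram[OF \<sigma>, of "{()}" "()" "\<lambda>_. 1" "\<lambda>_. f" g]) (use gram tot in auto)
  then show ?thesis using that by blast
qed

lemma isometry_sesqui:
  assumes "bounded_linear T" "\<And>c x. T (c *\<^sub>C x) = \<sigma> c *\<^sub>C T x" "\<sigma> = id \<or> \<sigma> = cnj"
    and "\<And>x y. x \<in> X \<Longrightarrow> y \<in> X \<Longrightarrow> cinner (T x) (T y) = \<sigma> (cinner x y)" "ccspan X = UNIV"
  shows "cinner (T x) (T y) = \<sigma> (cinner x y)"
  using sesqui_scaling[OF assms(1-3), of X 1 x y] assms(4,5) by simp

text \<open>For small \<open>t\<close> the map \<open>x \<mapsto> x - t (N x - y)\<close> is a contraction.\<close>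

lemma coercive_inverse:
  fixes N :: "'h::chilbert_space \<Rightarrow> 'h"
  assumes N: "bounded_clinear N" and c: "0 < c" "\<And>x. c * (norm x)\<^sup>2 \<le> Re (cinner x (N x))"
  obtains R where "bounded_clinear R" "\<And>x. N (R x) = x"
proof -
  have low: "c * norm x \<le> norm (N x)" for x
  proof (cases "x = 0")
    case False
    have "c * norm x * norm x \<le> norm (N x) * norm x"
      using c(2)[of x] Re_cinner_le[of x "N x"] by (simp add: power2_eq_square mult_ac)
    then show ?thesis using False by simp
  qed (simp add: bounded_clinearD[OF N])
  obtain K0 where K0: "0 < K0" "\<And>x. norm (N x) \<le> norm x * K0"
    using bounded_linear.pos_bounded[OF bounded_clinearD(1)[OF N]] by blast
  \<comment> \<open>\<open>K\<close> bounds the norm of \<open>N\<close> and exceeds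
    \<open>c\<close>. This \<open>t\<close> minimises \<open>1 - 2 t c + t^2 K^2\<close>; the
    minimum is \<open>1 - t c\<close>, which lies in the interval from 0 to 1.\<close>
  define K t where "K = c + K0" and "t = c / K\<^sup>2"
  have K: "0 < K" "c < K" using c(1) K0(1) by (auto simp: K_def)
  have q: "0 \<le> 1 - t * c" "1 - t * c < 1"
    using K c(1) power_strict_mono[of c K 2] by (simp_all add: t_def divide_le_eq flip: power2_eq_square)
  have contr: "norm (x - t *\<^sub>R N x) \<le> sqrt (1 - t * c) * norm x" for x
  proof -
    have "norm (N x) \<le> K * norm x" using K0(2)[of x] mult_nonneg_nonneg[OF less_imp_le[OF c(1)] norm_ge_zero, of x]
      unfolding K_def distrib_right mult.commute[of K0] by linarith
    then have "(norm (N x))\<^sup>2 \<le> (K * norm x)\<^sup>2" by (intro power_mono) auto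
    then have "t\<^sup>2 * (norm (N x))\<^sup>2 \<le> t\<^sup>2 * (K * norm x)\<^sup>2" by (intro mult_left_mono) auto
    also have "\<dots> = t * c * (norm x)\<^sup>2" using K by (simp add: t_def power2_eq_square)
    finally have "t\<^sup>2 * (norm (N x))\<^sup>2 \<le> t * c * (norm x)\<^sup>2" .
    moreover have "t * (c * (norm x)\<^sup>2) \<le> t * inner x (N x)"
      using c K by (intro mult_left_mono) (auto simp: t_def inner_eq_Re_cinner)
    moreover have "(norm (x - t *\<^sub>R N x))\<^sup>2 = (norm x)\<^sup>2 - 2 * (t * inner x (N x)) + t\<^sup>2 * (norm (N x))\<^sup>2"
      by (simp add: power2_norm_eq_inner inner_simps inner_commute) (simp add: power2_eq_square)
    ultimately have "(norm (x - t *\<^sub>R N x))\<^sup>2 \<le> (1 - t * c) * (norm x)\<^sup>2" by (simp add: algebra_simps)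
    then have "sqrt ((norm (x - t *\<^sub>R N x))\<^sup>2) \<le> sqrt ((1 - t * c) * (norm x)\<^sup>2)" by (rule real_sqrt_le_mono)
    then show ?thesis by (simp only: real_sqrt_mult real_sqrt_abs abs_norm_cancel)
  qed
  have "\<exists>x. N x = y" for y
  proof -
    have "\<exists>!x. x - t *\<^sub>R (N x - y) = x"
    proof (rule banach_fix_type)
      show "\<forall>x z. dist (x - t *\<^sub>R (N x - y)) (z - t *\<^sub>R (N z - y)) \<le> sqrt (1 - t * c) * dist x z"
        using contr[of "_ - _"] by (simp add: dist_norm bounded_clinearD[OF N] algebra_simps)
    qed (use q in auto)
    then show ?thesis using K c(1) by (auto simp: t_def)
  qed
  then obtain R where NR: "\<And>x. N (R x) = x" by metis
  have inj: "x = y" if "N x = N y" for x y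
    using low[of "x - y"] that c by (simp add: bounded_clinearD[OF N] mult_le_0_iff)
  have "bounded_clinear R"
  proof (rule bounded_clinearI)
    show "bounded_linear R"
    proof (rule bounded_linear_intro[where K = "1 / c"])
      show "R (x + y) = R x + R y" for x y by (rule inj) (simp add: NR bounded_clinearD[OF N])
      show "R (r *\<^sub>R x) = r *\<^sub>R R x" for x r by (rule inj) (simp add: NR bounded_clinearD[OF N] scaleR_scaleC)
      show "norm (R x) \<le> norm x * (1 / c)" for x using low[of "R x"] c by (simp add: NR field_simps)
    qed
    show "R (r *\<^sub>C x) = r *\<^sub>C R x" for x r by (rule inj) (simp add: NR bounded_clinearD[OF N])
  qed
  then show ?thesis using NR that by blast
qed

section \<open>Temperley--Lieb vectors\<close>

definition Ln :: "nat \<Rightarrow> 'n::finite list set" where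
  "Ln k = {I. length I = k}"

lemma finite_Ln [simp]: "finite (Ln k :: 'n::finite list set)"
  using finite_lists_length_eq[of "UNIV :: 'n set" k] by (simp add: Ln_def)

lemma Ln_0 [simp]: "Ln 0 = {[]}"
  by (auto simp: Ln_def)

lemma in_Ln [simp]: "I \<in> Ln k \<longleftrightarrow> length I = k"
  by (simp add: Ln_def)

lemma sum_Ln_Suc: "(\<Sum>I\<in>Ln (Suc k). f I) = (\<Sum>a\<in>(UNIV::'n::finite set). \<Sum>I\<in>Ln k. f (a # I))"
proof -
  have "Ln (Suc k) = (\<lambda>(a, I). a # I) ` ((UNIV::'n set) \<times> Ln k)"
    by (auto simp: Ln_def length_Suc_conv image_iff)
  moreover have "inj_on (\<lambda>(a, I). a # I) ((UNIV::'n set) \<times> Ln k)"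
    by (auto simp: inj_on_def)
  ultimately show ?thesis by (simp add: sum.reindex sum.cartesian_product case_prod_unfold)
qed

lemma sum_if_scaleC: "(\<Sum>d\<in>(UNIV::'n::finite set). (if d = b then z else 0) *\<^sub>C f d) = z *\<^sub>C (f b :: 'v::complex_vector)"
proof -
  have "(\<Sum>d\<in>(UNIV::'n set). (if d = b then z else 0) *\<^sub>C f d) = (\<Sum>d\<in>(UNIV::'n set). if d = b then z *\<^sub>C f b else 0)"
    by (intro sum.cong) auto
  then show ?thesis by simp
qed

lemma sum_if_mult: "(\<Sum>d\<in>(UNIV::'n::finite set). (if d = b then z else 0) * f d) = (z * f b :: complex)"
  using sum_if_scaleC[of b z f] by (simp add: scaleC_complex_def)

lemma sum_swap4:
  "(\<Sum>a\<in>A. \<Sum>b\<in>B. \<Sum>c\<in>C. \<Sum>d\<in>E. f a b c d) = (\<Sum>c\<in>C. \<Sum>d\<in>E. \<Sum>a\<in>A. \<Sum>b\<in>B. f a b c d)"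
proof -
  have "(\<Sum>b\<in>B. \<Sum>c\<in>C. \<Sum>d\<in>E. f a b c d) = (\<Sum>c\<in>C. \<Sum>d\<in>E. \<Sum>b\<in>B. f a b c d)" for a
    by (subst sum.swap, rule sum.cong[OF refl], rule sum.swap)
  then have "(\<Sum>a\<in>A. \<Sum>b\<in>B. \<Sum>c\<in>C. \<Sum>d\<in>E. f a b c d) = (\<Sum>a\<in>A. \<Sum>c\<in>C. \<Sum>d\<in>E. \<Sum>b\<in>B. f a b c d)" by simp
  also have "\<dots> = (\<Sum>c\<in>C. \<Sum>d\<in>E. \<Sum>a\<in>A. \<Sum>b\<in>B. f a b c d)"
    by (subst sum.swap, rule sum.cong[OF refl], rule sum.swap)
  finally show ?thesis .
qed

lemma sum_Ln_rev: "(\<Sum>I\<in>Ln k. f (rev I)) = (\<Sum>I\<in>Ln k. f I)"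
  by (rule sum.reindex_bij_witness[of _ rev rev]) auto

definition sl :: "'n \<Rightarrow> ('n list \<Rightarrow> complex) \<Rightarrow> 'n list \<Rightarrow> complex" where
  "sl a v = (\<lambda>I. v (a # I))"

lemma sl_app [simp]: "sl a v I = v (a # I)"
  by (simp add: sl_def)

text \<open>The numbers \<open>[k + 2] / [k + 1]\<close> for the quantum integers with \<open>[2] = D\<close>.\<close>

primrec tly :: "real \<Rightarrow> nat \<Rightarrow> real" where
  "tly D 0 = D"
| "tly D (Suc k) = D - 1 / tly D k"

lemma tly_gt_1: "D > 2 \<Longrightarrow> tly D k > 1"
proof (induction k)
  case (Suc k)
  then have "1 / tly D k < 1" by simp
  then have "1 < D - 1 / tly D k" using Suc.prems by linarith
  then show ?case by simp
qed simp

definition lw :: "('n \<Rightarrow> real) \<Rightarrow> 'n list \<Rightarrow> real" where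
  "lw \<beta> I = prod_list (map \<beta> I)"

lemma lw_simps [simp]: "lw \<beta> [] = 1" "lw \<beta> (a # I) = \<beta> a * lw \<beta> I"
  "lw \<beta> (I @ J) = lw \<beta> I * lw \<beta> J" "lw \<beta> (rev I) = lw \<beta> I"
proof -
  show "lw \<beta> [] = 1" "lw \<beta> (a # I) = \<beta> a * lw \<beta> I" by (simp_all add: lw_def)
  show app: "lw \<beta> (I @ J) = lw \<beta> I * lw \<beta> J" for I J by (simp add: lw_def)
  show "lw \<beta> (rev I) = lw \<beta> I"
    by (induction I) (simp_all add: app, simp_all add: lw_def)
qed

lemma lw_pos: "(\<And>a. 0 < \<beta> a) \<Longrightarrow> 0 < lw \<beta> I"
  by (induction I) simp_all

text \<open>Tensors in the k-fold power of C^n are functions on words of length \<open>k\<close>.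
  The diagonal weight \<open>\<beta>\<close> is needed because the orthogonality relations of a
  nontracial Haar state are weighted.\<close>

definition ip :: "('n::finite \<Rightarrow> real) \<Rightarrow> nat \<Rightarrow> ('n list \<Rightarrow> complex) \<Rightarrow> ('n list \<Rightarrow> complex) \<Rightarrow> complex" where
  "ip \<beta> k u v = (\<Sum>I\<in>Ln k. complex_of_real (lw \<beta> I) * cnj (u I) * v I)"

lemma ip_0: "ip \<beta> 0 u v = cnj (u []) * v []"
  by (simp add: ip_def)

lemma ip_Suc: "ip \<beta> (Suc k) u v = (\<Oplus>a. complex_of_real (\<beta> a) * ip \<beta> k (sl a u) (sl a v))"
  by (simp add: ip_def sum_Ln_Suc sum_distrib_left mult.assoc)

lemma ip_commute: "ip \<beta> k u v = cnj (ip \<beta> k v u)"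
  by (simp add: ip_def mult_ac)

lemma ip_zero_right [simp]: "ip \<beta> k u (\<lambda>I. 0) = 0"
  by (simp add: ip_def)

lemma ip_diff_left: "ip \<beta> k (\<lambda>I. v I - v' I) u = ip \<beta> k v u - ip \<beta> k v' u"
  by (simp add: ip_def right_diff_distrib left_diff_distrib sum_subtractf)

lemma ip_scale_right: "ip \<beta> k u (\<lambda>I. c * v I) = c * ip \<beta> k u v"
  by (simp add: ip_def sum_distrib_left mult_ac)

lemma ip_scale_left: "ip \<beta> k (\<lambda>I. c * u I) v = cnj c * ip \<beta> k u v"
  by (simp add: ip_def sum_distrib_left mult_ac)

lemma ip_sum_right: "ip \<beta> k u (\<lambda>I. \<Sum>i\<in>A. f i I) = (\<Sum>i\<in>A. ip \<beta> k u (f i))"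
  by (simp add: ip_def sum_distrib_left sum.swap[of _ A])

lemma ip_rev: "ip \<beta> k (\<lambda>I. u (rev I)) (\<lambda>I. v (rev I)) = ip \<beta> k u v"
  using sum_Ln_rev[of "\<lambda>I. complex_of_real (lw \<beta> I) * cnj (u I) * v I" k] by (simp add: ip_def)

text \<open>The matrix \<open>t\<close> is the invariant vector of \<open>u \<otimes> u\<close>; the hypothesis \<open>t_conj\<close> is the conjugate
  equation, with \<open>s = \<plusminus>1\<close>.\<close>

locale tl_vec =
  fixes t :: "'n::finite \<Rightarrow> 'n \<Rightarrow> complex" and s :: complex and D :: real
  assumes s_sq: "s * s = 1" and s_real: "cnj s = s" and D2: "D > 2"
    and t_conj: "\<And>a c. (\<Oplus>b. t a b * cnj (t b c)) = (if a = c then s else 0)"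
    and t_norm: "(\<Oplus>a b. cnj (t a b) * t a b) = complex_of_real D"
begin

abbreviation y :: "nat \<Rightarrow> real" where "y \<equiv> tly D"

lemma y_pos: "y k > 0" "y k \<noteq> 0" "complex_of_real (y k) \<noteq> 0"
  using tly_gt_1[OF D2, of k] by auto

lemma t_conj': "(\<Oplus>b. cnj (t a b) * t b c) = (if a = c then s else 0)"
proof -
  have "cnj (\<Oplus>b. t a b * cnj (t b c)) = cnj (if a = c then s else 0)" by (simp only: t_conj)
  then show ?thesis by (simp add: s_real split: if_splits)
qed

text \<open>The cap of the Temperley-Lieb calculus, applied to the first two legs.\<close>

definition tau :: "('n list \<Rightarrow> complex) \<Rightarrow> 'n list \<Rightarrow> complex" where
  "tau v = (\<lambda>J. \<Oplus>a b. cnj (t a b) * v (a # b # J))"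

text \<open>\<open>VV k\<close> is the highest weight space of \<open>(\<complex>\<^sup>n)\<^bsup>\<otimes>k\<^esup>\<close>, the range of the Jones--Wenzl projection,
  and \<open>EE k\<close> is \<open>\<complex>\<^sup>n \<otimes> VV k\<close>.\<close>

definition VV :: "nat \<Rightarrow> ('n list \<Rightarrow> complex) \<Rightarrow> bool" where
  "VV k v \<longleftrightarrow> (\<forall>I. length I \<noteq> k \<longrightarrow> v I = 0) \<and>
     (\<forall>I J. (\<Oplus>a b. cnj (t a b) * v (I @ a # b # J)) = 0)"

definition EE :: "nat \<Rightarrow> ('n list \<Rightarrow> complex) \<Rightarrow> bool" where
  "EE k v \<longleftrightarrow> v [] = 0 \<and> (\<forall>a. VV k (sl a v))"

lemma VV_supp: "VV k v \<Longrightarrow> length I \<noteq> k \<Longrightarrow> v I = 0"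
  by (simp add: VV_def)

lemma VV_contr: "VV k v \<Longrightarrow> (\<Oplus>a b. cnj (t a b) * v (I @ a # b # J)) = 0"
  by (simp add: VV_def)

lemma VV_zero: "VV k (\<lambda>I. 0)"
  by (simp add: VV_def)

lemma VV_sum: "(\<And>i. i \<in> A \<Longrightarrow> VV k (f i)) \<Longrightarrow> VV k (\<lambda>I. \<Sum>i\<in>A. c i * f i I)"
proof (induction A rule: infinite_finite_induct)
  case (insert x F)
  then have "VV k (f x)" "VV k (\<lambda>I. \<Sum>i\<in>F. c i * f i I)" by auto
  moreover have "(\<Oplus>a b. cnj (t a b) * (c x * f x (I @ a # b # J) + (\<Sum>i\<in>F. c i * f i (I @ a # b # J))))
    = c x * (\<Oplus>a b. cnj (t a b) * f x (I @ a # b # J))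
      + (\<Oplus>a b. cnj (t a b) * (\<Sum>i\<in>F. c i * f i (I @ a # b # J)))" for I J
    by (simp add: distrib_left sum.distrib sum_distrib_left[of "c x"] mult_ac)
  ultimately show ?case using insert(1,2) by (simp add: VV_def)
qed (simp_all add: VV_zero)

lemma VV_scale: "VV k u \<Longrightarrow> VV k (\<lambda>I. c * u I)"
  using VV_sum[of "{()}" k "\<lambda>_. u" "\<lambda>_. c"] by simp

lemma VV_diff: "VV k u \<Longrightarrow> VV k v \<Longrightarrow> VV k (\<lambda>I. c * u I - d * v I)"
  using VV_sum[of "UNIV :: bool set" k "\<lambda>b. if b then u else v" "\<lambda>b. if b then c else - d"]
  by (simp add: UNIV_bool)

lemma EE_diff: "EE k u \<Longrightarrow> EE k v \<Longrightarrow> EE k (\<lambda>I. c * u I - d * v I)"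
  by (simp add: EE_def sl_def VV_diff)

lemma EE_VV: "EE k v \<Longrightarrow> VV k (sl a v)"
  by (simp add: EE_def)

lemma EE_supp: "EE k v \<Longrightarrow> length I \<noteq> Suc k \<Longrightarrow> v I = 0"
proof (cases I)
  case (Cons a J)
  assume "EE k v" "length I \<noteq> Suc k"
  then have "sl a v J = 0" using Cons by (intro VV_supp[OF EE_VV]) auto
  then show ?thesis by (simp add: Cons)
qed (simp add: EE_def)

lemma VV_Suc_iff: "VV (Suc k) v \<longleftrightarrow> EE k v \<and> (\<forall>J. tau v J = 0)"
proof
  assume v: "VV (Suc k) v"
  have "VV k (sl a v)" for a
    unfolding VV_def
  proof (intro conjI allI impI)
    show "sl a v I = 0" if "length I \<noteq> k" for I using VV_supp[OF v, of "a # I"] that by simp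
    show "(\<Oplus>b c. cnj (t b c) * sl a v (I @ b # c # J)) = 0" for I J
      using VV_contr[OF v, of "a # I" J] by simp
  qed
  moreover have "tau v J = 0" for J using VV_contr[OF v, of "[]"] by (simp add: tau_def)
  ultimately show "EE k v \<and> (\<forall>J. tau v J = 0)" using VV_supp[OF v] by (simp add: EE_def)
next
  assume v: "EE k v \<and> (\<forall>J. tau v J = 0)"
  have "(\<Oplus>a b. cnj (t a b) * v (I @ a # b # J)) = 0" for I J
  proof (cases I)
    case Nil then show ?thesis using v by (simp add: tau_def)
  next
    case (Cons c I')
    have "VV k (sl c v)" using v by (simp add: EE_def)
    then show ?thesis using VV_contr[of k "sl c v" I' J] by (simp add: Cons)
  qed
  then show "VV (Suc k) v" using v by (auto simp: VV_def intro: EE_supp)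
qed

lemma VV_sl: "VV (Suc k) v \<Longrightarrow> VV k (sl a v)"
  by (simp add: VV_Suc_iff EE_def)

lemma VV_tau: "VV (Suc k) v \<Longrightarrow> tau v = (\<lambda>J. 0)"
  by (simp add: VV_Suc_iff fun_eq_iff)

lemma VV_EE: "VV (Suc k) v \<Longrightarrow> EE k v"
  by (simp add: VV_Suc_iff)

lemma tau_alt: "tau v = (\<lambda>J. \<Oplus>a b. cnj (t a b) * sl b (sl a v) J)"
  by (simp add: tau_def)

lemma VV_tau_EE: "EE (Suc k) v \<Longrightarrow> VV k (tau v)"
proof -
  assume v: "EE (Suc k) v"
  have "VV k (\<lambda>J. \<Oplus>p. cnj (t (fst p) (snd p)) * sl (snd p) (sl (fst p) v) J)"
    by (intro VV_sum VV_sl EE_VV[OF v])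
  moreover have "(\<lambda>J. \<Oplus>p. cnj (t (fst p) (snd p)) * sl (snd p) (sl (fst p) v) J) = tau v"
    by (simp add: tau_def sum.cartesian_product case_prod_unfold flip: UNIV_Times_UNIV)
  ultimately show ?thesis by simp
qed

lemma EE_0_VV: "EE 0 v \<Longrightarrow> VV (Suc 0) v"
proof -
  assume v: "EE 0 v"
  have "v (a # b # J) = 0" for a b J
    by (rule EE_supp[OF v]) simp
  then show ?thesis using v by (simp add: VV_Suc_iff tau_def)
qed

text \<open>The intertwiner from \<open>VV k\<close> into C^n \<otimes> \<open>VV (Suc k)\<close>.
  The tails of t \<otimes> v are not of highest weight; the correction is the same map one level
  down, applied to the tails of \<open>v\<close>, and \<open>s / y k\<close> is the factor for which
  contracting the second and third legs gives 0.\<close>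

primrec cr :: "nat \<Rightarrow> ('n list \<Rightarrow> complex) \<Rightarrow> 'n list \<Rightarrow> complex" where
  "cr 0 = (\<lambda>v I. case I of a # b # J \<Rightarrow> t a b * v J | _ \<Rightarrow> 0)"
| "cr (Suc k) = (\<lambda>v I. case I of a # b # J \<Rightarrow> t a b * v J - s / y k * cr k (sl a v) (b # J) | _ \<Rightarrow> 0)"

declare cr.simps [simp del]

lemma cr_Nil [simp]: "cr k v [] = 0" "cr k v [a] = 0"
  by (cases k; simp add: cr.simps)+

lemma cr_0 [simp]: "cr 0 v (a # b # J) = t a b * v J"
  by (simp add: cr.simps)

lemma cr_Suc: "cr (Suc k) v (a # I) = cr 0 v (a # I) - s / y k * cr k (sl a v) I"
  by (cases I) (simp_all add: cr.simps)

lemma cr_sum: "cr k (\<lambda>I. \<Sum>i\<in>A. c i * f i I) I = (\<Sum>i\<in>A. c i * cr k (f i) I)"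
proof (induction k arbitrary: f I)
  case 0
  show ?case
  proof (cases I)
    case (Cons a I') then show ?thesis
      by (cases I') (simp_all add: sum_distrib_left mult_ac)
  qed simp
next
  case (Suc k)
  have 0: "cr 0 (\<lambda>I. \<Sum>i\<in>A. c i * f i I) I = (\<Sum>i\<in>A. c i * cr 0 (f i) I)" for I
  proof (cases I)
    case (Cons a I') then show ?thesis
      by (cases I') (simp_all add: sum_distrib_left mult_ac)
  qed simp
  show ?case
  proof (cases I)
    case (Cons a J)
    have "cr k (sl a (\<lambda>I. \<Sum>i\<in>A. c i * f i I)) J = (\<Sum>i\<in>A. c i * cr k (sl a (f i)) J)"
      using Suc[of "\<lambda>i. sl a (f i)" J] by (simp add: sl_def)
    then show ?thesis unfolding Cons cr_Suc 0
      by (simp add: sum_subtractf right_diff_distrib sum_distrib_left mult_ac)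
  qed simp
qed

lemma cr_zero [simp]: "cr k (\<lambda>J. 0) = (\<lambda>J. 0)"
  using cr_sum[of k "\<lambda>_. 0" "\<lambda>_ _. 0" "{} :: nat set"] by (simp add: fun_eq_iff)

lemma tau_cr_0: "tau (cr 0 v) J = complex_of_real D * v J"
  using t_norm by (simp add: tau_def mult.assoc[symmetric] flip: sum_distrib_right)

text \<open>The leading term of \<open>cr\<close> gives \<open>s * v J\<close> by the conjugate
  equation; its correction contracts the first two legs of \<open>v\<close> and vanishes because
  \<open>v\<close> is of highest weight.\<close>

lemma tau_cr_aux:
  assumes v: "VV (Suc k) v"
  shows "(\<Oplus>a b. cnj (t a b) * cr k (sl a v) (b # J)) = s * v J"
proof (cases J)
  case Nil
  then show ?thesis using VV_supp[OF v, of "[]"] by simp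
next
  case (Cons c J')
  have 1: "(\<Oplus>a b. cnj (t a b) * cr 0 (sl a v) (b # J)) = s * v J"
  proof -
    have "(\<Oplus>a b. cnj (t a b) * cr 0 (sl a v) (b # J))
      = (\<Oplus>a. (\<Oplus>b. cnj (t a b) * t b c) * v (a # J'))"
      by (simp add: Cons sum_distrib_right mult.assoc)
    also have "\<dots> = (\<Oplus>a. if a = c then s * v (a # J') else 0)"
      unfolding t_conj' by (intro sum.cong) auto
    finally show ?thesis by (simp add: Cons)
  qed
  show ?thesis
  proof (cases k)
    case 0 then show ?thesis using 1 by simp
  next
    case (Suc k')
    have "(\<Oplus>a b. cnj (t a b) * cr k' (sl b (sl a v)) J)
      = (\<Oplus>p. cnj (t (fst p) (snd p)) * cr k' (sl (snd p) (sl (fst p) v)) J)"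
      by (simp add: sum.cartesian_product case_prod_unfold flip: UNIV_Times_UNIV)
    also have "\<dots> = cr k' (\<lambda>I. \<Oplus>p. cnj (t (fst p) (snd p)) * sl (snd p) (sl (fst p) v) I) J"
      by (simp only: cr_sum)
    also have "(\<lambda>I. \<Oplus>p. cnj (t (fst p) (snd p)) * sl (snd p) (sl (fst p) v) I) = tau v"
      by (simp add: tau_def sum.cartesian_product case_prod_unfold flip: UNIV_Times_UNIV)
    also have "cr k' (tau v) J = 0" by (simp add: VV_tau[OF v])
    finally have 2: "(\<Oplus>a b. cnj (t a b) * cr k' (sl b (sl a v)) J) = 0" .
    have "(\<Oplus>a b. cnj (t a b) * cr k (sl a v) (b # J))
      = (\<Oplus>a b. cnj (t a b) * cr 0 (sl a v) (b # J))
        - s / y k' * (\<Oplus>a b. cnj (t a b) * cr k' (sl b (sl a v)) J)"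
      by (simp add: Suc cr_Suc right_diff_distrib sum_subtractf sum_distrib_left mult_ac)
    then show ?thesis using 1 2 by simp
  qed
qed

text \<open>This is the origin of the recursion of \<open>tly\<close>: \<open>D\<close> is the value
  of the closed loop, and the correction contributes s * s / y = 1 / y.\<close>

lemma tau_cr:
  assumes v: "VV k v"
  shows "tau (cr k v) = (\<lambda>J. complex_of_real (y k) * v J)"
proof
  fix J
  show "tau (cr k v) J = y k * v J"
  proof (cases k)
    case 0 then show ?thesis by (simp add: tau_cr_0)
  next
    case (Suc k')
    have "tau (cr k v) J = tau (cr 0 v) J - s / y k' * (\<Oplus>a b. cnj (t a b) * cr k' (sl a v) (b # J))"
      by (simp add: Suc cr_Suc tau_def right_diff_distrib sum_subtractf sum_distrib_left mult_ac)
    also have "\<dots> = D * v J - s / y k' * (s * v J)"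
      using tau_cr_aux[of k' v J] v by (simp add: Suc tau_cr_0)
    also have "\<dots> = y k * v J"
      using s_sq by (simp add: Suc left_diff_distrib)
    finally show ?thesis .
  qed
qed

text \<open>Contracting the second and third legs yields \<open>s\<close> times \<open>v\<close>
  from the leading term, by the conjugate equation, and the same from the correction, by
  \<open>tau_cr\<close>.\<close>

lemma EE_cr: "VV k v \<Longrightarrow> EE (Suc k) (cr k v)"
proof (induction k arbitrary: v)
  case 0
  have "VV (Suc 0) (sl a (cr 0 v))" for a
  proof (rule EE_0_VV)
    have "sl b (sl a (cr 0 v)) = (\<lambda>J. t a b * v J)" for b by (simp add: fun_eq_iff)
    then show "EE 0 (sl a (cr 0 v))" using VV_scale[OF 0] by (simp add: EE_def)
  qed
  then show ?case by (simp add: EE_def)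
next
  case (Suc k)
  have IH: "EE (Suc k) (cr k (sl a v))" for a by (rule Suc.IH[OF VV_sl[OF Suc.prems]])
  have "VV (Suc (Suc k)) (sl a (cr (Suc k) v))" for a
    unfolding VV_Suc_iff[of "Suc k"]
  proof (intro conjI allI)
    have "sl b (sl a (cr (Suc k) v)) = (\<lambda>J. t a b * v J - s / y k * sl b (cr k (sl a v)) J)" for b
      by (simp add: fun_eq_iff cr_Suc)
    then have "VV (Suc k) (sl b (sl a (cr (Suc k) v)))" for b
      using VV_diff[OF Suc.prems EE_VV[OF IH[of a]], of "t a b" "s / y k" b] by metis
    then show "EE (Suc k) (sl a (cr (Suc k) v))" by (simp add: EE_def)
    fix J
    have "(\<Oplus>b c. cnj (t b c) * (t a b * v (c # J)))
        = (\<Oplus>c. (\<Oplus>b. t a b * cnj (t b c)) * v (c # J))"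
      by (subst sum.swap) (simp add: sum_distrib_left sum_distrib_right mult_ac)
    also have "\<dots> = (\<Oplus>c. if c = a then s * v (c # J) else 0)"
      unfolding t_conj by (intro sum.cong) auto
    finally have "(\<Oplus>b c. cnj (t b c) * (t a b * v (c # J))) = s * v (a # J)" by simp
    moreover have "tau (sl a (cr (Suc k) v)) J
       = (\<Oplus>b c. cnj (t b c) * (t a b * v (c # J))) - s / y k * tau (cr k (sl a v)) J"
      by (simp add: tau_def cr_Suc right_diff_distrib sum_subtractf sum_distrib_left mult_ac)
    moreover have "tau (cr k (sl a v)) J = y k * v (a # J)"
      using tau_cr[OF VV_sl[OF Suc.prems]] by simp
    ultimately show "tau (sl a (cr (Suc k) v)) J = 0" by (simp add: y_pos)
  qed
  then show ?case by (simp add: EE_def)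
qed

text \<open>The component of \<open>v \<in> EE k\<close> in \<open>VV (Suc k)\<close>.\<close>

primrec up :: "nat \<Rightarrow> ('n list \<Rightarrow> complex) \<Rightarrow> 'n list \<Rightarrow> complex" where
  "up 0 v = v"
| "up (Suc k) v = (\<lambda>I. v I - 1 / y k * cr k (tau v) I)"

lemma VV_up: "EE k v \<Longrightarrow> VV (Suc k) (up k v)"
proof (cases k)
  case 0 then show "EE k v \<Longrightarrow> ?thesis" by (simp add: EE_0_VV)
next
  case (Suc k')
  assume v: "EE k v"
  then have tv: "VV k' (tau v)" by (simp add: Suc VV_tau_EE)
  have "EE k (\<lambda>I. 1 * v I - 1 / y k' * cr k' (tau v) I)"
    using v EE_cr[OF tv] by (intro EE_diff) (auto simp: Suc)
  moreover have "tau (\<lambda>I. v I - 1 / y k' * cr k' (tau v) I) J = tau v J - 1 / y k' * tau (cr k' (tau v)) J" for J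
    by (simp add: tau_def right_diff_distrib sum_subtractf sum_distrib_left mult_ac)
  ultimately show ?thesis
    by (simp add: VV_Suc_iff Suc tau_cr[OF tv] y_pos)
qed

text \<open>The weights of two legs joined by \<open>t\<close> cancel, so the leading term of
  \<open>cr\<close> is adjoint to \<open>tau\<close>. The correction pairs \<open>cr k\<close> of a
  tail with a highest weight vector, which is 0 by induction.\<close>

lemma ip_cr:
  assumes \<beta>: "\<And>a b. t a b \<noteq> 0 \<Longrightarrow> \<beta> a * \<beta> b = 1"
  shows "VV k v \<Longrightarrow> EE (Suc k) u \<Longrightarrow> ip \<beta> (Suc (Suc k)) (cr k v) u = ip \<beta> k v (tau u)"
proof (induction k arbitrary: v u)
  have \<beta>': "complex_of_real (\<beta> a) * (complex_of_real (\<beta> b) * (cnj (t a b) * z)) = cnj (t a b) * z" for a b z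
  proof (cases "t a b = 0")
    case False
    have "complex_of_real (\<beta> a) * (complex_of_real (\<beta> b) * (cnj (t a b) * z))
      = complex_of_real (\<beta> a * \<beta> b) * (cnj (t a b) * z)" by simp
    then show ?thesis using \<beta>[OF False] by simp
  qed simp
  have first: "(\<Oplus>a b. complex_of_real (\<beta> a) * (complex_of_real (\<beta> b) * ip \<beta> k (\<lambda>J. t a b * v J) (sl b (sl a u))))
      = ip \<beta> k v (tau u)" for k v u
    unfolding tau_alt ip_sum_right ip_scale_right ip_scale_left \<beta>' ..
  {
    case 0
    have "sl b (sl a (cr 0 v)) = (\<lambda>J. t a b * v J)" for a b by (simp add: fun_eq_iff)
    then show ?case using first[of 0 v u] by (simp add: ip_Suc[of \<beta> 0] ip_Suc[of \<beta> "Suc 0"] sum_distrib_left)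
  next
    case (Suc k)
    have "ip \<beta> (Suc (Suc k)) (cr k (sl a v)) (sl a u) = 0" for a
    proof -
      have 1: "VV (Suc (Suc k)) (sl a u)" using Suc.prems by (simp add: EE_def)
      have "ip \<beta> (Suc (Suc k)) (cr k (sl a v)) (sl a u) = ip \<beta> k (sl a v) (tau (sl a u))"
        by (rule Suc.IH[OF VV_sl[OF Suc.prems(1)] VV_EE[OF 1]])
      then show ?thesis by (simp add: VV_tau[OF 1])
    qed
    moreover have "sl a (cr (Suc k) v) = (\<lambda>I. sl a (cr 0 v) I - s / y k * cr k (sl a v) I)" for a
      by (simp add: fun_eq_iff cr_Suc)
    ultimately have "ip \<beta> (Suc (Suc k)) (sl a (cr (Suc k) v)) (sl a u) = ip \<beta> (Suc (Suc k)) (sl a (cr 0 v)) (sl a u)" for a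
      by (simp only: ip_diff_left ip_scale_left) (simp add: sl_def)
    then have "ip \<beta> (Suc (Suc (Suc k))) (cr (Suc k) v) u
      = (\<Oplus>a. complex_of_real (\<beta> a) * ip \<beta> (Suc (Suc k)) (sl a (cr 0 v)) (sl a u))"
      by (simp only: ip_Suc[of _ "Suc (Suc k)"])
    also have "\<dots> = (\<Oplus>a b. complex_of_real (\<beta> a) * (complex_of_real (\<beta> b) * ip \<beta> (Suc k) (\<lambda>J. t a b * v J) (sl b (sl a u))))"
      by (simp add: ip_Suc[of _ "Suc k"] sum_distrib_left sl_def)
    finally show ?case by (simp add: first)
  }
qed

lemma ip_cr_cr:
  assumes "\<And>a b. t a b \<noteq> 0 \<Longrightarrow> \<beta> a * \<beta> b = 1" "VV k v" "VV k v'"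
  shows "ip \<beta> (Suc (Suc k)) (cr k v) (cr k v') = y k * ip \<beta> k v v'"
  using ip_cr[OF assms(1,2) EE_cr[OF assms(3)]] tau_cr[OF assms(3)] by (simp add: ip_scale_right)

lemma ip_cr_VV:
  assumes "\<And>a b. t a b \<noteq> 0 \<Longrightarrow> \<beta> a * \<beta> b = 1" "VV k v" "VV (Suc (Suc k)) u"
  shows "ip \<beta> (Suc (Suc k)) (cr k v) u = 0"
  using ip_cr[OF assms(1,2) VV_EE[OF assms(3)]] VV_tau[OF assms(3)] by simp

text \<open>The weight takes the same value on all words that differ only in a contracted pair, so
  it factors out of the contraction.\<close>

lemma VV_weight:
  assumes "\<And>a b. t a b \<noteq> 0 \<Longrightarrow> \<beta> a * \<beta> b = 1" and v: "VV k v"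
  shows "VV k (\<lambda>I. complex_of_real (lw \<beta> I) * v I)"
proof -
  have "cnj (t a b) * (complex_of_real (lw \<beta> (I @ a # b # J)) * z)
     = (lw \<beta> I * lw \<beta> J) * (cnj (t a b) * z)" for a b I J z
  proof (cases "t a b = 0")
    case False
    have "lw \<beta> (I @ a # b # J) = (\<beta> a * \<beta> b) * (lw \<beta> I * lw \<beta> J)" by simp
    then have "lw \<beta> (I @ a # b # J) = lw \<beta> I * lw \<beta> J" using assms(1)[OF False] by simp
    then show ?thesis by (simp only: of_real_mult mult_ac)
  qed simp
  then show ?thesis using v by (simp only: VV_def flip: sum_distrib_left) simp
qed

end

subsection \<open>Coefficients\<close>

text \<open>The multiplication is a parameter, so that the results can also be applied to the opposite
  algebra.\<close>

locale tl_algebra = tl_vec t s D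
  for t :: "'n::finite \<Rightarrow> 'n \<Rightarrow> complex" and s D +
  fixes m :: "'a::complex_star_algebra \<Rightarrow> 'a \<Rightarrow> 'a" and x :: "'n \<Rightarrow> 'n \<Rightarrow> 'a"
  assumes m_add: "m (p + q) r = m p r + m q r" "m p (q + r) = m p q + m p r"
    and m_scale: "m (z *\<^sub>C p) q = z *\<^sub>C m p q" "m p (z *\<^sub>C q) = z *\<^sub>C m p q"
    and m_assoc: "m (m p q) r = m p (m q r)"
    and m_one: "m 1 p = p" "m p 1 = p"
    and t_col: "(\<Oplus>c d. t c d *\<^sub>C m (x a c) (x b d)) = t a b *\<^sub>C 1"
    and t_row: "(\<Oplus>a b. cnj (t a b) *\<^sub>C m (x a c) (x b d)) = cnj (t c d) *\<^sub>C 1"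
begin

lemma m_zero [simp]: "m 0 p = 0" "m p 0 = 0"
  using m_scale(1)[of 0 0 p] m_scale(2)[of p 0 0] by simp_all

lemma m_sum: "m (sum f A) p = (\<Sum>i\<in>A. m (f i) p)" "m p (sum f A) = (\<Sum>i\<in>A. m p (f i))"
  by (induction A rule: infinite_finite_induct; simp add: m_add)+

fun wd :: "'n list \<Rightarrow> 'n list \<Rightarrow> 'a" where
  "wd [] [] = 1"
| "wd (a # I) (b # J) = m (x a b) (wd I J)"
| "wd _ _ = 0"

text \<open>The matrix coefficient of the k-th tensor power of the corepresentation \<open>x\<close>
  between \<open>\<phi>\<close> and \<open>v\<close>, conjugate-linear in
  \<open>\<phi>\<close>.\<close>

definition Cc :: "nat \<Rightarrow> ('n list \<Rightarrow> complex) \<Rightarrow> ('n list \<Rightarrow> complex) \<Rightarrow> 'a" where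
  "Cc k \<phi> v = (\<Sum>I\<in>Ln k. \<Sum>J\<in>Ln k. (cnj (\<phi> I) * v J) *\<^sub>C wd I J)"

lemma Cc_0: "Cc 0 \<phi> v = (cnj (\<phi> []) * v []) *\<^sub>C 1"
  by (simp add: Cc_def)

lemma Cc_Suc: "Cc (Suc k) \<phi> v = (\<Oplus>a b. m (x a b) (Cc k (sl a \<phi>) (sl b v)))"
  unfolding Cc_def sum_Ln_Suc m_sum m_scale sl_app wd.simps
  by (subst sum.swap[of _ UNIV "Ln k"]) simp

lemma Cc_sum_right: "Cc k \<phi> (\<lambda>I. \<Sum>i\<in>A. c i * f i I) = (\<Sum>i\<in>A. c i *\<^sub>C Cc k \<phi> (f i))"
proof -
  have "Cc k \<phi> (\<lambda>I. \<Sum>i\<in>A. c i * f i I) = (\<Sum>I\<in>Ln k. \<Sum>J\<in>Ln k. \<Sum>i\<in>A. (c i * (cnj (\<phi> I) * f i J)) *\<^sub>C wd I J)"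
    unfolding Cc_def by (simp add: sum_distrib_left mult_ac flip: scaleC_sum_left)
  also have "\<dots> = (\<Sum>i\<in>A. \<Sum>I\<in>Ln k. \<Sum>J\<in>Ln k. (c i * (cnj (\<phi> I) * f i J)) *\<^sub>C wd I J)"
    by (subst (2) sum.swap, subst sum.swap) simp
  finally show ?thesis by (simp add: Cc_def scaleC_sum_right scaleC_scaleC)
qed

lemma Cc_sum_left: "Cc k (\<lambda>I. \<Sum>i\<in>A. c i * f i I) v = (\<Sum>i\<in>A. cnj (c i) *\<^sub>C Cc k (f i) v)"
proof -
  have "Cc k (\<lambda>I. \<Sum>i\<in>A. c i * f i I) v = (\<Sum>I\<in>Ln k. \<Sum>J\<in>Ln k. \<Sum>i\<in>A. (cnj (c i) * (cnj (f i I) * v J)) *\<^sub>C wd I J)"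
    unfolding Cc_def by (simp add: sum_distrib_left sum_distrib_right mult_ac flip: scaleC_sum_left)
  also have "\<dots> = (\<Sum>i\<in>A. \<Sum>I\<in>Ln k. \<Sum>J\<in>Ln k. (cnj (c i) * (cnj (f i I) * v J)) *\<^sub>C wd I J)"
    by (subst (2) sum.swap, subst sum.swap) simp
  finally show ?thesis by (simp add: Cc_def scaleC_sum_right scaleC_scaleC)
qed

lemma Cc_scale: "Cc k \<phi> (\<lambda>I. c * v I) = c *\<^sub>C Cc k \<phi> v" "Cc k (\<lambda>I. c * \<phi> I) v = cnj c *\<^sub>C Cc k \<phi> v"
  using Cc_sum_right[of k \<phi> "\<lambda>_. c" "\<lambda>_. v" "{()}"] Cc_sum_left[of k "\<lambda>_. c" "\<lambda>_. \<phi>" "{()}" v] by simp_all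

lemma Cc_diff: "Cc k \<phi> (\<lambda>I. u I - c * v I) = Cc k \<phi> u - c *\<^sub>C Cc k \<phi> v"
    "Cc k (\<lambda>I. u I - c * v I) \<phi> = Cc k u \<phi> - cnj c *\<^sub>C Cc k v \<phi>"
  using Cc_sum_right[of k \<phi> "\<lambda>b. if b then 1 else - c" "\<lambda>b. if b then u else v" UNIV]
    Cc_sum_left[of k "\<lambda>b. if b then 1 else - c" "\<lambda>b. if b then u else v" UNIV \<phi>]
  by (simp_all add: UNIV_bool scaleC_minus_left)

lemma Cc_zero [simp]: "Cc k \<phi> (\<lambda>I. 0) = 0" "Cc k (\<lambda>I. 0) v = 0"
  by (simp_all add: Cc_def)

lemma Cc_tau_right: "(\<Oplus>a b. cnj (t a b) *\<^sub>C Cc k \<phi> (sl b (sl a v))) = Cc k \<phi> (tau v)"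
  using Cc_sum_right[of k \<phi> "\<lambda>p. cnj (t (fst p) (snd p))" "\<lambda>p. sl (snd p) (sl (fst p) v)" UNIV]
  by (simp add: tau_def sum.cartesian_product case_prod_unfold flip: UNIV_Times_UNIV)

lemma Cc_tau_left: "(\<Oplus>a b. t a b *\<^sub>C Cc k (sl b (sl a \<phi>)) v) = Cc k (tau \<phi>) v"
  using Cc_sum_left[of k "\<lambda>p. cnj (t (fst p) (snd p))" "\<lambda>p. sl (snd p) (sl (fst p) \<phi>)" UNIV v]
  by (simp add: tau_def sum.cartesian_product case_prod_unfold flip: UNIV_Times_UNIV)

lemma Cc_Suc_Suc: "Cc (Suc (Suc k)) \<phi> v
   = (\<Oplus>a b c d. m (m (x a c) (x b d)) (Cc k (sl b (sl a \<phi>)) (sl d (sl c v))))"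
  unfolding Cc_Suc[of "Suc k"] unfolding Cc_Suc[of k] m_sum m_assoc
  by (subst (2) sum.swap) simp

text \<open>By \<open>t_col\<close> the vector \<open>t\<close> is fixed by the tensor square of
  \<open>x\<close>; inserting it on the right index amounts to capping the left one.\<close>

lemma Cc_cr0_right: "Cc (Suc (Suc k)) \<phi> (cr 0 v) = Cc k (tau \<phi>) v"
proof -
  have "sl d (sl c (cr 0 v)) = (\<lambda>J. t c d * v J)" for c d by (simp add: fun_eq_iff)
  then have "Cc (Suc (Suc k)) \<phi> (cr 0 v)
     = (\<Oplus>a b. m (\<Oplus>c d. t c d *\<^sub>C m (x a c) (x b d)) (Cc k (sl b (sl a \<phi>)) v))"
    by (simp add: Cc_Suc_Suc Cc_scale m_scale m_sum)
  then show ?thesis by (simp add: t_col m_scale m_one Cc_tau_left)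
qed

lemma Cc_cr0_left: "Cc (Suc (Suc k)) (cr 0 \<phi>) v = Cc k \<phi> (tau v)"
proof -
  have "sl d (sl c (cr 0 v)) = (\<lambda>J. t c d * v J)" for c d v by (simp add: fun_eq_iff)
  then have "Cc (Suc (Suc k)) (cr 0 \<phi>) v
     = (\<Oplus>a b c d. m (cnj (t a b) *\<^sub>C m (x a c) (x b d)) (Cc k \<phi> (sl d (sl c v))))"
    by (simp add: Cc_Suc_Suc Cc_scale m_scale m_sum)
  also have "\<dots> = (\<Oplus>c d a b. m (cnj (t a b) *\<^sub>C m (x a c) (x b d)) (Cc k \<phi> (sl d (sl c v))))"
    by (rule sum_swap4)
  also have "\<dots> = (\<Oplus>c d. m (\<Oplus>a b. cnj (t a b) *\<^sub>C m (x a c) (x b d)) (Cc k \<phi> (sl d (sl c v))))"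
    by (simp add: m_sum)
  finally show ?thesis by (simp add: t_row m_scale m_one Cc_tau_right)
qed

lemma cr_Suc_fun: "cr (Suc k) v = (\<lambda>I. cr 0 v I - s / y k * (case I of [] \<Rightarrow> 0 | a # J \<Rightarrow> cr k (sl a v) J))"
proof
  fix I show "cr (Suc k) v I = cr 0 v I - s / y k * (case I of [] \<Rightarrow> 0 | a # J \<Rightarrow> cr k (sl a v) J)"
    by (cases I) (simp_all add: cr_Suc)
qed

lemma Cc_cr_Suc_right:
  "Cc (Suc (Suc (Suc k))) \<phi> (cr (Suc k) v) = Cc (Suc k) (tau \<phi>) v
     - (s / y k) *\<^sub>C (\<Oplus>a b. m (x a b) (Cc (Suc (Suc k)) (sl a \<phi>) (cr k (sl b v))))"
  unfolding cr_Suc_fun Cc_diff Cc_cr0_right unfolding Cc_Suc[of "Suc (Suc k)"] by (simp add: sl_def)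

lemma Cc_cr_Suc_left:
  "Cc (Suc (Suc (Suc k))) (cr (Suc k) \<phi>) v = Cc (Suc k) \<phi> (tau v)
     - (s / y k) *\<^sub>C (\<Oplus>a b. m (x a b) (Cc (Suc (Suc k)) (cr k (sl a \<phi>)) (sl b v)))"
  unfolding cr_Suc_fun Cc_diff Cc_cr0_left unfolding Cc_Suc[of "Suc (Suc k)"] by (simp add: sl_def s_real)

text \<open>Schur orthogonality of inequivalent summands, made explicit: the leading term of
  \<open>cr\<close> caps the highest weight vector \<open>\<phi>\<close>, and the correction
  vanishes by induction on the tails.\<close>

lemma Cc_VV_cr: "VV (Suc (Suc k)) \<phi> \<Longrightarrow> VV k v \<Longrightarrow> Cc (Suc (Suc k)) \<phi> (cr k v) = 0"
proof (induction k arbitrary: \<phi> v)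
  case 0 then show ?case by (simp add: Cc_cr0_right VV_tau[of "Suc 0"])
next
  case (Suc k)
  then have "Cc (Suc (Suc k)) (sl a \<phi>) (cr k (sl b v)) = 0" for a b by (intro Suc.IH VV_sl) auto
  then show ?case using Suc.prems by (simp add: Cc_cr_Suc_right VV_tau[of "Suc (Suc k)"])
qed

lemma Cc_cr_VV: "VV k \<phi> \<Longrightarrow> VV (Suc (Suc k)) v \<Longrightarrow> Cc (Suc (Suc k)) (cr k \<phi>) v = 0"
proof (induction k arbitrary: \<phi> v)
  case 0 then show ?case by (simp add: Cc_cr0_left VV_tau[of "Suc 0"])
next
  case (Suc k)
  then have "Cc (Suc (Suc k)) (cr k (sl a \<phi>)) (sl b v) = 0" for a b by (intro Suc.IH VV_sl) auto
  then show ?case using Suc.prems by (simp add: Cc_cr_Suc_left VV_tau[of "Suc (Suc k)"])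
qed

text \<open>The coefficients of the copy of the k-th irreducible embedded by \<open>cr k\<close>.
  The factor comes from \<open>tau_cr\<close>; the corrections vanish since the tails of
  \<open>cr k v\<close> are of highest weight.\<close>

lemma Cc_cr_cr:
  assumes \<phi>: "VV k \<phi>" and v: "VV k v"
  shows "Cc (Suc (Suc k)) (cr k \<phi>) (cr k v) = y k *\<^sub>C Cc k \<phi> v"
proof (cases k)
  case 0
  then show ?thesis using tau_cr[OF v] by (simp add: Cc_cr0_left Cc_scale)
next
  case (Suc k')
  have "VV (Suc (Suc k')) (sl b (cr k v))" for b using EE_cr[OF v] by (simp add: Suc EE_def)
  then have "Cc (Suc (Suc k')) (cr k' (sl a \<phi>)) (sl b (cr k v)) = 0" for a b
    using \<phi> by (intro Cc_cr_VV) (simp_all add: VV_sl Suc)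
  then show ?thesis using tau_cr[OF v] by (simp add: Suc Cc_cr_Suc_left Cc_scale)
qed

text \<open>The fusion rule \<open>u \<otimes> u\<^sub>k = u\<^sub>k\<^sub>+\<^sub>1 \<oplus> u\<^sub>k\<^sub>-\<^sub>1\<close>.\<close>

lemma Cc_fusion:
  assumes \<phi>: "EE (Suc k) \<phi>" and v: "EE (Suc k) v"
  shows "Cc (Suc (Suc k)) \<phi> v = Cc (Suc (Suc k)) (up (Suc k) \<phi>) (up (Suc k) v) + (1 / y k) *\<^sub>C Cc k (tau \<phi>) (tau v)"
proof -
  note t = VV_tau_EE[OF \<phi>] VV_tau_EE[OF v]
  note u = VV_up[OF \<phi>] VV_up[OF v]
  have *: "w = (\<lambda>I. up (Suc k) w I - (- (1 / complex_of_real (y k))) * cr k (tau w) I)" for w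
    by (simp add: fun_eq_iff)
  have "Cc (Suc (Suc k)) (\<lambda>I. up (Suc k) \<phi> I - (- (1 / complex_of_real (y k))) * cr k (tau \<phi>) I)
      (\<lambda>I. up (Suc k) v I - (- (1 / complex_of_real (y k))) * cr k (tau v) I)
    = Cc (Suc (Suc k)) (up (Suc k) \<phi>) (up (Suc k) v) + (1 / y k) *\<^sub>C Cc k (tau \<phi>) (tau v)"
    unfolding Cc_diff Cc_cr_cr[OF t] Cc_VV_cr[OF u(1) t(2)] Cc_cr_VV[OF t(1) u(2)]
    by (simp add: scaleC_scaleC y_pos del: up.simps)
  moreover have "Cc (Suc (Suc k)) \<phi> v = Cc (Suc (Suc k))
      (\<lambda>I. up (Suc k) \<phi> I - (- (1 / complex_of_real (y k))) * cr k (tau \<phi>) I)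
      (\<lambda>I. up (Suc k) v I - (- (1 / complex_of_real (y k))) * cr k (tau v) I)"
    by (rule arg_cong2[where f = "Cc (Suc (Suc k))"]; rule *)
  ultimately show ?thesis by (rule trans[rotated])
qed

definition sg :: "'n \<Rightarrow> ('n list \<Rightarrow> complex) \<Rightarrow> 'n list \<Rightarrow> complex" where
  "sg a v = (\<lambda>I. case I of [] \<Rightarrow> 0 | c # J \<Rightarrow> if c = a then v J else 0)"

lemma sl_sg: "sl c (sg a v) = (\<lambda>J. (if c = a then 1 else 0) * v J)"
  by (auto simp: sg_def fun_eq_iff)

lemma x_Cc: "m (x a b) (Cc k \<phi> v) = Cc (Suc k) (sg a \<phi>) (sg b v)"
proof -
  have "Cc (Suc k) (sg a \<phi>) (sg b v)
     = (\<Oplus>c. if c = a then (\<Oplus>d. if d = b then m (x a b) (Cc k \<phi> v) else 0) else 0)"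
    unfolding Cc_Suc sl_sg Cc_scale m_scale
  proof (intro sum.cong refl)
    fix c :: 'n
    show "(\<Oplus>d. (if d = b then 1 else 0) *\<^sub>C cnj (if c = a then 1 else 0) *\<^sub>C m (x c d) (Cc k \<phi> v))
      = (if c = a then (\<Oplus>d. if d = b then m (x a b) (Cc k \<phi> v) else 0) else 0)"
      by (cases "c = a") (simp_all add: sum_if_scaleC)
  qed
  then show ?thesis by simp
qed

lemma EE_single: "VV k v \<Longrightarrow> EE k (sg a v)"
  by (simp add: EE_def sl_sg VV_scale) (simp add: sg_def)

lemma tau_single: "tau (sg a v) = (\<lambda>J. \<Oplus>b. cnj (t a b) * sl b v J)"
proof
  fix J
  have "tau (sg a v) J = (\<Oplus>c. if c = a then (\<Oplus>b. cnj (t a b) * sl b v J) else 0)"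
    unfolding tau_def by (intro sum.cong refl) (auto simp: sg_def)
  then show "tau (sg a v) J = (\<Oplus>b. cnj (t a b) * sl b v J)" by simp
qed

text \<open>Only the lower component is made explicit: in the orthogonality relations the upper one
  is orthogonal to everything it is paired with.\<close>

lemma x_Cc_fusion:
  assumes \<phi>: "VV (Suc k) \<phi>" and v: "VV (Suc k) v"
  obtains \<phi>' v' where "VV (Suc (Suc k)) \<phi>'" "VV (Suc (Suc k)) v'"
    "m (x a b) (Cc (Suc k) \<phi> v) = Cc (Suc (Suc k)) \<phi>' v'
       + (1 / y k) *\<^sub>C (\<Oplus>e f. (t a e * cnj (t b f)) *\<^sub>C Cc k (sl e \<phi>) (sl f v))"
proof -
  note E = EE_single[OF \<phi>, of a] EE_single[OF v, of b]
  note u = VV_up[OF E(1)] VV_up[OF E(2)]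
  show ?thesis
    by (rule that[OF u])
      (simp add: x_Cc Cc_fusion[OF E] tau_single Cc_sum_left Cc_sum_right scaleC_sum_right scaleC_scaleC
        sum_distrib_left mult_ac sl_def del: up.simps)
qed

lemma x_Cc_0:
  assumes "VV 0 \<phi>" "VV 0 v"
  obtains \<phi>' v' where "VV (Suc 0) \<phi>'" "VV (Suc 0) v'" "m (x a b) (Cc 0 \<phi> v) = Cc (Suc 0) \<phi>' v'"
  by (rule that[OF EE_0_VV[OF EE_single[OF assms(1), of a]] EE_0_VV[OF EE_single[OF assms(2), of b]]])
    (rule x_Cc)

definition Sk :: "nat \<Rightarrow> 'a set" where
  "Sk k = {Cc k \<phi> v | \<phi> v. VV k \<phi> \<and> VV k v}"

definition Sall :: "'a set" where
  "Sall = cspan (\<Union>k. Sk k)"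

lemma Sk_Sall: "a \<in> Sk k \<Longrightarrow> a \<in> Sall"
  unfolding Sall_def by (rule complex_vector.span_base) auto

lemma Cc_in_Sall: "VV k \<phi> \<Longrightarrow> VV k v \<Longrightarrow> Cc k \<phi> v \<in> Sall"
  by (rule Sk_Sall[of _ k]) (auto simp: Sk_def)

text \<open>By fusion, multiplication by a generator preserves the span of the irreducible
  coefficients. Level 0 is separate because it has no lower component.\<close>

lemma x_Sall: "p \<in> Sall \<Longrightarrow> m (x a b) p \<in> Sall"
  unfolding Sall_def
proof (induction rule: complex_vector.span_induct_alt)
  case base show ?case by (simp add: complex_vector.span_zero)
next
  case (step c p q)
  then obtain k \<phi> v where p: "p = Cc k \<phi> v" "VV k \<phi>" "VV k v" by (auto simp: Sk_def)
  have "m (x a b) p \<in> Sall"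
  proof (cases k)
    case 0
    have p': "VV 0 \<phi>" "VV 0 v" using p 0 by auto
    obtain \<phi>' v' where "VV (Suc 0) \<phi>'" "VV (Suc 0) v'" "m (x a b) (Cc 0 \<phi> v) = Cc (Suc 0) \<phi>' v'"
      by (rule x_Cc_0[OF p', of a b])
    then show ?thesis using Cc_in_Sall[of "Suc 0" \<phi>' v'] by (simp add: p(1) 0)
  next
    case (Suc k')
    have p': "VV (Suc k') \<phi>" "VV (Suc k') v" using p Suc by auto
    obtain \<phi>' v' where *: "VV (Suc (Suc k')) \<phi>'" "VV (Suc (Suc k')) v'"
      "m (x a b) (Cc (Suc k') \<phi> v) = Cc (Suc (Suc k')) \<phi>' v'
       + (1 / y k') *\<^sub>C (\<Oplus>e f. (t a e * cnj (t b f)) *\<^sub>C Cc k' (sl e \<phi>) (sl f v))"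
      by (rule x_Cc_fusion[OF p', of a b])
    have "Cc k' (sl e \<phi>) (sl f v) \<in> Sall" for e f by (intro Cc_in_Sall VV_sl p')
    then show ?thesis unfolding p(1) Suc *(3) using Cc_in_Sall[OF *(1,2)] unfolding Sall_def
      by (intro complex_vector.span_add complex_vector.span_scale complex_vector.span_sum)
  qed
  then show ?case using step
    by (simp add: m_add m_scale complex_vector.span_add complex_vector.span_scale Sall_def)
qed

lemma one_Sall: "1 \<in> Sall"
proof -
  have "VV 0 (\<lambda>I. if I = [] then 1 else 0)" by (auto simp: VV_def)
  then have "Cc 0 (\<lambda>I. if I = [] then 1 else 0) (\<lambda>I. if I = [] then 1 else 0) \<in> Sall" by (intro Cc_in_Sall)
  then show ?thesis by (simp add: Cc_0)
qed

lemma wd_Sall: "wd I J \<in> Sall"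
  by (induction I J rule: wd.induct)
    (auto simp: one_Sall x_Sall, auto simp: Sall_def complex_vector.span_zero)

end

subsection \<open>Orthogonality relations\<close>

text \<open>\<open>A\<close> and \<open>B\<close> express the adjoints of the generators through the
  generators; their products with \<open>t\<close> and its conjugate are the diagonal weights of the
  orthogonality relations. About the Haar state itself, the substantial hypothesis is
  \<open>h_Cc\<close>.\<close>

locale tl_haar = tl_algebra t s D m x
  for t :: "'n::finite \<Rightarrow> 'n \<Rightarrow> complex" and s D and m :: "'a::complex_star_algebra \<Rightarrow> 'a \<Rightarrow> 'a" and x +
  fixes h :: "'a \<Rightarrow> complex" and A B :: "'n \<Rightarrow> 'n \<Rightarrow> complex" and \<alpha> \<beta> :: "'n \<Rightarrow> real"
  assumes h_add: "h (p + q) = h p + h q" and h_scale: "h (z *\<^sub>C p) = z * h p" and h_one: "h 1 = 1"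
    and h_star: "h (star p) = cnj (h p)"
    and star_m: "star (m p q) = m (star q) (star p)"
    and star_x: "star (x a b) = (\<Oplus>c d. (A a c * B d b) *\<^sub>C x c d)"
    and A_t: "\<And>a e. (\<Oplus>c. A a c * t c e) = (if e = a then complex_of_real (\<alpha> a) else 0)"
    and B_t: "\<And>b f. (\<Oplus>d. B d b * cnj (t d f)) = (if f = b then complex_of_real (\<beta> b) else 0)"
    and h_Cc: "\<And>k \<phi> v. VV (Suc k) \<phi> \<Longrightarrow> VV (Suc k) v \<Longrightarrow> h (Cc (Suc k) \<phi> v) = 0"
begin

text \<open>The product telescopes to the quantum integer [k + 1], the quantum dimension of the k-th
  irreducible.\<close>

definition g :: "nat \<Rightarrow> real" where "g k = (\<Prod>i<k. y i)"

lemma g_pos: "g k > 0"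
  unfolding g_def by (intro prod_pos) (simp add: y_pos)

lemma h_sum: "h (sum f S) = (\<Sum>i\<in>S. h (f i))"
proof -
  have "h 0 = 0" using h_scale[of 0 0] by simp
  then show ?thesis by (induction S rule: infinite_finite_induct) (simp_all add: h_add)
qed

definition hh :: "'a \<Rightarrow> 'a \<Rightarrow> complex" where "hh p q = h (m (star p) q)"

lemma star_zero' [simp]: "star (0::'a) = 0"
  using star_scaleC[of 0 "0::'a"] by simp

lemma star_sum': "star (sum f S) = (\<Sum>i\<in>S. star (f i :: 'a))"
  by (induction S rule: infinite_finite_induct) (simp_all add: star_add)

lemma hh_add: "hh (p + q) r = hh p r + hh q r" "hh r (p + q) = hh r p + hh r q"
  by (simp_all add: hh_def star_add m_add h_add)

lemma hh_scale: "hh (c *\<^sub>C p) r = cnj c * hh p r" "hh r (c *\<^sub>C p) = c * hh r p"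
  by (simp_all add: hh_def star_scaleC m_scale h_scale)

lemma hh_sum: "hh (sum f S) r = (\<Sum>i\<in>S. hh (f i) r)" "hh r (sum f S) = (\<Sum>i\<in>S. hh r (f i))"
  by (simp_all add: hh_def star_sum' m_sum h_sum)

lemma hh_commute: "hh p q = cnj (hh q p)"
  by (simp add: hh_def star_m star_star flip: h_star)

lemma hh_m: "hh p (m q r) = hh (m (star q) p) r"
  by (simp add: hh_def star_m star_star m_assoc)

text \<open>Peel one letter off the shorter factor and move it, as an adjoint, to the longer one.
  There \<open>star_x\<close> and the fusion rule produce an upper component, orthogonal by
  induction, and a lower one with factor 1 / y, to which the induction hypothesis applies
  again.\<close>

lemma hh_Cc_le:
  "l \<le> k \<Longrightarrow> VV k \<phi> \<Longrightarrow> VV k v \<Longrightarrow> VV l \<phi>' \<Longrightarrow> VV l v' \<Longrightarrow>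
     hh (Cc k \<phi> v) (Cc l \<phi>' v') = (if k = l then ip \<alpha> k \<phi>' \<phi> * ip \<beta> k v v' / g k else 0)"
proof (induction l arbitrary: k \<phi> v \<phi>' v')
  case 0
  have 1: "star 1 = (1::'a)" using star_mult[of "star 1" "1::'a"] by (simp add: star_star)
  show ?case
  proof (cases k)
    case 0 then show ?thesis
      by (simp add: Cc_0 hh_def star_scaleC 1 m_scale m_one h_scale h_one ip_0 g_def mult_ac)
  next
    case (Suc k')
    have "hh (Cc k \<phi> v) 1 = 0"
      using h_Cc[of k' \<phi> v] 0 by (simp add: Suc hh_def m_one h_star)
    then show ?thesis by (simp add: Suc Cc_0 hh_scale)
  qed
next
  case (Suc l)
  then obtain k' where k: "k = Suc k'" "l \<le> k'" using Suc.prems(1) by (metis Suc_le_D Suc_le_mono)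
  have x1: "hh (m (x c d) (Cc k \<phi> v)) (Cc l \<phi>'' v'') = (1 / y k') *
      (\<Oplus>e f. cnj (t c e * cnj (t d f)) * hh (Cc k' (sl e \<phi>) (sl f v)) (Cc l \<phi>'' v''))"
    if *: "VV l \<phi>''" "VV l v''" for c d \<phi>'' v''
  proof -
    obtain \<phi>1 v1 where 1: "VV (Suc (Suc k')) \<phi>1" "VV (Suc (Suc k')) v1" "m (x c d) (Cc k \<phi> v) = Cc (Suc (Suc k')) \<phi>1 v1
       + (1 / y k') *\<^sub>C (\<Oplus>e f. (t c e * cnj (t d f)) *\<^sub>C Cc k' (sl e \<phi>) (sl f v))"
      unfolding k(1) by (rule x_Cc_fusion[OF Suc.prems(2,3)[unfolded k(1)], of c d])
    have "hh (Cc (Suc (Suc k')) \<phi>1 v1) (Cc l \<phi>'' v'') = 0"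
      using Suc.IH[OF _ 1(1,2) *] k by simp
    then show ?thesis by (simp add: 1(3) hh_add hh_scale hh_sum)
  qed
  have x2: "hh (m (star (x a b)) (Cc k \<phi> v)) (Cc l \<phi>'' v'')
     = (\<alpha> a * \<beta> b / y k') * hh (Cc k' (sl a \<phi>) (sl b v)) (Cc l \<phi>'' v'')"
    if *: "VV l \<phi>''" "VV l v''" for a b \<phi>'' v''
  proof -
    let ?H = "\<lambda>e f. hh (Cc k' (sl e \<phi>) (sl f v)) (Cc l \<phi>'' v'')"
    have "hh (m (star (x a b)) (Cc k \<phi> v)) (Cc l \<phi>'' v'')
       = (\<Oplus>c d. cnj (A a c * B d b) * ((1 / y k') * (\<Oplus>e f. cnj (t c e * cnj (t d f)) * ?H e f)))"
      by (simp add: star_x m_sum m_scale hh_sum hh_scale x1[OF *] del: complex_cnj_mult)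
    also have "\<dots> = (1 / y k') * (\<Oplus>c d e f. cnj (A a c * t c e) * cnj (B d b * cnj (t d f)) * ?H e f)"
      by (simp add: sum_distrib_left mult_ac)
    also have "(\<Oplus>c d e f. cnj (A a c * t c e) * cnj (B d b * cnj (t d f)) * ?H e f)
      = (\<Oplus>e f c d. cnj (A a c * t c e) * cnj (B d b * cnj (t d f)) * ?H e f)"
      by (rule sum_swap4)
    also have "\<dots> = (\<Oplus>e f. cnj (\<Oplus>c. A a c * t c e) * cnj (\<Oplus>d. B d b * cnj (t d f)) * ?H e f)"
      by (simp add: sum_distrib_left sum_distrib_right sum_product mult_ac)
    also have "\<dots> = \<alpha> a * \<beta> b * ?H a b"
      unfolding A_t B_t if_distrib[of cnj] complex_cnj_zero complex_cnj_complex_of_real mult.assoc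
        sum_distrib_left[symmetric] sum_if_mult of_real_mult ..
    finally show ?thesis by simp
  qed
  have "hh (Cc k \<phi> v) (Cc (Suc l) \<phi>' v')
     = (\<Oplus>a b. hh (m (star (x a b)) (Cc k \<phi> v)) (Cc l (sl a \<phi>') (sl b v')))"
    by (simp add: Cc_Suc hh_sum hh_m)
  also have "\<dots> = (\<Oplus>a b. (\<alpha> a * \<beta> b / y k') *
      (if k' = l then ip \<alpha> k' (sl a \<phi>') (sl a \<phi>) * ip \<beta> k' (sl b v) (sl b v') / g k' else 0))"
    unfolding x2[OF VV_sl[OF Suc.prems(4)] VV_sl[OF Suc.prems(5)]]
      Suc.IH[OF k(2) VV_sl[OF Suc.prems(2)[unfolded k(1)]] VV_sl[OF Suc.prems(3)[unfolded k(1)]]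
        VV_sl[OF Suc.prems(4)] VV_sl[OF Suc.prems(5)]] ..
  also have "\<dots> = (if k = Suc l then (1 / (y k' * g k')) * ((\<Oplus>a. \<alpha> a * ip \<alpha> k' (sl a \<phi>') (sl a \<phi>)) *
      (\<Oplus>b. \<beta> b * ip \<beta> k' (sl b v) (sl b v'))) else 0)"
  proof (cases "k' = l")
    case True
    have "(\<Oplus>a. complex_of_real (\<alpha> a) * ip \<alpha> k' (sl a \<phi>') (sl a \<phi>)) *
        (\<Oplus>b. complex_of_real (\<beta> b) * ip \<beta> k' (sl b v) (sl b v'))
      = (\<Oplus>a b. (\<alpha> a * ip \<alpha> k' (sl a \<phi>') (sl a \<phi>)) * (\<beta> b * ip \<beta> k' (sl b v) (sl b v')))"
      by (rule sum_product)
    then show ?thesis using True by (simp only: k sum_distrib_left refl if_True) (simp add: mult_ac)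
  qed (simp add: k)
  also have "y k' * g k' = g k" by (simp add: k g_def)
  finally show ?case by (simp add: k ip_Suc)
qed

lemma hh_Cc:
  assumes "VV k \<phi>" "VV k v" "VV l \<phi>'" "VV l v'"
  shows "hh (Cc k \<phi> v) (Cc l \<phi>' v') = (if k = l then ip \<alpha> k \<phi>' \<phi> * ip \<beta> k v v' / g k else 0)"
proof (cases "l \<le> k")
  case True then show ?thesis using assms by (rule hh_Cc_le)
next
  case False
  then have "hh (Cc l \<phi>' v') (Cc k \<phi> v) = 0" using hh_Cc_le[of k l \<phi>' v' \<phi> v] assms by simp
  then show ?thesis using False hh_commute[of "Cc k \<phi> v"] by simp
qed

end

subsection \<open>Invariant vectors\<close>

lemma sum_mult_assoc:
  "(\<Sum>j\<in>A. p j * (\<Sum>k\<in>B. q j k * r k)) = (\<Sum>k\<in>B. (\<Sum>j\<in>A. p j * q j k) * (r k :: complex))"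
  by (simp add: sum_distrib_left sum_distrib_right mult.assoc) (rule sum.swap)

text \<open>The orthogonal projection onto a space of functions with finite support, built by
  Gram-Schmidt: the elements of \<open>X\<close> vanishing at the new point \<open>a\<close> form a
  subspace of codimension at most 1.\<close>

lemma reproducing_kernel:
  fixes X :: "('b \<Rightarrow> complex) set"
  assumes "finite A" "\<And>x i. x \<in> X \<Longrightarrow> i \<notin> A \<Longrightarrow> x i = 0" "(\<lambda>i. 0) \<in> X"
    and "\<And>c x y. x \<in> X \<Longrightarrow> y \<in> X \<Longrightarrow> (\<lambda>i. c * x i + y i) \<in> X"
  shows "\<exists>P. (\<forall>j. (\<lambda>i. P i j) \<in> X) \<and> (\<forall>i j. P j i = cnj (P i j)) \<and> (\<forall>x\<in>X. \<forall>i. (\<Sum>j\<in>A. P i j * x j) = x i)"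
  using assms
proof (induction A arbitrary: X rule: finite_induct)
  case empty
  have "x i = 0" if "x \<in> X" for x i using empty.prems(1)[of x i] that by simp
  then show ?case using empty.prems(2) by (intro exI[of _ "\<lambda>_ _. 0"]) auto
next
  case (insert a A)
  define X0 where "X0 = {x \<in> X. x a = 0}"
  have "\<exists>P. (\<forall>j. (\<lambda>i. P i j) \<in> X0) \<and> (\<forall>i j. P j i = cnj (P i j)) \<and> (\<forall>x\<in>X0. \<forall>i. (\<Sum>j\<in>A. P i j * x j) = x i)"
  proof (rule insert.IH)
    show "x i = 0" if "x \<in> X0" "i \<notin> A" for x i
      using that insert.prems(1)[of x i] by (cases "i = a") (auto simp: X0_def)
    show "(\<lambda>i. 0) \<in> X0" using insert.prems(2) by (simp add: X0_def)
    show "(\<lambda>i. c * x i + y i) \<in> X0" if "x \<in> X0" "y \<in> X0" for c x y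
      using that insert.prems(3)[of x y c] by (simp add: X0_def)
  qed
  then obtain P0 where P0: "\<And>j. (\<lambda>i. P0 i j) \<in> X0" "\<And>i j. P0 j i = cnj (P0 i j)"
    "\<And>x i. x \<in> X0 \<Longrightarrow> (\<Sum>j\<in>A. P0 i j * x j) = x i" by blast
  have P0a: "P0 a j = 0" "P0 j a = 0" for j
    using P0(1)[of j] P0(2)[of j a] by (simp_all add: X0_def)
  show ?case
  proof (cases "X = X0")
    case True
    have "(\<Sum>j\<in>insert a A. P0 i j * x j) = x i" if "x \<in> X" for x i
      using P0(3)[of x i] that True insert(1,2) by (simp add: P0a)
    moreover have "(\<lambda>i. P0 i j) \<in> X" for j using P0(1)[of j] True by simp
    ultimately show ?thesis using P0(2) by blast
  next
    case False
    then obtain x1 where x1: "x1 \<in> X" "x1 a \<noteq> 0" by (auto simp: X0_def)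
    note lin = insert.prems(3)
    have fin: "(\<lambda>i. \<Sum>j\<in>B. f j * P0 i j) \<in> X0" for f and B :: "'b set"
    proof (induction B rule: infinite_finite_induct)
      case (insert j B)
      have "(\<lambda>i. f j * P0 i j + (\<Sum>j\<in>B. f j * P0 i j)) \<in> X"
        using insert.IH P0(1)[of j] by (intro lin) (auto simp: X0_def)
      then show ?case using insert.hyps by (simp add: X0_def P0a)
    qed (use \<open>(\<lambda>i. 0) \<in> X\<close> in \<open>simp_all add: X0_def\<close>)
    \<comment> \<open>A vector of \<open>X\<close> orthogonal to \<open>X0\<close> and nonzero at
      \<open>a\<close>; the projection onto \<open>X\<close> is \<open>P0\<close> plus the
      projection onto the line of \<open>r\<close>.\<close>
    define r where "r i = x1 i - (\<Sum>j\<in>A. P0 i j * x1 j)" for i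
    have rX: "r \<in> X"
    proof -
      have "(\<lambda>i. \<Sum>j\<in>A. x1 j * P0 i j) \<in> X" using fin[of x1 A] by (simp add: X0_def)
      from insert.prems(3)[OF this x1(1), of "-1"] show ?thesis by (simp add: r_def[abs_def] mult.commute)
    qed
    have ra: "r a \<noteq> 0" using x1(2) by (simp add: r_def P0a)
    have P0r: "(\<Sum>j\<in>A. P0 i j * r j) = 0" for i
    proof -
      have "(\<Sum>j\<in>A. P0 i j * (\<Sum>k\<in>A. P0 j k * x1 k)) = (\<Sum>k\<in>A. (\<Sum>j\<in>A. P0 i j * P0 j k) * x1 k)"
        by (rule sum_mult_assoc)
      also have "\<dots> = (\<Sum>k\<in>A. P0 i k * x1 k)"
        using P0(3)[OF P0(1)] by simp
      finally show ?thesis by (simp add: r_def right_diff_distrib sum_subtractf)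
    qed
    define N where "N = (\<Sum>j\<in>insert a A. cnj (r j) * r j)"
    have "N = complex_of_real (\<Sum>j\<in>insert a A. (cmod (r j))\<^sup>2)"
      unfolding N_def of_real_sum by (intro sum.cong refl) (metis complex_norm_square mult.commute)
    moreover have "(\<Sum>j\<in>insert a A. (cmod (r j))\<^sup>2) > 0"
      using ra insert(1) by (intro sum_pos2[where i = a]) auto
    ultimately obtain S where "N = complex_of_real S" "S > 0" by blast
    then have N: "N \<noteq> 0" "cnj N = N" by auto
    define P where "P i j = P0 i j + r i * cnj (r j) / N" for i j
    show ?thesis
    proof (intro exI[of _ P] conjI allI ballI)
      fix i j
      have "(\<lambda>i. (cnj (r j) / N) * r i + P0 i j) \<in> X"
        using rX P0(1)[of j] by (intro insert.prems(3)) (auto simp: X0_def)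
      then show "(\<lambda>i. P i j) \<in> X" by (simp add: P_def[abs_def] add.commute mult.commute)
      show "P j i = cnj (P i j)" using P0(2)[of j i] by (simp add: P_def N)
    next
      fix x i assume x: "x \<in> X"
      define x0 where "x0 i = x i - x a / r a * r i" for i
      have "(\<lambda>i. (- (x a / r a)) * r i + x i) \<in> X" using rX x by (rule insert.prems(3))
      then have x0: "x0 \<in> X0" using ra by (simp add: X0_def x0_def[abs_def])
      have xx: "x j = x0 j + x a / r a * r j" for j by (simp add: x0_def)
      have "(\<Sum>j\<in>insert a A. cnj (r j) * x0 j) = (\<Sum>j\<in>A. cnj (r j) * (\<Sum>k\<in>A. P0 j k * x0 k))"
        using insert(1,2) x0 P0(3)[OF x0] by (simp add: X0_def)
      also have "\<dots> = (\<Sum>k\<in>A. (\<Sum>j\<in>A. cnj (r j) * P0 j k) * x0 k)"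
        by (rule sum_mult_assoc)
      also have "\<dots> = (\<Sum>k\<in>A. cnj (\<Sum>j\<in>A. P0 k j * r j) * x0 k)"
        by (intro sum.cong refl) (simp add: P0(2)[symmetric] mult.commute)
      finally have rx0: "(\<Sum>j\<in>insert a A. cnj (r j) * x0 j) = 0" by (simp add: P0r)
      have "(\<Sum>j\<in>insert a A. P i j * x j)
         = (\<Sum>j\<in>insert a A. P0 i j * x j) + r i / N * (\<Sum>j\<in>insert a A. cnj (r j) * x j)"
        by (simp add: P_def distrib_right distrib_left sum.distrib sum_distrib_left mult_ac)
      also have "(\<Sum>j\<in>insert a A. P0 i j * x j) = (\<Sum>j\<in>A. P0 i j * x0 j) + x a / r a * (\<Sum>j\<in>A. P0 i j * r j)"
        using insert(1,2) by (simp add: P0a) (subst xx, simp add: distrib_left sum.distrib sum_distrib_left sum_divide_distrib mult_ac)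
      also have "\<dots> = x0 i" using P0(3)[OF x0] P0r by simp
      also have "(\<Sum>j\<in>insert a A. cnj (r j) * x j)
         = (\<Sum>j\<in>insert a A. cnj (r j) * x0 j) + x a / r a * N"
        unfolding N_def by (subst xx, simp only: distrib_left sum.distrib sum_distrib_left mult_ac)
      also have "\<dots> = x a / r a * N" using rx0 by simp
      finally show "(\<Sum>j\<in>insert a A. P i j * x j) = x i" using N by (simp add: xx[of i] mult_ac)
    qed
  qed
qed

context tl_vec
begin

text \<open>\<open>ins p\<close> inserts \<open>t\<close> after the first p legs, and
  \<open>con p\<close> contracts the two legs after them: cups and caps at an arbitrary
  position.\<close>

primrec ins :: "nat \<Rightarrow> ('n list \<Rightarrow> complex) \<Rightarrow> 'n list \<Rightarrow> complex" where
  "ins 0 = cr 0"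
| "ins (Suc p) = (\<lambda>x I. case I of [] \<Rightarrow> 0 | a # J \<Rightarrow> ins p (sl a x) J)"

primrec con :: "nat \<Rightarrow> ('n list \<Rightarrow> complex) \<Rightarrow> 'n list \<Rightarrow> complex" where
  "con 0 = tau"
| "con (Suc p) = (\<lambda>z I. case I of [] \<Rightarrow> 0 | a # J \<Rightarrow> con p (sl a z) J)"

declare ins.simps [simp del] con.simps [simp del]

lemma ins_simps [simp]: "ins 0 = cr 0" "ins (Suc p) x [] = 0" "ins (Suc p) x (a # J) = ins p (sl a x) J"
  by (simp_all add: ins.simps)

lemma con_simps [simp]: "con 0 = tau" "con (Suc p) x [] = 0" "con (Suc p) x (a # J) = con p (sl a x) J"
  by (simp_all add: con.simps)

lemma sl_ins: "sl a (ins (Suc p) x) = ins p (sl a x)"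
  by (simp add: fun_eq_iff)

lemma sl_con: "sl a (con (Suc p) x) = con p (sl a x)"
  by (simp add: fun_eq_iff)

lemma ins_sum: "ins p (\<lambda>I. \<Sum>i\<in>A. c i * f i I) I = (\<Sum>i\<in>A. c i * ins p (f i) I)"
proof (induction p arbitrary: f I)
  case 0 then show ?case by (simp add: cr_sum)
next
  case (Suc p) then show ?case by (cases I) (simp_all add: sl_def)
qed

lemma tau_lin: "tau (\<lambda>I. c * x I + w I) I = c * tau x I + tau w I"
  by (simp add: tau_def distrib_left sum.distrib sum_distrib_left mult_ac)

lemma con_lin: "con p (\<lambda>I. c * x I + w I) I = c * con p x I + con p w I"
proof (induction p arbitrary: x w I)
  case 0 then show ?case by (simp add: tau_lin)
next
  case (Suc p) then show ?case by (cases I) (simp_all add: sl_def)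
qed

lemma con_zero: "con p (\<lambda>I. 0) I = 0"
proof (induction p arbitrary: I)
  case 0 then show ?case by (simp add: tau_def)
next
  case (Suc p) then show ?case by (cases I) (simp_all add: sl_def)
qed

lemma con_scale: "con p (\<lambda>I. c * x I) I = c * con p x I"
  using con_lin[of p c x "\<lambda>_. 0" I] by (simp add: con_zero)

lemma ins_app: "ins (length I) x (I @ a # b # J) = t a b * x (I @ J)"
  by (induction I arbitrary: x) simp_all

lemma con_app: "con (length I) z (I @ J) = (\<Oplus>a b. cnj (t a b) * z (I @ a # b # J))"
  by (induction I arbitrary: z) (simp_all add: tau_def)

definition supp :: "nat \<Rightarrow> ('n list \<Rightarrow> complex) \<Rightarrow> bool" where
  "supp m x \<longleftrightarrow> (\<forall>I. length I \<noteq> m \<longrightarrow> x I = 0)"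

lemma supp_sl: "supp (Suc m) x \<Longrightarrow> supp m (sl a x)"
  by (simp add: supp_def)

lemma supp_ins: "supp m x \<Longrightarrow> p \<le> m \<Longrightarrow> supp (Suc (Suc m)) (ins p x)"
proof (induction p arbitrary: m x)
  case 0
  show ?case unfolding supp_def
  proof (intro allI impI)
    fix I :: "'n list" assume I: "length I \<noteq> Suc (Suc m)"
    show "ins 0 x I = 0"
    proof (cases I)
      case (Cons a J) then show ?thesis using I 0 by (cases J) (auto simp: supp_def)
    qed simp
  qed
next
  case (Suc p)
  then obtain m' where m: "m = Suc m'" by (cases m) auto
  then have *: "supp (Suc (Suc m')) (ins p (sl a x))" for a using Suc by (intro Suc.IH supp_sl) auto
  show ?case unfolding supp_def
  proof (intro allI impI)
    fix I :: "'n list" assume "length I \<noteq> Suc (Suc m)"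
    then show "ins (Suc p) x I = 0" using * by (cases I) (auto simp: supp_def m)
  qed
qed

lemma con_ins_same: "supp m x \<Longrightarrow> p \<le> m \<Longrightarrow> con p (ins p x) I = complex_of_real D * x I"
proof (induction p arbitrary: m x I)
  case 0 then show ?case by (simp add: tau_cr_0)
next
  case (Suc p)
  then obtain m' where m: "m = Suc m'" by (cases m) auto
  show ?case
  proof (cases I)
    case Nil then show ?thesis using Suc.prems by (simp add: supp_def m)
  next
    case (Cons a J)
    have "con (Suc p) (ins (Suc p) x) I = con p (ins p (sl a x)) J" by (simp add: Cons sl_ins)
    also have "\<dots> = complex_of_real D * sl a x J" by (rule Suc.IH[OF supp_sl]) (use Suc.prems m in auto)
    finally show ?thesis by (simp add: Cons)
  qed
qed

text \<open>A cap shifted by one leg against a cup: the zigzag is straightened by the conjugate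
  equation.\<close>

lemma con_Suc_ins: "supp m x \<Longrightarrow> Suc p \<le> m \<Longrightarrow> con (Suc p) (ins p x) I = s * x I"
proof (induction p arbitrary: m x I)
  case 0
  show ?case
  proof (cases I)
    case Nil then show ?thesis using 0 by (simp add: supp_def)
  next
    case (Cons a J)
    have "(\<Oplus>b c. cnj (t b c) * (t a b * x (c # J))) = (\<Oplus>c. (\<Oplus>b. t a b * cnj (t b c)) * x (c # J))"
      by (subst sum.swap) (simp add: sum_distrib_left sum_distrib_right mult_ac)
    also have "\<dots> = (\<Oplus>c. (if c = a then s else 0) * x (c # J))"
      unfolding t_conj by (intro sum.cong) auto
    also have "\<dots> = s * x (a # J)" by (rule sum_if_mult)
    finally show ?thesis by (simp add: Cons tau_def)
  qed
next
  case (Suc p)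
  then obtain m' where m: "m = Suc m'" by (cases m) auto
  show ?case
  proof (cases I)
    case Nil then show ?thesis using Suc.prems by (simp add: supp_def m)
  next
    case (Cons a J)
    have "con (Suc (Suc p)) (ins (Suc p) x) I = con (Suc p) (ins p (sl a x)) J" by (simp add: Cons sl_ins)
    also have "\<dots> = s * sl a x J" by (rule Suc.IH[OF supp_sl]) (use Suc.prems m in auto)
    finally show ?thesis by (simp add: Cons)
  qed
qed

lemma con_ins_Suc: "supp m x \<Longrightarrow> Suc p \<le> m \<Longrightarrow> con p (ins (Suc p) x) I = s * x I"
proof (induction p arbitrary: m x I)
  case 0
  show ?case
  proof (cases I)
    case Nil then show ?thesis using 0 by (simp add: supp_def tau_def)
  next
    case (Cons c J)
    have "(\<Oplus>a b. cnj (t a b) * (t b c * x (a # J))) = (\<Oplus>a. (\<Oplus>b. cnj (t a b) * t b c) * x (a # J))"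
      by (simp add: sum_distrib_left sum_distrib_right mult_ac)
    also have "\<dots> = (\<Oplus>a. (if a = c then s else 0) * x (a # J))"
      unfolding t_conj' by (intro sum.cong) auto
    also have "\<dots> = s * x (c # J)" by (rule sum_if_mult)
    finally show ?thesis by (simp add: Cons tau_def)
  qed
next
  case (Suc p)
  then obtain m' where m: "m = Suc m'" by (cases m) auto
  show ?case
  proof (cases I)
    case Nil then show ?thesis using Suc.prems by (simp add: supp_def m)
  next
    case (Cons a J)
    have "con (Suc p) (ins (Suc (Suc p)) x) I = con p (ins (Suc p) (sl a x)) J" by (simp add: Cons sl_ins)
    also have "\<dots> = s * sl a x J" by (rule Suc.IH[OF supp_sl]) (use Suc.prems m in auto)
    finally show ?thesis by (simp add: Cons)
  qed
qed

lemma con_ins_far: "con (p + q + 2) (ins p x) I = ins p (con (p + q) x) I"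
proof (induction p arbitrary: x I)
  case 0
  show ?case
  proof (cases I)
    case (Cons a J)
    then show ?thesis
    proof (cases J)
      case (Cons b J')
      have "sl b (sl a (cr 0 x)) = (\<lambda>J. t a b * x J)" by (simp add: fun_eq_iff)
      then show ?thesis using \<open>I = a # J\<close> by (simp add: Cons con_scale numeral_2_eq_2)
    qed (simp add: Cons numeral_2_eq_2)
  qed (simp add: numeral_2_eq_2)
next
  case (Suc p)
  show ?case
  proof (cases I)
    case (Cons a J)
    have "con (Suc p + q + 2) (ins (Suc p) x) I = con (p + q + 2) (ins p (sl a x)) J"
      by (simp add: Cons sl_ins)
    also have "\<dots> = ins p (con (p + q) (sl a x)) J" by (rule Suc.IH)
    also have "\<dots> = ins (Suc p) (con (Suc p + q) x) I" by (simp add: Cons sl_con)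
    finally show ?thesis .
  qed simp
qed

lemma ins_con_far: "con p (ins (p + q + 2) x) I = ins (p + q) (con p x) I"
proof (induction p arbitrary: x I)
  case 0
  have "ins q (tau x) I = ins q (\<lambda>J. \<Oplus>p. cnj (t (fst p) (snd p)) * sl (snd p) (sl (fst p) x) J) I"
    by (simp add: tau_alt[of x] sum.cartesian_product case_prod_unfold flip: UNIV_Times_UNIV)
  also have "\<dots> = (\<Oplus>a b. cnj (t a b) * ins q (sl b (sl a x)) I)"
    unfolding ins_sum by (simp only: sum.cartesian_product case_prod_unfold UNIV_Times_UNIV)
  also have "\<dots> = tau (ins (q + 2) x) I"
    by (simp add: tau_def numeral_2_eq_2)
  finally show ?case by simp
next
  case (Suc p)
  show ?case
  proof (cases I)
    case (Cons a J)
    have "con (Suc p) (ins (Suc p + q + 2) x) I = con p (ins (p + q + 2) (sl a x)) J"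
      by (simp add: Cons sl_ins)
    also have "\<dots> = ins (p + q) (con p (sl a x)) J" by (rule Suc.IH)
    also have "\<dots> = ins (Suc p + q) (con (Suc p) x) I" by (simp add: Cons sl_con)
    finally show ?thesis .
  qed simp
qed

lemma ins_adjoint:
  "q \<le> m \<Longrightarrow> (\<Sum>L\<in>Ln (Suc (Suc m)). cnj (z L) * ins q x L) = (\<Sum>L\<in>Ln m. cnj (con q z L) * x L)"
proof (induction q arbitrary: m z x)
  case 0
  have "(\<Sum>L\<in>Ln (Suc (Suc m)). cnj (z L) * ins 0 x L)
      = (\<Oplus>a b. \<Sum>L\<in>Ln m. cnj (z (a # b # L)) * (t a b * x L))"
    by (simp add: sum_Ln_Suc)
  also have "\<dots> = (\<Oplus>a. \<Sum>L\<in>Ln m. \<Oplus>b. cnj (z (a # b # L)) * (t a b * x L))"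
    by (intro sum.cong refl sum.swap)
  also have "\<dots> = (\<Sum>L\<in>Ln m. \<Oplus>a b. cnj (z (a # b # L)) * (t a b * x L))"
    by (rule sum.swap)
  finally show ?case by (simp add: tau_def sum_distrib_left mult_ac)
next
  case (Suc q)
  then obtain m' where m: "m = Suc m'" by (cases m) auto
  have "(\<Sum>L\<in>Ln (Suc (Suc m')). cnj (sl a z L) * ins q (sl a x) L) = (\<Sum>L\<in>Ln m'. cnj (con q (sl a z) L) * sl a x L)" for a
    using Suc by (intro Suc.IH) (simp add: m)
  then show ?case by (simp add: m sum_Ln_Suc[of _ "Suc (Suc m')"] sum_Ln_Suc[of _ m'])
qed

text \<open>The span of all noncrossing pairings of \<open>m\<close> points, which are fixed by the
  m-th tensor power of the corepresentation.\<close>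

inductive Im :: "nat \<Rightarrow> ('n list \<Rightarrow> complex) \<Rightarrow> bool" where
  Im_unit: "Im 0 (\<lambda>I. if I = [] then 1 else 0)"
| Im_ins: "Im m x \<Longrightarrow> p \<le> m \<Longrightarrow> Im (Suc (Suc m)) (ins p x)"
| Im_zero: "Im m (\<lambda>I. 0)"
| Im_lin: "Im m x \<Longrightarrow> Im m w \<Longrightarrow> Im m (\<lambda>I. c * x I + w I)"

lemma Im_scale: "Im m x \<Longrightarrow> Im m (\<lambda>I. c * x I)"
  using Im_lin[OF _ Im_zero, of m x c] by simp

lemma Im_supp: "Im m x \<Longrightarrow> supp m x"
proof (induction rule: Im.induct)
  case (Im_ins m x p) then show ?case by (intro supp_ins)
qed (auto simp: supp_def)

text \<open>A cap meets the outermost cup in one of three ways: in the same place it closes a loop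
  of value \<open>D\<close>, one leg apart it forms a zigzag of value \<open>s\<close>, and farther
  away it commutes with the cup and acts on the smaller diagram.\<close>

lemma Im_con: "Im m x \<Longrightarrow> Suc (Suc p) \<le> m \<Longrightarrow> Im (m - 2) (con p x)"
proof (induction arbitrary: p rule: Im.induct)
  case (Im_ins m x q)
  note supp = Im_supp[OF Im_ins.hyps(1)]
  consider "p = q" | "p = Suc q" | "q = Suc p" | r where "p = q + r + 2" | r where "q = p + r + 2"
    by (metis add_2_eq_Suc' less_iff_Suc_add not_less_iff_gr_or_eq add_Suc_right add_0_right not0_implies_Suc)
  then show ?case
  proof cases
    case 1
    have "con p (ins q x) = (\<lambda>I. complex_of_real D * x I)" using con_ins_same[OF supp Im_ins.hyps(2)] by (simp add: 1 fun_eq_iff)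
    then show ?thesis using Im_ins.hyps(1) by (simp add: Im_scale)
  next
    case 2
    have "con p (ins q x) = (\<lambda>I. s * x I)" using con_Suc_ins[OF supp, of q] Im_ins.prems by (simp add: 2 fun_eq_iff)
    then show ?thesis using Im_ins.hyps(1) by (simp add: Im_scale)
  next
    case 3
    have "con p (ins q x) = (\<lambda>I. s * x I)" using con_ins_Suc[OF supp, of p] Im_ins.hyps(2) by (simp add: 3 fun_eq_iff)
    then show ?thesis using Im_ins.hyps(1) by (simp add: Im_scale)
  next
    case 4
    then have m: "m = Suc (Suc (m - 2))" "q \<le> m - 2" "Suc (Suc (q + r)) \<le> m" using Im_ins.prems by auto
    have "con p (ins q x) = ins q (con (q + r) x)" using con_ins_far[of q r x] by (simp add: 4 fun_eq_iff)
    moreover have "Im (Suc (Suc (m - 2))) (ins q (con (q + r) x))"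
      using m Im_ins.IH by (intro Im.Im_ins) auto
    ultimately show ?thesis using m by simp
  next
    case 5
    then have m: "m = Suc (Suc (m - 2))" "p + r \<le> m - 2" "Suc (Suc p) \<le> m" using Im_ins.hyps by auto
    have "con p (ins q x) = ins (p + r) (con p x)" using ins_con_far[of p r x] by (simp add: 5 fun_eq_iff)
    moreover have "Im (Suc (Suc (m - 2))) (ins (p + r) (con p x))"
      using m Im_ins.IH by (intro Im.Im_ins) auto
    ultimately show ?thesis using m by simp
  qed
next
  case (Im_zero m)
  have "con p (\<lambda>I. 0) = (\<lambda>I. 0)" by (simp add: fun_eq_iff con_zero)
  then show ?case by (simp add: Im.Im_zero)
next
  case (Im_lin m x w c)
  have "con p (\<lambda>I. c * x I + w I) = (\<lambda>I. c * con p x I + con p w I)" by (simp add: fun_eq_iff con_lin)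
  then show ?case using Im_lin by (simp add: Im.Im_lin)
qed simp

definition PP :: "nat \<Rightarrow> 'n list \<Rightarrow> 'n list \<Rightarrow> complex" where
  "PP m = (SOME P. (\<forall>j. Im m (\<lambda>i. P i j)) \<and> (\<forall>i j. P j i = cnj (P i j)) \<and>
     (\<forall>x. Im m x \<longrightarrow> (\<forall>i. (\<Sum>j\<in>Ln m. P i j * x j) = x i)))"

lemma PP: "Im m (\<lambda>i. PP m i j)" "PP m j i = cnj (PP m i j)" "Im m x \<Longrightarrow> (\<Sum>j\<in>Ln m. PP m i j * x j) = x i"
proof -
  have "\<exists>P. (\<forall>j. (\<lambda>i. P i j) \<in> {x. Im m x}) \<and> (\<forall>i j. P j i = cnj (P i j)) \<and>
     (\<forall>x\<in>{x. Im m x}. \<forall>i. (\<Sum>j\<in>Ln m. P i j * x j) = x i)"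
  proof (rule reproducing_kernel)
    show "x i = 0" if "x \<in> {x. Im m x}" "i \<notin> Ln m" for x i
      using that Im_supp[of m x] by (auto simp: supp_def)
  qed (auto simp: Im_zero Im_lin)
  then have "\<exists>P. (\<forall>j. Im m (\<lambda>i. P i j)) \<and> (\<forall>i j. P j i = cnj (P i j)) \<and>
     (\<forall>x. Im m x \<longrightarrow> (\<forall>i. (\<Sum>j\<in>Ln m. P i j * x j) = x i))" by simp
  from someI_ex[OF this] show "Im m (\<lambda>i. PP m i j)" "PP m j i = cnj (PP m i j)"
    "Im m x \<Longrightarrow> (\<Sum>j\<in>Ln m. PP m i j * x j) = x i"
    unfolding PP_def[symmetric] by blast+
qed

lemma Im_sum: "(\<And>i. i \<in> A \<Longrightarrow> Im m (f i)) \<Longrightarrow> Im m (\<lambda>I. \<Sum>i\<in>A. c i * f i I)"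
  by (induction A rule: infinite_finite_induct) (simp_all add: Im_zero Im_lin)

lemma PP_self_adjoint:
  "Im m z \<Longrightarrow> (\<Sum>K\<in>Ln m. cnj (z K) * (\<Sum>L\<in>Ln m. PP m K L * w L)) = (\<Sum>L\<in>Ln m. cnj (z L) * w L)"
proof -
  assume z: "Im m z"
  have "(\<Sum>K\<in>Ln m. cnj (z K) * (\<Sum>L\<in>Ln m. PP m K L * w L)) = (\<Sum>L\<in>Ln m. (\<Sum>K\<in>Ln m. cnj (z K) * PP m K L) * w L)"
    by (rule sum_mult_assoc)
  also have "\<dots> = (\<Sum>L\<in>Ln m. cnj (\<Sum>K\<in>Ln m. PP m L K * z K) * w L)"
    by (intro sum.cong refl) (simp add: PP(2)[symmetric] mult.commute)
  finally show ?thesis by (simp add: PP(3)[OF z])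
qed

lemma PP_ins:
  assumes "q \<le> m"
  shows "(\<Sum>L\<in>Ln (Suc (Suc m)). PP (Suc (Suc m)) K L * ins q x L) = ins q (\<lambda>K'. \<Sum>L\<in>Ln m. PP m K' L * x L) K"
proof -
  let ?m = "Suc (Suc m)"
  define u where "u K = (\<Sum>L\<in>Ln ?m. PP ?m K L * ins q x L)" for K
  define w where "w = ins q (\<lambda>K'. \<Sum>L\<in>Ln m. PP m K' L * x L)"
  have u: "Im ?m u"
    using Im_sum[of "Ln ?m" ?m "\<lambda>L K. PP ?m K L" "ins q x"] PP(1) by (simp add: u_def[abs_def] mult.commute)
  have w: "Im ?m w"
    unfolding w_def using Im_sum[of "Ln m" m "\<lambda>L K. PP m K L" x] PP(1) assms
    by (intro Im_ins) (simp_all add: mult.commute)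
  have "(\<Sum>L\<in>Ln ?m. cnj (z L) * u L) = (\<Sum>L\<in>Ln ?m. cnj (z L) * w L)" if z: "Im ?m z" for z
    unfolding u_def PP_self_adjoint[OF z] w_def ins_adjoint[OF assms]
    using Im_con[OF z, of q] assms by (subst PP_self_adjoint) auto
  from this[OF PP(1)] have "(\<Sum>L\<in>Ln ?m. PP ?m K L * u L) = (\<Sum>L\<in>Ln ?m. PP ?m K L * w L)"
    by (simp flip: PP(2))
  then show ?thesis by (simp add: PP(3)[OF u] PP(3)[OF w]) (simp add: u_def w_def)
qed

text \<open>The Haar state of a word coefficient ought to be the matrix entry of the projection onto
  the fixed vectors. Taking the diagrams for the fixed vectors gives a kernel whose compatibility
  with the relations can be verified directly.\<close>

definition haar_kernel :: "'n list \<Rightarrow> 'n list \<Rightarrow> complex" where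
  "haar_kernel I J = (if length I = length J then PP (length I) I J else 0)"

lemma haar_kernel_herm: "haar_kernel J I = cnj (haar_kernel I J)"
  unfolding haar_kernel_def using PP(2)[of "length I" J I] by (cases "length I = length J") simp_all

lemma haar_kernel_col:
  assumes "length I = length J"
  shows "(\<Oplus>c d. t c d * haar_kernel (I @ a # b # I') (J @ c # d # J')) = t a b * haar_kernel (I @ I') (J @ J')"
proof (cases "length I' = length J'")
  case True
  define m where "m = length (J @ J')"
  let ?K = "I @ a # b # I'"
  \<comment> \<open>The indicator of the target word turns \<open>PP_ins\<close> into a statement
    about single entries of the kernel.\<close>
  define x where "x L = (if L = J @ J' then 1 else 0::complex)" for L
  have "(\<Sum>L\<in>Ln (Suc (Suc m)). PP (Suc (Suc m)) ?K L * ins (length J) x L)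
     = (\<Sum>L\<in>Ln (Suc (Suc m)). cnj (cnj (PP (Suc (Suc m)) ?K L)) * ins (length J) x L)" by simp
  also have "\<dots> = (\<Sum>L\<in>Ln m. cnj (con (length J) (\<lambda>L. cnj (PP (Suc (Suc m)) ?K L)) L) * x L)"
    by (rule ins_adjoint) (simp add: m_def)
  also have "\<dots> = cnj (con (length J) (\<lambda>L. cnj (PP (Suc (Suc m)) ?K L)) (J @ J'))"
    by (simp add: x_def if_distrib m_def cong: if_cong)
  also have "\<dots> = (\<Oplus>c d. t c d * PP (Suc (Suc m)) ?K (J @ c # d # J'))"
    by (simp add: con_app)
  finally have 1: "(\<Oplus>c d. t c d * PP (Suc (Suc m)) ?K (J @ c # d # J'))
     = ins (length J) (\<lambda>K'. \<Sum>L\<in>Ln m. PP m K' L * x L) ?K"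
    using PP_ins[of "length J" m ?K x] by (simp add: m_def)
  also have "\<dots> = t a b * (\<Sum>L\<in>Ln m. PP m (I @ I') L * x L)"
    using ins_app[of I] assms by simp
  also have "(\<Sum>L\<in>Ln m. PP m (I @ I') L * x L) = PP m (I @ I') (J @ J')"
    by (simp add: x_def if_distrib m_def cong: if_cong)
  finally show ?thesis using assms True by (simp add: haar_kernel_def m_def)
qed (use assms in \<open>simp add: haar_kernel_def\<close>)

lemma haar_kernel_row:
  assumes "length I = length J"
  shows "(\<Oplus>a b. cnj (t a b) * haar_kernel (I @ a # b # I') (J @ c # d # J')) = cnj (t c d) * haar_kernel (I @ I') (J @ J')"
proof -
  have "cnj (\<Oplus>a b. t a b * haar_kernel (J @ c # d # J') (I @ a # b # I')) = cnj (t c d * haar_kernel (J @ J') (I @ I'))"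
    using haar_kernel_col[of J I] assms by simp
  then show ?thesis by (simp flip: haar_kernel_herm)
qed

lemma haar_kernel_Nil: "haar_kernel [] [] = 1"
  using PP(3)[OF Im_unit, of "[]"] by (simp add: haar_kernel_def)

lemma con_VV: "VV k v \<Longrightarrow> con p v I = 0"
proof (induction p arbitrary: k v I)
  case 0
  show ?case using VV_contr[OF 0, of "[]" I] by (simp add: tau_def)
next
  case (Suc p)
  show ?case
  proof (cases I)
    case (Cons a J)
    show ?thesis
    proof (cases k)
      case 0
      have "sl a v = (\<lambda>I. 0)" using Suc.prems by (auto simp: VV_def 0)
      then show ?thesis by (simp add: Cons con_zero)
    next
      case (Suc k')
      have "con p (sl a v) J = 0" by (rule Suc.IH[OF VV_sl]) (use Suc Suc.prems in auto)
      then show ?thesis by (simp add: Cons)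
    qed
  qed simp
qed

lemma Im_VV: "Im m x \<Longrightarrow> VV m v \<Longrightarrow> 0 < m \<Longrightarrow> (\<Sum>L\<in>Ln m. cnj (x L) * v L) = 0"
proof (induction rule: Im.induct)
  case (Im_ins m x p)
  have "(\<Sum>L\<in>Ln (Suc (Suc m)). cnj (ins p x L) * v L) = cnj (\<Sum>L\<in>Ln (Suc (Suc m)). cnj (v L) * ins p x L)"
    by (simp add: mult.commute)
  then show ?case using Im_ins by (simp add: ins_adjoint con_VV)
next
  case (Im_lin m x w c)
  then show ?case by (simp add: distrib_right sum.distrib mult.assoc flip: sum_distrib_left)
qed simp_all

lemma haar_kernel_VV:
  assumes "VV (Suc k) v"
  shows "(\<Sum>J\<in>Ln (Suc k). haar_kernel I J * v J) = 0"
proof (cases "length I = Suc k")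
  case True
  have "(\<Sum>J\<in>Ln (Suc k). haar_kernel I J * v J) = (\<Sum>J\<in>Ln (Suc k). cnj (PP (Suc k) J I) * v J)"
    using True by (intro sum.cong refl) (simp add: haar_kernel_def flip: PP(2))
  then show ?thesis using Im_VV[OF PP(1) assms] by simp
qed (simp add: haar_kernel_def)

end

section \<open>The algebra of a free orthogonal quantum group\<close>

subsection \<open>Linear functionals on the free algebra\<close>

lemma poly_mapping_single_induct [case_names single add]:
  assumes "\<And>w c. P (Poly_Mapping.single w c)" "\<And>p q. P p \<Longrightarrow> P q \<Longrightarrow> P (p + q)"
  shows "P (p :: 'b \<Rightarrow>\<^sub>0 complex)"
proof (induction p rule: Poly_Mapping.update_induct)
  case const
  show ?case using assms(1)[of _ 0] by simp
next
  case (update p k v)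
  have "Poly_Mapping.update k v p = Poly_Mapping.single k v + p"
    using update.hyps
    by (intro poly_mapping_eqI)
      (auto simp: Poly_Mapping.update.rep_eq lookup_add lookup_single when_def in_keys_iff)
  then show ?case using assms update.IH by simp
qed

definition lin :: "('b \<Rightarrow> 'v::complex_vector) \<Rightarrow> ('b \<Rightarrow>\<^sub>0 complex) \<Rightarrow> 'v" where
  "lin f p = (\<Sum>w\<in>Poly_Mapping.keys p. Poly_Mapping.lookup p w *\<^sub>C f w)"

lemma lin_superset:
  assumes "finite A" "Poly_Mapping.keys p \<subseteq> A"
  shows "lin f p = (\<Sum>w\<in>A. Poly_Mapping.lookup p w *\<^sub>C f w)"
  unfolding lin_def using assms by (intro sum.mono_neutral_left) (auto simp: in_keys_iff)

lemma lin_add: "lin f (p + q) = lin f p + lin f q"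
proof -
  let ?A = "Poly_Mapping.keys p \<union> Poly_Mapping.keys q"
  have "Poly_Mapping.keys (p + q) \<subseteq> ?A" by (rule keys_add)
  then show ?thesis
    by (subst (1 2 3) lin_superset[of ?A]) (auto simp: lookup_add scaleC_add_left sum.distrib)
qed

lemma lin_zero [simp]: "lin f 0 = 0"
  by (simp add: lin_def)

lemma lin_diff: "lin f (p - q) = lin f p - lin f q"
  using lin_add[of f "p - q" q] by (simp add: algebra_simps)

lemma lin_sum: "lin f (sum p A) = (\<Sum>i\<in>A. lin f (p i))"
  by (induction A rule: infinite_finite_induct) (simp_all add: lin_add)

lemma lin_single: "lin f (Poly_Mapping.single w c) = c *\<^sub>C f w"
  by (subst lin_superset[of "{w}"]) (auto simp: lookup_single)

lemma lin_fun_sum: "lin (\<lambda>w. \<Sum>i\<in>A. c i *\<^sub>C f i w) p = (\<Sum>i\<in>A. c i *\<^sub>C lin (f i) p)"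
  unfolding lin_def by (simp add: scaleC_sum_right scaleC_scaleC mult.commute sum.swap[of _ A])

lemma lin_single_mult:
  "lin f (Poly_Mapping.single w c * p) = c *\<^sub>C lin (\<lambda>w'. f (w + w')) (p :: 'b::monoid_add \<Rightarrow>\<^sub>0 complex)"
  by (induction p rule: poly_mapping_single_induct)
    (simp_all add: mult_single lin_single scaleC_scaleC distrib_left lin_add scaleC_add_right)

lemma lin_mult_single:
  "lin f (p * Poly_Mapping.single w c) = c *\<^sub>C lin (\<lambda>w'. f (w' + w)) (p :: 'b::monoid_add \<Rightarrow>\<^sub>0 complex)"
  by (induction p rule: poly_mapping_single_induct)
    (simp_all add: mult_single lin_single scaleC_scaleC distrib_right lin_add scaleC_add_right mult.commute)

lemma adj_generator_adj [simp]: "adj_generator (adj_generator g) = g"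
  by (cases g) simp_all

lemma adj_monomial_adj [simp]: "adj_monomial (adj_monomial w) = w"
  by (cases w) (simp add: adj_monomial_def rev_map[symmetric] comp_def)

lemma adj_monomial_eq_iff: "adj_monomial v = w \<longleftrightarrow> v = adj_monomial w"
  by auto

lemma lookup_free_star: "Poly_Mapping.lookup (free_star p) w = cnj (Poly_Mapping.lookup p (adj_monomial w))"
proof -
  have "Poly_Mapping.lookup (free_star p) w
      = (\<Sum>v\<in>Poly_Mapping.keys p. if v = adj_monomial w then cnj (Poly_Mapping.lookup p v) else 0)"
    unfolding free_star_def lookup_sum lookup_single
    by (intro sum.cong refl) (auto simp: when_def adj_monomial_eq_iff)
  then show ?thesis by (simp add: in_keys_iff)
qed

lemma free_star_simps:
  "free_star (p + q) = free_star p + free_star q" "free_star (p - q) = free_star p - free_star q"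
  "free_star 0 = 0" "free_star (free_star p) = p"
  "free_star (Poly_Mapping.single w c) = Poly_Mapping.single (adj_monomial w) (cnj c)"
  by (rule poly_mapping_eqI, simp add: lookup_free_star lookup_add lookup_minus lookup_single when_def adj_monomial_eq_iff)+

lemma free_star_sum: "free_star (sum p A) = (\<Sum>i\<in>A. free_star (p i))"
  by (induction A rule: infinite_finite_induct) (simp_all add: free_star_simps)

lemma adj_monomial_add: "adj_monomial (v + w) = adj_monomial w + adj_monomial v"
  by (simp add: adj_monomial_def plus_monomial_def)

lemma free_star_mult: "free_star (p * q) = free_star q * free_star p"
proof (induction p rule: poly_mapping_single_induct)
  case (single w c)
  show ?case
    by (induction q rule: poly_mapping_single_induct)
      (simp_all add: mult_single free_star_simps adj_monomial_add distrib_left distrib_right mult.commute)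
qed (simp add: distrib_left distrib_right free_star_simps)

text \<open>Allowing arbitrary words on both sides makes vanishing stable under two-sided
  multiplication, and treating \<open>free_star p\<close> along with \<open>p\<close> makes it
  stable under the star.\<close>

lemma star_ideal_null:
  fixes F :: "'n monomial \<Rightarrow> 'v::complex_vector"
  assumes X: "\<And>p a b. p \<in> X \<Longrightarrow> lin (\<lambda>w. F (a + w + b)) p = 0"
    and X': "\<And>p a b. p \<in> X \<Longrightarrow> lin (\<lambda>w. F (a + w + b)) (free_star p) = 0"
    and p: "p \<in> star_ideal X"
  shows "lin F p = 0"
proof -
  have left: "lin (\<lambda>w. F (a + w + b)) (r * p) = 0"
    if "\<And>a b. lin (\<lambda>w. F (a + w + b)) p = 0" for p r a b
    by (induction r rule: poly_mapping_single_induct)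
      (simp_all add: distrib_right lin_add lin_single_mult that flip: add.assoc)
  have right: "lin (\<lambda>w. F (a + w + b)) (p * r) = 0"
    if "\<And>a b. lin (\<lambda>w. F (a + w + b)) p = 0" for p r a b
  proof (induction r rule: poly_mapping_single_induct)
    case (single w c)
    have "lin (\<lambda>w'. F (a + (w' + w) + b)) p = 0" using that[of a "w + b"] by (simp add: add.assoc)
    then show ?case by (simp add: lin_mult_single)
  qed (simp add: distrib_left lin_add)
  from p have "\<forall>a b. lin (\<lambda>w. F (a + w + b)) p = 0 \<and> lin (\<lambda>w. F (a + w + b)) (free_star p) = 0"
  proof (induction rule: star_ideal.induct)
    case (ideal_gen p) then show ?case using X X' by blast
  next
    case ideal_zero show ?case by (simp add: free_star_simps)
  next
    case (ideal_add p q) then show ?case by (simp add: free_star_simps lin_add)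
  next
    case (ideal_mult_left p r) then show ?case by (simp add: free_star_mult left right)
  next
    case (ideal_mult_right p r) then show ?case by (simp add: free_star_mult left right)
  next
    case (ideal_star p) then show ?case by (simp add: free_star_simps)
  qed
  from this[rule_format, of 0 0] show ?thesis by simp
qed

lemma evaluate_lin: "evaluate u = lin (\<lambda>w. prod_list (map (generator_value u) (letters w)))"
  by (simp add: evaluate_def lin_def fun_eq_iff)

lemma letters_zero [simp]: "letters 0 = []"
  by (simp add: zero_monomial_def)

lemma Ao_relators_explicit:
  "(\<Oplus>k. free_gen i k * free_star (free_gen j k)) - (if i = j then 1 else 0)
     = (\<Oplus>k. Poly_Mapping.single (Monomial [Gen i k, Adj j k]) 1) - Poly_Mapping.single 0 (if i = j then 1 else 0)"
  "(\<Oplus>k. free_star (free_gen k i) * free_gen k j) - (if i = j then 1 else 0)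
     = (\<Oplus>k. Poly_Mapping.single (Monomial [Adj k i, Gen k j]) 1) - Poly_Mapping.single 0 (if i = j then 1 else 0)"
  "free_gen i j - (\<Oplus>k l.
        free_const (Q $ i $ k) * free_star (free_gen k l) * free_const (matrix_inv Q $ l $ j))
   = Poly_Mapping.single (Monomial [Gen i j]) 1 - (\<Oplus>k l.
        Poly_Mapping.single (Monomial [Adj k l]) (Q $ i $ k * matrix_inv Q $ l $ j))"
  by (simp_all add: free_gen_def free_const_def free_star_simps adj_monomial_def mult_single plus_monomial_def
      flip: single_one)

subsection \<open>Change of basis\<close>

definition mm :: "('n::finite \<Rightarrow> 'n \<Rightarrow> complex) \<Rightarrow> ('n \<Rightarrow> 'n \<Rightarrow> complex) \<Rightarrow> 'n \<Rightarrow> 'n \<Rightarrow> complex" where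
  "mm A B = (\<lambda>i j. \<Oplus>k. A i k * B k j)"

definition mI :: "'n \<Rightarrow> 'n \<Rightarrow> complex" where
  "mI = (\<lambda>i j. if i = j then 1 else 0)"

definition ms :: "complex \<Rightarrow> ('n::finite \<Rightarrow> 'n \<Rightarrow> complex) \<Rightarrow> 'n \<Rightarrow> 'n \<Rightarrow> complex" where
  "ms c A = (\<lambda>i j. c * A i j)"

definition mcnj :: "('n::finite \<Rightarrow> 'n \<Rightarrow> complex) \<Rightarrow> 'n \<Rightarrow> 'n \<Rightarrow> complex" where
  "mcnj A = (\<lambda>i j. cnj (A i j))"

definition mtr :: "('n::finite \<Rightarrow> 'n \<Rightarrow> complex) \<Rightarrow> 'n \<Rightarrow> 'n \<Rightarrow> complex" where
  "mtr A = (\<lambda>i j. A j i)"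

lemma m_app: "mcnj A i j = cnj (A i j)" "mtr A i j = A j i" "ms c A i j = c * A i j" "mI i j = (if i = j then 1 else 0)"
  by (simp_all add: mcnj_def mtr_def ms_def mI_def)

lemma mm_app: "mm A B i j = (\<Oplus>k. A i k * B k j)"
  by (simp add: mm_def)

lemma mm_assoc: "mm (mm A B) C = mm A (mm B C)"
  unfolding mm_def fun_eq_iff sum_mult_assoc by simp

lemma mm_I [simp]: "mm A mI = A" "mm mI A = A"
proof -
  have "(\<Oplus>k. A i k * mI k j) = A i j" for i j
    using sum_if_mult[of j 1 "\<lambda>k. A i k"] by (simp add: mI_def mult.commute)
  then show "mm A mI = A" by (simp add: mm_def)
  have "(\<Oplus>k. mI i k * A k j) = A i j" for i j
    using sum_if_mult[of i 1 "\<lambda>k. A k j"] by (simp add: mI_def eq_commute)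
  then show "mm mI A = A" by (simp add: mm_def)
qed

lemma mm_ms [simp]: "mm (ms c A) B = ms c (mm A B)" "mm A (ms c B) = ms c (mm A B)"
  by (simp_all add: mm_def ms_def sum_distrib_left mult_ac)

lemma ms_simps [simp]: "ms c (ms d A) = ms (c * d) A" "ms 1 A = A"
  by (simp_all add: ms_def mult_ac)

lemma mcnj_simps [simp]: "mcnj (mm A B) = mm (mcnj A) (mcnj B)" "mcnj (ms c A) = ms (cnj c) (mcnj A)"
  "mcnj (mcnj A) = A" "mcnj mI = mI"
  by (auto simp: mcnj_def mm_def ms_def mI_def fun_eq_iff)

lemma mtr_simps [simp]: "mtr (mm A B) = mm (mtr B) (mtr A)" "mtr (ms c A) = ms c (mtr A)"
  "mtr (mtr A) = A" "mtr mI = mI" "mtr (mcnj A) = mcnj (mtr A)"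
  by (auto simp: mcnj_def mtr_def mm_def ms_def mI_def fun_eq_iff mult.commute)

text \<open>The product A M B of a matrix over the algebra with scalar matrices on both
  sides.\<close>

definition sw :: "('n::finite \<Rightarrow> 'n \<Rightarrow> complex) \<Rightarrow> ('n \<Rightarrow> 'n \<Rightarrow> 'a::complex_vector) \<Rightarrow> ('n \<Rightarrow> 'n \<Rightarrow> complex) \<Rightarrow> 'n \<Rightarrow> 'n \<Rightarrow> 'a" where
  "sw A M B = (\<lambda>i j. \<Oplus>k l. (A i k * B l j) *\<^sub>C M k l)"

lemma sw_sw: "sw A (sw A' M B') B = sw (mm A A') M (mm B' B)"
proof (intro ext)
  fix i j
  have "sw A (sw A' M B') B i j
     = (\<Oplus>k l k' l'. ((A i k * A' k k') * (B' l' l * B l j)) *\<^sub>C M k' l')"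
    by (simp add: sw_def scaleC_sum_right scaleC_scaleC mult_ac)
  also have "\<dots> = (\<Oplus>k' l' k l. ((A i k * A' k k') * (B' l' l * B l j)) *\<^sub>C M k' l')"
    by (rule sum_swap4)
  also have "\<dots> = sw (mm A A') M (mm B' B) i j"
    by (simp add: sw_def mm_def sum_product flip: scaleC_sum_left)
  finally show "sw A (sw A' M B') B i j = sw (mm A A') M (mm B' B) i j" .
qed

lemma sw_I [simp]: "sw mI M mI = M"
proof (intro ext)
  fix i j
  have "sw mI M mI i j = (\<Oplus>k. if k = i then (\<Oplus>l. if l = j then M i j else 0) else 0)"
    unfolding sw_def mI_def
  proof (intro sum.cong refl)
    fix k
    show "(\<Oplus>l. ((if i = k then 1 else 0) * (if l = j then 1 else 0)) *\<^sub>C M k l)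
       = (if k = i then (\<Oplus>l. if l = j then M i j else 0) else 0)"
      by (cases "i = k") (simp_all add: sum_if_scaleC)
  qed
  then show "sw mI M mI i j = M i j" by simp
qed

lemma sw_ms: "sw (ms c A) M (ms d B) = sw (ms (c * d) A) M B"
  by (simp add: sw_def ms_def mult_ac)

definition lm :: "('n::finite \<Rightarrow> 'n \<Rightarrow> complex) \<Rightarrow> ('n \<Rightarrow> 'n \<Rightarrow> 'a::complex_vector) \<Rightarrow> 'n \<Rightarrow> 'n \<Rightarrow> 'a" where
  "lm A M = (\<lambda>i j. \<Oplus>k. A i k *\<^sub>C M k j)"

definition rm :: "('n::finite \<Rightarrow> 'n \<Rightarrow> 'a::complex_vector) \<Rightarrow> ('n \<Rightarrow> 'n \<Rightarrow> complex) \<Rightarrow> 'n \<Rightarrow> 'n \<Rightarrow> 'a" where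
  "rm M B = (\<lambda>i j. \<Oplus>k. B k j *\<^sub>C M i k)"

definition am :: "('n::finite \<Rightarrow> 'n \<Rightarrow> 'a::complex_star_algebra) \<Rightarrow> ('n \<Rightarrow> 'n \<Rightarrow> 'a) \<Rightarrow> 'n \<Rightarrow> 'n \<Rightarrow> 'a" where
  "am M N = (\<lambda>i j. \<Oplus>k. M i k * N k j)"

lemma sw_lm_rm: "sw A M B = lm A (rm M B)"
  by (simp add: sw_def lm_def rm_def scaleC_sum_right scaleC_scaleC)

lemma lm_lm: "lm A (lm B M) = lm (mm A B) M"
  unfolding lm_def mm_def fun_eq_iff by (auto simp: scaleC_sum_right scaleC_scaleC scaleC_sum_left intro: sum.swap)

lemma am_lm: "am (lm A M) N = lm A (am M N)"
  unfolding lm_def am_def fun_eq_iff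
  by (auto simp: scaleC_sum_right sum_distrib_right scaleC_mult_left intro: sum.swap)

lemma am_rm: "am M (rm N B) = rm (am M N) B"
  unfolding rm_def am_def fun_eq_iff
  by (auto simp: scaleC_sum_right sum_distrib_left scaleC_mult_right intro: sum.swap)

lemma am_rm_left: "am (rm M B) N = am M (lm B N)"
  unfolding rm_def am_def lm_def fun_eq_iff
  by (auto simp: sum_distrib_left sum_distrib_right scaleC_mult_right scaleC_mult_left intro: sum.swap)

lemma lm_I [simp]: "lm mI M = M"
proof -
  have "lm mI M i j = M i j" for i j
    using sum_if_scaleC[of i 1 "\<lambda>k. M k j"] by (simp add: lm_def mI_def eq_commute)
  then show ?thesis by (simp add: fun_eq_iff)
qed

lemma star_zero [simp]: "star (0::'a::complex_star_algebra) = 0"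
  using star_scaleC[of 0 "0::'a"] by simp

lemma star_sum: "star (sum f S) = (\<Sum>i\<in>S. star (f i :: 'a::complex_star_algebra))"
  by (induction S rule: infinite_finite_induct) (simp_all add: star_add)

lemma star_one [simp]: "star 1 = (1::'a::complex_star_algebra)"
  using star_mult[of "star 1" "1::'a"] by (simp add: star_star)

lemma star_sw: "star (sw A M B i j) = sw (mcnj A) (\<lambda>i j. star (M i j)) (mcnj B) i j"
  by (simp add: sw_def star_sum star_scaleC mcnj_def)

fun wordm :: "('n \<Rightarrow> 'n \<Rightarrow> 'a::complex_star_algebra) \<Rightarrow> 'n list \<Rightarrow> 'n list \<Rightarrow> 'a" where
  "wordm v [] [] = 1"
| "wordm v (a # I) (b # J) = v a b * wordm v I J"
| "wordm v _ _ = 0"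

lemma sum_swap3: "(\<Sum>k\<in>A. \<Sum>b\<in>B. \<Sum>c\<in>C. f k b c) = (\<Sum>b\<in>B. \<Sum>c\<in>C. \<Sum>k\<in>A. f k b c)"
  by (subst sum.swap) (intro sum.cong refl sum.swap)

text \<open>Under the unitary change of basis u = V v V^* the matrix of adjoints is multiplied by
  the conjugate of \<open>V\<close> and by the transpose of \<open>V\<close>. Hence \<open>Q\<close>
  changes by the congruence V q V^T, not by a similarity.\<close>

locale ao_change =
  fixes Q :: "complex^'n^'n" and u :: "'n::finite \<Rightarrow> 'n \<Rightarrow> 'a::complex_star_algebra"
    and V q :: "'n \<Rightarrow> 'n \<Rightarrow> complex" and r s :: complex
  assumes Ao: "Ao_algebra Q u"
    and V: "mm (mcnj (mtr V)) V = mI" "mm V (mcnj (mtr V)) = mI"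
    and r: "r \<noteq> 0" "cnj r = r" and s: "s * s = 1" "cnj s = s"
    and qq: "mm q (mcnj q) = ms s mI"
    and Q: "(\<lambda>i k. Q $ i $ k) = ms r (mm V (mm q (mtr V)))"
    and Qinv: "(\<lambda>i k. matrix_inv Q $ i $ k) = ms (s / r) (mm (mcnj V) (mm (mcnj q) (mcnj (mtr V))))"
begin

definition v :: "'n \<Rightarrow> 'n \<Rightarrow> 'a" where
  "v = sw (mcnj (mtr V)) u V"

lemma qq': "mm (mcnj q) q = ms s mI"
proof -
  have "mcnj (mm q (mcnj q)) = mcnj (ms s mI)" by (simp only: qq)
  then show ?thesis by (simp add: s)
qed

lemma V': "mm (mtr V) (mcnj V) = mI" "mm (mcnj V) (mtr V) = mI"
proof -
  have "mcnj (mm (mcnj (mtr V)) V) = mcnj mI" "mcnj (mm V (mcnj (mtr V))) = mcnj mI" by (simp_all only: V)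
  then show "mm (mtr V) (mcnj V) = mI" "mm (mcnj V) (mtr V) = mI" by simp_all
qed

lemma mm_cancel: "mm (mcnj (mtr V)) (mm V A) = A" "mm V (mm (mcnj (mtr V)) A) = A"
  "mm (mtr V) (mm (mcnj V) A) = A" "mm (mcnj V) (mm (mtr V) A) = A"
  "mm q (mm (mcnj q) A) = ms s A" "mm (mcnj q) (mm q A) = ms s A"
  by (simp_all add: V V' qq qq' flip: mm_assoc)

lemma u_v: "u = sw V v (mcnj (mtr V))"
  by (simp add: v_def sw_sw V)

lemma evaluate_relator: "p \<in> Ao_relators Q \<Longrightarrow> evaluate u p = 0"
  using Ao star_ideal.ideal_gen by (auto simp: Ao_algebra_def)

lemma u_unitary: "(\<Oplus>k. u i k * star (u j k)) = (if i = j then 1 else 0)"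
    "(\<Oplus>k. star (u k i) * u k j) = (if i = j then 1 else 0)"
proof -
  have "evaluate u ((\<Oplus>k. free_gen i k * free_star (free_gen j k)) - (if i = j then 1 else 0)) = 0"
    by (rule evaluate_relator) (auto simp: Ao_relators_def)
  then show "(\<Oplus>k. u i k * star (u j k)) = (if i = j then 1 else 0)"
    unfolding Ao_relators_explicit evaluate_lin lin_diff lin_sum lin_single
    by (simp add: zero_monomial_def split: if_splits)
  have "evaluate u ((\<Oplus>k. free_star (free_gen k i) * free_gen k j) - (if i = j then 1 else 0)) = 0"
    by (rule evaluate_relator) (auto simp: Ao_relators_def)
  then show "(\<Oplus>k. star (u k i) * u k j) = (if i = j then 1 else 0)"
    unfolding Ao_relators_explicit evaluate_lin lin_diff lin_sum lin_single
    by (simp add: zero_monomial_def split: if_splits)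
qed

lemma u_Q: "u = sw (\<lambda>i k. Q $ i $ k) (\<lambda>i j. star (u i j)) (\<lambda>i k. matrix_inv Q $ i $ k)"
proof (intro ext)
  fix i j
  have "evaluate u (free_gen i j - (\<Oplus>k l.
        free_const (Q $ i $ k) * free_star (free_gen k l) * free_const (matrix_inv Q $ l $ j))) = 0"
    by (rule evaluate_relator) (auto simp: Ao_relators_def)
  then show "u i j = sw (\<lambda>i k. Q $ i $ k) (\<lambda>i j. star (u i j)) (\<lambda>i k. matrix_inv Q $ i $ k) i j"
    unfolding Ao_relators_explicit evaluate_lin lin_diff lin_sum lin_single by (simp add: sw_def)
qed

lemma star_u_v: "(\<lambda>i j. star (u i j)) = sw (mcnj V) (\<lambda>i j. star (v i j)) (mtr V)"
  by (subst u_v) (simp add: star_sw fun_eq_iff)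

lemma v_star: "v = sw q (\<lambda>i j. star (v i j)) (ms s (mcnj q))"
proof -
  have "v = sw (mcnj (mtr V)) (sw (\<lambda>i k. Q $ i $ k) (sw (mcnj V) (\<lambda>i j. star (v i j)) (mtr V)) (\<lambda>i k. matrix_inv Q $ i $ k)) V"
    unfolding star_u_v[symmetric] u_Q[symmetric] by (rule v_def)
  then show ?thesis
    using r by (simp add: sw_sw Q Qinv mm_assoc mm_cancel sw_ms V V') (simp add: sw_def ms_def mult_ac)
qed

lemma star_v: "star (v a b) = (\<Oplus>c d. (s * cnj (q a c) * q d b) *\<^sub>C v c d)"
proof -
  have "sw (ms s (mcnj q)) v q = sw (ms s (mcnj q)) (sw q (\<lambda>i j. star (v i j)) (ms s (mcnj q))) q"
    by (simp flip: v_star)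
  also have "\<dots> = (\<lambda>i j. star (v i j))"
    by (simp add: sw_sw qq' s sw_ms)
  finally have "sw (ms s (mcnj q)) v q a b = star (v a b)" by (simp add: fun_eq_iff)
  then show ?thesis by (simp add: sw_def ms_def mcnj_def)
qed

lemma v_unitary: "(\<Oplus>k. v i k * star (v j k)) = (if i = j then 1 else 0)"
    "(\<Oplus>k. star (v k i) * v k j) = (if i = j then 1 else 0)"
proof -
  let ?u' = "\<lambda>i j. star (u j i)" and ?W = "mcnj (mtr V)"
  have v: "v = lm ?W (rm u V)" by (simp add: v_def sw_lm_rm)
  have v': "(\<lambda>i j. star (v j i)) = lm ?W (rm ?u' V)"
    unfolding sw_lm_rm[symmetric] v_def
    by (simp only: star_sw fun_eq_iff) (auto simp: sw_def mcnj_def mtr_def mult.commute intro: sum.swap)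
  have d: "lm ?W (rm (\<lambda>i j. if i = j then 1 else 0 :: 'a) V) i j = (if i = j then 1 else 0)" for i j
  proof -
    have "lm ?W (rm (\<lambda>i j. if i = j then 1 else 0 :: 'a) V) i j = (\<Oplus>a b. (if b = a then ?W i a * V a j else 0) *\<^sub>C 1)"
      unfolding lm_def rm_def by (auto simp: scaleC_sum_right scaleC_scaleC intro!: sum.cong)
    also have "\<dots> = mm ?W V i j *\<^sub>C 1"
      by (simp add: sum_if_scaleC) (simp add: mm_def scaleC_sum_left)
    finally show ?thesis by (simp add: V) (simp add: mI_def)
  qed
  have "am v (\<lambda>i j. star (v j i)) = lm ?W (rm (am u ?u') V)"
    unfolding v' unfolding v am_lm am_rm_left lm_lm V lm_I am_rm ..
  then have "am v (\<lambda>i j. star (v j i)) i j = (if i = j then 1 else 0)"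
    using d by (simp add: am_def[of u] u_unitary)
  then show "(\<Oplus>k. v i k * star (v j k)) = (if i = j then 1 else 0)" by (simp add: am_def)
  have "am (\<lambda>i j. star (v j i)) v = lm ?W (rm (am ?u' u) V)"
    unfolding v' unfolding v am_lm am_rm_left lm_lm V lm_I am_rm ..
  then have "am (\<lambda>i j. star (v j i)) v i j = (if i = j then 1 else 0)"
    using d by (simp add: am_def[of ?u'] u_unitary)
  then show "(\<Oplus>k. star (v k i) * v k j) = (if i = j then 1 else 0)" by (simp add: am_def)
qed

text \<open>Expands every free generator in the entries of \<open>v\<close>; adjoints are
  eliminated, so that words in \<open>v\<close> alone suffice.\<close>

definition coef :: "'n generator \<Rightarrow> 'n \<Rightarrow> 'n \<Rightarrow> complex" where
  "coef g a b = (case g of Gen i j \<Rightarrow> V i a * cnj (V j b)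
     | Adj i j \<Rightarrow> s * mm (mcnj V) (mcnj q) i a * mm q (mtr V) b j)"

lemma coef_simps [simp]: "coef (Gen i j) a b = V i a * cnj (V j b)"
  "coef (Adj i j) a b = s * mm (mcnj V) (mcnj q) i a * mm q (mtr V) b j"
  by (simp_all add: coef_def)

lemma generator_value_v: "generator_value u g = (\<Oplus>a b. coef g a b *\<^sub>C v a b)"
proof (cases g)
  case (Gen i j)
  have "u i j = sw V v (mcnj (mtr V)) i j" by (simp flip: u_v)
  then show ?thesis by (simp add: Gen sw_def mcnj_def mtr_def)
next
  case (Adj i j)
  have vs: "(\<lambda>i j. star (v i j)) = sw (mcnj q) v (ms s q)"
    by (auto simp: star_v fun_eq_iff sw_def mcnj_def ms_def mult_ac)
  have "star (u i j) = sw (mcnj V) (\<lambda>i j. star (v i j)) (mtr V) i j" by (simp flip: star_u_v)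
  also have "\<dots> = sw (mm (mcnj V) (mcnj q)) v (ms s (mm q (mtr V))) i j"
    unfolding vs sw_sw by simp
  finally show ?thesis by (simp add: Adj sw_def ms_def mult_ac)
qed

lemma generator_words: "prod_list (map (generator_value u) ws) \<in> cspan {wordm v I J | I J. True}"
proof (induction ws)
  case Nil
  have "1 = wordm v [] []" by simp
  then show ?case by (simp only: list.map prod_list.Nil) (intro complex_vector.span_base, blast)
next
  case (Cons g ws)
  have *: "v a b * x \<in> cspan {wordm v I J | I J. True}" if "x \<in> cspan {wordm v I J | I J. True}" for a b x
    using that
  proof (induction rule: complex_vector.span_induct_alt)
    case base show ?case by (simp add: complex_vector.span_zero)
  next
    case (step c x y)
    then obtain I J where "x = wordm v I J" by auto
    then have "v a b * x = wordm v (a # I) (b # J)" by simp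
    then have "v a b * x \<in> cspan {wordm v I J | I J. True}"
      by (simp only:) (intro complex_vector.span_base, blast)
    then show ?case using step
      by (simp add: distrib_left scaleC_mult_right complex_vector.span_add complex_vector.span_scale)
  qed
  then show ?case using Cons
    by (simp add: generator_value_v sum_distrib_right scaleC_mult_left complex_vector.span_sum complex_vector.span_scale)
qed

lemma words_span: "x \<in> cspan {wordm v I J | I J. True}"
proof -
  obtain p where p: "x = evaluate u p" using Ao by (metis Ao_algebra_def surjD)
  show ?thesis unfolding p evaluate_lin lin_def
    by (intro complex_vector.span_sum complex_vector.span_scale generator_words)
qed

text \<open>The value forced at the product of the word coefficient of \<open>I\<close>,
  \<open>J\<close> with the generators \<open>gs\<close> on a functional that takes the values
  \<open>P\<close> on words in \<open>v\<close>.\<close>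

primrec Lr :: "('n list \<Rightarrow> 'n list \<Rightarrow> complex) \<Rightarrow> 'n generator list \<Rightarrow> 'n list \<Rightarrow> 'n list \<Rightarrow> complex" where
  "Lr P [] = P"
| "Lr P (g # gs) = (\<lambda>I J. \<Oplus>a b. coef g a b * Lr P gs (I @ [a]) (J @ [b]))"

lemma Lr_snoc: "Lr P (gs @ [g]) = Lr (\<lambda>I J. \<Oplus>a b. coef g a b * P (I @ [a]) (J @ [b])) gs"
  by (induction gs) simp_all

lemma Lr_sum: "Lr (\<lambda>I J. \<Sum>k\<in>A. c k * P k I J) gs I J = (\<Sum>k\<in>A. c k * Lr (P k) gs I J)"
proof (induction gs arbitrary: I J)
  case (Cons g gs)
  have "Lr (\<lambda>I J. \<Sum>k\<in>A. c k * P k I J) (g # gs) I J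
     = (\<Oplus>a b. \<Sum>k\<in>A. coef g a b * (c k * Lr (P k) gs (I @ [a]) (J @ [b])))"
    by (simp add: Cons sum_distrib_left)
  also have "\<dots> = (\<Oplus>a. \<Sum>k\<in>A. \<Oplus>b. coef g a b * (c k * Lr (P k) gs (I @ [a]) (J @ [b])))"
    by (intro sum.cong refl sum.swap)
  also have "\<dots> = (\<Sum>k\<in>A. \<Oplus>a b. coef g a b * (c k * Lr (P k) gs (I @ [a]) (J @ [b])))"
    by (rule sum.swap)
  finally show ?case by (simp add: sum_distrib_left mult_ac)
qed simp

section \<open>Linear functionals with prescribed values on the words in \<open>v\<close>\<close>

context
  fixes P :: "'n list \<Rightarrow> 'n list \<Rightarrow> complex"
  assumes col: "\<And>I J I' J' a b. length I = length J \<Longrightarrow>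
      (\<Oplus>c d. q d c * P (I @ a # b # I') (J @ c # d # J')) = q b a * P (I @ I') (J @ J')"
    and row: "\<And>I J I' J' c d. length I = length J \<Longrightarrow>
      (\<Oplus>a b. cnj (q b a) * P (I @ a # b # I') (J @ c # d # J')) = cnj (q d c) * P (I @ I') (J @ J')"
begin

lemma Lr_col: "length I = length J \<Longrightarrow>
  (\<Oplus>c d. q d c * Lr P gs (I @ a # b # I') (J @ c # d # J')) = q b a * Lr P gs (I @ I') (J @ J')"
proof (induction gs arbitrary: I' J')
  case Nil then show ?case by (simp add: col)
next
  case (Cons g gs)
  have "(\<Oplus>c d. q d c * Lr P (g # gs) (I @ a # b # I') (J @ c # d # J'))
    = (\<Oplus>c d e f. coef g e f * (q d c * Lr P gs (I @ a # b # I' @ [e]) (J @ c # d # J' @ [f])))"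
    by (simp add: sum_distrib_left mult_ac)
  also have "\<dots> = (\<Oplus>e f c d. coef g e f * (q d c * Lr P gs (I @ a # b # I' @ [e]) (J @ c # d # J' @ [f])))"
    by (rule sum_swap4)
  also have "\<dots> = (\<Oplus>e f. coef g e f * (q b a * Lr P gs (I @ I' @ [e]) (J @ J' @ [f])))"
    using Cons by (simp flip: sum_distrib_left)
  finally show ?case by (simp add: sum_distrib_left mult_ac)
qed

lemma Lr_row: "length I = length J \<Longrightarrow>
  (\<Oplus>a b. cnj (q b a) * Lr P gs (I @ a # b # I') (J @ c # d # J')) = cnj (q d c) * Lr P gs (I @ I') (J @ J')"
proof (induction gs arbitrary: I' J')
  case Nil then show ?case by (simp add: row)
next
  case (Cons g gs)
  have "(\<Oplus>a b. cnj (q b a) * Lr P (g # gs) (I @ a # b # I') (J @ c # d # J'))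
    = (\<Oplus>a b e f. coef g e f * (cnj (q b a) * Lr P gs (I @ a # b # I' @ [e]) (J @ c # d # J' @ [f])))"
    by (simp add: sum_distrib_left mult_ac)
  also have "\<dots> = (\<Oplus>e f a b. coef g e f * (cnj (q b a) * Lr P gs (I @ a # b # I' @ [e]) (J @ c # d # J' @ [f])))"
    by (rule sum_swap4)
  also have "\<dots> = (\<Oplus>e f. coef g e f * (cnj (q d c) * Lr P gs (I @ I' @ [e]) (J @ J' @ [f])))"
    using Cons by (simp flip: sum_distrib_left)
  finally show ?case by (simp add: sum_distrib_left mult_ac)
qed

lemma sum4_product:
  "(\<Sum>a\<in>A. \<Sum>b\<in>B. (f a * g b) * (\<Sum>a'\<in>A'. \<Sum>b'\<in>B'. (f' a' * g' b') * (X a b a' b' :: complex)))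
   = (\<Sum>a\<in>A. \<Sum>a'\<in>A'. f a * f' a' * (\<Sum>b\<in>B. \<Sum>b'\<in>B'. g b * g' b' * X a b a' b'))"
proof -
  have "(\<Sum>a\<in>A. \<Sum>b\<in>B. (f a * g b) * (\<Sum>a'\<in>A'. \<Sum>b'\<in>B'. (f' a' * g' b') * X a b a' b'))
     = (\<Sum>a\<in>A. \<Sum>b\<in>B. \<Sum>a'\<in>A'. \<Sum>b'\<in>B'. f a * f' a' * (g b * g' b' * X a b a' b'))"
    by (simp add: sum_distrib_left mult_ac)
  also have "\<dots> = (\<Sum>a\<in>A. \<Sum>a'\<in>A'. \<Sum>b\<in>B. \<Sum>b'\<in>B'. f a * f' a' * (g b * g' b' * X a b a' b'))"
    by (intro sum.cong refl sum.swap)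
  finally show ?thesis by (simp add: sum_distrib_left)
qed

lemma Lr_two: "Lr P (g # g' # gs) I J
  = (\<Oplus>a b. coef g a b * (\<Oplus>a' b'. coef g' a' b' * Lr P gs (I @ a # a' # []) (J @ b # b' # [])))"
  by simp

lemma mat_entries:
  "(\<Oplus>k. mm q (mtr V) b' k * cnj (V k b)) = q b' b"
  "(\<Oplus>k. mm (mcnj V) (mcnj q) j k * q k a) = s * cnj (V j a)"
  "(\<Oplus>k. mm (mcnj V) (mcnj q) k a * V k b) = cnj (q b a)"
  "(\<Oplus>k. cnj (q b k) * mm q (mtr V) k i) = s * V i b"
  "(\<Oplus>k. V i k * cnj (V j k)) = (if i = j then 1 else 0)"
proof -
  let ?X = "mm (mcnj V) (mcnj q)" and ?Y = "mm q (mtr V)"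
  have "mm ?Y (mcnj V) b' b = q b' b" by (simp add: mm_assoc V')
  then show "(\<Oplus>k. ?Y b' k * cnj (V k b)) = q b' b"
    by (simp only: mm_app[of ?Y] m_app)
  have "mm ?X q j a = ms s (mcnj V) j a" by (simp add: mm_assoc qq')
  then show "(\<Oplus>k. ?X j k * q k a) = s * cnj (V j a)"
    by (simp only: mm_app[of ?X] m_app)
  have "mm (mtr ?X) V a b = mtr (mcnj q) a b" by (simp add: mm_assoc V)
  then show "(\<Oplus>k. ?X k a * V k b) = cnj (q b a)"
    by (simp only: mm_app[of "mtr ?X"] m_app)
  have "mm (mcnj q) ?Y b i = ms s (mtr V) b i" by (simp add: mm_cancel)
  then show "(\<Oplus>k. cnj (q b k) * ?Y k i) = s * V i b"
    by (simp only: mm_app[of "mcnj q" ?Y] m_app)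
  show "(\<Oplus>k. V i k * cnj (V j k)) = (if i = j then 1 else 0)"
    using fun_cong[OF fun_cong[OF V(2)], of i j] by (simp only: mm_app m_app)
qed

text \<open>The summation index \<open>k\<close> joins the two factors on the column side into the
  matrix \<open>q\<close>, which \<open>Lr_col\<close> moves to the row side; there the factors
  recombine to V times its adjoint.\<close>

lemma Lr_rel1:
  assumes "length I = length J"
  shows "(\<Oplus>k. Lr P (Gen i k # Adj j k # gs) I J) = (if i = j then 1 else 0) * Lr P gs I J"
proof -
  let ?X = "mm (mcnj V) (mcnj q)" and ?Y = "mm q (mtr V)"
  let ?L = "\<lambda>a b a' b'. Lr P gs (I @ a # a' # []) (J @ b # b' # [])"
  have "(\<Oplus>k. Lr P (Gen i k # Adj j k # gs) I J)
     = (\<Oplus>k a a'. V i a * (s * ?X j a') * (\<Oplus>b b'. cnj (V k b) * ?Y b' k * ?L a b a' b'))"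
    unfolding Lr_two coef_simps by (intro sum.cong refl sum4_product)
  also have "\<dots> = (\<Oplus>a a' k. V i a * (s * ?X j a') * (\<Oplus>b b'. cnj (V k b) * ?Y b' k * ?L a b a' b'))"
    by (subst sum.swap) (intro sum.cong refl sum.swap)
  also have "\<dots> = (\<Oplus>a a'. V i a * (s * ?X j a') * (\<Oplus>b b' k. cnj (V k b) * ?Y b' k * ?L a b a' b'))"
    unfolding sum_distrib_left[symmetric]
    by (intro sum.cong refl arg_cong2[where f = "(*)"] sum_swap3)
  also have "\<dots> = (\<Oplus>a a'. V i a * (s * ?X j a') * (\<Oplus>b b'. q b' b * ?L a b a' b'))"
    by (simp add: mat_entries(1)[symmetric] sum_distrib_right mult_ac)
  also have "\<dots> = (\<Oplus>a a'. V i a * (s * ?X j a') * (q a' a * Lr P gs I J))"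
    using Lr_col[OF assms, of gs _ _ "[]" "[]"] by simp
  also have "\<dots> = (\<Oplus>a. V i a * (s * (\<Oplus>a'. ?X j a' * q a' a))) * Lr P gs I J"
    by (simp add: sum_distrib_left sum_distrib_right mult_ac)
  also have "\<dots> = (\<Oplus>a. V i a * cnj (V j a)) * Lr P gs I J"
    unfolding mat_entries(2) using s(1) by (simp flip: mult.assoc)
  finally show ?thesis by (simp add: mat_entries(5))
qed

text \<open>Mirror image of the preceding relation: the summation joins the row indices, and
  \<open>Lr_row\<close> moves the resulting conjugate of \<open>q\<close> to the columns.\<close>

lemma Lr_rel2:
  assumes "length I = length J"
  shows "(\<Oplus>k. Lr P (Adj k i # Gen k j # gs) I J) = (if i = j then 1 else 0) * Lr P gs I J"
proof -
  let ?X = "mm (mcnj V) (mcnj q)" and ?Y = "mm q (mtr V)"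
  let ?L = "\<lambda>a b a' b'. Lr P gs (I @ a # a' # []) (J @ b # b' # [])"
  have "(\<Oplus>k. Lr P (Adj k i # Gen k j # gs) I J)
     = (\<Oplus>k a a'. (s * ?X k a) * V k a' * (\<Oplus>b b'. ?Y b i * cnj (V j b') * ?L a b a' b'))"
    unfolding Lr_two coef_simps by (intro sum.cong refl sum4_product)
  also have "\<dots> = (\<Oplus>a a' k. (s * ?X k a) * V k a' * (\<Oplus>b b'. ?Y b i * cnj (V j b') * ?L a b a' b'))"
    by (subst sum.swap) (intro sum.cong refl sum.swap)
  also have "\<dots> = (\<Oplus>a a'. s * (\<Oplus>k. ?X k a * V k a') * (\<Oplus>b b'. ?Y b i * cnj (V j b') * ?L a b a' b'))"
    by (simp only: sum_distrib_left[of s] sum_distrib_right[of _ UNIV "\<Oplus>b. _ b"] mult.assoc)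
  also have "\<dots> = (\<Oplus>a a' b b'. (s * (?Y b i * cnj (V j b'))) * (cnj (q a' a) * ?L a b a' b'))"
    unfolding mat_entries(3) by (simp add: sum_distrib_left mult_ac)
  also have "\<dots> = (\<Oplus>b b' a a'. (s * (?Y b i * cnj (V j b'))) * (cnj (q a' a) * ?L a b a' b'))"
    by (rule sum_swap4)
  also have "\<dots> = (\<Oplus>b b'. (s * (?Y b i * cnj (V j b'))) * (cnj (q b' b) * Lr P gs I J))"
    using Lr_row[OF assms, of gs "[]" _ _ "[]"] by (simp flip: sum_distrib_left)
  also have "\<dots> = (\<Oplus>b' b. (s * (?Y b i * cnj (V j b'))) * (cnj (q b' b) * Lr P gs I J))"
    by (rule sum.swap)
  also have "\<dots> = (\<Oplus>b'. cnj (V j b') * (s * (\<Oplus>b. cnj (q b' b) * ?Y b i))) * Lr P gs I J"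
    by (simp add: sum_distrib_left sum_distrib_right mult_ac)
  also have "\<dots> = (\<Oplus>b'. V i b' * cnj (V j b')) * Lr P gs I J"
    unfolding mat_entries(4) using s(1) by (simp add: mult.commute flip: mult.assoc)
  finally show ?thesis by (simp add: mat_entries(5))
qed

lemma coef_Gen_Adj: "coef (Gen i j) a b = (\<Oplus>k l. (Q $ i $ k * matrix_inv Q $ l $ j) * coef (Adj k l) a b)"
proof -
  let ?X = "mm (mcnj V) (mcnj q)" and ?Y = "mm q (mtr V)"
  have 1: "mm (\<lambda>i k. Q $ i $ k) ?X = ms (r * s) V"
    unfolding Q by (simp add: mm_assoc mm_cancel qq)
  have 2: "mm ?Y (\<lambda>i k. matrix_inv Q $ i $ k) = ms (s * s / r) (mcnj (mtr V))"
    unfolding Qinv by (simp add: mm_assoc mm_cancel)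
  have "(\<Oplus>k l. (Q $ i $ k * matrix_inv Q $ l $ j) * coef (Adj k l) a b)
      = s * (mm (\<lambda>i k. Q $ i $ k) ?X i a * mm ?Y (\<lambda>i k. matrix_inv Q $ i $ k) b j)"
    unfolding mm_def[of "\<lambda>i k. Q $ i $ k"] mm_def[of ?Y] sum_product by (simp add: sum_distrib_left mult_ac)
  also have "\<dots> = (s * s) * (s * s) * (V i a * cnj (V j b))"
    unfolding 1 2 using r by (simp add: ms_def mcnj_def mtr_def field_simps)
  finally show ?thesis by (simp add: s)
qed

lemma coef_Adj_Gen: "coef (Adj i j) a b = (\<Oplus>k l. cnj (Q $ i $ k * matrix_inv Q $ l $ j) * coef (Gen k l) a b)"
proof -
  let ?X = "mm (mcnj V) (mcnj q)" and ?Y = "mm q (mtr V)"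
  have 1: "mm (mcnj (\<lambda>i k. Q $ i $ k)) V = ms r ?X"
    unfolding Q by (simp add: mm_assoc V r)
  have 2: "mm (mcnj (mtr V)) (mcnj (\<lambda>i k. matrix_inv Q $ i $ k)) = ms (s / r) ?Y"
    unfolding Qinv by (simp add: mm_cancel r s)
  have "(\<Oplus>k l. cnj (Q $ i $ k * matrix_inv Q $ l $ j) * coef (Gen k l) a b)
      = mm (mcnj (\<lambda>i k. Q $ i $ k)) V i a * mm (mcnj (mtr V)) (mcnj (\<lambda>i k. matrix_inv Q $ i $ k)) b j"
    unfolding mm_def[of "mcnj (\<lambda>i k. Q $ i $ k)"] mm_def[of "mcnj (mtr V)"] sum_product
    by (simp add: mcnj_def mtr_def mult_ac)
  also have "\<dots> = coef (Adj i j) a b"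
    unfolding 1 2 using r by (simp add: ms_def)
  finally show ?thesis by simp
qed

lemma Lr_prefix:
  assumes "\<And>I J. length I = length J \<Longrightarrow> lin (\<lambda>w. Lr P (letters w @ b) I J) p = 0"
  shows "length I = length J \<Longrightarrow> lin (\<lambda>w. Lr P (a @ letters w @ b) I J) p = 0"
proof (induction a arbitrary: I J)
  case Nil then show ?case using assms by simp
next
  case (Cons g a)
  have "lin (\<lambda>w. Lr P ((g # a) @ letters w @ b) I J) p
     = lin (\<lambda>w. \<Oplus>k. coef g (fst k) (snd k) *\<^sub>C Lr P (a @ letters w @ b) (I @ [fst k]) (J @ [snd k])) p"
    by (simp add: sum.cartesian_product case_prod_unfold scaleC_complex_def flip: UNIV_Times_UNIV)
  then show ?case using Cons by (simp add: lin_fun_sum)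
qed

lemma Lr_relator:
  assumes p: "p \<in> Ao_relators Q" and IJ: "length I = length J"
  shows "lin (\<lambda>w. Lr P (letters w @ b) I J) p = 0" "lin (\<lambda>w. Lr P (letters w @ b) I J) (free_star p) = 0"
proof -
  have sw3: "(\<Oplus>k l. c k l * Lr P (g k l # b) I J)
      = (\<Oplus>x y. (\<Oplus>k l. c k l * coef (g k l) x y) * Lr P b (I @ [x]) (J @ [y]))" for c g
  proof -
    have "(\<Oplus>k l. c k l * Lr P (g k l # b) I J)
      = (\<Oplus>k l x y. c k l * coef (g k l) x y * Lr P b (I @ [x]) (J @ [y]))"
      by (simp add: sum_distrib_left mult.assoc)
    also have "\<dots> = (\<Oplus>x y k l. c k l * coef (g k l) x y * Lr P b (I @ [x]) (J @ [y]))"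
      by (rule sum_swap4)
    finally show ?thesis by (simp add: sum_distrib_right)
  qed
  from p consider (1) i j where "p = (\<Oplus>k. free_gen i k * free_star (free_gen j k)) - (if i = j then 1 else 0)"
    | (2) i j where "p = (\<Oplus>k. free_star (free_gen k i) * free_gen k j) - (if i = j then 1 else 0)"
    | (3) i j where "p = free_gen i j - (\<Oplus>k l.
        free_const (Q $ i $ k) * free_star (free_gen k l) * free_const (matrix_inv Q $ l $ j))"
    unfolding Ao_relators_def by blast
  then have "lin (\<lambda>w. Lr P (letters w @ b) I J) p = 0 \<and> lin (\<lambda>w. Lr P (letters w @ b) I J) (free_star p) = 0"
  proof cases
    case 1
    show ?thesis
      unfolding 1 Ao_relators_explicit free_star_simps free_star_sum lin_diff lin_sum lin_single
      using Lr_rel1[OF IJ, of i j b] Lr_rel1[OF IJ, of j i b]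
      by (auto simp: adj_monomial_def scaleC_complex_def simp del: Lr.simps(2))
  next
    case 2
    show ?thesis
      unfolding 2 Ao_relators_explicit free_star_simps free_star_sum lin_diff lin_sum lin_single
      using Lr_rel2[OF IJ, of i j b] Lr_rel2[OF IJ, of j i b]
      by (auto simp: adj_monomial_def scaleC_complex_def simp del: Lr.simps(2))
  next
    case 3
    have e1: "(\<Oplus>k l. (Q $ i $ k * matrix_inv Q $ l $ j) * Lr P (Adj k l # b) I J) = Lr P (Gen i j # b) I J"
      unfolding sw3 coef_Gen_Adj[symmetric] by simp
    have e2: "(\<Oplus>k l. cnj (Q $ i $ k * matrix_inv Q $ l $ j) * Lr P (Gen k l # b) I J) = Lr P (Adj i j # b) I J"
      unfolding sw3 coef_Adj_Gen[symmetric] by simp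
    show ?thesis
      unfolding 3 Ao_relators_explicit free_star_simps free_star_sum lin_diff lin_sum lin_single
      using e1 e2 by (simp add: adj_monomial_def scaleC_complex_def del: coef_simps Lr.simps(2))
  qed
  then show "lin (\<lambda>w. Lr P (letters w @ b) I J) p = 0" "lin (\<lambda>w. Lr P (letters w @ b) I J) (free_star p) = 0" by auto
qed

text \<open>\<open>Lr\<close> defines a functional on the free algebra that vanishes on the relators
  and their adjoints in every position, so it descends to the quotient. Its values on words in
  \<open>v\<close> are recovered by expanding each letter in the generators and using that
  \<open>V\<close> is unitary.\<close>

lemma functional_exists:
  obtains \<phi> :: "'a \<Rightarrow> complex" where "clinear \<phi>" "\<And>I J. length I = length J \<Longrightarrow> \<phi> (wordm v I J) = P I J"
proof -
  define F where "F w = Lr P (letters w) [] []" for w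
  define \<phi> where "\<phi> x = lin F (SOME p. evaluate u p = x)" for x
  have null: "lin F p = 0" if "p \<in> star_ideal (Ao_relators Q)" for p
  proof (rule star_ideal_null[OF _ _ that])
    fix p a b assume p: "p \<in> Ao_relators Q"
    show "lin (\<lambda>w. F (a + w + b)) p = 0" "lin (\<lambda>w. F (a + w + b)) (free_star p) = 0"
      using Lr_prefix[of "letters b" p "[]" "[]" "letters a"] Lr_prefix[of "letters b" "free_star p" "[]" "[]" "letters a"]
        Lr_relator[OF p] by (simp_all add: F_def plus_monomial_def)
  qed
  have \<phi>: "\<phi> (evaluate u p) = lin F p" for p
  proof -
    have "evaluate u (SOME q. evaluate u q = evaluate u p) = evaluate u p" by (rule someI_ex) blast
    then have "evaluate u ((SOME q. evaluate u q = evaluate u p) - p) = 0" by (simp add: evaluate_lin lin_diff)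
    then have "lin F ((SOME q. evaluate u q = evaluate u p) - p) = 0"
      using Ao null by (auto simp: Ao_algebra_def)
    then show ?thesis by (simp add: \<phi>_def lin_diff)
  qed
  have surj: "\<exists>p. x = evaluate u p" for x using Ao by (auto simp: Ao_algebra_def surj_def)
  have add: "\<phi> (x + y) = \<phi> x + \<phi> y" for x y
  proof -
    obtain p q where "x = evaluate u p" "y = evaluate u q" using surj by metis
    moreover have "evaluate u (p + q) = evaluate u p + evaluate u q" by (simp add: evaluate_lin lin_add)
    ultimately show ?thesis using \<phi>[of "p + q"] \<phi>[of p] \<phi>[of q] by (simp add: lin_add)
  qed
  have scale: "\<phi> (c *\<^sub>C x) = c *\<^sub>C \<phi> x" for c x
  proof -
    obtain p where p: "x = evaluate u p" using surj by metis
    have "lin f (Poly_Mapping.single 0 c * p) = c *\<^sub>C lin f p" for f :: "'n monomial \<Rightarrow> 'v::complex_vector"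
      by (simp add: lin_single_mult)
    then have "evaluate u (Poly_Mapping.single 0 c * p) = c *\<^sub>C x" "lin F (Poly_Mapping.single 0 c * p) = c *\<^sub>C lin F p"
      by (simp_all add: p evaluate_lin lin_single_mult)
    then show ?thesis using \<phi>[of "Poly_Mapping.single 0 c * p"] \<phi>[of p] by (simp add: p)
  qed
  have sum: "\<phi> (\<Sum>i\<in>A. c i *\<^sub>C f i) = (\<Sum>i\<in>A. c i * \<phi> (f i))" for A c and f :: "'n \<Rightarrow> 'a"
  proof -
    have "\<phi> 0 = 0" using scale[of 0 0] by simp
    then show ?thesis by (induction A rule: infinite_finite_induct) (simp_all add: add scale scaleC_complex_def)
  qed
  have words: "length K = length M \<Longrightarrow>
     \<phi> (prod_list (map (generator_value u) ws) * wordm v K M) = Lr (\<lambda>I J. P (I @ K) (J @ M)) ws [] []" for ws K M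
  proof (induction K M arbitrary: ws rule: list_induct2)
    case Nil
    have "prod_list (map (generator_value u) ws) = evaluate u (Poly_Mapping.single (Monomial ws) 1)"
      by (simp add: evaluate_lin lin_single)
    then show ?case by (simp add: \<phi> lin_single F_def)
  next
    case (Cons a K b M)
    let ?P = "\<lambda>i j I J. \<Oplus>c d. coef (Gen i j) c d * P (I @ c # K) (J @ d # M)"
    have "prod_list (map (generator_value u) ws) * wordm v (a # K) (b # M)
      = (\<Oplus>i j. (cnj (V i a) * V j b) *\<^sub>C (prod_list (map (generator_value u) (ws @ [Gen i j])) * wordm v K M))"
      by (simp add: v_def sw_def mcnj_def mtr_def sum_distrib_left sum_distrib_right scaleC_mult_left scaleC_mult_right mult.assoc)
    then have "\<phi> (prod_list (map (generator_value u) ws) * wordm v (a # K) (b # M))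
      = (\<Oplus>i j. (cnj (V i a) * V j b) * Lr (?P i j) ws [] [])"
      by (simp add: sum[of "\<lambda>_. 1", simplified] scale Cons scaleC_complex_def Lr_snoc del: map_append coef_simps)
    also have "\<dots> = Lr (\<lambda>I J. \<Oplus>i j. (cnj (V i a) * V j b) * ?P i j I J) ws [] []"
      using Lr_sum[of "\<lambda>k. cnj (V (fst k) a) * V (snd k) b" "\<lambda>k. ?P (fst k) (snd k)" UNIV ws "[]" "[]"]
      by (simp add: sum.cartesian_product case_prod_unfold flip: UNIV_Times_UNIV)
    also have "(\<lambda>I J. \<Oplus>i j. (cnj (V i a) * V j b) * ?P i j I J) = (\<lambda>I J. P (I @ a # K) (J @ b # M))"
    proof (intro ext)
      fix I J
      let ?p = "\<lambda>c d. P (I @ c # K) (J @ d # M)"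
      have VV: "mm (mcnj (mtr V)) V c d = (if c = d then 1 else 0)" for c d by (simp add: V) (simp add: mI_def)
      have "(\<Oplus>i j. (cnj (V i a) * V j b) * ?P i j I J)
        = (\<Oplus>i j c d. (cnj (V i a) * V i c) * (cnj (V j d) * V j b) * ?p c d)"
        by (simp add: sum_distrib_left mult_ac)
      also have "\<dots> = (\<Oplus>c d i j. (cnj (V i a) * V i c) * (cnj (V j d) * V j b) * ?p c d)"
        by (rule sum_swap4)
      also have "\<dots> = (\<Oplus>c d. mm (mcnj (mtr V)) V a c * mm (mcnj (mtr V)) V d b * ?p c d)"
        by (simp add: mm_def mcnj_def mtr_def sum_product flip: sum_distrib_right)
      also have "\<dots> = (\<Oplus>c. (if c = a then 1 else 0) * (\<Oplus>d. (if d = b then 1 else 0) * ?p c d))"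
        unfolding VV by (simp add: sum_distrib_left mult.assoc eq_commute)
      also have "\<dots> = ?p a b" unfolding sum_if_mult by simp
      finally show "(\<Oplus>i j. (cnj (V i a) * V j b) * ?P i j I J) = ?p a b" .
    qed
    finally show ?case .
  qed
  have "\<phi> (wordm v I J) = P I J" if "length I = length J" for I J
    using words[OF that, of "[]"] by simp
  moreover have "clinear \<phi>" by (simp add: clinear_iff add scale)
  ultimately show ?thesis using that by blast
qed

end

end

subsection \<open>Diagonalisation\<close>

definition cip :: "complex^'n \<Rightarrow> complex^'n \<Rightarrow> complex" where
  "cip x y = (\<Oplus>i. cnj (x $ i) * y $ i)"

lemma cip_simps: "cip x (y + z) = cip x y + cip x z" "cip (y + z) x = cip y x + cip z x"
  "cip x (c *s y) = c * cip x y" "cip (c *s x) y = cnj c * cip x y"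
  "cip x (y - z) = cip x y - cip x z" "cip (y - z) x = cip y x - cip z x"
  "cip x (r *\<^sub>R y) = complex_of_real r * cip x y" "cip (r *\<^sub>R x) y = complex_of_real r * cip x y"
  by (simp_all add: cip_def distrib_left distrib_right left_diff_distrib right_diff_distrib sum.distrib sum_subtractf sum_distrib_left
      scaleR_conv_of_real[where 'a = complex] mult_ac)

lemma cip_commute: "cip x y = cnj (cip y x)"
  by (simp add: cip_def mult.commute)

lemma inner_cip: "inner x y = Re (cip x y)"
  by (simp add: inner_vec_def cip_def inner_complex_def)

lemma cip_self: "cip x x = complex_of_real ((norm x)\<^sup>2)"
proof -
  have "cnj (cip x x) = cip x x" by (simp flip: cip_commute)
  then have "Im (cip x x) = 0" by (metis cnj.simps(2) neg_equal_zero)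
  then show ?thesis by (simp add: complex_eq_iff power2_norm_eq_inner inner_cip)
qed

lemma continuous_cip [continuous_intros]:
  "continuous_on S f \<Longrightarrow> continuous_on S g \<Longrightarrow> continuous_on S (\<lambda>x. cip (f x) (g x))"
  unfolding cip_def by (intro continuous_intros) auto

context
  fixes T :: "complex^'n \<Rightarrow> complex^'n"
  assumes T_add: "T (x + y) = T x + T y" and T_scale: "T (c *s x) = c *s T x"
    and T_herm: "cip x (T y) = cip (T x) y" and T_cont: "continuous_on UNIV T"
begin

text \<open>A maximum of the quadratic form on the unit sphere of \<open>M\<close> is an
  eigenvector: the defect \<open>w\<close> of the eigenvalue equation lies in \<open>M\<close>, and
  moving along \<open>w\<close> would otherwise violate maximality to first order.\<close>

lemma eigenvector_exists:
  assumes M: "\<And>x y. x \<in> M \<Longrightarrow> y \<in> M \<Longrightarrow> x + y \<in> M" "\<And>c x. x \<in> M \<Longrightarrow> c *s x \<in> M" "closed M"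
    and inv: "\<And>x. x \<in> M \<Longrightarrow> T x \<in> M" and x0: "x0 \<in> M" "x0 \<noteq> 0"
  obtains x and \<mu> :: real where "x \<in> M" "norm x = 1" "T x = \<mu> *\<^sub>R x"
proof -
  have Ms: "r *\<^sub>R x \<in> M" if "x \<in> M" for r x
  proof -
    have "r *\<^sub>R x = complex_of_real r *s x" by (simp add: vec_eq_iff scaleR_conv_of_real[where 'a = complex])
    then show ?thesis using M(2)[OF that] by simp
  qed
  have T_scaleR: "T (r *\<^sub>R x) = r *\<^sub>R T x" for r x
  proof -
    have "r *\<^sub>R x = complex_of_real r *s x" for x :: "complex^'n" by (simp add: vec_eq_iff scaleR_conv_of_real[where 'a = complex])
    then show ?thesis by (simp add: T_scale)
  qed
  let ?S = "sphere 0 1 \<inter> M"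
  define f where "f x = Re (cip x (T x))" for x
  have "compact ?S" using M(3) by (intro compact_Int_closed) auto
  moreover have "?S \<noteq> {}"
  proof -
    have "(1 / norm x0) *\<^sub>R x0 \<in> ?S" using x0 Ms by simp
    then show ?thesis by blast
  qed
  moreover have "continuous_on ?S f"
    unfolding f_def by (intro continuous_intros continuous_on_subset[OF T_cont]) auto
  ultimately obtain x where x: "x \<in> ?S" "\<And>y. y \<in> ?S \<Longrightarrow> f y \<le> f x"
    using continuous_attains_sup by metis
  define \<mu> where "\<mu> = f x"
  have f_hom: "f (r *\<^sub>R y) = r\<^sup>2 * f y" for r y by (simp add: f_def T_scaleR cip_simps power2_eq_square)
  have bound: "f y \<le> \<mu> * (norm y)\<^sup>2" if "y \<in> M" for y
  proof (cases "y = 0")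
    case True
    then show ?thesis by (simp add: f_def cip_def)
  next
    case False
    then have "f ((1 / norm y) *\<^sub>R y) \<le> \<mu>" unfolding \<mu>_def using that Ms by (intro x(2)) simp
    then show ?thesis using False unfolding f_hom by (simp add: power_divide pos_divide_le_eq)
  qed
  define w where "w = \<mu> *\<^sub>R x - T x"
  have "w \<in> M"
  proof -
    have "w = \<mu> *\<^sub>R x + (-1) *\<^sub>R T x" by (simp add: w_def)
    then show ?thesis using x(1) Ms M(1) inv by (metis IntD2)
  qed
  define C where "C = \<mu> * (norm w)\<^sup>2 - f w"
  have quad: "0 \<le> 2 * \<tau> * (norm w)\<^sup>2 + \<tau>\<^sup>2 * C" for \<tau> :: real
  proof -
    have "x + \<tau> *\<^sub>R w \<in> M" using x(1) Ms M(1) \<open>w \<in> M\<close> by auto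
    then have "f (x + \<tau> *\<^sub>R w) \<le> \<mu> * (norm (x + \<tau> *\<^sub>R w))\<^sup>2" by (rule bound)
    moreover have "f (x + \<tau> *\<^sub>R w) = f x + 2 * \<tau> * Re (cip w (T x)) + \<tau>\<^sup>2 * f w"
    proof -
      have "Re (cip x (T w)) = Re (cip w (T x))" using T_herm[of x w] cip_commute[of "T x" w] by simp
      then show ?thesis by (simp add: f_def T_add T_scaleR cip_simps power2_eq_square algebra_simps)
    qed
    moreover have "(norm (x + \<tau> *\<^sub>R w))\<^sup>2 = (norm x)\<^sup>2 + 2 * \<tau> * Re (cip w x) + \<tau>\<^sup>2 * (norm w)\<^sup>2"
    proof -
      have "inner x w = Re (cip w x)" by (simp add: inner_cip cip_commute[of x w])
      moreover have "(norm (x + \<tau> *\<^sub>R w))\<^sup>2 = (norm x)\<^sup>2 + 2 * \<tau> * inner x w + \<tau>\<^sup>2 * (norm w)\<^sup>2"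
        unfolding power2_norm_eq_inner
        by (simp only: inner_simps inner_commute[of w x]) (simp add: power2_eq_square algebra_simps)
      ultimately show ?thesis by simp
    qed
    moreover have "norm x = 1" using x(1) by simp
    moreover have "2 * \<tau> * (\<mu> * Re (cip w x) - Re (cip w (T x))) = 2 * \<tau> * (norm w)\<^sup>2"
    proof -
      have "cip w w = \<mu> * cip w x - cip w (T x)" by (simp add: w_def[symmetric] cip_simps(5,7)[symmetric])
      then have "Re (cip w w) = \<mu> * Re (cip w x) - Re (cip w (T x))" by simp
      then show ?thesis by (simp add: cip_self)
    qed
    ultimately show ?thesis by (simp add: \<mu>_def[symmetric] C_def algebra_simps)
  qed
  have "w = 0"
  proof (rule ccontr)
    assume "w \<noteq> 0"
    define a where "a = (norm w)\<^sup>2"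
    have a: "a > 0" using \<open>w \<noteq> 0\<close> by (simp add: a_def)
    \<comment> \<open>At the argument \<open>- a / k\<close> the linear term of \<open>quad\<close>
      dominates, because \<open>C\<close> is at most \<open>k\<close>.\<close>
    define k where "k = \<bar>C\<bar> + 1"
    have k: "k > 0" "C \<le> k" by (auto simp: k_def)
    have "0 \<le> 2 * (- a / k) * a + (- a / k)\<^sup>2 * C" unfolding a_def by (rule quad)
    also have "\<dots> = (a\<^sup>2 / k\<^sup>2) * (C - 2 * k)" using k by (simp add: field_simps power2_eq_square)
    also have "\<dots> < 0" using a k by (intro mult_pos_neg) auto
    finally show False by simp
  qed
  then show ?thesis using that[of x \<mu>] x(1) by (simp add: w_def)
qed

lemma orthonormal_eigenvectors:
  "k \<le> CARD('n) \<Longrightarrow> \<exists>e \<mu>. (\<forall>i<k. \<forall>j<k. cip (e i) (e j) = (if i = j then 1 else 0)) \<and> (\<forall>i<k. T (e i) = (\<mu> i :: real) *\<^sub>R e i)"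
proof (induction k)
  case 0 then show ?case by simp
next
  case (Suc k)
  then obtain e and \<mu> :: "nat \<Rightarrow> real" where e: "\<And>i j. i < k \<Longrightarrow> j < k \<Longrightarrow> cip (e i) (e j) = (if i = j then 1 else 0)"
    "\<And>i. i < k \<Longrightarrow> T (e i) = \<mu> i *\<^sub>R e i" by fastforce
  \<comment> \<open>Orthogonality is real here. Adding the multiples by the imaginary unit makes it
    complex, and these 2k vectors cannot span a real space of dimension 2n.\<close>
  let ?S = "e ` {..<k} \<union> (\<lambda>i. \<i> *s e i) ` {..<k}"
  have "dim ?S \<le> card ?S" by (rule dim_le_card') auto
  also have "\<dots> \<le> k + k"
    by (rule order_trans[OF card_Un_le]) (use card_image_le[of "{..<k}"] in \<open>auto intro!: add_mono\<close>)
  also have "\<dots> < DIM(complex^'n)" using Suc.prems by simp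
  finally obtain x0 where x0: "x0 \<noteq> 0" "\<And>y. y \<in> span ?S \<Longrightarrow> orthogonal x0 y"
    using orthogonal_to_subspace_exists by blast
  define M where "M = {x. \<forall>i<k. cip (e i) x = 0}"
  have "x0 \<in> M"
    unfolding M_def
  proof (intro CollectI allI impI)
    fix i assume i: "i < k"
    have "orthogonal x0 (e i)" "orthogonal x0 (\<i> *s e i)"
      using i by (auto intro!: x0(2) span_base)
    then have "Re (cip x0 (e i)) = 0" "Im (cip x0 (e i)) = 0"
      by (simp_all add: orthogonal_def inner_cip cip_simps)
    then have "cip x0 (e i) = 0" by (simp add: complex_eq_iff)
    then show "cip (e i) x0 = 0" by (simp add: cip_commute[of "e i"])
  qed
  have Mcl: "closed M"
  proof -
    have "M = (\<Inter>i\<in>{..<k}. {x. cip (e i) x = 0})" by (auto simp: M_def)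
    then show ?thesis by (auto intro!: closed_INT closed_Collect_eq continuous_intros)
  qed
  have TM: "T x \<in> M" if "x \<in> M" for x
    unfolding M_def
  proof (intro CollectI allI impI)
    fix i assume "i < k"
    then show "cip (e i) (T x) = 0" using that e(2) by (simp add: T_herm cip_simps M_def)
  qed
  obtain x \<nu> where x: "x \<in> M" "norm x = 1" "T x = (\<nu> :: real) *\<^sub>R x"
    by (rule eigenvector_exists[OF _ _ Mcl TM \<open>x0 \<in> M\<close> x0(1)]) (auto simp: M_def cip_simps)
  have 1: "cip x (e i) = 0" "cip (e i) x = 0" if "i < k" for i
    using x(1) that cip_commute[of x "e i"] by (auto simp: M_def)
  have 2: "cip x x = 1" using x(2) by (simp add: cip_self)
  show ?case
    by (intro exI[of _ "e(k := x)"] exI[of _ "\<mu>(k := \<nu>)"])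
      (auto simp: less_Suc_eq e 1 2 x(3))
qed

end

lemma spectral_theorem:
  fixes H :: "'n::finite \<Rightarrow> 'n \<Rightarrow> complex"
  assumes H: "mcnj (mtr H) = H"
  obtains V :: "'n \<Rightarrow> 'n \<Rightarrow> complex" and \<mu> :: "'n \<Rightarrow> real" where "mm (mcnj (mtr V)) V = mI" "mm V (mcnj (mtr V)) = mI"
    "\<And>i j. mm H V i j = \<mu> j * V i j"
proof -
  define T :: "complex^'n \<Rightarrow> complex^'n" where "T x = (\<chi> i. \<Oplus>j. H i j * x $ j)" for x
  have herm: "cip x (T y) = cip (T x) y" for x y
  proof -
    have "cip x (T y) = (\<Oplus>j. (\<Oplus>i. cnj (x $ i) * H i j) * y $ j)"
      unfolding cip_def T_def by (simp add: sum_mult_assoc)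
    also have "\<dots> = cip (T x) y"
    proof -
      have "cnj (H i j) = H j i" for i j
        using fun_cong[OF fun_cong[OF H], of j i] by (simp add: m_app)
      then show ?thesis by (simp add: cip_def T_def mult.commute)
    qed
    finally show ?thesis .
  qed
  have "\<exists>e \<mu>. (\<forall>i<CARD('n). \<forall>j<CARD('n). cip (e i) (e j) = (if i = j then 1 else 0)) \<and> (\<forall>i<CARD('n). T (e i) = (\<mu> i :: real) *\<^sub>R e i)"
  proof (rule orthonormal_eigenvectors)
    show "cip x (T y) = cip (T x) y" for x y by (rule herm)
    show "continuous_on UNIV T" unfolding T_def by (intro continuous_intros)
  qed (simp_all add: T_def vec_eq_iff distrib_left sum.distrib sum_distrib_left mult_ac)
  then obtain e and \<mu> :: "nat \<Rightarrow> real" where e: "\<And>i j. i < CARD('n) \<Longrightarrow> j < CARD('n) \<Longrightarrow> cip (e i) (e j) = (if i = j then 1 else 0)"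
    "\<And>i. i < CARD('n) \<Longrightarrow> T (e i) = \<mu> i *\<^sub>R e i" by blast
  obtain b :: "'n \<Rightarrow> nat" where b: "bij_betw b UNIV {..<CARD('n)}"
    using ex_bij_betw_finite_nat[of "UNIV :: 'n set"] by (auto simp: atLeast0LessThan)
  then have bl: "b j < CARD('n)" for j by (auto simp: bij_betw_def)
  have binj: "b i = b j \<longleftrightarrow> i = j" for i j using b by (auto simp: bij_betw_def inj_on_def)
  define V where "V i j = e (b j) $ i" for i j
  have 1: "mm (mcnj (mtr V)) V = mI"
  proof (intro ext)
    fix i j
    show "mm (mcnj (mtr V)) V i j = mI i j"
      using e(1)[OF bl bl, of i j] by (simp add: mm_app m_app V_def cip_def binj)
  qed
  have 2: "mm V (mcnj (mtr V)) = mI"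
  proof -
    let ?A = "(\<chi> i j. V i j) :: complex^'n^'n" and ?B = "(\<chi> i j. cnj (V j i)) :: complex^'n^'n"
    have "?B ** ?A = mat 1"
      using 1 by (simp add: matrix_matrix_mult_def mat_def vec_eq_iff fun_eq_iff mm_def mcnj_def mtr_def mI_def)
    then have "?A ** ?B = mat 1" by (simp add: matrix_left_right_inverse)
    then show ?thesis
      by (simp add: matrix_matrix_mult_def mat_def vec_eq_iff fun_eq_iff mm_def mcnj_def mtr_def mI_def)
  qed
  have "mm H V i j = \<mu> (b j) * V i j" for i j
  proof -
    have "T (e (b j)) $ i = (\<mu> (b j) *\<^sub>R e (b j)) $ i" using e(2)[OF bl] by simp
    then show ?thesis by (simp add: T_def mm_app V_def scaleR_conv_of_real[where 'a = complex])
  qed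
  then show ?thesis using that[of V "\<lambda>j. \<mu> (b j)"] 1 2 by blast
qed

text \<open>After scaling, Q times its conjugate is a sign \<open>s\<close>, and \<open>V\<close> is
  the unitary diagonalising the positive matrix q1 q1^*. Since the \<open>\<mu> i\<close> and their
  inverses have the same sum, twice this sum is the sum of \<open>\<mu> i + 1 / \<mu> i\<close>,
  hence at least 2n. Equality forces every \<open>\<mu> i\<close> to be 1 and Q^*Q to be scalar; so
  the sum exceeds 2 except in the excluded case.\<close>

lemma ao_diagonal_form:
  fixes Q :: "complex^'n::finite^'n"
  assumes n: "2 \<le> CARD('n)" and inv: "invertible Q" and QQ: "\<exists>c. Q ** map_matrix cnj Q = mat c"
    and n2: "\<not> (CARD('n) = 2 \<and> (\<exists>r::real. transpose (map_matrix cnj Q) ** Q = mat (complex_of_real r)))"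
  obtains V q :: "'n \<Rightarrow> 'n \<Rightarrow> complex" and r s :: complex and \<mu> :: "'n \<Rightarrow> real"
  where "mm (mcnj (mtr V)) V = mI" "mm V (mcnj (mtr V)) = mI"
    "r \<noteq> 0" "cnj r = r" "s * s = 1" "cnj s = s" "mm q (mcnj q) = ms s mI"
    "(\<lambda>i k. Q $ i $ k) = ms r (mm V (mm q (mtr V)))"
    "(\<lambda>i k. matrix_inv Q $ i $ k) = ms (s / r) (mm (mcnj V) (mm (mcnj q) (mcnj (mtr V))))"
    "\<And>i. \<mu> i > 0" "\<And>i j. q i j = s * \<mu> i * q j i"
    "\<And>i j. (\<Oplus>k. q i k * cnj (q j k)) = (if i = j then complex_of_real (\<mu> i) else 0)"
    "(\<Oplus>i. \<mu> i) > 2" "(\<Oplus>i. 1 / \<mu> i) = (\<Oplus>i. \<mu> i)"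
proof -
  define q0 where "q0 = (\<lambda>i k. Q $ i $ k)"
  obtain c where "Q ** map_matrix cnj Q = mat c" using QQ by blast
  then have q0: "mm q0 (mcnj q0) = ms c mI"
    by (simp add: matrix_matrix_mult_def mat_def vec_eq_iff fun_eq_iff mm_def mcnj_def mI_def ms_def q0_def if_distrib cong: if_cong)
  define p0 where "p0 = (\<lambda>i k. matrix_inv Q $ i $ k)"
  have qp: "mm q0 p0 = mI" "mm p0 q0 = mI"
    using someI_ex[OF inv[unfolded invertible_def]] unfolding matrix_inv_def[symmetric]
    by (simp_all add: matrix_matrix_mult_def mat_def vec_eq_iff fun_eq_iff mm_def mI_def q0_def p0_def)
  have q0': "mcnj q0 = ms c p0"
  proof -
    have "mcnj q0 = mm (mm p0 q0) (mcnj q0)" by (simp add: qp)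
    then show ?thesis by (simp add: mm_assoc q0)
  qed
  have c0: "c \<noteq> 0"
  proof
    assume "c = 0"
    then have "mcnj q0 = (\<lambda>_ _. 0)" by (simp add: q0' ms_def)
    then have "q0 = (\<lambda>_ _. 0)" by (simp add: mcnj_def fun_eq_iff)
    then have "mI = ((\<lambda>_ _. 0) :: 'n \<Rightarrow> 'n \<Rightarrow> complex)" using qp(1) by (simp add: mm_def)
    then have "\<forall>i::'n. mI i i = (0::complex)" by (auto simp: fun_eq_iff)
    then show False by (simp add: mI_def)
  qed
  \<comment> \<open>The conjugate of \<open>q0\<close> is a multiple of its inverse, so the two
    commute and their product equals its own conjugate.\<close>
  have creal: "cnj c = c"
  proof -
    have "ms c mI = mm (mcnj q0) q0" by (simp add: q0' qp)
    also have "\<dots> = mcnj (mm q0 (mcnj q0))" by simp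
    also have "\<dots> = ms (cnj c) mI" by (simp add: q0)
    finally have "ms c mI i i = ms (cnj c) mI i i" for i :: 'n by simp
    then show ?thesis by (simp add: m_app)
  qed
  define r where "r = complex_of_real (sqrt (cmod c))"
  define s where "s = c / cmod c"
  have r: "r \<noteq> 0" "cnj r = r" and rr: "r * r = cmod c" using c0 by (auto simp: r_def simp flip: of_real_mult)
  have s: "s * s = 1" "cnj s = s"
  proof -
    show "cnj s = s" by (simp add: s_def creal)
    have "c * c = complex_of_real ((cmod c)\<^sup>2)" using complex_norm_square[of c] by (simp add: creal)
    then show "s * s = 1" using c0 by (simp add: s_def power2_eq_square)
  qed
  define q1 where "q1 = ms (1 / r) q0"
  have q01: "q0 = ms r q1" using r by (simp add: q1_def)
  have q1: "mm q1 (mcnj q1) = ms s mI"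
    using r rr by (simp add: q1_def q0 s_def)
  define H where "H = mm q1 (mcnj (mtr q1))"
  obtain V :: "'n \<Rightarrow> 'n \<Rightarrow> complex" and \<mu> :: "'n \<Rightarrow> real" where V: "mm (mcnj (mtr V)) V = mI" "mm V (mcnj (mtr V)) = mI"
    and HV: "\<And>i j. mm H V i j = \<mu> j * V i j"
    using spectral_theorem[of H] by (simp add: H_def) blast
  have V': "mm (mtr V) (mcnj V) = mI" "mm (mcnj V) (mtr V) = mI"
    using arg_cong[OF V(1), of mcnj] arg_cong[OF V(2), of mcnj] by simp_all
  have can: "mm (mcnj (mtr V)) (mm V A) = A" "mm V (mm (mcnj (mtr V)) A) = A"
    "mm (mtr V) (mm (mcnj V) A) = A" "mm (mcnj V) (mm (mtr V) A) = A" for A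
    by (simp_all add: V V' flip: mm_assoc)
  define q where "q = mm (mcnj (mtr V)) (mm q1 (mcnj V))"
  have q1': "mm q1 (mm (mcnj q1) A) = ms s A" for A by (simp add: q1 flip: mm_assoc)
  have qq: "mm q (mcnj q) = ms s mI"
    by (simp add: q_def mm_assoc can q1' V)
  have qd: "mm q (mcnj (mtr q)) i j = (if i = j then complex_of_real (\<mu> i) else 0)" for i j
  proof -
    have "mm q (mcnj (mtr q)) i j = mm (mcnj (mtr V)) (mm H V) i j"
      by (simp add: q_def H_def mm_assoc can)
    also have "mm H V = (\<lambda>i j. \<mu> j * V i j)" by (simp add: fun_eq_iff HV)
    also have "mm (mcnj (mtr V)) (\<lambda>i j. \<mu> j * V i j) i j = \<mu> j * mm (mcnj (mtr V)) V i j"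
      by (simp add: mm_app sum_distrib_left mult_ac)
    also have "mm (mcnj (mtr V)) V i j = (if i = j then 1 else 0)" by (simp only: V m_app)
    finally show ?thesis by (cases "i = j") simp_all
  qed
  have qsum: "(\<Oplus>k. q i k * cnj (q j k)) = (if i = j then complex_of_real (\<mu> i) else 0)" for i j
    using qd[of i j] by (simp only: mm_app m_app)
  have qsym: "q j i = s * \<mu> j * q i j" for i j
  proof -
    have "mm (mcnj q) q = mcnj (mm q (mcnj q))" by simp
    then have qq': "mm (mcnj q) q = ms s mI" by (simp add: qq s)
    have "ms s (mcnj (mtr q)) = mm (mm (mcnj q) q) (mcnj (mtr q))" by (simp add: qq')
    also have "\<dots> = mm (mcnj q) (mm q (mcnj (mtr q)))" by (rule mm_assoc)
    also have "mm q (mcnj (mtr q)) = (\<lambda>i j. if i = j then complex_of_real (\<mu> i) else 0)" by (simp add: fun_eq_iff qd)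
    finally have "ms s (mcnj (mtr q)) i j = mm (mcnj q) (\<lambda>i j. if i = j then complex_of_real (\<mu> i) else 0) i j" by simp
    also have "\<dots> = (\<Oplus>k. (if k = j then complex_of_real (\<mu> j) else 0) * cnj (q i k))"
      unfolding mm_app m_app by (intro sum.cong) auto
    also have "\<dots> = \<mu> j * cnj (q i j)" by (rule sum_if_mult)
    finally have "cnj (s * cnj (q j i)) = cnj (\<mu> j * cnj (q i j))" by (simp add: m_app)
    then have "s * q j i = \<mu> j * q i j" by (simp add: s)
    then have "s * (s * q j i) = s * (\<mu> j * q i j)" by simp
    then show ?thesis using s(1) by (simp add: mult.assoc[symmetric])
  qed
  have sumsq: "(\<Oplus>k. (cmod (q i k))\<^sup>2) = \<mu> i" for i
  proof -
    have "complex_of_real (\<Oplus>k. (cmod (q i k))\<^sup>2) = (\<Oplus>k. q i k * cnj (q i k))"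
      unfolding of_real_sum by (intro sum.cong refl) (metis complex_norm_square)
    then show ?thesis using qsum[of i i] by (simp del: of_real_sum)
  qed
  have pos: "\<mu> i > 0" for i
  proof -
    have "\<mu> i \<noteq> 0"
    proof
      assume "\<mu> i = 0"
      then have "\<forall>k. q i k = 0" using sumsq[of i] by (simp add: sum_nonneg_eq_0_iff)
      then have "mm q (mcnj q) i i = 0" by (simp add: mm_app)
      then show False using s by (auto simp: qq m_app)
    qed
    moreover have "\<mu> i \<ge> 0" unfolding sumsq[symmetric] by (intro sum_nonneg) auto
    ultimately show ?thesis by simp
  qed
  \<comment> \<open>By \<open>qsym\<close>, column i of \<open>q\<close> has square sum
    \<open>1 / \<mu> i\<close>, whereas row i has \<open>\<mu> i\<close>; both totals run over all
    entries.\<close>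
  have inv_sum: "(\<Oplus>i. 1 / \<mu> i) = (\<Oplus>i. \<mu> i)"
  proof -
    have "cmod s * cmod s = 1" using s(1) by (metis norm_mult norm_one)
    then have cs: "cmod s = 1" using norm_ge_zero[of s] by (auto simp: square_eq_1_iff)
    have "(cmod (q k i))\<^sup>2 = (1 / (\<mu> i)\<^sup>2) * (cmod (q i k))\<^sup>2" for i k
      using qsym[of i k] pos[of i] cs by (simp add: norm_mult power_mult_distrib)
    then have "(\<Oplus>k. (cmod (q k i))\<^sup>2) = (\<Oplus>k. (1 / (\<mu> i)\<^sup>2) * (cmod (q i k))\<^sup>2)" for i
      by (intro sum.cong refl)
    then have "(\<Oplus>k. (cmod (q k i))\<^sup>2) = (1 / (\<mu> i)\<^sup>2) * \<mu> i" for i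
      by (simp only: sum_distrib_left[symmetric] sumsq)
    then have "1 / \<mu> i = (\<Oplus>k. (cmod (q k i))\<^sup>2)" for i
      using pos[of i] by (simp add: power2_eq_square)
    then have "(\<Oplus>i. 1 / \<mu> i) = (\<Oplus>i k. (cmod (q k i))\<^sup>2)" by simp
    also have "\<dots> = (\<Oplus>k i. (cmod (q k i))\<^sup>2)" by (rule sum.swap)
    finally show ?thesis by (simp add: sumsq)
  qed
  have D: "(\<Oplus>i. \<mu> i) > 2"
  proof -
    have ge: "\<mu> i + 1 / \<mu> i \<ge> 2" "\<mu> i + 1 / \<mu> i = 2 \<Longrightarrow> \<mu> i = 1" for i
    proof -
      have "\<mu> i + 1 / \<mu> i - 2 = (\<mu> i - 1)\<^sup>2 / \<mu> i" using pos[of i] by (simp add: field_simps power2_eq_square)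
      moreover have "(\<mu> i - 1)\<^sup>2 / \<mu> i \<ge> 0" using pos[of i] by simp
      ultimately show "\<mu> i + 1 / \<mu> i \<ge> 2" by linarith
      show "\<mu> i = 1" if "\<mu> i + 1 / \<mu> i = 2"
      proof -
        have "(\<mu> i - 1)\<^sup>2 / \<mu> i = 0" using that \<open>\<mu> i + 1 / \<mu> i - 2 = _\<close> by linarith
        then show ?thesis using pos[of i] by simp
      qed
    qed
    have sum2: "2 * (\<Oplus>i. \<mu> i) = (\<Oplus>i. \<mu> i + 1 / \<mu> i)"
      using inv_sum by (simp add: sum.distrib)
    have "(\<Sum>i\<in>(UNIV::'n set). 2) \<le> (\<Oplus>i. \<mu> i + 1 / \<mu> i)" by (intro sum_mono ge)
    then have n': "real CARD('n) \<le> (\<Oplus>i. \<mu> i)" using sum2 by simp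
    show ?thesis
    proof (cases "CARD('n) = 2")
      case False
      then show ?thesis using n n' by simp
    next
      case True
      show ?thesis
      proof (rule ccontr)
        assume "\<not> ?thesis"
        then have "(\<Oplus>i. \<mu> i + 1 / \<mu> i - 2) = 0" using sum2 n' True by (simp add: sum_subtractf)
        then have "\<mu> i + 1 / \<mu> i - 2 = 0" for i using ge(1) by (simp add: sum_nonneg_eq_0_iff)
        then have m1: "\<mu> i = 1" for i using ge(2)[of i] by (simp add: algebra_simps)
        then have "mm H V = V" by (simp add: fun_eq_iff HV)
        then have "H = mI" using V(2) mm_assoc[of H V "mcnj (mtr V)"] by simp
        then have "mm q1 (mcnj (mtr q1)) = mI" by (simp add: H_def)
        then have qt: "mm q0 (mcnj (mtr q0)) = ms (r * r) mI" by (simp add: q01 r)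
        have "mm (mcnj (mtr q0)) q0 = ms (r * r) mI"
        proof -
          have "mcnj (mtr q0) = mm (mm p0 q0) (mcnj (mtr q0))" by (simp add: qp)
          also have "\<dots> = ms (r * r) p0" by (simp add: mm_assoc qt)
          finally show ?thesis by (simp add: qp)
        qed
        then have "transpose (map_matrix cnj Q) ** Q = mat (complex_of_real (cmod c))"
          unfolding rr by (simp add: matrix_matrix_mult_def mat_def vec_eq_iff fun_eq_iff mm_def mcnj_def mtr_def mI_def
              ms_def q0_def transpose_def if_distrib cong: if_cong)
        then show False using n2 True by blast
      qed
    qed
  qed
  have Q: "(\<lambda>i k. Q $ i $ k) = ms r (mm V (mm q (mtr V)))"
    using q01 by (simp add: q_def mm_assoc can V' flip: q0_def)
  have Qi: "(\<lambda>i k. matrix_inv Q $ i $ k) = ms (s / r) (mm (mcnj V) (mm (mcnj q) (mcnj (mtr V))))"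
  proof -
    have "p0 = ms (1 / c) (mcnj q0)" using c0 by (simp add: q0')
    also have "\<dots> = ms (r / c) (mm (mcnj V) (mm (mcnj q) (mcnj (mtr V))))"
      by (simp add: q01 r q_def mm_assoc can V)
    also have "r / c = s / r"
    proof -
      have "s * c = cmod c" using s(1) c0 by (simp add: s_def field_simps)
      then have "r * r = s * c" using rr by simp
      then show ?thesis using r c0 by (simp add: field_simps)
    qed
    finally show ?thesis by (simp add: p0_def)
  qed
  show ?thesis by (rule that[OF V r s qq Q Qi pos qsym qsum D inv_sum])
qed

section \<open>Words and matrix coefficients\<close>

lemma tensor_mult [simp]:
  fixes a a' :: "'a::complex_star_algebra" and b b' :: "'b::complex_star_algebra"
  shows "(a \<otimes>\<^sub>a b) * (a' \<otimes>\<^sub>a b') = (a * a') \<otimes>\<^sub>a (b * b')"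
  using tensor_lift_tensor[OF cbilinear_mult_tensor'[of "a' \<otimes>\<^sub>a b'"], of a b]
  by (simp add: times_tensor_prod_def tensor_lift_tensor[OF cbilinear_mult_tensor])

lemma tensor_star [simp]:
  fixes a :: "'a::complex_star_algebra" and b :: "'b::complex_star_algebra"
  shows "star (a \<otimes>\<^sub>a b) = star a \<otimes>\<^sub>a star b"
proof -
  interpret st: tensor_extension cnj "\<lambda>(a::'a) (b::'b). star a \<otimes>\<^sub>a star b"
    by unfold_locales (simp_all add: star_add star_scaleC tensor_add_left tensor_add_right
        tensor_scale_left tensor_scale_right)
  show ?thesis by (simp add: star_tensor_prod_def)
qed

lemma tensor_sum_left: "(\<Sum>i\<in>A. f i) \<otimes>\<^sub>a b = (\<Sum>i\<in>A. f i \<otimes>\<^sub>a b)"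
  by (induction A rule: infinite_finite_induct) (simp_all add: tensor_add_left)

lemma tensor_sum_right: "b \<otimes>\<^sub>a (\<Sum>i\<in>A. f i) = (\<Sum>i\<in>A. b \<otimes>\<^sub>a f i)"
  by (induction A rule: infinite_finite_induct) (simp_all add: tensor_add_right)

lemma clinearD:
  assumes "clinear f"
  shows "f (x + y) = f x + f y" "f (c *\<^sub>C x) = c *\<^sub>C f x" "f 0 = 0" "f (sum g A) = (\<Sum>i\<in>A. f (g i))"
proof -
  show 1: "f (x + y) = f x + f y" for x y using assms by (simp add: clinear_iff)
  show 2: "f (c *\<^sub>C x) = c *\<^sub>C f x" for c x using assms by (simp add: clinear_iff)
  show 3: "f 0 = 0" using 2[of 0 0] by simp
  show "f (sum g A) = (\<Sum>i\<in>A. f (g i))"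
    by (induction A rule: infinite_finite_induct) (simp_all add: 1 3)
qed

lemma clinear_diff: "clinear f \<Longrightarrow> f (x - y) = f x - f y"
  using clinearD(1)[of f "x - y" y] by (simp add: algebra_simps)

lemma tensor_lift_sum:
  assumes "cbilinear f"
  shows "tensor_lift f (\<Sum>i\<in>A. a i \<otimes>\<^sub>a b i) = (\<Sum>i\<in>A. f (a i) (b i))"
  by (simp add: clinearD(4)[OF tensor_lift_clinear[OF assms]] tensor_lift_tensor[OF assms])

lemma cbilinearI:
  assumes "\<And>x y y'. f x (y + y') = f x y + f x y'" "\<And>x x' y. f (x + x') y = f x y + f x' y"
    "\<And>c x y. f (c *\<^sub>C x) y = c *\<^sub>C f x y" "\<And>c x y. f x (c *\<^sub>C y) = c *\<^sub>C f x y"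
  shows "cbilinear f"
  using assms by (simp add: cbilinear_def clinear_iff)

lemma wordm_append:
  "length I = length J \<Longrightarrow> wordm v (I @ I') (J @ J') = wordm v I J * wordm v I' J'"
  by (induction I J rule: list_induct2) (simp_all add: mult.assoc)

lemma wordm_length: "length I \<noteq> length J \<Longrightarrow> wordm v I J = 0"
  by (induction v I J rule: wordm.induct) auto

text \<open>The two halves of the universal property are kept separately: \<open>words_span\<close>
  says that \<open>v\<close> generates, and \<open>functional_exists\<close> that words satisfy no
  relations beyond those imposed by \<open>q\<close>.\<close>

locale ao_group =
  fixes v :: "'n::finite \<Rightarrow> 'n \<Rightarrow> 'a::complex_star_algebra"
    and q :: "'n \<Rightarrow> 'n \<Rightarrow> complex" and s :: complex and lam :: "'n \<Rightarrow> real"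
    and G :: "('a, 'h::chilbert_space, 'k::chilbert_space) quantum_group"
  assumes s: "s * s = 1" "cnj s = s"
    and lam_pos: "\<And>i. lam i > 0"
    and q_sym: "\<And>i j. q i j = s * complex_of_real (lam i) * q j i"
    and qq: "\<And>i j. (\<Oplus>k. q i k * cnj (q k j)) = (if i = j then s else 0)"
    and lam_sum: "(\<Oplus>i. lam i) > 2" and lam_inv_sum: "(\<Oplus>i. 1 / lam i) = (\<Oplus>i. lam i)"
    and star_v: "\<And>a b. star (v a b) = (\<Oplus>c d. (s * cnj (q a c) * q d b) *\<^sub>C v c d)"
    and v_unitary: "\<And>i j. (\<Oplus>k. v i k * star (v j k)) = (if i = j then 1 else 0)"
      "\<And>i j. (\<Oplus>k. star (v k i) * v k j) = (if i = j then 1 else 0)"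
    and words_span: "\<And>x. x \<in> cspan {wordm v I J | I J. True}"
    and functional_exists: "\<And>P. (\<And>I J I' J' a b. length I = length J \<Longrightarrow>
        (\<Oplus>c d. q d c * P (I @ a # b # I') (J @ c # d # J')) = q b a * P (I @ I') (J @ J')) \<Longrightarrow>
      (\<And>I J I' J' c d. length I = length J \<Longrightarrow>
        (\<Oplus>a b. cnj (q b a) * P (I @ a # b # I') (J @ c # d # J')) = cnj (q d c) * P (I @ I') (J @ J')) \<Longrightarrow>
      (\<exists>\<phi>. clinear \<phi> \<and> (\<forall>I J. length I = length J \<longrightarrow> \<phi> (wordm v I J) = P I J))"
    and hopf: "hopf_star_algebra G"
    and comult_v: "\<And>i j. comult G (v i j) = (\<Oplus>k. v i k \<otimes>\<^sub>a v k j)"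
    and haar: "haar_state G" and gnsm: "gns_map G" and hten: "hilbert_tensor G"
begin

abbreviation h :: "'a \<Rightarrow> complex" where "h \<equiv> haar G"
abbreviation \<Lambda> :: "'a \<Rightarrow> 'h" where "\<Lambda> \<equiv> gns G"
abbreviation \<epsilon> :: "'a \<Rightarrow> complex" where "\<epsilon> \<equiv> counit G"
abbreviation \<kappa> :: "'a \<Rightarrow> 'a" where "\<kappa> \<equiv> antipode G"
abbreviation \<delta> :: "'a \<Rightarrow> ('a, 'a) tensor_prod" where "\<delta> \<equiv> comult G"
abbreviation W :: "'n list \<Rightarrow> 'n list \<Rightarrow> 'a" where "W \<equiv> wordm v"
definition D :: real where "D = (\<Oplus>i. lam i)"

lemma D_gt_2: "D > 2"
  using lam_sum by (simp add: D_def)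

lemma q_sym': "q j i = s / complex_of_real (lam i) * q i j"
proof -
  have "lam i \<noteq> 0" using lam_pos[of i] by simp
  then have "s / complex_of_real (lam i) * q i j = (s * s) * q j i" by (subst q_sym) simp
  then show ?thesis using s(1) by simp
qed

text \<open>Two applications of \<open>q_sym\<close>. Hence every weight that is a power of
  \<open>lam\<close> cancels on the two legs joined by the invariant vector.\<close>

lemma q_lam: "q i j \<noteq> 0 \<Longrightarrow> lam i * lam j = 1"
proof -
  assume *: "q i j \<noteq> 0"
  have "q i j = s * complex_of_real (lam i) * (s * complex_of_real (lam j) * q i j)"
    using q_sym[of i j] q_sym[of j i] by simp
  also have "\<dots> = (s * s) * (complex_of_real (lam i * lam j) * q i j)" by simp
  finally have "complex_of_real (lam i * lam j) * q i j = 1 * q i j" using s(1) by simp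
  then have "complex_of_real (lam i * lam j) = 1" using * by (simp only: mult_cancel_right) simp
  then show ?thesis by (simp only: of_real_eq_1_iff)
qed

lemma qq': "(\<Oplus>k. cnj (q i k) * q k j) = (if i = j then s else 0)"
proof -
  have "cnj (\<Oplus>k. q i k * cnj (q k j)) = cnj (if i = j then s else 0)" by (simp only: qq)
  then show ?thesis by (simp add: s split: if_splits)
qed

lemma q_row: "(\<Oplus>k. q i k * cnj (q j k)) = (if i = j then complex_of_real (lam i) else 0)"
proof -
  have "(\<Oplus>k. q i k * cnj (q j k)) = (\<Oplus>k. q i k * cnj (s * complex_of_real (lam j) * q k j))"
    by (subst (2) q_sym) simp
  also have "\<dots> = s * lam j * (\<Oplus>k. q i k * cnj (q k j))"
    by (simp add: s sum_distrib_left mult_ac)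
  finally show ?thesis using s(1) by (simp add: qq mult_ac flip: mult.assoc)
qed

lemma q_col: "(\<Oplus>k. q k i * cnj (q k j)) = (if i = j then complex_of_real (1 / lam i) else 0)"
proof -
  have "(\<Oplus>k. q k i * cnj (q k j)) = (\<Oplus>k. s / complex_of_real (lam i) * q i k * cnj (q k j))"
    by (subst q_sym') simp
  also have "\<dots> = s / lam i * (\<Oplus>k. q i k * cnj (q k j))"
    by (simp add: sum_distrib_left mult_ac)
  finally show ?thesis using s(1) by (simp add: qq)
qed

text \<open>Invariance of the vector of \<open>q\<close> under the tensor square of
  \<open>v\<close>: it is unitarity, with the adjoints rewritten by \<open>star_v\<close>.\<close>

lemma v_col: "(\<Oplus>c d. q d c *\<^sub>C (v a c * v b d)) = q b a *\<^sub>C 1"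
proof -
  have "q b a *\<^sub>C (1::'a) = (\<Oplus>e. q b e *\<^sub>C (\<Oplus>k. v a k * star (v e k)))"
    unfolding v_unitary using sum_if_scaleC[of a 1 "\<lambda>e. q b e *\<^sub>C (1::'a)"]
    by (simp add: scaleC_scaleC if_distrib eq_commute cong: if_cong)
  also have "\<dots> = (\<Oplus>e k c d. (q b e * (s * cnj (q e c) * q d k)) *\<^sub>C (v a k * v c d))"
    by (simp add: star_v sum_distrib_left scaleC_sum_right scaleC_scaleC scaleC_mult_right)
  also have "\<dots> = (\<Oplus>k c d e. (q b e * (s * cnj (q e c) * q d k)) *\<^sub>C (v a k * v c d))"
    by (rule trans[OF sum.swap sum.cong[OF refl sum_swap3]])
  also have "\<dots> = (\<Oplus>k c d. ((\<Oplus>e. q b e * cnj (q e c)) * (s * q d k)) *\<^sub>C (v a k * v c d))"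
    by (simp only: sum_distrib_right scaleC_sum_left) (simp only: mult_ac)
  also have "\<dots> = (\<Oplus>k c. (if c = b then 1 else 0) *\<^sub>C (\<Oplus>d. q d k *\<^sub>C (v a k * v c d)))"
    unfolding qq using s(1) by (intro sum.cong refl) (auto simp: mult.assoc[symmetric])
  finally show ?thesis by (simp add: sum_if_scaleC)
qed

lemma v_row: "(\<Oplus>a b. cnj (q b a) *\<^sub>C (v a c * v b d)) = cnj (q d c) *\<^sub>C 1"
proof -
  have "cnj (q d c) *\<^sub>C (1::'a) = (\<Oplus>e. cnj (q e c) *\<^sub>C (\<Oplus>k. star (v k e) * v k d))"
    unfolding v_unitary using sum_if_scaleC[of d 1 "\<lambda>e. cnj (q e c) *\<^sub>C (1::'a)"]
    by (simp add: scaleC_scaleC if_distrib cong: if_cong)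
  also have "\<dots> = (\<Oplus>e k a b. (cnj (q e c) * (s * cnj (q k a) * q b e)) *\<^sub>C (v a b * v k d))"
    by (simp add: star_v sum_distrib_right scaleC_sum_right scaleC_scaleC scaleC_mult_left)
  also have "\<dots> = (\<Oplus>k a b e. (cnj (q e c) * (s * cnj (q k a) * q b e)) *\<^sub>C (v a b * v k d))"
    by (rule trans[OF sum.swap sum.cong[OF refl sum_swap3]])
  also have "\<dots> = (\<Oplus>k a b. ((\<Oplus>e. q b e * cnj (q e c)) * (s * cnj (q k a))) *\<^sub>C (v a b * v k d))"
    by (simp only: sum_distrib_right scaleC_sum_left) (simp only: mult_ac)
  also have "\<dots> = (\<Oplus>k a b. (if b = c then 1 else 0) *\<^sub>C (cnj (q k a) *\<^sub>C (v a b * v k d)))"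
    unfolding qq using s(1) by (intro sum.cong refl) (auto simp: mult.assoc[symmetric])
  also have "\<dots> = (\<Oplus>k a. cnj (q k a) *\<^sub>C (v a c * v k d))"
    by (simp add: sum_if_scaleC del: scaleC_scaleC complex_vector.scale_scale)
  also have "\<dots> = (\<Oplus>a b. cnj (q b a) *\<^sub>C (v a c * v b d))" by (rule sum.swap)
  finally show ?thesis by simp
qed

text \<open>The calculus for the given product, in which words grow at their left end.\<close>

sublocale L: tl_algebra "\<lambda>a b. q b a" s D "(*)" v
proof
  show "(\<Oplus>b. q b a * cnj (q c b)) = (if a = c then s else 0)" for a c
    using qq'[of c a] by (simp add: mult.commute eq_commute)
  have "(\<Oplus>a b. cnj (q b a) * q b a) = (\<Oplus>b a. q b a * cnj (q b a))"
    by (subst sum.swap) (simp add: mult.commute)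
  then show "(\<Oplus>a b. cnj (q b a) * q b a) = complex_of_real D"
    by (simp add: q_row D_def)
qed (simp_all add: s D_gt_2 distrib_left distrib_right scaleC_mult_left scaleC_mult_right mult.assoc v_col v_row)

text \<open>For the opposite product words grow at their right end, as under E_2. The two legs of
  the invariant vector change places, so \<open>q\<close> replaces its transpose.\<close>

sublocale R: tl_algebra q s D "\<lambda>x y. y * x" v
proof
  show "(\<Oplus>a b. cnj (q a b) * q a b) = complex_of_real D"
    using q_row by (simp add: mult.commute[of "cnj _"] D_def)
  show "(\<Oplus>c d. q c d *\<^sub>C (v b d * v a c)) = q a b *\<^sub>C 1" for a b
    by (subst sum.swap) (rule v_col)
  show "(\<Oplus>a b. cnj (q a b) *\<^sub>C (v b d * v a c)) = cnj (q c d) *\<^sub>C 1" for c d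
    by (subst sum.swap) (rule v_row)
qed (simp_all add: s D_gt_2 distrib_left distrib_right scaleC_mult_left scaleC_mult_right mult.assoc qq)

lemma L_wd: "L.wd I J = W I J"
  by (induction I J rule: L.wd.induct) simp_all

lemma R_wd: "R.wd I J = W (rev I) (rev J)"
proof (induction I J rule: R.wd.induct)
  case (2 a I b J)
  show ?case
  proof (cases "length I = length J")
    case True then show ?thesis using 2 by (simp add: wordm_append)
  next
    case False
    then have "W (rev I) (rev J) = 0" "W (rev I @ [a]) (rev J @ [b]) = 0" by (simp_all add: wordm_length)
    then show ?thesis using 2 by simp
  qed
qed (simp_all add: wordm_length)

lemma R_L_Cc: "R.Cc k \<phi> w = L.Cc k (\<lambda>I. \<phi> (rev I)) (\<lambda>I. w (rev I))"
proof -
  have "R.Cc k \<phi> w = (\<Sum>I\<in>Ln k. \<Sum>J\<in>Ln k. (cnj (\<phi> I) * w J) *\<^sub>C W (rev I) (rev J))"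
    by (simp add: R.Cc_def R_wd)
  also have "\<dots> = (\<Sum>I\<in>Ln k. \<Sum>J\<in>Ln k. (cnj (\<phi> (rev (rev I))) * w (rev (rev J))) *\<^sub>C W (rev I) (rev J))" by simp
  also have "\<dots> = (\<Sum>I\<in>Ln k. \<Sum>J\<in>Ln k. (cnj (\<phi> (rev I)) * w (rev J)) *\<^sub>C W I J)"
    by (subst sum_Ln_rev[where f = "\<lambda>I. \<Sum>J\<in>Ln k. (cnj (\<phi> (rev I)) * w (rev (rev J))) *\<^sub>C W I (rev J)"])
      (intro sum.cong refl sum_Ln_rev[where f = "\<lambda>J. (cnj (\<phi> (rev _)) * w (rev J)) *\<^sub>C W _ J"])
  finally show ?thesis by (simp add: L.Cc_def L_wd)
qed

lemma R_L_VV: "R.VV k w \<Longrightarrow> L.VV k (\<lambda>I. w (rev I))"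
  unfolding L.VV_def
proof (intro conjI allI impI)
  assume w: "R.VV k w"
  show "w (rev I) = 0" if "length I \<noteq> k" for I using R.VV_supp[OF w] that by simp
  show "(\<Oplus>a b. cnj (q b a) * w (rev (I @ a # b # J))) = 0" for I J
    using R.VV_contr[OF w, of "rev J" "rev I"] by (subst sum.swap) simp
qed

lemma L_R_VV: "L.VV k w \<Longrightarrow> R.VV k (\<lambda>I. w (rev I))"
  unfolding R.VV_def
proof (intro conjI allI impI)
  assume w: "L.VV k w"
  show "w (rev I) = 0" if "length I \<noteq> k" for I using L.VV_supp[OF w] that by simp
  show "(\<Oplus>a b. cnj (q a b) * w (rev (I @ a # b # J))) = 0" for I J
    using L.VV_contr[OF w, of "rev J" "rev I"] by (subst sum.swap) simp
qed

lemma S_induct [case_names add scale one mult]: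
  assumes "\<And>x y. P x \<Longrightarrow> P y \<Longrightarrow> P (x + y)" "\<And>c x. P x \<Longrightarrow> P (c *\<^sub>C x)" "P 1" "\<And>a b x. P x \<Longrightarrow> P (v a b * x)"
  shows "P x"
proof -
  have 0: "P 0" using assms(2)[OF assms(3), of 0] by simp
  have W: "P (W I J)" for I J
  proof (cases "length I = length J")
    case True then show ?thesis by (induction I J rule: list_induct2) (simp_all add: assms)
  qed (simp add: 0 wordm_length)
  show ?thesis using words_span[of x]
    by (induction rule: complex_vector.span_induct_alt) (use 0 W assms in auto)
qed

lemma W_induct [case_names add scale word]:
  assumes "\<And>x y. P x \<Longrightarrow> P y \<Longrightarrow> P (x + y)" "\<And>c x. P x \<Longrightarrow> P (c *\<^sub>C x)"
    "\<And>I J. length I = length J \<Longrightarrow> P (W I J)"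
  shows "P x"
proof -
  have 0: "P 0" using assms(2)[OF assms(3)[of "[]" "[]"], of 0] by simp
  have W: "P (W I J)" for I J using assms(3) 0 by (cases "length I = length J") (simp_all add: wordm_length)
  show ?thesis using words_span[of x]
    by (induction rule: complex_vector.span_induct_alt) (use 0 W assms in auto)
qed

lemma Cc_induct [case_names add scale Cc]:
  assumes "\<And>x y. P x \<Longrightarrow> P y \<Longrightarrow> P (x + y)" "\<And>c x. P x \<Longrightarrow> P (c *\<^sub>C x)"
    "\<And>k \<phi> w. L.VV k \<phi> \<Longrightarrow> L.VV k w \<Longrightarrow> P (L.Cc k \<phi> w)"
  shows "P x"
proof -
  have "P (L.Cc 0 (\<lambda>I. 0) (\<lambda>I. 0))" by (intro assms(3) L.VV_zero)
  then have 0: "P 0" by simp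
  have "P y" if "y \<in> L.Sall" for y
    using that unfolding L.Sall_def
    by (induction rule: complex_vector.span_induct_alt) (use 0 assms in \<open>auto simp: L.Sk_def\<close>)
  then have W: "P (W I J)" for I J using L.wd_Sall[of I J] by (simp add: L_wd)
  show ?thesis by (rule W_induct) (use assms W in auto)
qed

lemma clinear_eq_words:
  assumes "clinear f" "clinear f'" "\<And>I J. length I = length J \<Longrightarrow> f (W I J) = f' (W I J)"
  shows "f x = f' x"
  by (induction x rule: W_induct) (simp_all add: assms(3) clinearD[OF assms(1)] clinearD[OF assms(2)])

subsection \<open>Hopf algebra structure on words\<close>

lemma delta_props: "clinear \<delta>" "\<delta> 1 = 1 \<otimes>\<^sub>a 1" "\<delta> (x * y) = \<delta> x * \<delta> y" "\<delta> (star x) = star (\<delta> x)"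
  using hopf by (auto simp: hopf_star_algebra_def star_hom_def one_tensor_prod_def)

lemma eps_props: "clinear \<epsilon>" "\<epsilon> 1 = 1" "\<epsilon> (x * y) = \<epsilon> x * \<epsilon> y" "\<epsilon> (star x) = cnj (\<epsilon> x)"
  using hopf by (auto simp: hopf_star_algebra_def star_hom_def star_complex_def)

lemma kappa_clinear: "clinear \<kappa>"
  using hopf by (auto simp: hopf_star_algebra_def)

lemma delta_W: "length I = length J \<Longrightarrow> \<delta> (W I J) = (\<Sum>K\<in>Ln (length I). W I K \<otimes>\<^sub>a W K J)"
proof (induction I J rule: list_induct2)
  case Nil show ?case by (simp add: delta_props)
next
  case (Cons a I b J)
  have "\<delta> (W (a # I) (b # J)) = (\<Oplus>k. \<Sum>K\<in>Ln (length I). (v a k * W I K) \<otimes>\<^sub>a (v k b * W K J))"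
    by (simp add: delta_props comult_v Cons sum_product)
  then show ?case by (simp add: sum_Ln_Suc)
qed

lemma W_unitary: "length I = length J \<Longrightarrow> (\<Sum>K\<in>Ln (length I). W I K * star (W J K)) = (if I = J then 1 else 0)"
proof (induction I J rule: list_induct2)
  case Nil show ?case by simp
next
  case (Cons a I b J)
  have "(\<Sum>K\<in>Ln (length (a # I)). W (a # I) K * star (W (b # J) K))
     = (\<Oplus>k. v a k * (\<Sum>K\<in>Ln (length I). W I K * star (W J K)) * star (v b k))"
    by (simp add: sum_Ln_Suc star_mult mult.assoc sum_distrib_left sum_distrib_right)
  also have "\<dots> = (if I = J then \<Oplus>k. v a k * star (v b k) else 0)" by (simp only: Cons.IH) simp
  finally show ?case by (simp add: v_unitary)
qed

text \<open>The counit axiom says that the scalar matrix of values of \<open>\<epsilon>\<close>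
  times the matrix \<open>W\<close> is \<open>W\<close>; as \<open>W\<close> has a right inverse,
  the scalar matrix is the identity.\<close>

lemma eps_W: "length I = length (J :: 'n list) \<Longrightarrow> \<epsilon> (W I J) = (if I = J then 1 else 0)"
proof -
  have bil: "cbilinear (\<lambda>a b::'a. \<epsilon> a *\<^sub>C b)"
    by (intro cbilinearI) (simp_all add: clinearD[OF eps_props(1)] scaleC_add_left scaleC_add_right scaleC_scaleC scaleC_complex_def mult_ac)
  have 1: "(\<Sum>K\<in>Ln (length I). \<epsilon> (W I K) *\<^sub>C W K J) = W I J" if "length I = length J" for I J :: "'n list"
  proof -
    have "tensor_lift (\<lambda>a b. \<epsilon> a *\<^sub>C b) (\<delta> (W I J)) = W I J" using hopf by (simp add: hopf_star_algebra_def)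
    then show ?thesis by (simp add: delta_W[OF that] tensor_lift_sum[OF bil])
  qed
  assume IJ: "length I = length J"
  have "(if I = J then 1 else 0) = (\<Sum>L\<in>Ln (length I). W I L * star (W J L))" using W_unitary[OF IJ] by simp
  also have "\<dots> = (\<Sum>L\<in>Ln (length I). \<Sum>K\<in>Ln (length I). \<epsilon> (W I K) *\<^sub>C (W K L * star (W J L)))"
    by (intro sum.cong refl) (simp add: 1[symmetric, of I] sum_distrib_right scaleC_mult_left)
  also have "\<dots> = (\<Sum>K\<in>Ln (length I). \<epsilon> (W I K) *\<^sub>C (\<Sum>L\<in>Ln (length I). W K L * star (W J L)))"
    by (subst sum.swap) (simp add: scaleC_sum_right)
  also have "\<dots> = (\<Sum>K\<in>Ln (length I). if K = J then \<epsilon> (W I J) *\<^sub>C 1 else 0)"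
  proof (intro sum.cong refl)
    fix K :: "'n list" assume "K \<in> Ln (length I)"
    then show "\<epsilon> (W I K) *\<^sub>C (\<Sum>L\<in>Ln (length I). W K L * star (W J L)) = (if K = J then \<epsilon> (W I J) *\<^sub>C 1 else 0)"
      using W_unitary[of K J] IJ by simp
  qed
  also have "\<dots> = \<epsilon> (W I J) *\<^sub>C 1" using IJ by simp
  \<comment> \<open>The equation so far compares multiples of 1 in the algebra; since
    \<open>\<epsilon> 1 = 1\<close>, applying the counit compares the scalars.\<close>
  finally have "\<epsilon> (\<epsilon> (W I J) *\<^sub>C 1) = \<epsilon> (if I = J then 1 else 0)" by simp
  then show ?thesis using eps_props by (simp add: clinearD[OF eps_props(1)] scaleC_complex_def split: if_splits)
qed

text \<open>The antipode is determined by its being a left inverse of an invertible matrix.\<close>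

lemma kappa_left:
  assumes "\<delta> x = (\<Sum>K\<in>A. a K \<otimes>\<^sub>a b K)"
  shows "(\<Sum>K\<in>A. \<kappa> (a K) * b K) = \<epsilon> x *\<^sub>C 1"
proof -
  have bil: "cbilinear (\<lambda>a b. \<kappa> a * b)"
    by (intro cbilinearI) (simp_all add: clinearD[OF kappa_clinear] distrib_left distrib_right scaleC_mult_left scaleC_mult_right)
  show ?thesis
  proof -
    have "tensor_lift (\<lambda>a b. \<kappa> a * b) (\<delta> x) = \<epsilon> x *\<^sub>C 1" using hopf by (simp add: hopf_star_algebra_def)
    then show ?thesis by (simp add: assms tensor_lift_sum[OF bil])
  qed
qed

lemma kappa_W: "length I = length J \<Longrightarrow> \<kappa> (W I J) = star (W J I)"
proof -
  assume IJ: "length I = length J"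
  have "\<kappa> (W I J) = (\<Sum>K\<in>Ln (length I). \<kappa> (W I K) * (\<Sum>L\<in>Ln (length I). W K L * star (W J L)))"
  proof -
    have "(\<Sum>K\<in>Ln (length I). \<kappa> (W I K) * (\<Sum>L\<in>Ln (length I). W K L * star (W J L))) = (\<Sum>K\<in>Ln (length I). if K = J then \<kappa> (W I J) else 0)"
      by (intro sum.cong refl) (use W_unitary[of _ J] IJ in auto)
    then show ?thesis using IJ by simp
  qed
  also have "\<dots> = (\<Sum>L\<in>Ln (length I). (\<Sum>K\<in>Ln (length I). \<kappa> (W I K) * W K L) * star (W J L))"
    by (simp add: sum_distrib_left sum_distrib_right mult.assoc) (rule sum.swap)
  also have "\<dots> = (\<Sum>L\<in>Ln (length I). if L = I then star (W J I) else 0)"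
    by (intro sum.cong refl) (auto simp: kappa_left[OF delta_W] eps_W)
  finally show ?thesis by simp
qed

text \<open>The entrywise adjoint of \<open>v\<close> is unitary only up to the weight
  \<open>lam\<close>. By \<open>q_sym\<close> the weight turns the \<open>q\<close> in
  \<open>star_v\<close> into its transpose, after which \<open>v_col\<close> applies.\<close>

lemma v_unitary_twisted: "(\<Oplus>k. complex_of_real (lam k) *\<^sub>C (star (v i k) * v j k)) = (if i = j then complex_of_real (lam i) else 0) *\<^sub>C 1"
proof -
  have *: "complex_of_real (lam k) * q d k = s * q k d" for k d
    using q_sym[of k d] s(1) by (simp flip: mult.assoc)
  have "(\<Oplus>k. complex_of_real (lam k) *\<^sub>C (star (v i k) * v j k))
     = (\<Oplus>k c d. (s * cnj (q i c) * (complex_of_real (lam k) * q d k)) *\<^sub>C (v c d * v j k))"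
    by (simp add: star_v sum_distrib_right scaleC_sum_right scaleC_scaleC scaleC_mult_left mult_ac)
  also have "\<dots> = (\<Oplus>k c d. (cnj (q i c) * q k d) *\<^sub>C (v c d * v j k))"
    unfolding * using s(1) by (simp add: mult_ac) (simp flip: mult.assoc)
  also have "\<dots> = (\<Oplus>c d k. (cnj (q i c) * q k d) *\<^sub>C (v c d * v j k))"
    by (rule sum_swap3)
  also have "\<dots> = (\<Oplus>c. cnj (q i c) *\<^sub>C (\<Oplus>d k. q k d *\<^sub>C (v c d * v j k)))"
    by (simp add: scaleC_sum_right scaleC_scaleC)
  also have "\<dots> = (\<Oplus>c. q j c * cnj (q i c)) *\<^sub>C 1"
    unfolding v_col by (simp add: scaleC_sum_left scaleC_scaleC mult.commute)
  finally show ?thesis by (auto simp: q_row)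
qed

lemma W_unitary_twisted: "length I = length J \<Longrightarrow>
  (\<Sum>K\<in>Ln (length I). complex_of_real (lw lam K) *\<^sub>C (star (W I K) * W J K)) = (if I = J then complex_of_real (lw lam I) else 0) *\<^sub>C 1"
proof (induction I J rule: list_induct2)
  case Nil show ?case by simp
next
  case (Cons a I b J)
  have "(\<Sum>K\<in>Ln (length (a # I)). complex_of_real (lw lam K) *\<^sub>C (star (W (a # I) K) * W (b # J) K))
     = (\<Oplus>k. \<Sum>K\<in>Ln (length I). complex_of_real (lw lam K) *\<^sub>C (star (W I K) * (complex_of_real (lam k) *\<^sub>C (star (v a k) * v b k)) * W J K))"
    by (simp add: sum_Ln_Suc star_mult mult.assoc scaleC_mult_left scaleC_mult_right scaleC_scaleC mult.commute[of "complex_of_real (lam _)"])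
  also have "\<dots> = (\<Sum>K\<in>Ln (length I). complex_of_real (lw lam K) *\<^sub>C (star (W I K) * (\<Oplus>k. complex_of_real (lam k) *\<^sub>C (star (v a k) * v b k)) * W J K))"
    by (subst sum.swap) (simp add: sum_distrib_left sum_distrib_right scaleC_sum_right)
  also have "\<dots> = (if a = b then complex_of_real (lam a) else 0) *\<^sub>C (\<Sum>K\<in>Ln (length I). complex_of_real (lw lam K) *\<^sub>C (star (W I K) * W J K))"
    by (simp add: v_unitary_twisted scaleC_mult_left scaleC_mult_right scaleC_sum_right scaleC_scaleC mult.commute)
  finally show ?case by (simp only: Cons.IH) (simp add: scaleC_scaleC)
qed

lemma lwl_pos: "lw lam I > 0" "lw lam I \<noteq> 0"
  using lw_pos[of lam I] lam_pos by auto

text \<open>As for \<open>W\<close>, with the twisted unitarity supplying the right inverse of the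
  matrix of adjoints. The quotient of weights is what keeps the antipode from being
  involutive.\<close>

lemma kappa_star_W: "length I = length J \<Longrightarrow> \<kappa> (star (W I J)) = complex_of_real (lw lam I / lw lam J) *\<^sub>C W J I"
proof -
  assume IJ: "length I = length J"
  have d: "\<delta> (star (W I L)) = (\<Sum>K\<in>Ln (length I). star (W I K) \<otimes>\<^sub>a star (W K L))" if "length L = length I" for L
    using that by (simp add: delta_props delta_W star_sum)
  have ts: "(\<Sum>L\<in>Ln (length I). star (W K L) * (complex_of_real (lw lam L / lw lam J) *\<^sub>C W J L)) = (if K = J then 1 else 0)"
    if "length K = length I" for K
  proof -
    have "(\<Sum>L\<in>Ln (length I). star (W K L) * (complex_of_real (lw lam L / lw lam J) *\<^sub>C W J L))
      = complex_of_real (1 / lw lam J) *\<^sub>C (\<Sum>L\<in>Ln (length K). complex_of_real (lw lam L) *\<^sub>C (star (W K L) * W J L))"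
      by (simp add: scaleC_sum_right scaleC_scaleC scaleC_mult_right that)
    also have "\<dots> = (if K = J then 1 else 0)"
      using W_unitary_twisted[of K J] that IJ lwl_pos(2)[of J] by (simp add: scaleC_scaleC)
    finally show ?thesis .
  qed
  have "\<kappa> (star (W I J)) = (\<Sum>K\<in>Ln (length I). \<kappa> (star (W I K)) * (\<Sum>L\<in>Ln (length I). star (W K L) * (complex_of_real (lw lam L / lw lam J) *\<^sub>C W J L)))"
  proof -
    have "(\<Sum>K\<in>Ln (length I). \<kappa> (star (W I K)) * (\<Sum>L\<in>Ln (length I). star (W K L) * (complex_of_real (lw lam L / lw lam J) *\<^sub>C W J L)))
      = (\<Sum>K\<in>Ln (length I). if K = J then \<kappa> (star (W I J)) else 0)"
      by (intro sum.cong refl) (simp add: ts del: of_real_divide)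
    then show ?thesis using IJ by simp
  qed
  also have "\<dots> = (\<Sum>L\<in>Ln (length I). (\<Sum>K\<in>Ln (length I). \<kappa> (star (W I K)) * star (W K L)) * (complex_of_real (lw lam L / lw lam J) *\<^sub>C W J L))"
    by (simp add: sum_distrib_left sum_distrib_right mult.assoc) (rule sum.swap)
  also have "\<dots> = (\<Sum>L\<in>Ln (length I). if L = I then complex_of_real (lw lam I / lw lam J) *\<^sub>C W J I else 0)"
    by (intro sum.cong refl) (auto simp: kappa_left[OF d] eps_props eps_W)
  finally show ?thesis by simp
qed

subsection \<open>The Haar state\<close>

lemma h_clinear: "clinear h" and h_one: "h 1 = 1"
  using haar by (auto simp: haar_state_def)

lemmas h_simps = clinearD[OF h_clinear, unfolded scaleC_complex_def]

lemma L_clinear: "clinear \<Lambda>"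
  using gnsm by (simp add: gns_map_def)

lemmas \<Lambda>_simps = clinearD[OF L_clinear] clinear_diff[OF L_clinear]

lemma cinner_gns: "cinner (\<Lambda> x) (\<Lambda> y) = h (star x * y)"
  using gnsm by (simp add: gns_map_def)

lemma h_star: "h (star x) = cnj (h x)"
proof -
  have "h (star x) = cinner (\<Lambda> x) (\<Lambda> 1)" "h x = cinner (\<Lambda> 1) (\<Lambda> x)" by (simp_all add: cinner_gns)
  then show ?thesis using cinner_commute by metis
qed

lemma h_W: "length I = length J \<Longrightarrow> (\<Sum>K\<in>Ln (length I). h (W I K) *\<^sub>C W K J) = h (W I J) *\<^sub>C 1"
proof -
  assume "length I = length J"
  have bil: "cbilinear (\<lambda>a b::'a. h a *\<^sub>C b)"
    by (intro cbilinearI) (simp_all add: h_simps scaleC_add_left scaleC_add_right scaleC_scaleC mult_ac)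
  show ?thesis
  proof -
    have "tensor_lift (\<lambda>a b. h a *\<^sub>C b) (\<delta> (W I J)) = h (W I J) *\<^sub>C 1" using haar by (simp add: haar_state_def)
    then show ?thesis by (simp add: delta_W \<open>length I = length J\<close> tensor_lift_sum[OF bil])
  qed
qed

text \<open>Apply the functional with values \<open>haar_kernel\<close> to the invariance of
  \<open>h\<close>: the matrix of \<open>h\<close> on words then factors through this kernel, which
  kills highest weight vectors of positive level.\<close>

lemma h_Cc: "L.VV (Suc k) w \<Longrightarrow> h (L.Cc (Suc k) \<phi> w) = 0"
proof -
  assume w: "L.VV (Suc k) w"
  have "\<exists>\<psi>. clinear \<psi> \<and> (\<forall>I J. length I = length J \<longrightarrow> \<psi> (W I J) = L.haar_kernel I J)"
    by (rule functional_exists) (use L.haar_kernel_col L.haar_kernel_row in auto)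
  then obtain \<psi> where \<psi>: "clinear \<psi>" "\<And>I J. length I = length J \<Longrightarrow> \<psi> (W I J) = L.haar_kernel I J" by blast
  have \<psi>1: "\<psi> 1 = 1" using \<psi>(2)[of "[]" "[]"] by (simp add: L.haar_kernel_Nil)
  have hW: "h (W I J) = (\<Sum>K\<in>Ln (Suc k). h (W I K) * L.haar_kernel K J)" if "length I = Suc k" "length J = Suc k" for I J
    using arg_cong[OF h_W[of I J], of \<psi>] that by (simp add: clinearD[OF \<psi>(1)] \<psi>(2) \<psi>1 scaleC_complex_def)
  have "h (L.Cc (Suc k) \<phi> w) = (\<Sum>I\<in>Ln (Suc k). \<Sum>J\<in>Ln (Suc k). (cnj (\<phi> I) * w J) * h (W I J))"
    by (simp add: L.Cc_def h_simps L_wd)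
  also have "\<dots> = (\<Sum>I\<in>Ln (Suc k). \<Sum>J\<in>Ln (Suc k). \<Sum>K\<in>Ln (Suc k). cnj (\<phi> I) * h (W I K) * (L.haar_kernel K J * w J))"
    by (intro sum.cong refl, subst hW) (simp_all add: sum_distrib_left mult_ac)
  also have "\<dots> = (\<Sum>I\<in>Ln (Suc k). \<Sum>K\<in>Ln (Suc k). \<Sum>J\<in>Ln (Suc k). cnj (\<phi> I) * h (W I K) * (L.haar_kernel K J * w J))"
    by (intro sum.cong refl sum.swap)
  finally show ?thesis using L.haar_kernel_VV[OF w] by (simp flip: sum_distrib_left)
qed

sublocale LH: tl_haar "\<lambda>a b. q b a" s D "(*)" v h "\<lambda>a c. cnj (q a c)" "\<lambda>d b. s * q d b" lam "\<lambda>_. 1"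
proof
  show "(\<Oplus>c. cnj (q a c) * q e c) = (if e = a then complex_of_real (lam a) else 0)" for a e
    using q_row[of e a] by (simp add: mult.commute)
  show "(\<Oplus>d. s * q d b * cnj (q f d)) = (if f = b then complex_of_real 1 else 0)" for b f
    using qq'[of f b] s(1) by (simp add: mult.assoc mult.commute[of "q _ _"] flip: sum_distrib_left)
qed (simp_all add: h_simps h_one h_star star_mult star_v h_Cc mult_ac)

text \<open>Orthogonality for the opposite product evaluates \<open>h (y * star x)\<close>, as
  \<open>LH\<close> evaluates \<open>h (star x * y)\<close>; the weights move from the left index to
  the right one.\<close>

sublocale RH: tl_haar q s D "\<lambda>x y. y * x" v h "\<lambda>a c. s * cnj (q a c)" "\<lambda>d b. q d b" "\<lambda>_. 1" "\<lambda>b. 1 / lam b"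
proof
  show "(\<Oplus>c. s * cnj (q a c) * q c e) = (if e = a then complex_of_real 1 else 0)" for a e
    using qq'[of a e] s(1) by (auto simp: mult.assoc simp flip: sum_distrib_left)
  show "(\<Oplus>d. q d b * cnj (q d f)) = (if f = b then complex_of_real (1 / lam b) else 0)" for b f
    using q_col[of b f] by auto
  show "h (R.Cc (Suc k) \<phi> w) = 0" if "R.VV (Suc k) w" for k \<phi> w
    using h_Cc[OF R_L_VV[OF that]] by (simp add: R_L_Cc)
qed (simp_all add: h_simps h_one h_star star_mult star_v mult_ac)

end

lemma sum_delta2:
  "(\<Sum>c\<in>(UNIV::'n::finite set). \<Sum>d\<in>(UNIV::'m::finite set). if c = a then if d = b then z else 0 else 0) = (z::'v::comm_monoid_add)"
proof -
  have "(\<Sum>d\<in>(UNIV::'m set). if c = a then if d = b then z else 0 else 0) = (if c = a then z else 0)" for c :: 'n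
    by simp
  then show ?thesis by simp
qed

text \<open>Let z be column j of A minus the diagonal matrix. From the value of A^2 it follows that
  A z = - d_j z, and positivity of A = B B^* forces z = 0.\<close>

lemma matrix_positive_root_unique:
  fixes A B :: "'n::finite \<Rightarrow> 'n \<Rightarrow> complex" and d :: "'n \<Rightarrow> real"
  assumes d: "\<And>i. 0 < d i"
    and AB: "\<And>i j. A i j = (\<Oplus>k. B i k * cnj (B j k))"
    and AA: "\<And>i j. (\<Oplus>k. A i k * A k j) = (if i = j then complex_of_real ((d i)\<^sup>2) else 0)"
  shows "A i j = (if i = j then complex_of_real (d i) else 0)"
proof -
  define z where "z i = A i j - (if i = j then complex_of_real (d j) else 0)" for i
  have Az: "(\<Oplus>k. A i k * z k) = - complex_of_real (d j) * z i" for i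
    using AA[of i j] sum_if_mult[of j "complex_of_real (d j)" "A i"]
    by (simp add: z_def right_diff_distrib sum_subtractf mult.commute power2_eq_square)
  have "- complex_of_real (d j) * (\<Oplus>i. cnj (z i) * z i) = (\<Oplus>i. cnj (z i) * (\<Oplus>k. A i k * z k))"
    unfolding Az by (simp add: sum_distrib_left mult_ac)
  also have "\<dots> = (\<Oplus>i k l. (B i l * cnj (z i)) * cnj (B k l * cnj (z k)))"
    by (simp add: AB sum_distrib_left sum_distrib_right mult_ac)
  also have "\<dots> = (\<Oplus>l. (\<Oplus>i. B i l * cnj (z i)) * cnj (\<Oplus>k. B k l * cnj (z k)))"
    by (rule trans[OF sum_swap3[symmetric]]) (simp only: cnj_sum sum_product)
  also have "\<dots> = complex_of_real (\<Oplus>l. (cmod (\<Oplus>i. B i l * cnj (z i)))\<^sup>2)"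
    by (simp only: of_real_sum complex_norm_square)
  finally have "- complex_of_real (d j) * (\<Oplus>i. cnj (z i) * z i) = \<dots>" .
  moreover have "(\<Oplus>i. cnj (z i) * z i) = complex_of_real (\<Oplus>i. (cmod (z i))\<^sup>2)"
    by (simp only: of_real_sum complex_norm_square mult.commute)
  ultimately have "complex_of_real (- d j * (\<Oplus>i. (cmod (z i))\<^sup>2)) = complex_of_real (\<Oplus>l. (cmod (\<Oplus>i. B i l * cnj (z i)))\<^sup>2)"
    by simp
  then have "- d j * (\<Oplus>i. (cmod (z i))\<^sup>2) = (\<Oplus>l. (cmod (\<Oplus>i. B i l * cnj (z i)))\<^sup>2)"
    by (simp only: of_real_eq_iff)
  then have "0 \<le> - d j * (\<Oplus>i. (cmod (z i))\<^sup>2)" by (simp add: sum_nonneg)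
  then have "(\<Oplus>i. (cmod (z i))\<^sup>2) \<le> 0" using d[of j] by (simp add: mult_le_0_iff)
  then have "(\<Oplus>i. (cmod (z i))\<^sup>2) = 0" by (intro antisym sum_nonneg) auto
  then have "z i = 0" by (simp add: sum_nonneg_eq_0_iff)
  then show ?thesis by (auto simp: z_def split: if_splits)
qed

lemma clinear_compose: "clinear f \<Longrightarrow> clinear g \<Longrightarrow> clinear (\<lambda>x. f (g x))"
  by (simp add: clinear_iff)

context ao_group
begin

subsection \<open>Modular automorphisms\<close>

text \<open>The power of the weight \<open>lw lam I\<close> with complex exponent
  \<open>z\<close>.\<close>

definition cw :: "complex \<Rightarrow> 'n list \<Rightarrow> complex" where
  "cw z I = exp (z * complex_of_real (ln (lw lam I)))"

lemma cw_simps [simp]: "cw z [] = 1" "cw 0 I = 1" "cw z (rev I) = cw z I" "cw z I \<noteq> 0"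
  by (simp_all add: cw_def)

lemma cw_append: "cw z (I @ J) = cw z I * cw z J" "cw z (a # I) = cw z [a] * cw z I"
  using lwl_pos(1)[of I] lwl_pos(1)[of J] lam_pos[of a] by (simp_all add: cw_def ln_mult distrib_left exp_add)

lemma cw_add: "cw (z + w) I = cw z I * cw w I"
  by (simp add: cw_def distrib_right exp_add)

lemma cw_one: "cw 1 I = complex_of_real (lw lam I)"
  using lwl_pos(1)[of I] by (simp add: cw_def exp_of_real)

lemma cw_minus: "cw (- z) I = inverse (cw z I)"
  using cw_add[of z "- z" I] by (simp add: field_simps)

lemma cw_cnj: "cnj (cw z I) = cw (cnj z) I"
  by (simp add: cw_def exp_cnj)

definition rw :: "real \<Rightarrow> 'n \<Rightarrow> real" where
  "rw t i = lam i powr t"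

lemma lw_powr: "lw (rw t) I = lw lam I powr t"
proof (induction I)
  case (Cons a I) then show ?case using lwl_pos(1)[of I] lam_pos[of a] by (simp add: powr_mult rw_def)
qed (use lw_simps in simp)

lemma cw_of_real: "cw (complex_of_real t) I = complex_of_real (lw (rw t) I)"
  using lwl_pos(1)[of I] by (simp add: cw_def lw_powr powr_def exp_of_real flip: of_real_mult)

lemma rw_q: "q b a \<noteq> 0 \<Longrightarrow> rw t a * rw t b = 1"
  using q_lam[of b a] lam_pos[of a] lam_pos[of b] powr_mult[of "lam a" "lam b" t] by (simp add: rw_def mult.commute)

lemma cw_q: "q b a \<noteq> 0 \<Longrightarrow> cw z [a] * cw z [b] = 1"
  using q_lam[of b a] lam_pos[of a] lam_pos[of b] ln_mult[of "lam a" "lam b"]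
  by (simp add: cw_def mult.commute flip: exp_add distrib_left of_real_add)

lemma cw_q': "q b a * cw z (I @ a # b # I') = q b a * cw z (I @ I')"
proof (cases "q b a = 0")
  case False
  have "cw z (I @ a # b # I') = cw z I * (cw z [a] * cw z [b]) * cw z I'"
    by (simp add: cw_append(1) cw_append(2)[of z a "b # I'"] cw_append(2)[of z b I'])
  then show ?thesis using cw_q[OF False, of z] by (simp add: cw_append(1))
qed simp

text \<open>A diagonal kernel is compatible with the relations because its weight cancels on the two
  letters joined by \<open>q\<close>.\<close>

lemma char_exists: "\<exists>\<phi>. clinear \<phi> \<and> (\<forall>I J. length I = length J \<longrightarrow> \<phi> (W I J) = (if I = J then cw (- z) I else 0))"
proof (rule functional_exists)
  fix I J I' J' :: "'n list" and a b assume IJ: "length I = length J"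
  have "(\<Oplus>c d. q d c * (if I @ a # b # I' = J @ c # d # J' then cw (- z) (I @ a # b # I') else 0))
     = (\<Oplus>c d. if c = a then if d = b then (if I @ I' = J @ J' then q b a * cw (- z) (I @ a # b # I') else 0) else 0 else 0)"
    using IJ by (intro sum.cong refl) auto
  also have "\<dots> = q b a * (if I @ I' = J @ J' then cw (- z) (I @ I') else 0)"
    using cw_q'[of b a "- z" I I'] by (cases "I @ I' = J @ J'") (simp_all add: sum_delta2 del: append_eq_append_conv)
  finally show "(\<Oplus>c d. q d c * (if I @ a # b # I' = J @ c # d # J' then cw (- z) (I @ a # b # I') else 0))
     = q b a * (if I @ I' = J @ J' then cw (- z) (I @ I') else 0)" .
next
  fix I J I' J' :: "'n list" and c d assume IJ: "length I = length J"
  have "(\<Oplus>a b. cnj (q b a) * (if I @ a # b # I' = J @ c # d # J' then cw (- z) (I @ a # b # I') else 0))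
     = (\<Oplus>a b. if a = c then if b = d then (if I @ I' = J @ J' then cnj (q d c) * cw (- z) (I @ c # d # I') else 0) else 0 else 0)"
    using IJ by (intro sum.cong refl) auto
  also have "\<dots> = cnj (q d c) * (if I @ I' = J @ J' then cw (- z) (I @ I') else 0)"
    using arg_cong[OF cw_q'[of d c "cnj (- z)" I I'], of cnj]
    by (cases "I @ I' = J @ J'") (simp_all add: sum_delta2 cw_cnj del: append_eq_append_conv)
  finally show "(\<Oplus>a b. cnj (q b a) * (if I @ a # b # I' = J @ c # d # J' then cw (- z) (I @ a # b # I') else 0))
     = cnj (q d c) * (if I @ I' = J @ J' then cw (- z) (I @ I') else 0)" .
qed

definition chr :: "complex \<Rightarrow> 'a \<Rightarrow> complex" where
  "chr z = (SOME \<phi>. clinear \<phi> \<and> (\<forall>I J. length I = length J \<longrightarrow> \<phi> (W I J) = (if I = J then cw (- z) I else 0)))"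

lemma chr: "clinear (chr z)" "length I = length J \<Longrightarrow> chr z (W I J) = (if I = J then cw (- z) I else 0)"
  using someI_ex[OF char_exists[of z]] by (auto simp: chr_def)

lemmas chr_lin = clinearD[OF chr(1), unfolded scaleC_complex_def]

lemma bil_left: "clinear f \<Longrightarrow> cbilinear (\<lambda>b c. f c *\<^sub>C (b::'a))"
  and bil_right: "clinear f \<Longrightarrow> cbilinear (\<lambda>b c. f b *\<^sub>C (c::'a))"
  by (intro cbilinearI; simp add: clinearD scaleC_add_left scaleC_add_right scaleC_scaleC scaleC_complex_def mult_ac)+

lemma conv_left_clinear: "clinear f \<Longrightarrow> clinear (conv_left G f)"
  using clinear_compose[OF tensor_lift_clinear[OF bil_left] delta_props(1)] by (simp add: conv_left_def[abs_def])

lemma conv_right_clinear: "clinear f \<Longrightarrow> clinear (\<lambda>x. conv_right G x f)"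
  using clinear_compose[OF tensor_lift_clinear[OF bil_right] delta_props(1)] by (simp add: conv_right_def)

lemma conv_left_W: "clinear f \<Longrightarrow> length I = length J \<Longrightarrow> conv_left G f (W I J) = (\<Sum>K\<in>Ln (length I). f (W K J) *\<^sub>C W I K)"
  by (simp add: conv_left_def delta_W tensor_lift_sum[OF bil_left])

lemma conv_right_W: "clinear f \<Longrightarrow> length I = length J \<Longrightarrow> conv_right G (W I J) f = (\<Sum>K\<in>Ln (length I). f (W I K) *\<^sub>C W K J)"
  by (simp add: conv_right_def delta_W tensor_lift_sum[OF bil_right])

text \<open>Acts diagonally on words, by the powers \<open>z\<close> and \<open>w\<close> of the
  weights of the two indices; the signs undo the minus sign in \<open>chr\<close>. This covers the
  modular group (z = w), the scaling group (w = -z) and the one-sided twist of the Kac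
  unitary.\<close>

definition ma :: "complex \<Rightarrow> complex \<Rightarrow> 'a \<Rightarrow> 'a" where
  "ma z w x = conv_left G (chr (- w)) (conv_right G x (chr (- z)))"

lemma ma_clinear: "clinear (ma z w)"
  using clinear_compose[OF conv_left_clinear[OF chr(1)] conv_right_clinear[OF chr(1)]] by (simp add: ma_def[abs_def])

lemmas ma_lin = clinearD[OF ma_clinear] clinear_diff[OF ma_clinear]

lemma ma_W: "length I = length J \<Longrightarrow> ma z w (W I J) = (cw z I * cw w J) *\<^sub>C W I J"
proof -
  assume IJ: "length I = length J"
  have "conv_right G (W I J) (chr (- z)) = (\<Sum>K\<in>Ln (length I). if K = I then cw z I *\<^sub>C W I J else 0)"
    unfolding conv_right_W[OF chr(1) IJ] by (intro sum.cong refl) (auto simp: chr)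
  then have 1: "conv_right G (W I J) (chr (- z)) = cw z I *\<^sub>C W I J" by simp
  have "conv_left G (chr (- w)) (W I J) = (\<Sum>K\<in>Ln (length I). if K = J then cw w J *\<^sub>C W I J else 0)"
    unfolding conv_left_W[OF chr(1) IJ] by (intro sum.cong refl) (auto simp: chr IJ)
  then have "conv_left G (chr (- w)) (W I J) = cw w J *\<^sub>C W I J" using IJ by simp
  then show ?thesis
    by (simp add: ma_def 1 clinearD[OF conv_left_clinear[OF chr(1)]] scaleC_scaleC)
qed

lemma ma_one [simp]: "ma z w 1 = 1"
  using ma_W[of "[]" "[]" z w] by simp

lemma W_W: "length I = length J \<Longrightarrow> W I J * W I' J' = W (I @ I') (J @ J')"
  by (simp add: wordm_append)

lemma clinear_mult: "clinear f \<Longrightarrow> clinear (\<lambda>x. f (a * x))" "clinear f \<Longrightarrow> clinear (\<lambda>x. f (x * a))"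
    "clinear f \<Longrightarrow> clinear (\<lambda>x. a * f x)" "clinear f \<Longrightarrow> clinear (\<lambda>x. f x * a)" for f :: "'a \<Rightarrow> 'a"
  by (simp_all add: clinear_iff distrib_left distrib_right scaleC_mult_left scaleC_mult_right)

lemma ma_mult: "ma z w (x * y) = ma z w x * ma z w y"
proof (rule clinear_eq_words[where f = "\<lambda>x. ma z w (x * y)"])
  fix I J :: "'n list" assume IJ: "length I = length J"
  show "ma z w (W I J * y) = ma z w (W I J) * ma z w y"
  proof (rule clinear_eq_words[where f = "\<lambda>y. ma z w (W I J * y)"])
    fix I' J' :: "'n list" assume "length I' = length J'"
    then show "ma z w (W I J * W I' J') = ma z w (W I J) * ma z w (W I' J')"
      using IJ by (simp add: W_W ma_W cw_append(1) scaleC_mult_left scaleC_mult_right scaleC_scaleC mult_ac)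
  qed (simp_all add: clinear_mult ma_clinear)
qed (simp_all add: clinear_mult ma_clinear)

lemma ma_ma: "ma z w (ma z' w' x) = ma (z + z') (w + w') x"
proof (rule clinear_eq_words[where f = "\<lambda>x. ma z w (ma z' w' x)"])
  show "clinear (\<lambda>x. ma z w (ma z' w' x))" by (rule clinear_compose[OF ma_clinear ma_clinear])
qed (simp_all add: ma_clinear ma_W ma_lin scaleC_scaleC cw_add mult_ac)

lemma ma_zero [simp]: "ma 0 0 x = x"
  by (rule clinear_eq_words[where f = "ma 0 0"]) (simp_all add: ma_clinear ma_W, simp add: clinear_iff)

lemma ma_star_v: "ma z w (star (v a b)) = (cw (- z) [a] * cw (- w) [b]) *\<^sub>C star (v a b)"
proof -
  have *: "(s * cnj (q a c) * q d b) * (cw z [c] * cw w [d]) = (s * cnj (q a c) * q d b) * (cw (- z) [a] * cw (- w) [b])" for c d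
  proof (cases "q a c = 0 \<or> q d b = 0")
    case False
    then have "cw z [c] * cw z [a] = 1" "cw w [b] * cw w [d] = 1" using cw_q[of a c z] cw_q[of d b w] by auto
    then have "cw z [c] = cw (- z) [a]" "cw w [d] = cw (- w) [b]" by (simp_all add: cw_minus field_simps)
    then show ?thesis by simp
  qed auto
  have "ma z w (v c d) = (cw z [c] * cw w [d]) *\<^sub>C v c d" for c d using ma_W[of "[c]" "[d]" z w] by simp
  then show ?thesis
    by (simp only: star_v ma_lin scaleC_scaleC scaleC_sum_right * mult.commute[of "cw _ _ * cw _ _" "s * _ * _"])
qed

lemma ma_star: "ma z w (star x) = star (ma (- cnj z) (- cnj w) x)"
proof (induction x rule: S_induct)
  case (mult a b x)
  have "v a b = W [a] [b]" by simp
  then have "ma (- cnj z) (- cnj w) (v a b) = (cw (- cnj z) [a] * cw (- cnj w) [b]) *\<^sub>C v a b" using ma_W[of "[a]" "[b]"] by simp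
  then show ?case using mult
    by (simp add: star_mult ma_mult ma_star_v star_scaleC cw_cnj scaleC_mult_left scaleC_mult_right)
qed (simp_all add: ma_lin star_add star_scaleC)

lemma ma_Cc: "ma z w (L.Cc k \<phi> u) = L.Cc k (\<lambda>I. cnj (cw z I) * \<phi> I) (\<lambda>I. cw w I * u I)"
  unfolding L.Cc_def ma_lin L_wd by (intro sum.cong refl) (simp add: ma_W scaleC_scaleC mult_ac)

lemma VV_cw: "L.VV k u \<Longrightarrow> L.VV k (\<lambda>I. cw (complex_of_real t) I * u I)"
  unfolding cw_of_real by (rule L.VV_weight) (auto intro: rw_q)

abbreviation rma :: "real \<Rightarrow> real \<Rightarrow> 'a \<Rightarrow> 'a" where
  "rma a b \<equiv> ma (complex_of_real a) (complex_of_real b)"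

text \<open>Real weights preserve the highest weight spaces, and \<open>h\<close> vanishes on all
  levels but 0, where the weight is 1.\<close>

lemma h_rma: "h (rma a b x) = h x"
proof (induction x rule: Cc_induct)
  case (Cc k \<phi> w)
  show ?case
  proof (cases k)
    case 0 then show ?thesis by (simp add: L.Cc_0 ma_lin h_simps)
  next
    case (Suc l)
    show ?thesis unfolding Suc ma_Cc using VV_cw Cc by (simp add: h_Cc Suc)
  qed
qed (simp_all add: ma_lin h_simps)

lemma rma_star: "rma a b (star x) = star (rma (- a) (- b) x)"
  by (simp add: ma_star)

text \<open>The Haar state is invariant under \<open>rma\<close>, and the star turns
  \<open>rma a b\<close> into its inverse.\<close>

lemma rma_symmetric: "cinner (\<Lambda> x) (\<Lambda> (rma a b y)) = cinner (\<Lambda> (rma a b x)) (\<Lambda> y)"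
proof -
  have "h (star x * rma a b y) = h (rma (- a) (- b) (star x * rma a b y))" by (rule h_rma[symmetric])
  also have "\<dots> = h (star (rma a b x) * y)" using rma_star[of "- a" "- b" x] by (simp add: ma_mult ma_ma)
  finally show ?thesis by (simp only: cinner_gns)
qed

text \<open>The modular automorphism of the Haar state; unrelated to the tensor
  \<open>R.sg\<close>.\<close>

abbreviation sg :: "'a \<Rightarrow> 'a" where "sg \<equiv> rma (-1) (-1)"

text \<open>The left side is given by orthogonality for the opposite product, with weights 1 and 1 /
  lam, the right side by orthogonality for the product, with weights lam and 1. They differ by 1 /
  lam on both indices, which is \<open>sg\<close>.\<close>

theorem KMS: "h (x * star y) = h (star y * sg x)"
proof (induction x rule: Cc_induct)
  case (Cc k \<phi> w)
  show ?case
  proof (induction y rule: Cc_induct)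
    case (Cc l \<phi>' w')
    have "h (L.Cc k \<phi> w * star (L.Cc l \<phi>' w')) = RH.hh (R.Cc l (\<lambda>I. \<phi>' (rev I)) (\<lambda>I. w' (rev I))) (R.Cc k (\<lambda>I. \<phi> (rev I)) (\<lambda>I. w (rev I)))"
      by (simp add: RH.hh_def R_L_Cc)
    also have "\<dots> = (if l = k then ip (\<lambda>_. 1) l \<phi> \<phi>' * ip (\<lambda>b. 1 / lam b) l w' w / RH.g l else 0)"
      using Cc \<open>L.VV k \<phi>\<close> \<open>L.VV k w\<close> by (simp add: RH.hh_Cc L_R_VV ip_rev)
    also have "\<dots> = LH.hh (L.Cc l \<phi>' w') (L.Cc k (\<lambda>I. cnj (cw (-1) I) * \<phi> I) (\<lambda>I. cw (-1) I * w I))"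
    proof -
      have V: "L.VV k (\<lambda>I. cnj (cw (-1) I) * \<phi> I)" "L.VV k (\<lambda>I. cw (-1) I * w I)"
        using VV_cw[of k \<phi> "-1"] VV_cw[of k w "-1"] \<open>L.VV k \<phi>\<close> \<open>L.VV k w\<close> by (simp_all add: cw_cnj)
      have lwi: "lw (\<lambda>b. 1 / lam b) I = 1 / lw lam I" for I by (induction I) (simp_all add: lw_def)
      have lw1: "lw (\<lambda>_. 1) I = 1" for I :: "'n list" by (induction I) (simp_all add: lw_def)
      have "ip lam l (\<lambda>I. cnj (cw (-1) I) * \<phi> I) \<phi>' = ip (\<lambda>_. 1) l \<phi> \<phi>'"
        using lwl_pos(2) by (simp add: ip_def cw_minus cw_one lw1 flip: mult.assoc)
      moreover have "ip (\<lambda>_. 1) l w' (\<lambda>I. cw (-1) I * w I) = ip (\<lambda>b. 1 / lam b) l w' w"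
        by (simp add: ip_def cw_minus cw_one lw1 lwi field_simps)
      ultimately show ?thesis using V Cc by (cases "l = k") (simp_all add: LH.hh_Cc RH.g_def LH.g_def)
    qed
    finally show ?case using ma_Cc[of "-1" "-1" k \<phi> w] by (simp add: LH.hh_def)
  qed (simp_all add: star_add star_scaleC distrib_left distrib_right scaleC_mult_left scaleC_mult_right h_simps)
qed (simp_all add: distrib_left distrib_right scaleC_mult_left scaleC_mult_right h_simps ma_lin)

lemma KMS': "h (x * y) = h (y * sg x)"
  using KMS[of x "star y"] by (simp add: star_star)

subsection \<open>The Woronowicz characters\<close>

lemma chr_one: "chr z 1 = 1"
  using chr(2)[of "[]" "[]"] by simp

lemma chr_clinear_mult: "clinear f \<Longrightarrow> clinear (\<lambda>x. f (x * a))" "clinear f \<Longrightarrow> clinear (\<lambda>x. f (a * x))"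
    "clinear f \<Longrightarrow> clinear (\<lambda>x. f x * c)" "clinear f \<Longrightarrow> clinear (\<lambda>x. c * f x)" for f :: "'a \<Rightarrow> complex"
  unfolding clinear_iff by (simp_all add: distrib_left distrib_right scaleC_mult_left scaleC_mult_right scaleC_complex_def)

lemma chr_mult: "chr z (x * y) = chr z x * chr z y"
proof (rule clinear_eq_words[where f = "\<lambda>x. chr z (x * y)"])
  fix I J :: "'n list" assume IJ: "length I = length J"
  show "chr z (W I J * y) = chr z (W I J) * chr z y"
  proof (rule clinear_eq_words[where f = "\<lambda>y. chr z (W I J * y)"])
    fix I' J' :: "'n list" assume "length I' = length J'"
    then show "chr z (W I J * W I' J') = chr z (W I J) * chr z (W I' J')"
      using IJ by (simp add: W_W chr cw_append(1))
  qed (simp_all add: chr_clinear_mult chr)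
qed (simp_all add: chr_clinear_mult chr)

lemma chr_star_v: "chr z (star (v a b)) = (if a = b then cw z [a] else 0)"
proof -
  have "chr z (star (v a b)) = (\<Oplus>c d. (s * cnj (q a c) * q d b) * (if c = d then cw (- z) [c] else 0))"
    using chr(2)[of "[_]" "[_]" z] by (simp add: star_v chr_lin)
  also have "\<dots> = (\<Oplus>c. (s * cnj (q a c) * q c b) * cw (- z) [c])"
  proof (intro sum.cong refl)
    fix c
    have "(\<Oplus>d. (s * cnj (q a c) * q d b) * (if c = d then cw (- z) [c] else 0)) = (\<Oplus>d. if d = c then (s * cnj (q a c) * q c b) * cw (- z) [c] else 0)"
      by (intro sum.cong refl) simp
    then show "(\<Oplus>d. (s * cnj (q a c) * q d b) * (if c = d then cw (- z) [c] else 0)) = (s * cnj (q a c) * q c b) * cw (- z) [c]"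
      by simp
  qed
  also have "\<dots> = (\<Oplus>c. (s * cnj (q a c) * q c b) * cw z [a])"
  proof (intro sum.cong refl)
    fix c show "(s * cnj (q a c) * q c b) * cw (- z) [c] = (s * cnj (q a c) * q c b) * cw z [a]"
    proof (cases "q a c = 0")
      case False
      then show ?thesis using cw_q[of a c z] by (simp add: cw_minus field_simps)
    qed simp
  qed
  also have "\<dots> = s * (\<Oplus>c. cnj (q a c) * q c b) * cw z [a]"
    by (simp add: sum_distrib_left sum_distrib_right mult_ac)
  finally show ?thesis using s(1) by (simp add: qq')
qed

lemma woronowicz_exists: "is_woronowicz_characters G chr"
  unfolding is_woronowicz_characters_def
proof (intro conjI allI)
  fix z w :: complex and x y :: 'a
  show "clinear (chr z)" "chr z 1 = 1" "chr z (x * y) = chr z x * chr z y" by (simp_all add: chr chr_one chr_mult)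
  show "(\<lambda>z. chr z x) holomorphic_on UNIV"
  proof (induction x rule: W_induct)
    case (word I J)
    then show ?case by (cases "I = J") (simp_all add: chr cw_def, intro holomorphic_intros)
  qed (auto simp: chr_lin intro!: holomorphic_intros)
  show "chr 0 = \<epsilon>"
    by (rule ext, rule clinear_eq_words) (simp_all add: chr eps_props eps_W)
  have bil: "cbilinear (\<lambda>b c::'a. chr z b * chr w c)"
    by (intro cbilinearI) (simp_all add: chr_lin distrib_left distrib_right scaleC_complex_def)
  show "tensor_lift (\<lambda>b c. chr z b * chr w c) (\<delta> x) = chr (z + w) x"
  proof (rule clinear_eq_words[where f = "\<lambda>x. tensor_lift (\<lambda>b c. chr z b * chr w c) (\<delta> x)"])
    show "clinear (\<lambda>x. tensor_lift (\<lambda>b c. chr z b * chr w c) (\<delta> x))"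
      by (rule clinear_compose[OF tensor_lift_clinear[OF bil] delta_props(1)])
    fix I J :: "'n list" assume IJ: "length I = length J"
    have "tensor_lift (\<lambda>b c. chr z b * chr w c) (\<delta> (W I J)) = (\<Sum>K\<in>Ln (length I). if K = I then (if I = J then cw (- z) I * cw (- w) I else 0) else 0)"
      unfolding delta_W[OF IJ] tensor_lift_sum[OF bil] using IJ by (intro sum.cong refl) (auto simp: chr)
    then show "tensor_lift (\<lambda>b c. chr z b * chr w c) (\<delta> (W I J)) = chr (z + w) (W I J)"
      using IJ cw_add[of "- z" "- w" I] by (auto simp: chr)
  qed (rule chr)
  show "chr z (star x) = cnj (chr (- cnj z) x)"
  proof (induction x rule: S_induct)
    case (mult a b x)
    have "chr (- cnj z) (v a b) = (if a = b then cw (cnj z) [a] else 0)" using chr(2)[of "[a]" "[b]" "- cnj z"] by simp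
    then show ?case using mult by (simp add: star_mult chr_mult chr_star_v cw_cnj)
  qed (simp_all add: star_add star_scaleC chr_lin chr_one)
  have ma: "conv_left G (chr a) (conv_right G x (chr b)) = ma (- b) (- a) x" for a b by (simp add: ma_def)
  show "\<kappa> (\<kappa> x) = conv_left G (chr (-1)) (conv_right G x (chr 1))"
    unfolding ma
  proof (rule clinear_eq_words[where f = "\<lambda>x. \<kappa> (\<kappa> x)"])
    show "clinear (\<lambda>x. \<kappa> (\<kappa> x))" by (rule clinear_compose[OF kappa_clinear kappa_clinear])
    fix I J :: "'n list" assume "length I = length J"
    then show "\<kappa> (\<kappa> (W I J)) = ma (- 1) (- (- 1)) (W I J)"
      by (simp add: kappa_W kappa_star_W ma_W cw_minus cw_one field_simps)
  qed (rule ma_clinear)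
  show "h (x * y) = h (y * conv_left G (chr 1) (conv_right G x (chr 1)))"
    unfolding ma using KMS'[of x y] by simp
qed

definition bs :: "'n \<Rightarrow> 'n list \<Rightarrow> complex" where
  "bs a = (\<lambda>I. if I = [a] then 1 else 0)"

lemma bs_VV: "L.VV (Suc 0) (bs a)" "R.VV (Suc 0) (bs a)"
  by (auto simp: L.VV_def R.VV_def bs_def)

lemma v_Cc: "v a b = L.Cc (Suc 0) (bs a) (bs b)"
proof -
  have "L.Cc (Suc 0) (bs a) (bs b) = (\<Oplus>c d. if c = a then if d = b then v a b else 0 else 0)"
    unfolding L.Cc_Suc by (intro sum.cong refl) (simp add: L.Cc_0 bs_def)
  then show ?thesis by (simp only: sum_delta2)
qed

lemma h_vv: "h (star (v a b) * v c d) = (if a = c \<and> b = d then complex_of_real (lam a / D) else 0)"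
proof -
  have ip1: "ip \<beta> (Suc 0) (bs i) (bs j) = (if i = j then complex_of_real (\<beta> i) else 0)" for \<beta> i j
  proof -
    have "ip \<beta> (Suc 0) (bs i) (bs j) = (\<Oplus>a. if a = i then (if i = j then complex_of_real (\<beta> i) else 0) else 0)"
      unfolding ip_Suc by (intro sum.cong refl) (simp add: ip_0 bs_def)
    then show ?thesis by simp
  qed
  have "h (star (v a b) * v c d) = LH.hh (L.Cc (Suc 0) (bs a) (bs b)) (L.Cc (Suc 0) (bs c) (bs d))"
    by (simp add: LH.hh_def flip: v_Cc)
  then show ?thesis by (simp add: LH.hh_Cc bs_VV ip1 LH.g_def)
qed

lemma v_independent:
  assumes "\<And>b. h (b * (\<Oplus>k l. c k l *\<^sub>C v k l)) = h (b * (\<Oplus>k l. d k l *\<^sub>C v k l))"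
  shows "c i j = d i j"
proof -
  have *: "h (star (v i j) * (\<Oplus>k l. c k l *\<^sub>C v k l)) = c i j * complex_of_real (lam i / D)" for c
  proof -
    have "h (star (v i j) * (\<Oplus>k l. c k l *\<^sub>C v k l)) = (\<Oplus>k l. if k = i then if l = j then c i j * complex_of_real (lam i / D) else 0 else 0)"
      unfolding sum_distrib_left h_simps scaleC_mult_right h_vv by (intro sum.cong refl) auto
    then show ?thesis by (simp only: sum_delta2)
  qed
  show ?thesis using assms[of "star (v i j)"] lam_pos[of i] D_gt_2 unfolding * by simp
qed

lemma char_eq:
  assumes f: "clinear f" "f 1 = 1" "\<And>a b. f (a * b) = f a * f b"
    and f': "clinear f'" "f' 1 = 1" "\<And>a b. f' (a * b) = f' a * f' b" and eq: "\<And>a b. f (v a b) = f' (v a b)"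
  shows "f x = (f' x :: complex)"
  by (induction x rule: S_induct) (simp_all add: clinearD[OF f(1)] clinearD[OF f'(1)] f(2,3) f'(2,3) eq)

text \<open>Let F z be the matrix of values of f z on \<open>v\<close>. For real parameters it is
  positive by the group law and the star condition; the trace formula determines F 1, positive
  square roots determine F at all 1 / 2^k, and holomorphy does the rest.\<close>

lemma woronowicz_unique:
  assumes f: "is_woronowicz_characters G f"
  shows "f = chr"
proof -
  note f' = f[unfolded is_woronowicz_characters_def]
  have lin: "clinear (f z)" and one: "f z 1 = 1" and mult: "f z (a * b) = f z a * f z b" for z a b using f' by auto
  have hol: "(\<lambda>z. f z a) holomorphic_on UNIV" for a using f' by auto
  have f0: "f 0 = \<epsilon>" using f' by auto
  have add: "tensor_lift (\<lambda>b c. f z b * f w c) (\<delta> a) = f (z + w) a" for z w a using f' by auto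
  have st: "f z (star a) = cnj (f (- cnj z) a)" for z a using f' by auto
  have hs: "h (a * b) = h (b * conv_left G (f 1) (conv_right G a (f 1)))" for a b using f' by auto
  define F where "F z i j = f z (v i j)" for z i j
  have bil: "cbilinear (\<lambda>b c::'a. f z b * f w c)" for z w
    by (intro cbilinearI) (simp_all add: clinearD[OF lin] distrib_left distrib_right scaleC_complex_def)
  have Fadd: "F (z + w) i j = (\<Oplus>k. F z i k * F w k j)" for z w i j
    using add[of z w "v i j"] by (simp add: F_def comult_v tensor_lift_sum[OF bil])
  have F0: "F 0 i j = (if i = j then 1 else 0)" for i j
    using eps_W[of "[i]" "[j]"] by (simp add: F_def f0)
  have Finv: "(\<Oplus>k. F z i k * cnj (F (- cnj z) j k)) = (if i = j then 1 else 0)" for z i j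
    using arg_cong[OF v_unitary(1)[of i j], of "f z"] by (simp add: clinearD[OF lin] mult one st F_def)
  have herm: "cnj (F (- cnj z) j i) = F (- z) i j" for z i j
  proof -
    have "F (- z) i j = (\<Oplus>k. F (- z) i k * (\<Oplus>l. F z k l * cnj (F (- cnj z) j l)))"
      unfolding Finv using sum_if_mult[of j 1 "F (- z) i"] by (simp add: mult.commute)
    also have "\<dots> = (\<Oplus>l. F (- z + z) i l * cnj (F (- cnj z) j l))"
      unfolding Fadd by (rule sum_mult_assoc)
    also have "\<dots> = (\<Oplus>l. (if l = i then 1 else 0) * cnj (F (- cnj z) j l))"
      by (intro sum.cong refl) (simp add: F0)
    finally show ?thesis unfolding sum_if_mult by simp
  qed
  have pos: "F (complex_of_real t) i j = (\<Oplus>k. F (complex_of_real (t / 2)) i k * cnj (F (complex_of_real (t / 2)) j k))" for t i j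
    using Fadd[of "complex_of_real (t/2)" "complex_of_real (t/2)" i j] herm[of "- complex_of_real (t/2)" _ _]
    by simp
  \<comment> \<open>The unknown family and \<open>sg\<close> satisfy the same trace formula, and the
    Haar state separates the coefficients of \<open>v\<close>. This gives the products of entries of
    F 1; positivity then removes the remaining sign.\<close>
  have F1: "F 1 i k * F 1 l j = (if i = k \<and> l = j then complex_of_real (1 / (lam i * lam j)) else 0)" for i j k l
  proof -
    have 1: "conv_left G (f 1) (conv_right G (v i j) (f 1)) = (\<Oplus>k l. (F 1 i k * F 1 l j) *\<^sub>C v k l)"
    proof -
      have "conv_right G (v i j) (f 1) = (\<Oplus>k. F 1 i k *\<^sub>C v k j)"
        by (simp add: conv_right_def comult_v tensor_lift_sum[OF bil_right[OF lin]] F_def)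
      moreover have "conv_left G (f 1) (v k j) = (\<Oplus>l. F 1 l j *\<^sub>C v k l)" for k
        by (simp add: conv_left_def comult_v tensor_lift_sum[OF bil_left[OF lin]] F_def)
      ultimately show ?thesis
        by (simp add: clinearD[OF conv_left_clinear[OF lin]] scaleC_sum_right scaleC_scaleC)
    qed
    have 2: "sg (v i j) = (\<Oplus>k l. (if i = k \<and> l = j then complex_of_real (1 / (lam i * lam j)) else 0) *\<^sub>C v k l)"
    proof -
      have "sg (v i j) = complex_of_real (1 / (lam i * lam j)) *\<^sub>C v i j"
        using ma_W[of "[i]" "[j]" "-1" "-1"] by (simp add: cw_minus cw_one field_simps)
      also have "\<dots> = (\<Oplus>k l. if k = i then if l = j then complex_of_real (1 / (lam i * lam j)) *\<^sub>C v i j else 0 else 0)"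
        by (simp only: sum_delta2)
      finally show ?thesis by (auto intro!: sum.cong)
    qed
    show ?thesis
      by (rule v_independent[where c = "\<lambda>k l. F 1 i k * F 1 l j" and d = "\<lambda>k l. if i = k \<and> l = j then complex_of_real (1 / (lam i * lam j)) else 0"])
        (unfold 1[symmetric] 2[symmetric] hs[symmetric], rule KMS')
  qed
  have F1d: "F 1 i j = (if i = j then complex_of_real (lam i powr (- 1)) else 0)" for i j
  proof (rule matrix_positive_root_unique[where B = "F (complex_of_real (1/2))"])
    show "F 1 i j = (\<Oplus>k. F (complex_of_real (1/2)) i k * cnj (F (complex_of_real (1/2)) j k))" for i j
      using pos[of 1 i j] by simp
    show "(\<Oplus>k. F 1 i k * F 1 k j) = (if i = j then complex_of_real ((lam i powr (- 1))\<^sup>2) else 0)" for i j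
    proof -
      have "(\<Oplus>k. F 1 i k * F 1 k j) = (\<Oplus>k. if k = i then (if i = j then complex_of_real (1 / (lam i * lam j)) else 0) else 0)"
        unfolding F1 by (intro sum.cong refl) auto
      then show ?thesis using lam_pos[of i] by (auto simp: powr_minus power2_eq_square divide_inverse abs_of_pos)
    qed
    show "0 < lam i powr (- 1)" for i using lam_pos[of i] by simp
  qed
  \<comment> \<open>By \<open>pos\<close>, the matrix at t is B B^* with B the matrix at t / 2, so
    each halving of the parameter takes the unique positive square root.\<close>
  have Fk: "F (complex_of_real (1 / 2 ^ k)) i j = (if i = j then complex_of_real (lam i powr (- (1 / 2 ^ k))) else 0)" for k i j
  proof (induction k arbitrary: i j)
    case 0 then show ?case using F1d[of i j] by simp
  next
    case (Suc k)
    let ?t = "1 / 2 ^ Suc k :: real"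
    show ?case
    proof (rule matrix_positive_root_unique[where B = "F (complex_of_real (?t/2))"])
      show "F (complex_of_real ?t) i j = (\<Oplus>l. F (complex_of_real (?t/2)) i l * cnj (F (complex_of_real (?t/2)) j l))" for i j
        by (rule pos)
      show "(\<Oplus>l. F (complex_of_real ?t) i l * F (complex_of_real ?t) l j) = (if i = j then complex_of_real ((lam i powr (- ?t))\<^sup>2) else 0)" for i j
      proof -
        have e: "complex_of_real ?t + complex_of_real ?t = complex_of_real (1 / 2 ^ k)" by simp
        have p2: "(lam i powr (- ?t))\<^sup>2 = lam i powr (- (1 / 2 ^ k))"
          by (simp add: power2_eq_square flip: powr_add)
        show ?thesis
          by (rule trans[OF Fadd[of "complex_of_real ?t" "complex_of_real ?t" i j, unfolded e Suc.IH, symmetric]]) (simp only: p2)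
      qed
      show "0 < lam i powr (- ?t)" for i using lam_pos[of i] by simp
    qed
  qed
  have dyadic: "f (complex_of_real (1 / 2 ^ k)) x = chr (complex_of_real (1 / 2 ^ k)) x" for k x
  proof (rule char_eq)
    fix a b
    have "chr (complex_of_real (1 / 2 ^ k)) (v a b) = (if a = b then complex_of_real (lam a powr (- (1 / 2 ^ k))) else 0)"
      using chr(2)[of "[a]" "[b]" "complex_of_real (1 / 2 ^ k)"] cw_of_real[of "- (1 / 2 ^ k)" "[a]"] by (auto simp: rw_def)
    then show "f (complex_of_real (1 / 2 ^ k)) (v a b) = chr (complex_of_real (1 / 2 ^ k)) (v a b)"
      using Fk[of k a b] by (simp add: F_def)
  qed (simp_all add: lin one mult chr chr_one chr_mult)
  have "f z x - chr z x = 0" for z x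
  proof (rule analytic_continuation[where f = "\<lambda>z. f z x - chr z x" and w = z and S = UNIV and U = "range (\<lambda>k. complex_of_real (1 / 2 ^ k))" and \<xi> = 0])
    show "(\<lambda>z. f z x - chr z x) holomorphic_on UNIV"
      using hol[of x] woronowicz_exists by (auto simp: is_woronowicz_characters_def intro!: holomorphic_intros)
    have "(\<lambda>k. complex_of_real (1 / 2 ^ k)) \<longlonglongrightarrow> complex_of_real 0"
      by (intro tendsto_of_real) (use LIMSEQ_power_zero[of "1/2::real"] in \<open>simp add: power_one_over\<close>)
    then show "0 islimpt range (\<lambda>k. complex_of_real (1 / 2 ^ k))"
      unfolding islimpt_sequential by (intro exI[of _ "\<lambda>k. complex_of_real (1 / 2 ^ k)"]) auto
    show "f z x - chr z x = 0" if "z \<in> range (\<lambda>k. complex_of_real (1 / 2 ^ k))" for z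
      using that dyadic by auto
  \<comment> \<open>The points 1 / 2^k accumulate at 0 and the difference is entire, so the identity
    theorem applies.\<close>
  qed auto
  then show ?thesis by (auto simp: fun_eq_iff)
qed

lemma woronowicz_char: "woronowicz_char G = chr"
  unfolding woronowicz_char_def by (rule the_equality) (rule woronowicz_exists woronowicz_unique, assumption?)+

lemma unitary_antipode: "unitary_antipode G x = \<kappa> (rma (1/2) (-1/2) x)"
  by (simp add: unitary_antipode_def woronowicz_char ma_def)

end

lemma pr_best: "z \<in> ccspan X \<Longrightarrow> norm (x - pr X x) \<le> norm (x - z)"
proof -
  assume z: "z \<in> ccspan X"
  have "pr X x - z \<in> ccspan X" by (rule csubspaceD(4)[OF csubspace_ccspan]) (simp_all add: z)
  then have "cinner (x - pr X x) (pr X x - z) = 0" using pr_orth orth_commute by blast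
  then have "(norm ((x - pr X x) + (pr X x - z)))\<^sup>2 = (norm (x - pr X x))\<^sup>2 + (norm (pr X x - z))\<^sup>2"
    by (rule norm_add_orthogonal)
  then have "(norm (x - pr X x))\<^sup>2 \<le> (norm (x - z))\<^sup>2" by simp
  then show ?thesis by (rule power2_le_imp_le) simp
qed

context ao_group
begin

subsection \<open>The modular conjugation\<close>

lemma tot_L: "ccspan (range \<Lambda>) = UNIV"
proof -
  have "closure (range \<Lambda>) = UNIV" using gnsm by (simp add: gns_map_def)
  moreover have "range \<Lambda> \<subseteq> cspan (range \<Lambda>)" by (rule complex_vector.span_superset)
  ultimately show ?thesis using closure_mono unfolding ccspan_def by blast
qed

definition LW :: "'h set" where
  "LW = {\<Lambda> (W I J) | I J. length I = length J}"

lemma Lx_LW: "\<Lambda> x \<in> cspan LW"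
proof (induction x rule: W_induct)
  case (word I J)
  then show ?case by (intro complex_vector.span_base) (auto simp: LW_def)
qed (auto simp: \<Lambda>_simps complex_vector.span_add complex_vector.span_scale)

lemma tot_LW: "ccspan LW = UNIV"
proof -
  have "ccspan (range \<Lambda>) \<subseteq> ccspan LW"
    by (rule ccspan_minimal) (use Lx_LW closure_subset[of "cspan LW"] in \<open>auto simp: ccspan_def[of LW]\<close>, simp_all flip: ccspan_def)
  then show ?thesis by (simp only: tot_L top.extremum_unique)
qed

text \<open>By KMS, moving one factor past the other costs the weight 1 / lam on both indices; the
  exponents 1/2 on the two factors compensate it symmetrically. This twisted star is therefore the
  antiunitary part of the star operation.\<close>

lemma J_gram: "cinner (\<Lambda> (star (rma (1/2) (1/2) x))) (\<Lambda> (star (rma (1/2) (1/2) y))) = cnj (cinner (\<Lambda> x) (\<Lambda> y))"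
proof -
  have "h (rma (1/2) (1/2) x * star (rma (1/2) (1/2) y)) = h (rma (-1/2) (-1/2) (star y * x))"
    by (simp add: KMS ma_ma ma_mult ma_star)
  also have "\<dots> = h (star (star x * y))" by (simp only: h_rma star_mult star_star)
  finally show ?thesis by (simp add: cinner_gns star_star h_star)
qed

lemma J_ex: "\<exists>T. bounded_linear T \<and> (\<forall>c x. T (c *\<^sub>C x) = cnj c *\<^sub>C T x) \<and> (\<forall>x. T (\<Lambda> x) = \<Lambda> (star (rma (1/2) (1/2) x)))"
  by (rule isometry_extension[of cnj "\<lambda>x. \<Lambda> (star (rma (1/2) (1/2) x))" \<Lambda>]) (simp, rule J_gram, rule tot_L, blast)

definition J0 :: "'h \<Rightarrow> 'h" where
  "J0 = (SOME T. bounded_linear T \<and> (\<forall>c x. T (c *\<^sub>C x) = cnj c *\<^sub>C T x) \<and> (\<forall>x. T (\<Lambda> x) = \<Lambda> (star (rma (1/2) (1/2) x))))"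

lemma J0: "bounded_linear J0" "J0 (c *\<^sub>C \<xi>) = cnj c *\<^sub>C J0 \<xi>" "J0 (\<Lambda> x) = \<Lambda> (star (rma (1/2) (1/2) x))"
  using someI_ex[OF J_ex] by (simp_all add: J0_def)

lemma J0_J0 [simp]: "J0 (J0 \<xi>) = \<xi>"
proof (rule eq_on_ccspan[where X = "range \<Lambda>" and \<sigma> = id])
  show "bounded_linear (\<lambda>\<xi>. J0 (J0 \<xi>))" by (rule bounded_linear_compose[OF J0(1) J0(1)])
  show "J0 (J0 \<xi>) = \<xi>" if "\<xi> \<in> range \<Lambda>" for \<xi>
    using that by (auto simp: J0 ma_star ma_ma star_star)
qed (simp_all add: J0 tot_L)

lemma cinner_J0: "cinner (J0 \<xi>) (J0 \<eta>) = cinner \<eta> \<xi>"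
  using isometry_sesqui[of J0 cnj "range \<Lambda>" \<xi> \<eta>, OF J0(1,2)] J_gram tot_L by (force simp: J0(3) simp flip: cinner_commute)

lemma antiunitary_J0: "antiunitary J0"
  unfolding antiunitary_def
proof (intro conjI allI)
  show "surj J0" by (rule surjI[of J0 J0]) simp
  show "J0 (x + y) = J0 x + J0 y" for x y using J0(1) by (simp add: linear_simps)
qed (simp_all add: J0 cinner_J0)

abbreviation mh :: "'a \<Rightarrow> 'a" where "mh \<equiv> rma (-1/2) (-1/2)"

text \<open>The graph of the candidate for the square root of the modular operator:
  \<open>J0\<close> composed with the closure of the star operation.\<close>

definition P0 :: "('h \<times> 'h) set" where
  "P0 = {(\<xi>, \<eta>). (\<xi>, J0 \<eta>) \<in> tomita_graph G}"

lemma P0_iff: "(\<xi>, \<eta>) \<in> P0 \<longleftrightarrow> (\<exists>x. (\<lambda>n. \<Lambda> (x n)) \<longlonglongrightarrow> \<xi> \<and> (\<lambda>n. \<Lambda> (mh (x n))) \<longlonglongrightarrow> \<eta>)"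
proof
  assume "(\<xi>, \<eta>) \<in> P0"
  then have "(\<xi>, J0 \<eta>) \<in> closure {(\<Lambda> x, \<Lambda> (star x)) | x. True}" by (simp add: P0_def tomita_graph_def)
  then obtain f where f: "\<And>n. f n \<in> {(\<Lambda> x, \<Lambda> (star x)) | x. True}" "f \<longlonglongrightarrow> (\<xi>, J0 \<eta>)"
    by (auto simp: closure_sequential)
  have "\<exists>x. \<forall>n. f n = (\<Lambda> (x n), \<Lambda> (star (x n)))" by (rule choice) (use f(1) in auto)
  then obtain x where x: "f = (\<lambda>n. (\<Lambda> (x n), \<Lambda> (star (x n))))" by (auto simp: fun_eq_iff)
  have 1: "(\<lambda>n. \<Lambda> (x n)) \<longlonglongrightarrow> \<xi>" and 2: "(\<lambda>n. \<Lambda> (star (x n))) \<longlonglongrightarrow> J0 \<eta>"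
    using tendsto_fst[OF f(2)] tendsto_snd[OF f(2)] by (simp_all add: x)
  have "(\<lambda>n. J0 (\<Lambda> (star (x n)))) \<longlonglongrightarrow> J0 (J0 \<eta>)" by (rule bounded_linear.tendsto[OF J0(1) 2])
  then show "\<exists>x. (\<lambda>n. \<Lambda> (x n)) \<longlonglongrightarrow> \<xi> \<and> (\<lambda>n. \<Lambda> (mh (x n))) \<longlonglongrightarrow> \<eta>"
    using 1 by (auto simp: J0 ma_star star_star)
next
  assume "\<exists>x. (\<lambda>n. \<Lambda> (x n)) \<longlonglongrightarrow> \<xi> \<and> (\<lambda>n. \<Lambda> (mh (x n))) \<longlonglongrightarrow> \<eta>"
  then obtain x where x: "(\<lambda>n. \<Lambda> (x n)) \<longlonglongrightarrow> \<xi>" "(\<lambda>n. \<Lambda> (mh (x n))) \<longlonglongrightarrow> \<eta>" by blast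
  have "(\<lambda>n. J0 (\<Lambda> (mh (x n)))) \<longlonglongrightarrow> J0 \<eta>" by (rule bounded_linear.tendsto[OF J0(1) x(2)])
  then have "(\<lambda>n. \<Lambda> (star (x n))) \<longlonglongrightarrow> J0 \<eta>" by (simp add: J0 ma_ma)
  then have "(\<lambda>n. (\<Lambda> (x n), \<Lambda> (star (x n)))) \<longlonglongrightarrow> (\<xi>, J0 \<eta>)" using x(1) by (intro tendsto_Pair)
  then have "(\<xi>, J0 \<eta>) \<in> closure {(\<Lambda> x, \<Lambda> (star x)) | x. True}"
    by (rule closure_sequential[THEN iffD2, OF exI, OF conjI, rotated]) auto
  then show "(\<xi>, \<eta>) \<in> P0" by (simp add: P0_def tomita_graph_def)
qed

lemma P0_L: "(\<Lambda> x, \<Lambda> (mh x)) \<in> P0"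
proof -
  have "(\<Lambda> x, \<Lambda> (star x)) \<in> tomita_graph G" unfolding tomita_graph_def by (rule subsetD[OF closure_subset]) blast
  then show ?thesis by (simp add: P0_def J0 ma_ma)
qed

lemma closed_P0: "closed P0"
proof -
  have "P0 = (\<lambda>p. (fst p, J0 (snd p))) -` tomita_graph G" by (auto simp: P0_def)
  moreover have "closed (tomita_graph G)" by (simp add: tomita_graph_def)
  ultimately show ?thesis
    by (auto intro!: closed_vimage continuous_intros bounded_linear.continuous_on[OF J0(1)])
qed

lemma P0_add: "(\<xi>, \<eta>) \<in> P0 \<Longrightarrow> (\<xi>', \<eta>') \<in> P0 \<Longrightarrow> (\<xi> + \<xi>', \<eta> + \<eta>') \<in> P0"
proof -
  assume "(\<xi>, \<eta>) \<in> P0" "(\<xi>', \<eta>') \<in> P0"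
  then obtain x x' where x: "(\<lambda>n. \<Lambda> (x n)) \<longlonglongrightarrow> \<xi>" "(\<lambda>n. \<Lambda> (mh (x n))) \<longlonglongrightarrow> \<eta>"
    and x': "(\<lambda>n. \<Lambda> (x' n)) \<longlonglongrightarrow> \<xi>'" "(\<lambda>n. \<Lambda> (mh (x' n))) \<longlonglongrightarrow> \<eta>'" by (auto simp: P0_iff)
  show ?thesis unfolding P0_iff
    using tendsto_add[OF x(1) x'(1)] tendsto_add[OF x(2) x'(2)]
    by (intro exI[of _ "\<lambda>n. x n + x' n"]) (simp add: \<Lambda>_simps ma_lin)
qed

lemma P0_symmetric: "(\<xi>, \<eta>) \<in> P0 \<Longrightarrow> (\<xi>', \<eta>') \<in> P0 \<Longrightarrow> cinner \<eta> \<xi>' = cinner \<xi> \<eta>'"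
proof -
  assume "(\<xi>, \<eta>) \<in> P0" "(\<xi>', \<eta>') \<in> P0"
  then obtain x x' where x: "(\<lambda>n. \<Lambda> (x n)) \<longlonglongrightarrow> \<xi>" "(\<lambda>n. \<Lambda> (mh (x n))) \<longlonglongrightarrow> \<eta>"
    and x': "(\<lambda>n. \<Lambda> (x' n)) \<longlonglongrightarrow> \<xi>'" "(\<lambda>n. \<Lambda> (mh (x' n))) \<longlonglongrightarrow> \<eta>'" by (auto simp: P0_iff)
  have "(\<lambda>n. cinner (\<Lambda> (mh (x n))) (\<Lambda> (x' n))) \<longlonglongrightarrow> cinner \<eta> \<xi>'" by (rule tendsto_cinner[OF x(2) x'(1)])
  moreover have "(\<lambda>n. cinner (\<Lambda> (x n)) (\<Lambda> (mh (x' n)))) \<longlonglongrightarrow> cinner \<xi> \<eta>'" by (rule tendsto_cinner[OF x(1) x'(2)])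
  ultimately show ?thesis
    using rma_symmetric[of _ "-1/2" "-1/2"] by (auto intro: LIMSEQ_unique)
qed

lemma P0_nonneg: "(\<xi>, \<eta>) \<in> P0 \<Longrightarrow> cinner \<xi> \<eta> \<in> \<real>\<^sub>\<ge>\<^sub>0"
proof -
  assume "(\<xi>, \<eta>) \<in> P0"
  then obtain x where x: "(\<lambda>n. \<Lambda> (x n)) \<longlonglongrightarrow> \<xi>" "(\<lambda>n. \<Lambda> (mh (x n))) \<longlonglongrightarrow> \<eta>" by (auto simp: P0_iff)
  have *: "cinner (\<Lambda> y) (\<Lambda> (mh y)) \<in> \<real>\<^sub>\<ge>\<^sub>0" for y
  proof -
    have "cinner (\<Lambda> y) (\<Lambda> (mh y)) = cinner (\<Lambda> y) (\<Lambda> (rma (-1/4) (-1/4) (rma (-1/4) (-1/4) y)))"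
      by (simp add: ma_ma)
    then show ?thesis by (simp only: rma_symmetric cinner_self) simp
  qed
  have "(\<lambda>n. cinner (\<Lambda> (x n)) (\<Lambda> (mh (x n)))) \<longlonglongrightarrow> cinner \<xi> \<eta>" by (rule tendsto_cinner[OF x])
  then show ?thesis by (rule closed_sequentially[OF closed_nonneg_Reals_complex, rotated]) (rule *)
qed

definition mu :: "'n list \<Rightarrow> 'n list \<Rightarrow> real" where
  "mu I J = lw (rw (-1/2)) I * lw (rw (-1/2)) J"

lemma mu_pos: "mu I J > 0"
proof -
  have "rw t i > 0" for t i using lam_pos[of i] by (simp add: rw_def)
  then show ?thesis unfolding mu_def by (intro mult_pos_pos lw_pos)
qed

lemma mh_W: "length I = length J \<Longrightarrow> mh (W I J) = complex_of_real (mu I J) *\<^sub>C W I J"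
  by (simp only: ma_W cw_of_real mu_def of_real_mult)

text \<open>The words on which \<open>mh\<close> acts by the scalar \<open>r\<close>; the positive
  part of the star operation is diagonal along these mutually orthogonal sets.\<close>

definition XE :: "real \<Rightarrow> 'h set" where
  "XE r = {\<Lambda> (W I J) | I J. length I = length J \<and> mu I J = r}"

lemma XE_mh: "\<xi> \<in> XE r \<Longrightarrow> \<exists>x. \<xi> = \<Lambda> x \<and> mh x = complex_of_real r *\<^sub>C x"
  unfolding XE_def using mh_W by blast

lemma XE_orth: "\<xi> \<in> XE r \<Longrightarrow> \<eta> \<in> XE r' \<Longrightarrow> r \<noteq> r' \<Longrightarrow> cinner \<xi> \<eta> = 0"
proof -
  assume "\<xi> \<in> XE r" "\<eta> \<in> XE r'" "r \<noteq> r'"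
  then obtain x y where "\<xi> = \<Lambda> x" "mh x = complex_of_real r *\<^sub>C x" "\<eta> = \<Lambda> y" "mh y = complex_of_real r' *\<^sub>C y" using XE_mh by blast
  then show ?thesis using rma_symmetric[of x "-1/2" "-1/2" y] \<open>r \<noteq> r'\<close> by (simp add: \<Lambda>_simps cinner_simps)
qed

text \<open>On the span of eigenvectors the twist \<open>mh\<close> is scalar multiplication, so the
  images of an approximating sequence converge as well.\<close>

lemma P0_eigen: "\<xi> \<in> ccspan (XE r) \<Longrightarrow> (\<xi>, complex_of_real r *\<^sub>C \<xi>) \<in> P0"
proof -
  assume "\<xi> \<in> ccspan (XE r)"
  have span: "\<exists>x. \<eta> = \<Lambda> x \<and> mh x = complex_of_real r *\<^sub>C x" if "\<eta> \<in> cspan (XE r)" for \<eta>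
    using that
  proof (induction rule: complex_vector.span_induct_alt)
    case base then show ?case by (intro exI[of _ 0]) (simp add: \<Lambda>_simps ma_lin)
  next
    case (step c x y)
    then obtain a b where "x = \<Lambda> a" "mh a = complex_of_real r *\<^sub>C a" "y = \<Lambda> b" "mh b = complex_of_real r *\<^sub>C b" using XE_mh by blast
    then show ?case by (intro exI[of _ "c *\<^sub>C a + b"]) (simp add: \<Lambda>_simps ma_lin scaleC_add_right scaleC_scaleC mult.commute)
  qed
  obtain f where f: "\<And>n. f n \<in> cspan (XE r)" "f \<longlonglongrightarrow> \<xi>" using \<open>\<xi> \<in> ccspan (XE r)\<close> unfolding ccspan_def closure_sequential by blast
  have "\<exists>x. \<forall>n. f n = \<Lambda> (x n) \<and> mh (x n) = complex_of_real r *\<^sub>C x n" by (rule choice) (use span f(1) in auto)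
  then obtain x where x: "\<And>n. f n = \<Lambda> (x n)" "\<And>n. mh (x n) = complex_of_real r *\<^sub>C x n" by blast
  have 1: "(\<lambda>n. \<Lambda> (x n)) \<longlonglongrightarrow> \<xi>" using f(2) by (simp flip: x(1))
  have "(\<lambda>n. \<Lambda> (mh (x n))) \<longlonglongrightarrow> complex_of_real r *\<^sub>C \<xi>"
    unfolding x(2) \<Lambda>_simps by (rule bounded_linear.tendsto[OF bounded_linear_scaleC 1])
  then show ?thesis using 1 unfolding P0_iff by blast
qed

text \<open>The adjoint relation holds componentwise along the eigenspaces, so projections of the
  pair onto finitely many of them lie in \<open>P0\<close>. They converge to the pair, since every
  combination of words involves finitely many eigenvalues, and \<open>P0\<close> is closed.\<close>

lemma P0_maximal:
  assumes vw: "\<And>x. cinner (\<Lambda> (mh x)) \<xi> = cinner (\<Lambda> x) \<eta>"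
  shows "(\<xi>, \<eta>) \<in> P0"
proof -
  have 1: "pr (XE r) \<eta> = complex_of_real r *\<^sub>C pr (XE r) \<xi>" for r
  proof (rule pr_eqI)
    show "complex_of_real r *\<^sub>C pr (XE r) \<xi> \<in> ccspan (XE r)" by (rule csubspaceD(3)[OF csubspace_ccspan]) simp
    fix \<zeta> assume z: "\<zeta> \<in> XE r"
    then obtain x where x: "\<zeta> = \<Lambda> x" "mh x = complex_of_real r *\<^sub>C x" using XE_mh by blast
    have "cinner \<zeta> (pr (XE r) \<xi>) = cinner \<zeta> \<xi>" using z ccspan_superset by (intro pr_cinner) blast
    then show "cinner \<zeta> (\<eta> - complex_of_real r *\<^sub>C pr (XE r) \<xi>) = 0"
      using vw[of x] unfolding x by (simp add: \<Lambda>_simps cinner_simps)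
  qed
  have 2: "(pr (\<Union> (XE ` A)) \<xi>, pr (\<Union> (XE ` A)) \<eta>) \<in> P0" if "finite A" for A
    using that
  proof induction
    case empty
    have "pr {} \<xi> = 0" for \<xi> :: 'h by (rule pr_zero) simp
    then show ?case using P0_L[of 0] by (simp add: \<Lambda>_simps ma_lin)
  next
    case (insert r A)
    have "pr (\<Union> (XE ` insert r A)) \<zeta> = pr (XE r) \<zeta> + pr (\<Union> (XE ` A)) \<zeta>" for \<zeta>
      using insert.hyps XE_orth by (simp, intro pr_Un) blast
    then show ?case using P0_add[OF P0_eigen[of "pr (XE r) \<xi>" r] insert.IH] by (simp add: 1)
  qed
  have 3: "\<exists>A. finite A \<and> \<zeta> \<in> cspan (\<Union> (XE ` A))" if "\<zeta> \<in> cspan LW" for \<zeta>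
    using that
  proof (induction rule: complex_vector.span_induct_alt)
    case base then show ?case by (intro exI[of _ "{}"]) (simp add: complex_vector.span_zero)
  next
    case (step c x y)
    then obtain A I J where A: "finite A" "y \<in> cspan (\<Union> (XE ` A))" and I: "x = \<Lambda> (W I J)" "length I = length J" by (auto simp: LW_def)
    have "x \<in> cspan (\<Union> (XE ` insert (mu I J) A))" by (rule complex_vector.span_base) (use I in \<open>auto simp: XE_def\<close>)
    moreover have "y \<in> cspan (\<Union> (XE ` insert (mu I J) A))" using A(2) complex_vector.span_mono[of "\<Union> (XE ` A)"] by auto
    ultimately show ?case using A(1)
      by (intro exI[of _ "insert (mu I J) A"]) (auto intro: complex_vector.span_add complex_vector.span_scale)
  qed
  have 4: "\<exists>A. finite A \<and> (\<forall>B. A \<subseteq> B \<longrightarrow> norm (\<zeta> - pr (\<Union> (XE ` B)) \<zeta>) < e)" if "0 < e" for \<zeta> e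
  proof -
    have "\<zeta> \<in> closure (cspan LW)" using tot_LW by (simp add: ccspan_def)
    then obtain z where z: "z \<in> cspan LW" "dist z \<zeta> < e" using \<open>0 < e\<close> closure_approachable by blast
    obtain A where A: "finite A" "z \<in> cspan (\<Union> (XE ` A))" using 3[OF z(1)] by blast
    have "norm (\<zeta> - pr (\<Union> (XE ` B)) \<zeta>) < e" if "A \<subseteq> B" for B
    proof -
      have "z \<in> cspan (\<Union> (XE ` B))" using A(2) complex_vector.span_mono[of "\<Union> (XE ` A)" "\<Union> (XE ` B)"] that by blast
      then have "z \<in> ccspan (\<Union> (XE ` B))" unfolding ccspan_def using closure_subset by blast
      then have "norm (\<zeta> - pr (\<Union> (XE ` B)) \<zeta>) \<le> norm (\<zeta> - z)" by (rule pr_best)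
      then show ?thesis using z(2) by (simp add: dist_norm norm_minus_commute)
    qed
    then show ?thesis using A(1) by blast
  qed
  have "(\<xi>, \<eta>) \<in> closure P0"
  proof (rule closure_approachable[THEN iffD2], intro allI impI)
    fix e :: real assume e: "0 < e"
    obtain A where A: "finite A" "\<And>B. A \<subseteq> B \<Longrightarrow> norm (\<xi> - pr (\<Union> (XE ` B)) \<xi>) < e / 2" using 4[of "e / 2" \<xi>] e by auto
    obtain A' where A': "finite A'" "\<And>B. A' \<subseteq> B \<Longrightarrow> norm (\<eta> - pr (\<Union> (XE ` B)) \<eta>) < e / 2" using 4[of "e / 2" \<eta>] e by auto
    let ?B = "A \<union> A'" and ?X = "\<Union> (XE ` (A \<union> A'))"
    have "dist (pr ?X \<xi>, pr ?X \<eta>) (\<xi>, \<eta>) \<le> dist (pr ?X \<xi>) \<xi> + dist (pr ?X \<eta>) \<eta>"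
      unfolding dist_Pair_Pair by (rule sqrt_sum_squares_le_sum) simp_all
    also have "\<dots> < e / 2 + e / 2"
      using A(2)[of ?B] A'(2)[of ?B] by (intro add_strict_mono) (simp_all add: dist_norm norm_minus_commute)
    finally show "\<exists>p\<in>P0. dist p (\<xi>, \<eta>) < e" using 2[of ?B] A(1) A'(1) by (intro bexI[of _ "(pr ?X \<xi>, pr ?X \<eta>)"]) auto
  qed
  then show ?thesis using closed_P0 by simp
qed

lemma pos_self_adjoint_P0: "pos_self_adjoint P0"
  unfolding pos_self_adjoint_def
proof (intro conjI ballI)
  have "(v, w) \<in> P0" if "\<forall>(x, y)\<in>P0. cinner y v = cinner x w" for v w
    by (rule P0_maximal) (use that P0_L in blast)
  then show "P0 = {(v, w). \<forall>(x, y)\<in>P0. cinner y v = cinner x w}"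
    using P0_symmetric by blast
  show "case p of (x, y) \<Rightarrow> cinner x y \<in> \<real>\<^sub>\<ge>\<^sub>0" if "p \<in> P0" for p
    using that P0_nonneg by auto
qed

text \<open>For an eigenvector \<xi> with eigenvalue r > 0 let J1 w = J0 \<xi>. Both (\<xi>, r w)
  and, by self-adjointness, (w, r \<xi>) belong to the second positive graph. Positivity at their
  difference reads - r |\<xi> - w|^2 \<ge> 0, so w = \<xi>.\<close>

lemma modular_conj_unique:
  assumes J1: "antiunitary J1" and P1: "pos_self_adjoint {(\<xi>, \<eta>). (\<xi>, J1 \<eta>) \<in> tomita_graph G}"
  shows "J1 = J0"
proof -
  let ?P1 = "{(\<xi>, \<eta>). (\<xi>, J1 \<eta>) \<in> tomita_graph G}"
  have J1': "surj J1" "\<And>x y. J1 (x + y) = J1 x + J1 y" "\<And>c x. J1 (c *\<^sub>C x) = cnj c *\<^sub>C J1 x" "\<And>x y. cinner (J1 x) (J1 y) = cinner y x"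
    using J1 by (auto simp: antiunitary_def)
  have nJ1: "norm (J1 x) = norm x" for x
  proof -
    have "complex_of_real ((norm (J1 x))\<^sup>2) = complex_of_real ((norm x)\<^sup>2)" using J1'(4)[of x x] by (simp only: cinner_self)
    then show ?thesis by (simp only: of_real_eq_iff power2_eq_iff_nonneg norm_ge_zero)
  qed
  have bl: "bounded_linear J1"
    by (rule bounded_linear_intro[where K = 1]) (simp_all add: J1' scaleR_scaleC nJ1)
  have sa: "?P1 = {(v, w). \<forall>(x, y)\<in>?P1. cinner y v = cinner x w}" and nn: "\<And>p. p \<in> ?P1 \<Longrightarrow> (case p of (x, y) \<Rightarrow> cinner x y \<in> \<real>\<^sub>\<ge>\<^sub>0)"
    using P1 unfolding pos_self_adjoint_def by blast+
  have P1_iff: "(v, w) \<in> ?P1 \<longleftrightarrow> (\<forall>x y. (x, J1 y) \<in> tomita_graph G \<longrightarrow> cinner y v = cinner x w)" for v w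
    by (subst sa) auto
  have "J1 \<xi> = J0 \<xi>" if "\<xi> \<in> LW" for \<xi>
  proof -
    obtain I J where IJ: "\<xi> = \<Lambda> (W I J)" "length I = length J" using \<open>\<xi> \<in> LW\<close> by (auto simp: LW_def)
    define x where "x = W I J"
    define r where "r = mu I J"
    have x: "\<xi> = \<Lambda> x" "mh x = complex_of_real r *\<^sub>C x" and r: "r > 0"
      using mh_W IJ by (simp_all only: x_def r_def mu_pos)
    have P0x: "(\<xi>, complex_of_real r *\<^sub>C \<xi>) \<in> P0" using P0_L[of x] unfolding x by (simp add: \<Lambda>_simps)
    obtain w where w: "J1 w = J0 \<xi>" using J1'(1) by (metis surjD)
    have 1: "(\<xi>, complex_of_real r *\<^sub>C w) \<in> ?P1"
      using P0x by (simp add: P0_def J1'(3) J0(2) w)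
    have 2: "(w, complex_of_real r *\<^sub>C \<xi>) \<in> ?P1"
      unfolding P1_iff
    proof (intro allI impI)
      fix a b assume ab: "(a, J1 b) \<in> tomita_graph G"
      have "(a, J0 (J1 b)) \<in> P0" using ab by (simp add: P0_def)
      then have "cinner (J0 (J1 b)) \<xi> = cinner a (complex_of_real r *\<^sub>C \<xi>)" using P0x by (rule P0_symmetric)
      moreover have "cinner b w = cinner (J0 (J1 b)) \<xi>"
        using J1'(4)[of w b] cinner_J0[of \<xi> "J0 (J1 b)"] by (simp add: w)
      ultimately show "cinner b w = cinner a (complex_of_real r *\<^sub>C \<xi>)" by simp
    qed
    have "(\<xi> - w, complex_of_real r *\<^sub>C (w - \<xi>)) \<in> ?P1"
      using 1 2 unfolding P1_iff by (simp add: cinner_simps scaleC_diff_right)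
    then have "cinner (\<xi> - w) (complex_of_real r *\<^sub>C (w - \<xi>)) \<in> \<real>\<^sub>\<ge>\<^sub>0" using nn by blast
    moreover have "cinner (\<xi> - w) (complex_of_real r *\<^sub>C (w - \<xi>)) = complex_of_real (- r * (norm (\<xi> - w))\<^sup>2)"
    proof -
      have "w - \<xi> = - (\<xi> - w)" by simp
      then have "cinner (\<xi> - w) (complex_of_real r *\<^sub>C (w - \<xi>)) = - (complex_of_real r * cinner (\<xi> - w) (\<xi> - w))"
        by (simp only: cinner_scaleC_right cinner_minus_right mult_minus_right)
      then show ?thesis by (simp only: cinner_self) simp
    qed
    ultimately have "0 \<le> - r * (norm (\<xi> - w))\<^sup>2" by (simp only: nonneg_Reals_of_real_iff)
    then have "(norm (\<xi> - w))\<^sup>2 \<le> 0" using r by (simp add: mult_le_0_iff)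
    then have "\<xi> = w" by simp
    then show ?thesis using w by simp
  qed
  then have "J1 \<xi> = J0 \<xi>" for \<xi>
    by (rule eq_on_ccspan[where X = LW and \<sigma> = cnj, OF bl J0(1) J1'(3) J0(2)]) (simp_all add: tot_LW)
  then show ?thesis by (rule ext)
qed

lemma modular_conj: "modular_conj G = J0"
  unfolding modular_conj_def
proof (rule the_equality)
  show "antiunitary J0 \<and> pos_self_adjoint {(\<xi>, \<eta>). (\<xi>, J0 \<eta>) \<in> tomita_graph G}"
    using antiunitary_J0 pos_self_adjoint_P0 by (simp add: P0_def)
qed (use modular_conj_unique in blast)

subsection \<open>The unitary of the Kac system\<close>

text \<open>The unitary of the Kac system on the level of the algebra: the antipode with a modular
  twist, which is trivial when all \<open>lam\<close> are 1.\<close>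

definition U0 :: "'a \<Rightarrow> 'a" where
  "U0 x = \<kappa> (ma 1 0 x)"

lemma U0_clinear: "clinear U0"
  unfolding U0_def[abs_def] by (rule clinear_compose[OF kappa_clinear ma_clinear])

lemma U0_W: "length I = length J \<Longrightarrow> U0 (W I J) = complex_of_real (lw lam I) *\<^sub>C star (W J I)"
  by (simp add: U0_def ma_W clinearD[OF kappa_clinear] kappa_W cw_one)

lemma star_W_ma: "length I = length J \<Longrightarrow> ma z w (star (W I J)) = (cw (- z) I * cw (- w) J) *\<^sub>C star (W I J)"
  by (simp add: ma_star ma_W star_scaleC cw_cnj)

lemma U0_star_W: "length I = length J \<Longrightarrow> complex_of_real (lw lam J) *\<^sub>C U0 (star (W I J)) = W J I"
  using lwl_pos(2)[of I] lwl_pos(2)[of J]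
  by (simp add: U0_def star_W_ma clinearD[OF kappa_clinear] kappa_star_W cw_minus cw_one scaleC_scaleC)

lemma U0_U0: "U0 (U0 x) = x"
proof (rule clinear_eq_words[where f = "\<lambda>x. U0 (U0 x)" and f' = "\<lambda>x. x"])
  show "clinear (\<lambda>x. U0 (U0 x))" by (rule clinear_compose[OF U0_clinear U0_clinear])
  show "clinear (\<lambda>x::'a. x)" by (simp add: clinear_iff)
  fix I J :: "'n list" assume "length I = length J"
  then show "U0 (U0 (W I J)) = W I J" by (simp add: U0_W clinearD[OF U0_clinear] U0_star_W)
qed

lemma kappa_mult: "\<kappa> (x * y) = \<kappa> y * \<kappa> x"
proof (rule clinear_eq_words[where f = "\<lambda>x. \<kappa> (x * y)"])
  fix I J :: "'n list" assume IJ: "length I = length J"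
  show "\<kappa> (W I J * y) = \<kappa> y * \<kappa> (W I J)"
  proof (rule clinear_eq_words[where f = "\<lambda>y. \<kappa> (W I J * y)"])
    fix I' J' :: "'n list" assume "length I' = length J'"
    then show "\<kappa> (W I J * W I' J') = \<kappa> (W I' J') * \<kappa> (W I J)"
      using IJ by (simp add: W_W kappa_W) (simp add: star_mult flip: W_W)
  qed (simp_all add: clinear_mult kappa_clinear)
qed (simp_all add: clinear_mult kappa_clinear)

lemma U0_mult: "U0 (x * y) = U0 y * U0 x"
  by (simp add: U0_def ma_mult kappa_mult)

text \<open>The unitary antipode followed by the star, that is, the second conjugation on the level
  of the algebra.\<close>

definition rr :: "'a \<Rightarrow> 'a" where
  "rr x = star (\<kappa> (rma (1/2) (-1/2) x))"

lemma rr_W: "length I = length J \<Longrightarrow> rr (W I J) = (cw (1/2) I * cw (-1/2) J) *\<^sub>C W J I"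
  by (simp add: rr_def ma_W clinearD[OF kappa_clinear] kappa_W star_scaleC star_star cw_cnj)

lemma rr_add: "rr (x + y) = rr x + rr y" and rr_scale: "rr (c *\<^sub>C x) = cnj c *\<^sub>C rr x"
  by (simp_all add: rr_def ma_lin clinearD[OF kappa_clinear] star_add star_scaleC)

lemma rr_mult: "rr (x * y) = rr x * rr y"
  by (simp add: rr_def ma_mult kappa_mult star_mult)

lemma rr_star: "rr (star x) = star (rr x)"
proof (induction x rule: W_induct)
  case (word I J)
  have e: "cw (-1/2) I * cw (1/2) J * (complex_of_real (lw lam I) / complex_of_real (lw lam J)) = cw (1/2) I * cw (-1/2) J"
    using cw_add[of "-1/2" 1 I] cw_add[of "1/2" "-1" J] by (simp add: cw_minus cw_one field_simps)
  have "rr (star (W I J)) = star (\<kappa> ((cw (-1/2) I * cw (1/2) J) *\<^sub>C star (W I J)))"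
    using word by (simp add: rr_def star_W_ma)
  also have "\<dots> = star ((cw (1/2) I * cw (-1/2) J) *\<^sub>C W J I)"
    using word by (simp only: clinearD[OF kappa_clinear] kappa_star_W scaleC_scaleC of_real_divide e)
  finally show ?case using word by (simp add: rr_W)
qed (simp_all add: rr_add rr_scale star_add star_scaleC)

lemma rr_Cc: "rr (L.Cc k \<phi> u) = L.Cc k (\<lambda>I. cw (-1/2) I * u I) (\<lambda>I. cw (1/2) I * \<phi> I)"
proof -
  have rr0: "rr 0 = 0" using rr_scale[of 0 0] by simp
  have rr_sum: "rr (sum f A) = (\<Sum>i\<in>A. rr (f i))" for f :: "'n list \<Rightarrow> 'a" and A
    by (induction A rule: infinite_finite_induct) (simp_all add: rr0 rr_add)
  have "rr (L.Cc k \<phi> u) = (\<Sum>I\<in>Ln k. \<Sum>J\<in>Ln k. (\<phi> I * cnj (u J) * (cw (1/2) I * cw (-1/2) J)) *\<^sub>C W J I)"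
    unfolding L.Cc_def rr_sum L_wd by (intro sum.cong refl) (simp add: rr_scale rr_W scaleC_scaleC)
  also have "\<dots> = (\<Sum>J\<in>Ln k. \<Sum>I\<in>Ln k. (cnj (cw (-1/2) J * u J) * (cw (1/2) I * \<phi> I)) *\<^sub>C W J I)"
    by (subst sum.swap) (simp add: cw_cnj mult_ac)
  finally show ?thesis by (simp add: L.Cc_def L_wd)
qed

lemma h_rr: "h (rr x) = cnj (h x)"
proof (induction x rule: Cc_induct)
  case (Cc k \<phi> w)
  show ?case
  proof (cases k)
    case 0 then show ?thesis using rr_W[of "[]" "[]"] by (simp add: L.Cc_0 rr_scale h_simps h_one)
  next
    case (Suc l)
    have "L.VV k (\<lambda>I. cw (1/2) I * \<phi> I)" using VV_cw[of k \<phi> "1/2"] Cc by simp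
    then show ?thesis using Cc unfolding Suc rr_Cc by (simp add: h_Cc)
  qed
qed (simp_all add: rr_add rr_scale h_simps)

lemma cinner_rr: "cinner (\<Lambda> (rr x)) (\<Lambda> (rr y)) = cnj (cinner (\<Lambda> x) (\<Lambda> y))"
  by (simp add: cinner_gns h_rr flip: rr_star rr_mult)

lemma modular_conj_hat: "bounded_linear (modular_conj_hat G)" "modular_conj_hat G (\<Lambda> x) = \<Lambda> (rr x)"
    "modular_conj_hat G (c *\<^sub>C \<xi>) = cnj c *\<^sub>C modular_conj_hat G \<xi>"
proof -
  obtain T where T: "bounded_linear T" "\<And>c x. T (c *\<^sub>C x) = cnj c *\<^sub>C T x" "\<And>x. T (\<Lambda> x) = \<Lambda> (rr x)"
    by (rule isometry_extension[of cnj "\<lambda>x. \<Lambda> (rr x)" \<Lambda>]) (simp_all add: cinner_rr tot_L)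
  have "modular_conj_hat G = T"
    unfolding modular_conj_hat_def
  proof (rule the_equality)
    show "bounded_linear T \<and> (\<forall>x. T (\<Lambda> x) = \<Lambda> (star (unitary_antipode G x)))"
      using T by (simp add: unitary_antipode rr_def)
    fix A assume A: "bounded_linear A \<and> (\<forall>x. A (\<Lambda> x) = \<Lambda> (star (unitary_antipode G x)))"
    then have eq: "A (\<Lambda> x) = T (\<Lambda> x)" for x by (simp add: T unitary_antipode rr_def)
    have "closure (range \<Lambda>) \<subseteq> {\<xi>. A \<xi> = T \<xi>}"
      by (intro closure_minimal closed_Collect_eq linear_continuous_on) (use A T(1) eq in auto)
    then show "A = T" using gnsm by (auto simp: gns_map_def)
  qed
  then show "bounded_linear (modular_conj_hat G)" "modular_conj_hat G (\<Lambda> x) = \<Lambda> (rr x)"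
    "modular_conj_hat G (c *\<^sub>C \<xi>) = cnj c *\<^sub>C modular_conj_hat G \<xi>" using T by auto
qed

abbreviation KU :: "'h \<Rightarrow> 'h" where "KU \<equiv> kac_unitary G"

lemma KU_L: "KU (\<Lambda> x) = \<Lambda> (U0 x)"
proof -
  have "star (rma (1/2) (1/2) (rr x)) = U0 x"
  proof (induction x rule: W_induct)
    case (word I J)
    have e: "cw (1/2) I * cw (1/2) I = complex_of_real (lw lam I)" "cw (-1/2) J * cw (1/2) J = 1"
      using cw_add[of "1/2" "1/2" I] cw_add[of "-1/2" "1/2" J] by (simp_all add: cw_one)
    have "star (rma (1/2) (1/2) (rr (W I J))) = (cw (1/2) I * cw (1/2) I * (cw (-1/2) J * cw (1/2) J)) *\<^sub>C star (W J I)"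
      using word by (simp add: rr_W ma_lin ma_W star_scaleC scaleC_scaleC cw_cnj mult_ac)
    then show ?case using word by (simp only: e U0_W) simp
  qed (simp_all add: rr_add rr_scale ma_lin star_add star_scaleC clinearD[OF U0_clinear])
  then show ?thesis by (simp add: kac_unitary_def modular_conj modular_conj_hat J0)
qed

lemma KU_bounded: "bounded_clinear KU"
proof (rule bounded_clinearI)
  show "bounded_linear KU" unfolding kac_unitary_def modular_conj comp_def
    by (rule bounded_linear_compose[OF J0(1) modular_conj_hat(1)])
  show "KU (c *\<^sub>C x) = c *\<^sub>C KU x" for c x by (simp add: kac_unitary_def modular_conj modular_conj_hat J0)
qed

lemma KU_cinner: "cinner (KU \<xi>) (KU \<eta>) = cinner \<xi> \<eta>"
proof -
  have "cinner (KU \<xi>) (KU \<eta>) = id (cinner \<xi> \<eta>)"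
  proof (rule isometry_sesqui[where X = "range \<Lambda>" and \<sigma> = id])
    show "cinner (KU x) (KU y) = id (cinner x y)" if xy: "x \<in> range \<Lambda>" "y \<in> range \<Lambda>" for x y
    proof -
      obtain a b where ab: "x = \<Lambda> a" "y = \<Lambda> b" using xy by blast
      show ?thesis using cinner_rr[of b a] cinner_commute[of "\<Lambda> a" "\<Lambda> b"]
        by (simp add: ab kac_unitary_def modular_conj modular_conj_hat cinner_J0)
    qed
  qed (simp_all add: bounded_clinearD[OF KU_bounded] tot_L)
  then show ?thesis by simp
qed

end

lemma closure_span_le: "closure (span X) \<subseteq> ccspan X"
  unfolding ccspan_def by (rule closure_mono[OF span_le_cspan])

context ao_group
begin

subsection \<open>Operators on the tensor square\<close>

abbreviation tn :: "'h \<Rightarrow> 'h \<Rightarrow> 'k" where "tn \<equiv> tens G"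

lemma tn_cbilinear: "cbilinear tn"
  using hten by (simp add: hilbert_tensor_def)

lemma tn_clinear: "clinear (tn \<xi>)" "clinear (\<lambda>\<xi>. tn \<xi> \<eta>)"
  using tn_cbilinear by (auto simp: cbilinear_def)

lemmas tn_simps = clinearD[OF tn_clinear(1)] clinearD[OF tn_clinear(2)] clinear_diff[OF tn_clinear(1)] clinear_diff[OF tn_clinear(2)]

lemma cinner_tn: "cinner (tn \<xi> \<eta>) (tn \<xi>' \<eta>') = cinner \<xi> \<xi>' * cinner \<eta> \<eta>'"
  using hten by (simp add: hilbert_tensor_def)

lemma norm_tn: "norm (tn \<xi> \<eta>) = norm \<xi> * norm \<eta>"
proof -
  have "complex_of_real ((norm (tn \<xi> \<eta>))\<^sup>2) = complex_of_real ((norm \<xi> * norm \<eta>)\<^sup>2)"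
    using cinner_tn[of \<xi> \<eta> \<xi> \<eta>] by (simp only: cinner_self power_mult_distrib of_real_mult)
  then show ?thesis by (simp only: of_real_eq_iff power2_eq_iff_nonneg norm_ge_zero mult_nonneg_nonneg)
qed

lemma tn_bounded: "bounded_clinear (\<lambda>\<xi>. tn \<xi> \<eta>)" "bounded_clinear (tn \<xi>)"
proof -
  show "bounded_clinear (\<lambda>\<xi>. tn \<xi> \<eta>)"
    by (rule bounded_clinearI, rule bounded_linear_intro[where K = "norm \<eta>"]) (simp_all add: tn_simps scaleR_scaleC norm_tn)
  show "bounded_clinear (tn \<xi>)"
    by (rule bounded_clinearI, rule bounded_linear_intro[where K = "norm \<xi>"]) (simp_all add: tn_simps scaleR_scaleC norm_tn mult.commute)
qed

lemma tot_tn: "ccspan (range (\<lambda>(\<xi>, \<eta>). tn \<xi> \<eta>)) = UNIV"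
proof -
  have "{tn \<xi> \<eta> | \<xi> \<eta>. True} = range (\<lambda>(\<xi>, \<eta>). tn \<xi> \<eta>)" by auto
  then have "closure (span (range (\<lambda>(\<xi>, \<eta>). tn \<xi> \<eta>))) = UNIV" using hten by (simp add: hilbert_tensor_def)
  then show ?thesis using closure_span_le by blast
qed

lemma tn_in_ccspan:
  assumes "\<xi> \<in> ccspan X" "\<And>\<zeta>. \<zeta> \<in> X \<Longrightarrow> tn \<zeta> \<eta> \<in> ccspan Y"
  shows "tn \<xi> \<eta> \<in> ccspan Y"
  using bounded_clinear_maps_ccspan[OF tn_bounded(1) assms(2) assms(1)] .

lemma tn_in_ccspan':
  assumes "\<eta> \<in> ccspan X" "\<And>\<zeta>. \<zeta> \<in> X \<Longrightarrow> tn \<xi> \<zeta> \<in> ccspan Y"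
  shows "tn \<xi> \<eta> \<in> ccspan Y"
  using bounded_clinear_maps_ccspan[OF tn_bounded(2) assms(2) assms(1)] .

lemma tot_tnL: "ccspan (range (\<lambda>(x, y). tn (\<Lambda> x) (\<Lambda> y))) = UNIV"
proof -
  let ?Y = "range (\<lambda>(x, y). tn (\<Lambda> x) (\<Lambda> y))"
  have 1: "tn (\<Lambda> x) (\<Lambda> y) \<in> ccspan ?Y" for x y by (rule subsetD[OF ccspan_superset]) auto
  have 2: "tn \<xi> (\<Lambda> y) \<in> ccspan ?Y" for \<xi> y
    by (rule tn_in_ccspan[of _ "range \<Lambda>"]) (use 1 tot_L in auto)
  have 3: "tn \<xi> \<eta> \<in> ccspan ?Y" for \<xi> \<eta>
    by (rule tn_in_ccspan'[of _ "range \<Lambda>"]) (use 2 tot_L in auto)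
  have "ccspan (range (\<lambda>(\<xi>, \<eta>). tn \<xi> \<eta>)) \<subseteq> ccspan ?Y"
    by (rule ccspan_minimal) (use 3 in auto)
  then show ?thesis by (simp only: tot_tn top.extremum_unique)
qed

lemma op_eqI:
  assumes "bounded_clinear S" "bounded_clinear T" "\<And>\<xi> \<eta>. S (tn \<xi> \<eta>) = T (tn \<xi> \<eta>)"
  shows "S = T"
proof
  fix x show "S x = T x"
    by (rule bounded_clinear_eq_on[OF assms(1,2), of "range (\<lambda>(\<xi>, \<eta>). tn \<xi> \<eta>)"]) (use assms(3) tot_tn in auto)
qed

lemma op_eqI_L:
  assumes "bounded_clinear S" "bounded_clinear T" "\<And>x y. S (tn (\<Lambda> x) (\<Lambda> y)) = T (tn (\<Lambda> x) (\<Lambda> y))"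
  shows "S = T"
proof
  fix x show "S x = T x"
    by (rule bounded_clinear_eq_on[OF assms(1,2), of "range (\<lambda>(x, y). tn (\<Lambda> x) (\<Lambda> y))"]) (use assms(3) tot_tnL in auto)
qed

lemma op_tensor_eqI: "bounded_clinear T \<Longrightarrow> (\<And>\<xi> \<eta>. T (tn \<xi> \<eta>) = tn (A \<xi>) (B \<eta>)) \<Longrightarrow> op_tensor G A B = T"
  unfolding op_tensor_def by (rule the_equality) (auto intro: op_eqI)

lemma bounded_clinear_id_cond: "bounded_linear T \<Longrightarrow> (\<And>c x. T (c *\<^sub>C x) = id c *\<^sub>C T x) \<Longrightarrow> bounded_clinear T"
  by (rule bounded_clinearI) auto

lemma isometry_tn:
  assumes "\<And>\<xi> \<eta> \<xi>' \<eta>'. cinner (f \<xi> \<eta>) (f \<xi>' \<eta>') = cinner \<xi> \<xi>' * cinner \<eta> \<eta>'"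
  shows "\<exists>T. bounded_clinear T \<and> (\<forall>\<xi> \<eta>. T (tn \<xi> \<eta>) = (f \<xi> \<eta> :: 'k))"
proof -
  obtain T where T: "bounded_linear T" "\<And>c x. T (c *\<^sub>C x) = id c *\<^sub>C T x" "\<And>p. T (case p of (\<xi>, \<eta>) \<Rightarrow> tn \<xi> \<eta>) = (case p of (\<xi>, \<eta>) \<Rightarrow> f \<xi> \<eta>)"
    by (rule isometry_extension[of id "\<lambda>(\<xi>, \<eta>). f \<xi> \<eta>" "\<lambda>(\<xi>, \<eta>). tn \<xi> \<eta>"])
      (simp, auto simp: assms cinner_tn tot_tn)
  show ?thesis using bounded_clinear_id_cond[OF T(1,2)] T(3)[of "(_, _)"] by auto
qed

lemma isometry_cinner:
  assumes T: "bounded_clinear T" and X: "\<And>x y. x \<in> X \<Longrightarrow> y \<in> X \<Longrightarrow> cinner (T x) (T y) = cinner x y" and tot: "ccspan X = UNIV"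
  shows "cinner (T x) (T y) = cinner x y"
  using isometry_sesqui[of T id X x y] X tot by (simp add: bounded_clinearD[OF T])

lemma op_tensor_isometric:
  assumes "\<And>\<xi> \<xi>'. cinner (A \<xi>) (A \<xi>') = cinner \<xi> \<xi>'" "\<And>\<xi> \<xi>'. cinner (B \<xi>) (B \<xi>') = cinner \<xi> \<xi>'"
  shows "bounded_clinear (op_tensor G A B)" "op_tensor G A B (tn \<xi> \<eta>) = tn (A \<xi>) (B \<eta>)"
    "cinner (op_tensor G A B x) (op_tensor G A B y) = cinner x y"
proof -
  obtain T where T: "bounded_clinear T" "\<And>\<xi> \<eta>. T (tn \<xi> \<eta>) = tn (A \<xi>) (B \<eta>)"
    using isometry_tn[of "\<lambda>\<xi> \<eta>. tn (A \<xi>) (B \<eta>)"] by (auto simp: cinner_tn assms)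
  have [simp]: "op_tensor G A B = T" by (rule op_tensor_eqI) (use T in auto)
  show "bounded_clinear (op_tensor G A B)" "op_tensor G A B (tn \<xi> \<eta>) = tn (A \<xi>) (B \<eta>)" using T by auto
  show "cinner (op_tensor G A B x) (op_tensor G A B y) = cinner x y"
    by (rule isometry_cinner[OF _ _ tot_tn]) (use T in \<open>auto simp: cinner_tn assms\<close>)
qed

lemma flip: "bounded_clinear (flip G)" "flip G (tn \<xi> \<eta>) = tn \<eta> \<xi>" "cinner (flip G x) (flip G y) = cinner x y"
proof -
  obtain T where T: "bounded_clinear T" "\<And>\<xi> \<eta>. T (tn \<xi> \<eta>) = tn \<eta> \<xi>"
    using isometry_tn[of "\<lambda>\<xi> \<eta>. tn \<eta> \<xi>"] by (auto simp: cinner_tn mult.commute)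
  have [simp]: "flip G = T"
    unfolding flip_def by (rule the_equality) (use T in \<open>auto intro: op_eqI\<close>)
  show "bounded_clinear (flip G)" "flip G (tn \<xi> \<eta>) = tn \<eta> \<xi>" using T by auto
  show "cinner (flip G x) (flip G y) = cinner x y"
    by (rule isometry_cinner[OF _ _ tot_tn]) (use T in \<open>auto simp: cinner_tn mult.commute\<close>)
qed

definition TT :: "('a, 'a) tensor_prod \<Rightarrow> 'k" where
  "TT = tensor_lift (\<lambda>a b. tn (\<Lambda> a) (\<Lambda> b))"

lemma TT: "clinear TT" "TT (a \<otimes>\<^sub>a b) = tn (\<Lambda> a) (\<Lambda> b)"
proof -
  have "cbilinear (\<lambda>a b. tn (\<Lambda> a) (\<Lambda> b))" by (intro cbilinearI) (simp_all add: \<Lambda>_simps tn_simps)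
  then show "clinear TT" "TT (a \<otimes>\<^sub>a b) = tn (\<Lambda> a) (\<Lambda> b)" unfolding TT_def by (auto intro: tensor_lift_clinear tensor_lift_tensor)
qed

definition h2 :: "('a, 'a) tensor_prod \<Rightarrow> complex" where
  "h2 = tensor_lift (\<lambda>a b. h a * h b)"

lemma h2: "clinear h2" "h2 (a \<otimes>\<^sub>a b) = h a * h b"
proof -
  have "cbilinear (\<lambda>a b. h a * h b)" by (intro cbilinearI) (simp_all add: h_simps distrib_left distrib_right scaleC_complex_def)
  then show "clinear h2" "h2 (a \<otimes>\<^sub>a b) = h a * h b" unfolding h2_def by (auto intro: tensor_lift_clinear tensor_lift_tensor)
qed

lemma cinner_TT: "cinner (TT p) (TT r) = h2 (star p * r)"
proof (induction p)
  case (tensor a b)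
  show ?case
    by (induction r) (simp_all add: TT h2 cinner_tn cinner_gns clinearD[OF TT(1)] clinearD[OF h2(1)] cinner_simps distrib_left)
qed (simp add: clinearD[OF TT(1)] clinearD[OF h2(1)] cinner_simps star_add distrib_right)

text \<open>Haar invariance in the first leg. For \<open>z = star x * x'\<close> it is the isometry
  of the multiplicative unitary.\<close>

lemma h2_delta: "h2 ((1 \<otimes>\<^sub>a a) * \<delta> z * (1 \<otimes>\<^sub>a b)) = h z * h (a * b)"
proof (induction z rule: W_induct)
  case (word I J)
  have "h2 ((1 \<otimes>\<^sub>a a) * \<delta> (W I J) * (1 \<otimes>\<^sub>a b)) = h (a * (\<Sum>K\<in>Ln (length I). h (W I K) *\<^sub>C W K J) * b)"
    by (simp add: delta_W word sum_distrib_left sum_distrib_right clinearD[OF h2(1)] h2 h_simps scaleC_mult_left scaleC_mult_right)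
  also have "\<dots> = h (a * (h (W I J) *\<^sub>C 1) * b)" by (simp only: h_W[OF word])
  finally show ?case by (simp add: scaleC_mult_left scaleC_mult_right h_simps)
qed (simp_all add: clinearD[OF delta_props(1)] clinearD[OF h2(1)] distrib_left distrib_right scaleC_mult_left scaleC_mult_right h_simps scaleC_complex_def)

lemma mult_unitary: "bounded_clinear (mult_unitary G)"
    "mult_unitary G (tn (\<Lambda> x) (\<Lambda> y)) = TT (\<delta> x * (1 \<otimes>\<^sub>a y))" "cinner (mult_unitary G x') (mult_unitary G y') = cinner x' y'"
proof -
  have gram: "cinner (TT (\<delta> x * (1 \<otimes>\<^sub>a y))) (TT (\<delta> x' * (1 \<otimes>\<^sub>a y'))) = cinner (tn (\<Lambda> x) (\<Lambda> y)) (tn (\<Lambda> x') (\<Lambda> y'))" for x y x' y'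
  proof -
    have "star (\<delta> x * (1 \<otimes>\<^sub>a y)) * (\<delta> x' * (1 \<otimes>\<^sub>a y')) = (1 \<otimes>\<^sub>a star y) * \<delta> (star x * x') * (1 \<otimes>\<^sub>a y')"
      by (simp add: star_mult delta_props mult.assoc)
    then show ?thesis by (simp add: cinner_TT h2_delta cinner_tn cinner_gns)
  qed
  obtain T where T: "bounded_linear T" "\<And>c x. T (c *\<^sub>C x) = id c *\<^sub>C T x" "\<And>p. T (case p of (x, y) \<Rightarrow> tn (\<Lambda> x) (\<Lambda> y)) = (case p of (x, y) \<Rightarrow> TT (\<delta> x * (1 \<otimes>\<^sub>a y)))"
    by (rule isometry_extension[of id "\<lambda>(x, y). TT (\<delta> x * (1 \<otimes>\<^sub>a y))" "\<lambda>(x, y). tn (\<Lambda> x) (\<Lambda> y)"])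
      (simp, auto simp: gram tot_tnL)
  have T': "bounded_clinear T" "\<And>x y. T (tn (\<Lambda> x) (\<Lambda> y)) = TT (\<delta> x * (1 \<otimes>\<^sub>a y))"
    using bounded_clinear_id_cond[OF T(1,2)] T(3)[of "(_, _)"] by auto
  have [simp]: "mult_unitary G = T"
    unfolding mult_unitary_def by (rule the_equality) (use T' in \<open>auto intro: op_eqI_L simp: TT_def\<close>)
  show "bounded_clinear (mult_unitary G)" "mult_unitary G (tn (\<Lambda> x) (\<Lambda> y)) = TT (\<delta> x * (1 \<otimes>\<^sub>a y))" using T' by auto
  show "cinner (mult_unitary G x') (mult_unitary G y') = cinner x' y'"
    by (rule isometry_cinner[OF _ _ tot_tnL]) (use T' gram in auto)
qed

abbreviation \<Theta> :: "'k \<Rightarrow> 'k" where "\<Theta> \<equiv> reversing G"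

lemma op_idU: "bounded_clinear (op_tensor G id KU)" "op_tensor G id KU (tn \<xi> \<eta>) = tn \<xi> (KU \<eta>)"
    "cinner (op_tensor G id KU x) (op_tensor G id KU y) = cinner x y"
  and op_UU: "bounded_clinear (op_tensor G KU KU)" "op_tensor G KU KU (tn \<xi> \<eta>) = tn (KU \<xi>) (KU \<eta>)"
    "cinner (op_tensor G KU KU x) (op_tensor G KU KU y) = cinner x y"
  using op_tensor_isometric[of id KU] op_tensor_isometric[of KU KU] by (simp_all add: KU_cinner)

lemma Theta_bounded: "bounded_clinear \<Theta>"
  unfolding reversing_def comp_def
  by (rule bounded_clinear_compose[OF flip(1)], rule bounded_clinear_compose[OF op_idU(1)],
      rule bounded_clinear_compose[OF mult_unitary(1)], rule bounded_clinear_compose[OF op_UU(1)], rule flip(1))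

lemma Theta_isometric: "cinner (\<Theta> x) (\<Theta> y) = cinner x y"
  by (simp add: reversing_def flip mult_unitary op_idU op_UU)

text \<open>No weight survives: the factor \<open>lw lam I\<close> and the adjoint of
  \<open>W K I\<close> combine to \<open>U0 (W I K)\<close>, which antimultiplicativity joins to
  \<open>U0 x\<close>; the outer Kac unitary then undoes \<open>U0\<close>.\<close>

lemma Theta_W:
  assumes "length I = length J"
  shows "\<Theta> (tn (\<Lambda> x) (\<Lambda> (W I J))) = (\<Sum>K\<in>Ln (length I). tn (\<Lambda> (x * W I K)) (\<Lambda> (star (W J K))))"
proof -
  have "\<Theta> (tn (\<Lambda> x) (\<Lambda> (W I J))) = flip G (op_tensor G id KU (TT (\<delta> (U0 (W I J)) * (1 \<otimes>\<^sub>a U0 x))))"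
    by (simp add: reversing_def flip op_idU op_UU KU_L mult_unitary)
  also have "\<delta> (U0 (W I J)) * (1 \<otimes>\<^sub>a U0 x) = (\<Sum>K\<in>Ln (length I). star (W J K) \<otimes>\<^sub>a ((complex_of_real (lw lam I) *\<^sub>C star (W K I)) * U0 x))"
    by (simp add: U0_W assms delta_props delta_W clinearD[OF delta_props(1)] star_sum scaleC_sum_right sum_distrib_right scaleC_mult_left tensor_scale_right)
  also have "\<dots> = (\<Sum>K\<in>Ln (length I). star (W J K) \<otimes>\<^sub>a U0 (x * W I K))"
    by (intro sum.cong refl) (simp add: U0_mult U0_W)
  finally show ?thesis
    by (simp only: clinearD[OF TT(1)] TT bounded_clinearD[OF op_idU(1)] bounded_clinearD[OF flip(1)] op_idU flip KU_L U0_U0)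
qed

lemma Theta_v: "\<Theta> (tn (\<Lambda> x) (\<Lambda> (v i j))) = (\<Oplus>k. tn (\<Lambda> (x * v i k)) (\<Lambda> (star (v j k))))"
  using Theta_W[of "[i]" "[j]" x] by (simp add: sum_Ln_Suc)

subsection \<open>Left and right multiplication\<close>

lemma bounded_L_eqI:
  assumes "bounded_clinear S" "bounded_clinear T" "\<And>x. S (\<Lambda> x) = T (\<Lambda> x)"
  shows "S = T"
proof
  fix x show "S x = T x"
    by (rule bounded_clinear_eq_on[OF assms(1,2), of "range \<Lambda>"]) (use assms(3) tot_L in auto)
qed

text \<open>The adjoint of tensoring with \<open>e\<close> in the second leg; its bound is obtained
  by pairing with its own value.\<close>

lemma slot_exists: "\<exists>T. bounded_clinear T \<and> (\<forall>\<xi> \<eta>. T (tn \<xi> \<eta>) = cinner e \<eta> *\<^sub>C \<xi>)"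
proof -
  have bd: "norm (\<Sum>(c, p)\<leftarrow>ps. id c *\<^sub>C (case p of (\<xi>, \<eta>) \<Rightarrow> cinner e \<eta> *\<^sub>C \<xi>)) \<le> norm e * norm (\<Sum>(c, p)\<leftarrow>ps. c *\<^sub>C (case p of (\<xi>, \<eta>) \<Rightarrow> tn \<xi> \<eta>))"
    (is "norm (?X ps) \<le> norm e * norm (?Y ps)") for ps
  proof -
    have "cinner z (?X qs) = cinner (tn z e) (?Y qs)" for z qs
      by (induction qs) (auto simp: cinner_simps cinner_tn)
    then have "cmod (cinner (?X ps) (?X ps)) \<le> (norm (?X ps) * norm e) * norm (?Y ps)"
      using cmod_cinner_le[of "tn (?X ps) e" "?Y ps"] by (simp only: norm_tn)
    moreover have "cmod (cinner (?X ps) (?X ps)) = norm (?X ps) * norm (?X ps)"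
      unfolding cinner_self by (simp only: norm_of_real power2_eq_square abs_mult abs_norm_cancel)
    ultimately have "norm (?X ps) * norm (?X ps) \<le> norm (?X ps) * (norm e * norm (?Y ps))"
      by (simp only: mult.assoc)
    then show ?thesis by (cases "norm (?X ps) = 0") (simp_all add: mult_le_cancel_left)
  qed
  obtain T where T: "bounded_linear T" "\<And>c x. T (c *\<^sub>C x) = id c *\<^sub>C T x" "\<And>p. T (case p of (\<xi>, \<eta>) \<Rightarrow> tn \<xi> \<eta>) = (case p of (\<xi>, \<eta>) \<Rightarrow> cinner e \<eta> *\<^sub>C \<xi>)"
    by (rule extension_exists[of id "\<lambda>(\<xi>, \<eta>). cinner e \<eta> *\<^sub>C \<xi>" "norm e" "\<lambda>(\<xi>, \<eta>). tn \<xi> \<eta>"])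
      (simp, rule bd, rule tot_tn, rule that)
  show ?thesis using bounded_clinear_id_cond[OF T(1,2)] T(3)[of "(_, _)"] by auto
qed

text \<open>For a single generator no norm identity is available, but the multiplications by all
  \<open>v k b\<close> with \<open>b\<close> fixed are jointly isometric, since the columns of
  \<open>v\<close> are unitary. The construction takes place on the tensor square because the edge
  action lives there.\<close>

lemma action_exists: "\<exists>C. bounded_clinear C \<and> (\<forall>y \<eta>. C (tn (\<Lambda> y) \<eta>) = tn (\<Lambda> (x * y)) \<eta>)"
proof (induction x rule: S_induct)
  case (add x y)
  then obtain A B where "bounded_clinear A" "\<And>z \<eta>. A (tn (\<Lambda> z) \<eta>) = tn (\<Lambda> (x * z)) \<eta>" "bounded_clinear B" "\<And>z \<eta>. B (tn (\<Lambda> z) \<eta>) = tn (\<Lambda> (y * z)) \<eta>" by blast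
  then show ?case by (intro exI[of _ "\<lambda>\<xi>. A \<xi> + B \<xi>"]) (simp add: bounded_clinear_add distrib_right \<Lambda>_simps tn_simps)
next
  case (scale c x)
  then obtain A where "bounded_clinear A" "\<And>z \<eta>. A (tn (\<Lambda> z) \<eta>) = tn (\<Lambda> (x * z)) \<eta>" by blast
  then show ?case by (intro exI[of _ "\<lambda>\<xi>. c *\<^sub>C A \<xi>"]) (simp add: bounded_clinear_scaleC scaleC_mult_left \<Lambda>_simps tn_simps)
next
  case one then show ?case by (intro exI[of _ "\<lambda>\<xi>. \<xi>"]) (simp add: bounded_clinear_ident)
next
  case (mult a b x)
  then obtain A where A: "bounded_clinear A" "\<And>z \<eta>. A (tn (\<Lambda> z) \<eta>) = tn (\<Lambda> (x * z)) \<eta>" by blast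
  have "(\<Oplus>k. cinner (\<Lambda> (v k b * y)) (\<Lambda> (v k b * z))) = h (star y * (\<Oplus>k. star (v k b) * v k b) * z)" for y z
    by (simp add: cinner_gns star_mult mult.assoc sum_distrib_left sum_distrib_right h_simps)
  then have L: "(\<Oplus>k. cinner (\<Lambda> (v k b * y)) (\<Lambda> (v k b * z))) = cinner (\<Lambda> y) (\<Lambda> z)" for y z
    by (simp only: v_unitary) (simp add: cinner_gns)
  have gram: "(\<Oplus>k. complex_of_real 1 * cinner (case p of (y, \<eta>) \<Rightarrow> tn (\<Lambda> (v k b * y)) \<eta>) (case r of (y, \<eta>) \<Rightarrow> tn (\<Lambda> (v k b * y)) \<eta>))
     = id (cinner (case p of (y, \<eta>) \<Rightarrow> tn (\<Lambda> y) \<eta>) (case r of (y, \<eta>) \<Rightarrow> tn (\<Lambda> y) \<eta>))" for p r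
    by (cases p, cases r) (simp add: cinner_tn L flip: sum_distrib_right)
  have "tn \<xi> \<eta> \<in> ccspan (range (\<lambda>(y, \<eta>). tn (\<Lambda> y) \<eta>))" for \<xi> \<eta>
    by (rule tn_in_ccspan[of _ "range \<Lambda>"]) (use tot_L ccspan_superset in fastforce)+
  then have "ccspan (range (\<lambda>(\<xi>, \<eta>). tn \<xi> \<eta>)) \<subseteq> ccspan (range (\<lambda>(y, \<eta>). tn (\<Lambda> y) \<eta>))"
    by (intro ccspan_minimal) auto
  then have tot: "ccspan (range (\<lambda>(y, \<eta>). tn (\<Lambda> y) \<eta>)) = UNIV" by (simp only: tot_tn top.extremum_unique)
  obtain T where T: "bounded_linear T" "\<And>c x. T (c *\<^sub>C x) = id c *\<^sub>C T x" "\<And>p. T (case p of (y, \<eta>) \<Rightarrow> tn (\<Lambda> y) \<eta>) = (case p of (y, \<eta>) \<Rightarrow> tn (\<Lambda> (v a b * y)) \<eta>)"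
    by (rule extension_exists_gram[of id UNIV a "\<lambda>_. 1" "\<lambda>k p. case p of (y, \<eta>) \<Rightarrow> tn (\<Lambda> (v k b * y)) \<eta>" "\<lambda>(y, \<eta>). tn (\<Lambda> y) \<eta>"])
      (simp, simp, simp, simp, rule gram, rule tot, rule that)
  show ?case using A bounded_clinear_id_cond[OF T(1,2)] T(3)[of "(_, _)"]
    by (intro exI[of _ "\<lambda>\<xi>. T (A \<xi>)"]) (simp add: bounded_clinear_compose mult.assoc)
qed

text \<open>Embed with \<Lambda> 1 in the second leg, act there, and slice with the unit vector
  \<Lambda> 1.\<close>

lemma lmult_exists: "\<exists>A. bounded_clinear A \<and> (\<forall>y. A (\<Lambda> y) = \<Lambda> (x * y))"
proof -
  obtain C where C: "bounded_clinear C" "\<And>y \<eta>. C (tn (\<Lambda> y) \<eta>) = tn (\<Lambda> (x * y)) \<eta>" using action_exists by blast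
  obtain T where T: "bounded_clinear T" "\<And>\<xi> \<eta>. T (tn \<xi> \<eta>) = cinner (\<Lambda> 1) \<eta> *\<^sub>C \<xi>" using slot_exists by blast
  have "cinner (\<Lambda> 1) (\<Lambda> 1) = 1" by (simp add: cinner_gns h_one)
  then show ?thesis using C T
    using bounded_clinear_compose[OF T(1) bounded_clinear_compose[OF C(1) tn_bounded(1)], of "\<Lambda> 1"]
    by (intro exI[of _ "\<lambda>\<xi>. T (C (tn \<xi> (\<Lambda> 1)))"]) simp
qed

abbreviation lm :: "'a \<Rightarrow> 'h \<Rightarrow> 'h" where "lm \<equiv> lmult G"

lemma lm: "bounded_clinear (lm x)" "lm x (\<Lambda> y) = \<Lambda> (x * y)"
proof -
  obtain A where A: "bounded_clinear A" "\<And>y. A (\<Lambda> y) = \<Lambda> (x * y)" using lmult_exists by blast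
  have "lm x = A" unfolding lmult_def by (rule the_equality) (use A in \<open>auto intro: bounded_L_eqI\<close>)
  then show "bounded_clinear (lm x)" "lm x (\<Lambda> y) = \<Lambda> (x * y)" using A by auto
qed

abbreviation act :: "'a \<Rightarrow> 'k \<Rightarrow> 'k" where "act \<equiv> edge_action G"

lemma act: "bounded_clinear (act x)" "act x (tn \<xi> \<eta>) = tn (lm x \<xi>) \<eta>"
proof -
  obtain C where C: "bounded_clinear C" "\<And>y \<eta>. C (tn (\<Lambda> y) \<eta>) = tn (\<Lambda> (x * y)) \<eta>" using action_exists by blast
  have C': "C (tn \<xi> \<eta>) = tn (lm x \<xi>) \<eta>" for \<xi> \<eta>
  proof -
    have "(\<lambda>\<xi>. C (tn \<xi> \<eta>)) = (\<lambda>\<xi>. tn (lm x \<xi>) \<eta>)"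
      by (rule bounded_L_eqI[OF bounded_clinear_compose[OF C(1) tn_bounded(1)] bounded_clinear_compose[OF tn_bounded(1) lm(1)]])
        (simp add: C lm)
    then show ?thesis by (simp add: fun_eq_iff)
  qed
  have "act x = C" unfolding edge_action_def by (rule op_tensor_eqI) (use C C' in auto)
  then show "bounded_clinear (act x)" "act x (tn \<xi> \<eta>) = tn (lm x \<xi>) \<eta>" using C C' by auto
qed

text \<open>KMS moves the right factors together and produces the weight
  \<open>lam a * lam j\<close>; divided by it, the squared norms along a row of \<open>v\<close> sum
  up by unitarity.\<close>

lemma rmult_exists: "\<exists>A. bounded_clinear A \<and> (\<forall>x. A (\<Lambda> x) = \<Lambda> (x * v a b))"
proof -
  have gram: "(\<Oplus>j. complex_of_real (1 / (lam a * lam j)) * cinner (\<Lambda> (y * v a j)) (\<Lambda> (z * v a j))) = id (cinner (\<Lambda> y) (\<Lambda> z))" for y z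
  proof -
    have "complex_of_real (1 / (lam a * lam j)) * cinner (\<Lambda> (y * v a j)) (\<Lambda> (z * v a j)) = h (star y * z * (v a j * star (v a j)))" for j
    proof -
      have "sg (star (v a j)) = complex_of_real (lam a * lam j) *\<^sub>C star (v a j)"
        using star_W_ma[of "[a]" "[j]" "-1" "-1"] by (simp add: cw_one)
      then have "cinner (\<Lambda> (y * v a j)) (\<Lambda> (z * v a j)) = complex_of_real (lam a * lam j) * h (star y * z * (v a j * star (v a j)))"
        using KMS'[of "star (v a j)" "star y * z * v a j"] by (simp add: cinner_gns star_mult mult.assoc scaleC_mult_right h_simps)
      then show ?thesis using lam_pos[of a] lam_pos[of j] by simp
    qed
    then have "(\<Oplus>j. complex_of_real (1 / (lam a * lam j)) * cinner (\<Lambda> (y * v a j)) (\<Lambda> (z * v a j))) = h (star y * z * (\<Oplus>j. v a j * star (v a j)))"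
      by (simp only: sum_distrib_left h_simps)
    then show ?thesis by (simp only: v_unitary) (simp add: cinner_gns)
  qed
  obtain T where T: "bounded_linear T" "\<And>c x. T (c *\<^sub>C x) = id c *\<^sub>C T x" "\<And>y. T (\<Lambda> y) = \<Lambda> (y * v a b)"
    by (rule extension_exists_gram[of id UNIV b "\<lambda>j. 1 / (lam a * lam j)" "\<lambda>j y. \<Lambda> (y * v a j)" \<Lambda>])
      (simp, simp, simp, simp add: lam_pos, rule gram, rule tot_L, rule that)
  show ?thesis using bounded_clinear_id_cond[OF T(1,2)] T(3) by blast
qed

definition rm :: "'n \<Rightarrow> 'n \<Rightarrow> 'h \<Rightarrow> 'h" where
  "rm a b = (SOME A. bounded_clinear A \<and> (\<forall>x. A (\<Lambda> x) = \<Lambda> (x * v a b)))"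

lemma rm: "bounded_clinear (rm a b)" "rm a b (\<Lambda> x) = \<Lambda> (x * v a b)"
  using someI_ex[OF rmult_exists[of a b]] by (auto simp: rm_def)

lemma lm_rm: "lm x (rm a b \<xi>) = rm a b (lm x \<xi>)"
proof -
  have "(\<lambda>\<xi>. lm x (rm a b \<xi>)) = (\<lambda>\<xi>. rm a b (lm x \<xi>))"
    by (rule bounded_L_eqI) (simp_all add: lm rm bounded_clinear_compose mult.assoc)
  then show ?thesis by (simp add: fun_eq_iff)
qed

subsection \<open>The space of edges\<close>

text \<open>The squared norm of \<open>\<Lambda> (v a b)\<close>, which depends on the row index
  only.\<close>

definition Nv :: "'n \<Rightarrow> real" where "Nv a = lam a / D"

lemma Nv_pos: "Nv a > 0" "Nv a \<noteq> 0"
  using lam_pos[of a] D_gt_2 by (simp_all add: Nv_def)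

lemma cinner_vv: "cinner (\<Lambda> (v a b)) (\<Lambda> (v c d)) = (if a = c \<and> b = d then complex_of_real (Nv a) else 0)"
  by (simp only: cinner_gns h_vv Nv_def)

abbreviation p1 :: "'h \<Rightarrow> 'h" where "p1 \<equiv> dir_proj G {v}"
abbreviation KK :: "'k set" where "KK \<equiv> edge_space G {v}"
abbreviation KA :: "'k set" where "KA \<equiv> alg_edge_space G {v}"

lemma range_p1: "range p1 = cspan {\<Lambda> (v a b) | a b. True}" (is "_ = ?M")
proof -
  have "\<Lambda> ` cspan {v i j | i j. True} = cspan (\<Lambda> ` {v i j | i j. True})"
    using module_hom.span_image[OF Vector_Spaces.linear.axioms(3)[OF L_clinear]] by (simp add: cspan_def)
  also have "\<Lambda> ` {v i j | i j. True} = {\<Lambda> (v a b) | a b. True}" by auto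
  finally have p1: "p1 = orth_proj ?M" by (simp add: dir_proj_def corep_proj_def fun_eq_iff)
  have "p1 \<eta> \<in> ?M" for \<eta>
  proof -
    let ?y = "\<Oplus>a b. (cinner (\<Lambda> (v a b)) \<eta> / complex_of_real (Nv a)) *\<^sub>C \<Lambda> (v a b)"
    have y: "?y \<in> ?M" by (intro complex_vector.span_sum complex_vector.span_scale complex_vector.span_base) blast
    have "cinner (\<Lambda> (v c d)) ?y = cinner (\<Lambda> (v c d)) \<eta>" for c d
    proof -
      have "cinner (\<Lambda> (v c d)) ?y = (\<Oplus>a b. if a = c then if b = d then cinner (\<Lambda> (v c d)) \<eta> else 0 else 0)"
        unfolding cinner_sum_right cinner_scaleC_right cinner_vv using Nv_pos by (intro sum.cong refl) auto
      then show ?thesis by (simp only: sum_delta2)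
    qed
    then have "?M \<subseteq> {z. cinner (\<eta> - ?y) z = 0}"
      by (intro complex_vector.span_minimal csubspace_orth) (auto simp: cinner_diff_right orth_commute[of "\<eta> - _"])
    then have "p1 \<eta> = ?y"
      unfolding p1 by (intro orth_proj_eqI complex_vector.subspace_span y) (auto simp: orth_commute[of "\<eta> - _"])
    then show ?thesis using y by simp
  qed
  moreover have "p1 \<eta> = \<eta>" if "\<eta> \<in> ?M" for \<eta>
    unfolding p1 using that by (intro orth_proj_eqI) auto
  ultimately show ?thesis by (intro subset_antisym subsetI) (blast, metis rangeI)
qed

lemma L_v_range_p1: "\<Lambda> (v a b) \<in> range p1"
  unfolding range_p1 by (intro complex_vector.span_base) blast

definition KG :: "'k set" where
  "KG = {tn (\<Lambda> x) (\<Lambda> (v a b)) | x a b. True}"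

lemma tn_range_p1:
  assumes "complex_vector.subspace S" "\<And>a b. tn \<xi> (\<Lambda> (v a b)) \<in> S" "\<eta> \<in> range p1"
  shows "tn \<xi> \<eta> \<in> S"
proof -
  have "complex_vector.subspace {\<eta>. tn \<xi> \<eta> \<in> S}" using assms(1) by (auto simp: csubspace_iff tn_simps)
  then have "range p1 \<subseteq> {\<eta>. tn \<xi> \<eta> \<in> S}"
    unfolding range_p1 by (intro complex_vector.span_minimal) (use assms(2) in auto)
  then show ?thesis using assms(3) by blast
qed

lemma KA_cspan: "KA = cspan KG"
proof
  have "tn (\<Lambda> x) \<eta> \<in> cspan KG" if "\<eta> \<in> range p1" for x \<eta>
    by (rule tn_range_p1[OF _ _ that]) (auto simp: KG_def intro: complex_vector.span_base)
  then have "cspan {tn (\<Lambda> x) \<eta> | x \<eta>. \<eta> \<in> range p1} \<subseteq> cspan KG"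
    by (intro complex_vector.span_minimal) auto
  then show "KA \<subseteq> cspan KG" unfolding alg_edge_space_def using span_le_cspan by blast
  have "cspan KG = span KG"
  proof (rule span_eq_cspan[symmetric])
    fix c x assume "x \<in> KG"
    then obtain y a b where "x = tn (\<Lambda> y) (\<Lambda> (v a b))" unfolding KG_def by blast
    then have "c *\<^sub>C x = tn (\<Lambda> (c *\<^sub>C y)) (\<Lambda> (v a b))" by (simp add: \<Lambda>_simps tn_simps)
    then show "c *\<^sub>C x \<in> KG" unfolding KG_def by blast
  qed
  also have "\<dots> \<subseteq> KA"
    unfolding alg_edge_space_def KG_def by (intro span_mono) (use L_v_range_p1 in blast)
  finally show "cspan KG \<subseteq> KA" .
qed

lemma KG_in: "tn (\<Lambda> x) (\<Lambda> (v a b)) \<in> ccspan KG"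
  by (rule subsetD[OF ccspan_superset]) (auto simp: KG_def)

lemma KK_ccspan: "KK = ccspan KG"
proof
  have "tn \<xi> \<eta> \<in> ccspan KG" if "\<eta> \<in> range p1" for \<xi> \<eta>
  proof (rule tn_range_p1[OF csubspace_ccspan _ that])
    show "tn \<xi> (\<Lambda> (v a b)) \<in> ccspan KG" for a b
      by (rule tn_in_ccspan[of _ "range \<Lambda>"]) (use tot_L KG_in in auto)
  qed
  then have "ccspan {tn \<xi> \<eta> | \<xi> \<eta>. \<eta> \<in> range p1} \<subseteq> ccspan KG" by (intro ccspan_minimal) auto
  then show "KK \<subseteq> ccspan KG"
    unfolding edge_space_def by (rule order_trans[OF closure_span_le])
  have "KA \<subseteq> span {tn \<xi> \<eta> | \<xi> \<eta>. \<eta> \<in> range p1}"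
    unfolding alg_edge_space_def by (rule span_mono) blast
  then show "ccspan KG \<subseteq> KK"
    unfolding ccspan_def KA_cspan[symmetric] edge_space_def by (rule closure_mono)
qed

lemma KA_KK: "KA \<subseteq> KK"
  unfolding KK_ccspan KA_cspan ccspan_def by (rule closure_subset)

lemma tn_v_KK: "tn \<xi> (\<Lambda> (v a b)) \<in> KK"
  unfolding KK_ccspan
  by (rule tn_in_ccspan[of _ "range \<Lambda>"]) (use tot_L KG_in in auto)

lemma KK_sub: "complex_vector.subspace KK" "closed KK"
  by (simp_all add: KK_ccspan)

lemma tn_star_v: "tn \<xi> (\<Lambda> (star (v a b))) = (\<Oplus>c d. (s * cnj (q a c) * q d b) *\<^sub>C tn \<xi> (\<Lambda> (v c d)))"
  by (simp add: star_v \<Lambda>_simps tn_simps)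

lemma tn_star_v_KK: "tn \<xi> (\<Lambda> (star (v a b))) \<in> KK"
  unfolding tn_star_v by (intro csubspaceD(6)[OF KK_sub(1)] csubspaceD(3)[OF KK_sub(1)] tn_v_KK)

lemma Theta_tn_v: "\<Theta> (tn \<xi> (\<Lambda> (v i j))) = (\<Oplus>k. tn (rm i k \<xi>) (\<Lambda> (star (v j k))))"
proof -
  have "(\<lambda>\<xi>. \<Theta> (tn \<xi> (\<Lambda> (v i j)))) = (\<lambda>\<xi>. \<Oplus>k. tn (rm i k \<xi>) (\<Lambda> (star (v j k))))"
    by (rule ext, rule bounded_clinear_eq_on[where X = "range \<Lambda>"])
      (auto simp: tot_L Theta_v rm intro!: bounded_clinear_compose[OF Theta_bounded] bounded_clinear_compose[OF tn_bounded(1)] bounded_clinear_sum tn_bounded)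
  then show ?thesis by (simp add: fun_eq_iff)
qed

lemma Theta_KK: "X \<in> KK \<Longrightarrow> \<Theta> X \<in> KK"
proof -
  have "\<Theta> x \<in> ccspan KG" if xG: "x \<in> KG" for x
  proof -
    obtain y a b where "x = tn (\<Lambda> y) (\<Lambda> (v a b))" using xG by (auto simp: KG_def)
    then have "\<Theta> x \<in> KK" unfolding Theta_tn_v by (simp add: Theta_tn_v csubspaceD(6)[OF KK_sub(1)] tn_star_v_KK)
    then show ?thesis by (simp add: KK_ccspan)
  qed
  then show "X \<in> KK \<Longrightarrow> \<Theta> X \<in> KK"
    unfolding KK_ccspan by (rule bounded_clinear_maps_ccspan[OF Theta_bounded])
qed

definition sl1 :: "'n \<Rightarrow> 'n \<Rightarrow> 'k \<Rightarrow> 'h" where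
  "sl1 a b = (SOME T. bounded_clinear T \<and> (\<forall>\<xi> \<eta>. T (tn \<xi> \<eta>) = cinner (\<Lambda> (v a b)) \<eta> *\<^sub>C \<xi>))"

lemma sl1: "bounded_clinear (sl1 a b)" "sl1 a b (tn \<xi> \<eta>) = cinner (\<Lambda> (v a b)) \<eta> *\<^sub>C \<xi>"
  using someI_ex[OF slot_exists[of "\<Lambda> (v a b)"]] by (auto simp: sl1_def)

lemma cinner_sl1: "cinner \<xi> (sl1 a b X) = cinner (tn \<xi> (\<Lambda> (v a b))) X"
proof -
  have "ccspan (range (\<lambda>(\<xi>, \<eta>). tn \<xi> \<eta>)) \<subseteq> {X. cinner \<xi> (sl1 a b X) = cinner (tn \<xi> (\<Lambda> (v a b))) X}"
  proof (rule ccspan_minimal)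
    show "closed {X. cinner \<xi> (sl1 a b X) = cinner (tn \<xi> (\<Lambda> (v a b))) X}"
      by (intro closed_Collect_eq continuous_on_cinner continuous_intros bounded_clinearD(8)[OF sl1(1)])
  qed (auto simp: csubspace_iff bounded_clinearD[OF sl1(1)] sl1 cinner_simps cinner_tn)
  then show ?thesis using tot_tn by auto
qed

lemma sl1_v: "sl1 a b (tn \<xi> (\<Lambda> (v c d))) = (if a = c \<and> b = d then complex_of_real (Nv a) *\<^sub>C \<xi> else 0)"
  by (simp add: sl1 cinner_vv)

lemma KK_expand: "X \<in> KK \<Longrightarrow> X = (\<Oplus>a b. complex_of_real (1 / Nv a) *\<^sub>C tn (sl1 a b X) (\<Lambda> (v a b)))"
proof -
  assume X: "X \<in> KK"
  define p where "p X = (\<Oplus>a b. complex_of_real (1 / Nv a) *\<^sub>C tn (sl1 a b X) (\<Lambda> (v a b)))" for X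
  have "X = p X"
  proof (rule bounded_clinear_eq_on[where X = KG and S = "\<lambda>x. x" and T = p])
    show "bounded_clinear p" unfolding p_def[abs_def]
      by (intro bounded_clinear_sum bounded_clinear_scaleC bounded_clinear_compose[OF tn_bounded(1)] sl1)
    fix x assume "x \<in> KG"
    then obtain y c d where x: "x = tn (\<Lambda> y) (\<Lambda> (v c d))" by (auto simp: KG_def)
    have "p x = (\<Oplus>a b. if a = c then if b = d then x else 0 else 0)"
      unfolding p_def x sl1_v using Nv_pos(2) by (intro sum.cong refl) (auto simp: tn_simps scaleC_scaleC)
    then show "x = p x" by (simp only: sum_delta2)
  qed (use X bounded_clinear_ident in \<open>auto simp: KK_ccspan\<close>)
  then show ?thesis by (simp add: p_def)
qed

lemma sl1_orth: "(\<And>\<xi>. \<xi> \<in> KK \<Longrightarrow> cinner \<xi> X = 0) \<Longrightarrow> sl1 a b X = 0"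
proof -
  assume "\<And>\<xi>. \<xi> \<in> KK \<Longrightarrow> cinner \<xi> X = 0"
  then have "cinner (sl1 a b X) (sl1 a b X) = 0" unfolding cinner_sl1 using tn_v_KK by blast
  then show ?thesis by simp
qed

text \<open>The target map in terms of the components along the orthogonal vectors
  \<open>\<Lambda> (v a b)\<close>. As it is built from slices, it vanishes on the orthogonal
  complement of the edge space, as \<open>target\<close> demands.\<close>

definition EE2 :: "'k \<Rightarrow> 'h" where
  "EE2 X = (\<Oplus>a b. complex_of_real (1 / Nv a) *\<^sub>C rm a b (sl1 a b X))"

lemma EE2_bounded: "bounded_clinear EE2"
  unfolding EE2_def[abs_def] by (intro bounded_clinear_sum bounded_clinear_scaleC bounded_clinear_compose[OF rm(1)] sl1)

lemma EE2_v: "EE2 (tn \<xi> (\<Lambda> (v c d))) = rm c d \<xi>"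
proof -
  have "EE2 (tn \<xi> (\<Lambda> (v c d))) = (\<Oplus>a b. if a = c then if b = d then rm c d \<xi> else 0 else 0)"
    unfolding EE2_def sl1_v using Nv_pos(2) by (intro sum.cong refl) (auto simp: bounded_clinearD[OF rm(1)] scaleC_scaleC)
  then show ?thesis by (simp only: sum_delta2)
qed

abbreviation E2 :: "'k \<Rightarrow> 'h" where "E2 \<equiv> target G {v}"

lemma target: "E2 = EE2"
  unfolding target_def
proof (rule the_equality)
  have 1: "EE2 (tn (\<Lambda> x) (\<Lambda> y)) = \<Lambda> (x * y)" if y: "\<Lambda> y \<in> range p1" for x y
  proof -
    have "complex_vector.subspace {\<eta>. EE2 (tn (\<Lambda> x) \<eta>) = lm x \<eta>}"
      by (auto simp: csubspace_iff tn_simps bounded_clinearD[OF EE2_bounded] bounded_clinearD[OF lm(1)])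
    then have "range p1 \<subseteq> {\<eta>. EE2 (tn (\<Lambda> x) \<eta>) = lm x \<eta>}"
      unfolding range_p1 by (intro complex_vector.span_minimal) (auto simp: EE2_v rm lm)
    then have "EE2 (tn (\<Lambda> x) (\<Lambda> y)) = lm x (\<Lambda> y)" using y by blast
    then show ?thesis by (simp only: lm)
  qed
  have 2: "EE2 X = 0" if "\<forall>\<xi>\<in>KK. cinner \<xi> X = 0" for X
    using that by (simp add: EE2_def sl1_orth bounded_clinearD[OF rm(1)])
  show "bounded_clinear EE2 \<and> (\<forall>x y. \<Lambda> y \<in> range p1 \<longrightarrow> EE2 (tn (\<Lambda> x) (\<Lambda> y)) = \<Lambda> (x * y)) \<and>
     (\<forall>\<zeta>. (\<forall>\<xi>\<in>KK. cinner \<xi> \<zeta> = 0) \<longrightarrow> EE2 \<zeta> = 0)"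
    using 1 2 EE2_bounded by blast
  fix E assume E: "bounded_clinear E \<and> (\<forall>x y. \<Lambda> y \<in> range p1 \<longrightarrow> E (tn (\<Lambda> x) (\<Lambda> y)) = \<Lambda> (x * y)) \<and>
     (\<forall>\<zeta>. (\<forall>\<xi>\<in>KK. cinner \<xi> \<zeta> = 0) \<longrightarrow> E \<zeta> = 0)"
  have KE: "E X = EE2 X" if "X \<in> KK" for X
    by (rule bounded_clinear_eq_on[where X = KG]) (use E EE2_bounded 1 L_v_range_p1 that in \<open>auto simp: KK_ccspan KG_def\<close>)
  show "E = EE2"
  proof
    fix X
    let ?p = "pr KG X"
    have p: "?p \<in> KK" by (simp add: KK_ccspan)
    have "\<forall>\<xi>\<in>KK. cinner \<xi> (X - ?p) = 0" using pr_orth by (auto simp: KK_ccspan)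
    then have "E (X - ?p) = 0" "EE2 (X - ?p) = 0" using E 2 by blast+
    then show "E X = EE2 X" using KE[OF p] E by (simp add: bounded_clinearD[OF EE2_bounded] bounded_clinearD[of E])
  qed
qed

lemmas E2_bounded = EE2_bounded[folded target]
lemmas E2_v = EE2_v[folded target]

lemma E2_act: "X \<in> KK \<Longrightarrow> E2 (act x X) = lm x (E2 X)"
  unfolding KK_ccspan
  by (rule bounded_clinear_eq_on[where X = KG])
    (auto simp: KG_def act E2_v lm_rm intro!: bounded_clinear_compose[OF E2_bounded] bounded_clinear_compose[OF lm(1)] act E2_bounded)

lemma act_KK: "X \<in> KK \<Longrightarrow> act x X \<in> KK"
  unfolding KK_ccspan
proof (erule bounded_clinear_maps_ccspan[OF act(1), rotated])
  fix z assume "z \<in> KG"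
  then obtain y a b where "z = tn (\<Lambda> y) (\<Lambda> (v a b))" unfolding KG_def by blast
  then show "act x z \<in> ccspan KG" by (simp add: act lm KG_in)
qed

lemma Theta_act: "X \<in> KK \<Longrightarrow> \<Theta> (act x X) = act x (\<Theta> X)"
  unfolding KK_ccspan
  by (rule bounded_clinear_eq_on[where X = KG])
    (auto simp: KG_def act Theta_tn_v lm_rm bounded_clinearD(7)[OF act(1)] intro!: bounded_clinear_compose[OF Theta_bounded] bounded_clinear_compose[OF act(1)] act Theta_bounded)

end

context ao_group
begin

subsection \<open>Blocks of the edge space\<close>

abbreviation e1 :: "'n \<Rightarrow> real" where "e1 \<equiv> \<lambda>_. 1"

abbreviation gg :: "nat \<Rightarrow> real" where "gg \<equiv> LH.g"

lemma gg_Suc: "gg (Suc k) = gg k * tly D k"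
  by (simp add: LH.g_def)

lemma y_pos: "tly D k > 0" "tly D k > 1"
  using tly_gt_1[OF D_gt_2, of k] by simp_all

lemma cinner_RCc:
  assumes "R.VV k \<phi>" "R.VV k w" "R.VV l \<phi>'" "R.VV l w'"
  shows "cinner (\<Lambda> (R.Cc k \<phi> w)) (\<Lambda> (R.Cc l \<phi>' w')) = (if k = l then ip lam k \<phi>' \<phi> * ip e1 k w w' / complex_of_real (gg k) else 0)"
proof -
  have "cinner (\<Lambda> (R.Cc k \<phi> w)) (\<Lambda> (R.Cc l \<phi>' w')) = LH.hh (R.Cc k \<phi> w) (R.Cc l \<phi>' w')"
    by (simp add: cinner_gns LH.hh_def)
  then show ?thesis using assms by (simp add: R_L_Cc LH.hh_Cc R_L_VV ip_rev)
qed

definition LS :: "nat \<Rightarrow> 'h set" where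
  "LS k = {\<Lambda> (R.Cc k \<phi> w) | \<phi> w. R.VV k \<phi> \<and> R.VV k w}"

lemma LS_orth: "x \<in> LS k \<Longrightarrow> y \<in> LS l \<Longrightarrow> k \<noteq> l \<Longrightarrow> cinner x y = 0"
  unfolding LS_def using cinner_RCc by auto

text \<open>A coefficient of the tensor product of the k-th irreducible with \<open>v\<close>, with
  the last factor kept in the second leg instead of being multiplied; E_2 carries out this
  multiplication.\<close>

definition om :: "nat \<Rightarrow> ('n list \<Rightarrow> complex) \<Rightarrow> ('n list \<Rightarrow> complex) \<Rightarrow> 'k" where
  "om k \<phi> w = (\<Oplus>a b. tn (\<Lambda> (R.Cc k (sl a \<phi>) (sl b w))) (\<Lambda> (v a b)))"

lemma om_diff: "om k (\<lambda>I. u I - c * u' I) w = om k u w - cnj c *\<^sub>C om k u' w"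
    "om k w (\<lambda>I. u I - c * u' I) = om k w u - c *\<^sub>C om k w u'"
proof -
  have *: "sl a (\<lambda>I. u I - c * u' I) = (\<lambda>I. sl a u I - c * sl a u' I)" for a by (simp add: sl_def)
  show "om k (\<lambda>I. u I - c * u' I) w = om k u w - cnj c *\<^sub>C om k u' w"
    by (simp only: om_def * R.Cc_diff \<Lambda>_simps tn_simps sum_subtractf scaleC_sum_right)
  show "om k w (\<lambda>I. u I - c * u' I) = om k w u - c *\<^sub>C om k w u'"
    by (simp only: om_def * R.Cc_diff \<Lambda>_simps tn_simps sum_subtractf scaleC_sum_right)
qed

lemma om_KK: "om k \<phi> w \<in> KK"
  unfolding om_def by (intro csubspaceD(6)[OF KK_sub(1)] tn_v_KK)

lemma cinner_KK_sum: "cinner (\<Oplus>a b. tn (X a b) (\<Lambda> (v a b))) (\<Oplus>a b. tn (Y a b) (\<Lambda> (v a b)))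
   = (\<Oplus>a b. complex_of_real (Nv a) * cinner (X a b) (Y a b))"
proof -
  have "cinner (\<Oplus>a b. tn (X a b) (\<Lambda> (v a b))) (\<Oplus>a b. tn (Y a b) (\<Lambda> (v a b)))
     = (\<Oplus>a b c d. if c = a then if d = b then complex_of_real (Nv a) * cinner (X a b) (Y a b) else 0 else 0)"
    unfolding cinner_sum_left cinner_sum_right cinner_tn cinner_vv by (intro sum.cong refl) auto
  then show ?thesis by (simp only: sum_delta2)
qed

lemma cinner_om:
  assumes "R.EE k \<phi>" "R.EE k w" "R.EE l \<phi>'" "R.EE l w'"
  shows "cinner (om k \<phi> w) (om l \<phi>' w') = (if k = l then ip lam (Suc k) \<phi>' \<phi> * ip e1 (Suc k) w w' / complex_of_real (D * gg k) else 0)"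
proof -
  have "cinner (om k \<phi> w) (om l \<phi>' w') = (\<Oplus>a b. complex_of_real (Nv a) *
      (if k = l then ip lam k (sl a \<phi>') (sl a \<phi>) * ip e1 k (sl b w) (sl b w') / complex_of_real (gg k) else 0))"
    unfolding om_def cinner_KK_sum using assms
    by (intro sum.cong refl) (simp add: cinner_RCc R.EE_VV)
  also have "\<dots> = (if k = l then ip lam (Suc k) \<phi>' \<phi> * ip e1 (Suc k) w w' / complex_of_real (D * gg k) else 0)"
    by (simp add: ip_Suc Nv_def sum_product sum_divide_distrib mult_ac) (intro impI, rule sum.swap)
  finally show ?thesis .
qed

lemma E2_om: "E2 (om k \<phi> w) = \<Lambda> (R.Cc (Suc k) \<phi> w)"
  by (simp add: om_def bounded_clinearD(7)[OF E2_bounded] E2_v rm R.Cc_Suc \<Lambda>_simps)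

text \<open>\<open>cl True k\<close> and \<open>cl False k\<close> are the two summands of \<open>\<complex>\<^sup>n \<otimes> V\<^sub>k \<cong> V\<^bsub>k+1\<^esub> \<oplus> V\<^bsub>k-1\<^esub>\<close>.\<close>

definition cl :: "bool \<Rightarrow> nat \<Rightarrow> ('n list \<Rightarrow> complex) \<Rightarrow> bool" where
  "cl p k \<phi> \<longleftrightarrow> (if p then R.VV (Suc k) \<phi> else (\<exists>j \<phi>0. k = Suc j \<and> R.VV j \<phi>0 \<and> \<phi> = R.cr j \<phi>0))"

lemma cl_EE: "cl p k \<phi> \<Longrightarrow> R.EE k \<phi>"
  by (auto simp: cl_def R.VV_EE R.EE_cr split: if_splits)

lemma q_lam_ones: "q a b \<noteq> 0 \<Longrightarrow> lam a * lam b = 1" "q a b \<noteq> 0 \<Longrightarrow> e1 a * e1 b = 1"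
  using q_lam by auto

lemma ip_cl:
  assumes "cl p k \<phi>" "cl p' k \<phi>'" "p \<noteq> p'" and \<beta>: "\<And>a b. q a b \<noteq> 0 \<Longrightarrow> \<beta> a * \<beta> b = 1"
  shows "ip \<beta> (Suc k) \<phi> \<phi>' = 0"
proof -
  have 1: "ip \<beta> (Suc k) \<phi> \<phi>' = 0" if "cl False k \<phi>" "cl True k \<phi>'" for \<phi> \<phi>'
    using that R.ip_cr_VV[OF \<beta>] by (auto simp: cl_def)
  show ?thesis
  proof (cases p)
    case True then show ?thesis using assms 1[of \<phi>' \<phi>] ip_commute[of \<beta> "Suc k" \<phi> \<phi>'] by simp
  next
    case False then show ?thesis using assms 1 by simp
  qed
qed

text \<open>\<open>p\<close> is the sign of the summand containing the left index and
  \<open>r\<close> that of the right one. Only generators are collected; the blocks themselves are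
  the closed spans.\<close>

definition Bl :: "nat \<Rightarrow> bool \<Rightarrow> bool \<Rightarrow> 'k set" where
  "Bl k p r = {om k \<phi> w | \<phi> w. cl p k \<phi> \<and> cl r k w}"

lemma BlI: "cl p k \<phi> \<Longrightarrow> cl r k w \<Longrightarrow> om k \<phi> w \<in> Bl k p r"
  unfolding Bl_def by blast

lemma Bl_orth: "x \<in> Bl k p r \<Longrightarrow> y \<in> Bl k' p' r' \<Longrightarrow> k \<noteq> k' \<or> p \<noteq> p' \<or> r \<noteq> r' \<Longrightarrow> cinner x y = 0"
proof -
  assume "x \<in> Bl k p r" "y \<in> Bl k' p' r'" and ne: "k \<noteq> k' \<or> p \<noteq> p' \<or> r \<noteq> r'"
  then obtain \<phi> w \<phi>' w' where x: "x = om k \<phi> w" "cl p k \<phi>" "cl r k w" and y: "y = om k' \<phi>' w'" "cl p' k' \<phi>'" "cl r' k' w'"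
    unfolding Bl_def by blast
  show ?thesis
  proof (cases "k = k'")
    case False then show ?thesis using x y by (simp add: cinner_om cl_EE)
  next
    case True
    then have "ip lam (Suc k) \<phi>' \<phi> = 0 \<or> ip e1 (Suc k) w w' = 0"
      using ne x y ip_cl[of p' k \<phi>' p \<phi> lam] ip_cl[of r k w r' w' e1] q_lam_ones by blast
    then show ?thesis using x y True by (auto simp: cinner_om cl_EE)
  qed
qed

lemma om_left_split: "R.EE k \<phi> \<Longrightarrow> cl r k w \<Longrightarrow> om k \<phi> w \<in> cspan (Bl k True r \<union> Bl k False r)"
proof (cases k)
  case 0
  assume "R.EE k \<phi>" "cl r k w"
  then have "om k \<phi> w \<in> Bl k True r" using 0 R.EE_0_VV by (intro BlI) (auto simp: cl_def)
  then show ?thesis by (intro complex_vector.span_base) simp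
next
  case (Suc j)
  assume E: "R.EE k \<phi>" and w: "cl r k w"
  have 1: "om k (R.up k \<phi>) w = om k \<phi> w - cnj (1 / complex_of_real (tly D j)) *\<^sub>C om k (R.cr j (R.tau \<phi>)) w"
    unfolding om_diff(1)[symmetric] Suc R.up.simps by simp
  have "om k (R.up k \<phi>) w \<in> Bl k True r" using w R.VV_up[OF E] by (intro BlI) (auto simp: cl_def[of True])
  moreover have "om k (R.cr j (R.tau \<phi>)) w \<in> Bl k False r"
    using w R.VV_tau_EE E Suc unfolding Bl_def by (intro CollectI exI conjI) (auto simp: cl_def)
  moreover have "om k \<phi> w = om k (R.up k \<phi>) w + cnj (1 / complex_of_real (tly D j)) *\<^sub>C om k (R.cr j (R.tau \<phi>)) w"
    by (simp add: 1)
  ultimately show ?thesis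
    by (metis UnI1 UnI2 complex_vector.span_add complex_vector.span_base complex_vector.span_scale)
qed

definition BB :: "nat \<Rightarrow> 'k set" where
  "BB k = (\<Union>p. \<Union>r. Bl k p r)"

lemma om_split: "R.EE k \<phi> \<Longrightarrow> R.EE k w \<Longrightarrow> om k \<phi> w \<in> cspan (BB k)"
proof (cases k)
  case 0
  assume "R.EE k \<phi>" "R.EE k w"
  then have "om k \<phi> w \<in> Bl k True True" using 0 R.EE_0_VV by (intro BlI) (auto simp: cl_def)
  then show ?thesis by (intro complex_vector.span_base) (auto simp: BB_def)
next
  case (Suc j)
  assume E: "R.EE k \<phi>" and w: "R.EE k w"
  have 1: "om k \<phi> (R.up k w) = om k \<phi> w - (1 / complex_of_real (tly D j)) *\<^sub>C om k \<phi> (R.cr j (R.tau w))"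
    unfolding om_diff(2)[symmetric] Suc R.up.simps by simp
  have sub: "cspan (Bl k True r \<union> Bl k False r) \<subseteq> cspan (BB k)" for r
    by (rule complex_vector.span_mono) (auto simp: BB_def)
  have "om k \<phi> (R.up k w) \<in> cspan (BB k)" using om_left_split[OF E, of True] R.VV_up[OF w] sub by (auto simp: cl_def)
  moreover have "om k \<phi> (R.cr j (R.tau w)) \<in> cspan (BB k)"
  proof -
    have "cl False k (R.cr j (R.tau w))" using R.VV_tau_EE w Suc by (auto simp: cl_def)
    then show ?thesis using om_left_split[OF E, of False] sub by blast
  qed
  moreover have "om k \<phi> w = om k \<phi> (R.up k w) + (1 / complex_of_real (tly D j)) *\<^sub>C om k \<phi> (R.cr j (R.tau w))"
    by (simp add: 1)
  ultimately show ?thesis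
    by (metis complex_vector.span_add complex_vector.span_scale)
qed

lemma tn_om: "tn (\<Lambda> (R.Cc k \<phi> w)) (\<Lambda> (v c d)) = om k (R.sg c \<phi>) (R.sg d w)"
proof -
  have "om k (R.sg c \<phi>) (R.sg d w) = (\<Oplus>a b. if a = c then if b = d then tn (\<Lambda> (R.Cc k \<phi> w)) (\<Lambda> (v c d)) else 0 else 0)"
    unfolding om_def R.sl_sg by (intro sum.cong refl) (auto simp: \<Lambda>_simps tn_simps)
  then show ?thesis by (simp only: sum_delta2)
qed

lemma tn_BB: "R.VV k \<phi> \<Longrightarrow> R.VV k w \<Longrightarrow> tn (\<Lambda> (R.Cc k \<phi> w)) (\<Lambda> (v c d)) \<in> cspan (BB k)"
  unfolding tn_om by (intro om_split R.EE_single)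

lemma L_Cc_R: "L.Cc k \<phi> w = R.Cc k (\<lambda>I. \<phi> (rev I)) (\<lambda>I. w (rev I))"
  by (simp add: R_L_Cc)

lemma KK_BB: "KK = ccspan (\<Union>k. BB k)"
proof
  have "tn (\<Lambda> x) (\<Lambda> (v c d)) \<in> cspan (\<Union>k. BB k)" for x c d
  proof (induction x rule: Cc_induct)
    case (Cc k \<phi> w)
    then have "tn (\<Lambda> (L.Cc k \<phi> w)) (\<Lambda> (v c d)) \<in> cspan (BB k)"
      unfolding L_Cc_R by (intro tn_BB L_R_VV)
    then show ?case using complex_vector.span_mono[of "BB k" "\<Union>k. BB k"] by blast
  qed (simp_all add: \<Lambda>_simps tn_simps complex_vector.span_add complex_vector.span_scale)
  then have "KG \<subseteq> ccspan (\<Union>k. BB k)" unfolding KG_def ccspan_def using closure_subset by blast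
  then show "KK \<subseteq> ccspan (\<Union>k. BB k)" unfolding KK_ccspan by (rule ccspan_minimal) simp_all
  have "BB k \<subseteq> KK" for k using om_KK by (auto simp: BB_def Bl_def)
  then show "ccspan (\<Union>k. BB k) \<subseteq> KK" using KK_sub by (intro ccspan_minimal) auto
qed

text \<open>A coefficient between the two inequivalent summands of C^n \<otimes> \<open>VV k\<close>
  vanishes once the product is carried out.\<close>

lemma E2_mixed: "p \<noteq> r \<Longrightarrow> x \<in> Bl k p r \<Longrightarrow> E2 x = 0"
proof -
  assume "p \<noteq> r" "x \<in> Bl k p r"
  then obtain \<phi> w where x: "x = om k \<phi> w" "cl p k \<phi>" "cl (\<not> p) k w" unfolding Bl_def by (cases p; cases r) auto
  show ?thesis
  proof (cases p)
    case True
    then obtain j w0 where "k = Suc j" "R.VV j w0" "w = R.cr j w0" "R.VV (Suc k) \<phi>" using x by (auto simp: cl_def)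
    then show ?thesis by (simp add: x(1) E2_om R.Cc_VV_cr \<Lambda>_simps)
  next
    case False
    then obtain j \<phi>0 where "k = Suc j" "R.VV j \<phi>0" "\<phi> = R.cr j \<phi>0" "R.VV (Suc k) w" using x by (auto simp: cl_def)
    then show ?thesis by (simp add: x(1) E2_om R.Cc_cr_VV \<Lambda>_simps)
  qed
qed

lemma Bl_0: "Bl 0 False r = {}" "Bl 0 p False = {}"
  by (auto simp: Bl_def cl_def)

lemma E2_pp: "x \<in> Bl k True True \<Longrightarrow> E2 x \<in> LS (Suc k)"
proof -
  assume "x \<in> Bl k True True"
  then obtain \<phi> w where "x = om k \<phi> w" "R.VV (Suc k) \<phi>" "R.VV (Suc k) w" by (auto simp: Bl_def cl_def)
  moreover from this have "E2 x = \<Lambda> (R.Cc (Suc k) \<phi> w)" by (simp add: E2_om)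
  ultimately show ?thesis unfolding LS_def by blast
qed

lemma E2_mm: "x \<in> Bl (Suc k) False False \<Longrightarrow> E2 x \<in> LS k"
proof -
  assume "x \<in> Bl (Suc k) False False"
  then obtain \<phi>0 w0 where x: "x = om (Suc k) (R.cr k \<phi>0) (R.cr k w0)" "R.VV k \<phi>0" "R.VV k w0" by (auto simp: Bl_def cl_def)
  have "E2 x = \<Lambda> (R.Cc k \<phi>0 (\<lambda>I. complex_of_real (tly D k) * w0 I))" using x by (simp add: E2_om R.Cc_cr_cr R.Cc_scale)
  then show ?thesis unfolding LS_def using x R.VV_scale by blast
qed

text \<open>The Gram matrices on the two sides differ only in the normalisations
  \<open>D * gg k\<close> and \<open>gg (Suc k)\<close>, whose quotient is the factor.\<close>

lemma E2_pp_norm: "x \<in> ccspan (Bl k True True) \<Longrightarrow> (norm (E2 x))\<^sup>2 = D / tly D k * (norm x)\<^sup>2"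
proof (rule gram_scaling[OF E2_bounded])
  fix x y assume "x \<in> Bl k True True" "y \<in> Bl k True True"
  then obtain \<phi> w \<phi>' w' where x: "x = om k \<phi> w" "R.VV (Suc k) \<phi>" "R.VV (Suc k) w"
    and y: "y = om k \<phi>' w'" "R.VV (Suc k) \<phi>'" "R.VV (Suc k) w'" by (auto simp: Bl_def cl_def)
  show "cinner (E2 x) (E2 y) = complex_of_real (D / tly D k) * cinner x y"
    using x y y_pos(1)[of k] D_gt_2 LH.g_pos[of k]
    by (simp add: E2_om cinner_RCc cinner_om R.VV_EE gg_Suc field_simps)
qed

text \<open>The two maps \<open>cr k\<close> contribute y_k^2 both in the edge space and in its
  image; what remains is the quotient of \<open>D * gg (Suc k)\<close> and
  \<open>gg k\<close>.\<close>

lemma E2_mm_norm: "x \<in> ccspan (Bl (Suc k) False False) \<Longrightarrow> (norm (E2 x))\<^sup>2 = D * tly D k * (norm x)\<^sup>2"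
proof (rule gram_scaling[OF E2_bounded])
  fix x y assume "x \<in> Bl (Suc k) False False" "y \<in> Bl (Suc k) False False"
  then obtain \<phi> w \<phi>' w' where x: "x = om (Suc k) (R.cr k \<phi>) (R.cr k w)" "R.VV k \<phi>" "R.VV k w"
    and y: "y = om (Suc k) (R.cr k \<phi>') (R.cr k w')" "R.VV k \<phi>'" "R.VV k w'" by (auto simp: Bl_def cl_def)
  show "cinner (E2 x) (E2 y) = complex_of_real (D * tly D k) * cinner x y"
    using x y y_pos(1)[of k] D_gt_2 LH.g_pos[of k] R.ip_cr_cr[of lam k \<phi>' \<phi>] R.ip_cr_cr[of e1 k w w'] q_lam_ones
    by (simp add: E2_om cinner_RCc cinner_om R.EE_cr gg_Suc R.Cc_cr_cr \<Lambda>_simps cinner_simps field_simps)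
qed

subsection \<open>The reversing operator on blocks\<close>

text \<open>Half of the expansion of \<open>star (v b d)\<close> by \<open>star_v\<close>: the
  factor \<open>s * cnj (q b e)\<close> contracts the column leg of the old edge, and
  \<open>e\<close> becomes the row index of the new one. The other half, \<open>q f d\<close>, is
  \<open>uq\<close>.\<close>

definition wq :: "'n \<Rightarrow> ('n list \<Rightarrow> complex) \<Rightarrow> 'n list \<Rightarrow> complex" where
  "wq e w = (\<lambda>I. \<Oplus>b. (s * cnj (q b e)) * sl b w I)"

lemma wq_VV: "R.EE k w \<Longrightarrow> R.VV k (wq e w)"
  unfolding wq_def by (intro R.VV_sum R.EE_VV)

definition uq :: "'n \<Rightarrow> ('n list \<Rightarrow> complex) \<Rightarrow> 'n list \<Rightarrow> complex" where
  "uq f w = (\<lambda>I. \<Oplus>d. q f d * R.sg d w I)"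

lemma Theta_om: "\<Theta> (om k \<phi> w) = (\<Oplus>e f. tn (\<Lambda> (R.Cc (Suc k) \<phi> (uq f (wq e w)))) (\<Lambda> (v e f)))"
proof -
  have 1: "R.Cc (Suc k) \<phi> (uq f (wq e w)) = (\<Oplus>d b a. (s * cnj (q b e) * q f d) *\<^sub>C (R.Cc k (sl a \<phi>) (sl b w) * v a d))" for e f
  proof -
    have "R.Cc (Suc k) \<phi> (uq f (wq e w)) = (\<Oplus>d. q f d *\<^sub>C R.Cc (Suc k) \<phi> (R.sg d (wq e w)))"
      unfolding uq_def by (rule R.Cc_sum_right)
    also have "\<dots> = (\<Oplus>d. q f d *\<^sub>C (\<Oplus>a. R.Cc k (sl a \<phi>) (wq e w) * v a d))"
    proof (intro sum.cong refl arg_cong[where f = "scaleC _"])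
      fix d
      have "R.Cc (Suc k) \<phi> (R.sg d (wq e w)) = (\<Oplus>a b. if b = d then R.Cc k (sl a \<phi>) (wq e w) * v a d else 0)"
        unfolding R.Cc_Suc R.sl_sg by (intro sum.cong refl) simp
      then show "R.Cc (Suc k) \<phi> (R.sg d (wq e w)) = (\<Oplus>a. R.Cc k (sl a \<phi>) (wq e w) * v a d)" by simp
    qed
    also have "\<dots> = (\<Oplus>d a b. (s * cnj (q b e) * q f d) *\<^sub>C (R.Cc k (sl a \<phi>) (sl b w) * v a d))"
    proof -
      have "R.Cc k (sl a \<phi>) (wq e w) = (\<Oplus>b. (s * cnj (q b e)) *\<^sub>C R.Cc k (sl a \<phi>) (sl b w))" for a
        unfolding wq_def by (rule R.Cc_sum_right)
      then show ?thesis by (simp add: sum_distrib_right scaleC_sum_right scaleC_scaleC scaleC_mult_left mult_ac)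
    qed
    also have "\<dots> = (\<Oplus>d b a. (s * cnj (q b e) * q f d) *\<^sub>C (R.Cc k (sl a \<phi>) (sl b w) * v a d))"
      by (intro sum.cong refl sum.swap)
    finally show ?thesis .
  qed
  have "\<Theta> (om k \<phi> w) = (\<Oplus>a b d. tn (\<Lambda> (R.Cc k (sl a \<phi>) (sl b w) * v a d)) (\<Lambda> (star (v b d))))"
    unfolding om_def by (simp add: bounded_clinearD(7)[OF Theta_bounded] Theta_v)
  also have "\<dots> = (\<Oplus>a b d e f. (s * cnj (q b e) * q f d) *\<^sub>C tn (\<Lambda> (R.Cc k (sl a \<phi>) (sl b w) * v a d)) (\<Lambda> (v e f)))"
    unfolding tn_star_v ..
  also have "\<dots> = (\<Oplus>d b a e f. (s * cnj (q b e) * q f d) *\<^sub>C tn (\<Lambda> (R.Cc k (sl a \<phi>) (sl b w) * v a d)) (\<Lambda> (v e f)))"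
    by (rule trans[OF sum_swap3[symmetric]]) (rule sum.cong[OF refl sum.swap])
  also have "\<dots> = (\<Oplus>d e f b a. (s * cnj (q b e) * q f d) *\<^sub>C tn (\<Lambda> (R.Cc k (sl a \<phi>) (sl b w) * v a d)) (\<Lambda> (v e f)))"
    by (intro sum.cong refl sum_swap4)
  also have "\<dots> = (\<Oplus>e f d b a. (s * cnj (q b e) * q f d) *\<^sub>C tn (\<Lambda> (R.Cc k (sl a \<phi>) (sl b w) * v a d)) (\<Lambda> (v e f)))"
    by (rule sum_swap3)
  also have "\<dots> = (\<Oplus>e f. tn (\<Lambda> (R.Cc (Suc k) \<phi> (uq f (wq e w)))) (\<Lambda> (v e f)))"
    unfolding 1 by (simp add: \<Lambda>_simps tn_simps)
  finally show ?thesis .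
qed

lemma om_sg: "om k (R.sg e \<phi>) w = (\<Oplus>f. tn (\<Lambda> (R.Cc k \<phi> (sl f w))) (\<Lambda> (v e f)))"
proof -
  have "om k (R.sg e \<phi>) w = (\<Oplus>a. if a = e then (\<Oplus>f. tn (\<Lambda> (R.Cc k \<phi> (sl f w))) (\<Lambda> (v e f))) else 0)"
    unfolding om_def R.sl_sg by (intro sum.cong refl) (auto simp: \<Lambda>_simps tn_simps)
  then show ?thesis by simp
qed

lemma uq_Cons: "uq f w [] = 0" "uq f w (d # I) = q f d * w I"
proof -
  show "uq f w [] = 0" by (simp add: uq_def R.sg_def)
  have "uq f w (d # I) = (\<Oplus>d'. (if d' = d then q f d else 0) * w I)"
    unfolding uq_def by (intro sum.cong refl) (auto simp: R.sg_def)
  then show "uq f w (d # I) = q f d * w I" unfolding sum_if_mult by simp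
qed

lemma uq_cr: "uq f w = sl f (R.cr 0 w)"
proof
  fix I show "uq f w I = sl f (R.cr 0 w) I" by (cases I) (simp_all add: uq_Cons)
qed

text \<open>\<open>uq f\<close> gives slice f of the leading term of \<open>R.cr k (wq e w)\<close>.
  The correction contributes nothing, because its coefficient against a highest weight vector
  vanishes.\<close>

lemma Theta_plus:
  assumes \<phi>: "R.VV (Suc k) \<phi>" and w: "R.EE k w"
  shows "\<Theta> (om k \<phi> w) = (\<Oplus>e. om (Suc k) (R.sg e \<phi>) (R.cr k (wq e w)))"
proof -
  have "R.Cc (Suc k) \<phi> (uq f (wq e w)) = R.Cc (Suc k) \<phi> (sl f (R.cr k (wq e w)))" for e f
  proof (cases k)
    case 0 then show ?thesis by (simp add: uq_cr)
  next
    case (Suc j)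
    have "sl f (R.cr (Suc j) (wq e w)) = (\<lambda>I. uq f (wq e w) I - (s / complex_of_real (tly D j)) * R.cr j (sl f (wq e w)) I)"
    proof
      fix I show "sl f (R.cr (Suc j) (wq e w)) I = uq f (wq e w) I - (s / complex_of_real (tly D j)) * R.cr j (sl f (wq e w)) I"
        by (simp add: R.cr_Suc uq_cr)
    qed
    moreover have "R.VV j (sl f (wq e w))" using R.VV_sl wq_VV[OF w] Suc by blast
    then have "R.Cc (Suc (Suc j)) \<phi> (R.cr j (sl f (wq e w))) = 0" using \<phi> Suc by (simp add: R.Cc_VV_cr)
    ultimately show ?thesis unfolding Suc by (simp only: R.Cc_diff) simp
  qed
  then show ?thesis by (simp add: Theta_om om_sg)
qed

text \<open>Against \<open>R.cr j \<phi>\<close> only the lower component of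
  \<open>uq f (wq e w)\<close> contributes. It is found with \<open>R.tau\<close>, and the conjugate
  equation reduces it to slice f of \<open>wq e w\<close>, up to \<open>s\<close>.\<close>

lemma Theta_minus:
  assumes \<phi>: "R.VV j \<phi>" and w: "R.EE (Suc j) w"
  shows "\<Theta> (om (Suc j) (R.cr j \<phi>) w) = (\<Oplus>e. om j (R.sg e \<phi>) (\<lambda>I. s * wq e w I))"
proof -
  have "R.Cc (Suc (Suc j)) (R.cr j \<phi>) (uq f (wq e w)) = R.Cc j \<phi> (sl f (\<lambda>I. s * wq e w I))" for e f
  proof -
    let ?u = "uq f (wq e w)"
    have V: "R.VV (Suc j) (wq e w)" by (rule wq_VV[OF w])
    have E: "R.EE (Suc j) ?u"
      unfolding R.EE_def
    proof (intro conjI allI)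
      show "?u [] = 0" by (simp add: uq_Cons)
      fix a have "sl a ?u = (\<lambda>I. q f a * wq e w I)" by (simp add: sl_def uq_Cons)
      then show "R.VV (Suc j) (sl a ?u)" using R.VV_scale[OF V] by simp
    qed
    have tau: "R.tau ?u = sl f (\<lambda>I. s * wq e w I)"
    proof
      fix J
      have "R.tau ?u J = (\<Oplus>b. (\<Oplus>a. q f a * cnj (q a b)) * wq e w (b # J))"
        unfolding R.tau_def uq_Cons by (subst sum.swap) (simp add: sum_distrib_left sum_distrib_right mult_ac)
      also have "\<dots> = (\<Oplus>b. (if b = f then s else 0) * wq e w (b # J))"
        unfolding qq by (intro sum.cong refl) auto
      finally show "R.tau ?u J = sl f (\<lambda>I. s * wq e w I) J" unfolding sum_if_mult by simp
    qed
    have "?u = (\<lambda>I. R.up (Suc j) ?u I - (- 1 / complex_of_real (tly D j)) * R.cr j (R.tau ?u) I)" by simp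
    then have "R.Cc (Suc (Suc j)) (R.cr j \<phi>) ?u = R.Cc (Suc (Suc j)) (R.cr j \<phi>) (R.up (Suc j) ?u)
        - (- 1 / complex_of_real (tly D j)) *\<^sub>C R.Cc (Suc (Suc j)) (R.cr j \<phi>) (R.cr j (R.tau ?u))"
      by (subst \<open>?u = _\<close>, subst R.Cc_diff(1)) (rule refl)
    also have "\<dots> = R.Cc j \<phi> (R.tau ?u)"
      using R.Cc_cr_VV[OF \<phi> R.VV_up[OF E]] R.Cc_cr_cr[OF \<phi> R.VV_tau_EE[OF E]] y_pos(1)[of j]
      by (simp add: scaleC_scaleC)
    finally show ?thesis unfolding tau .
  qed
  then show ?thesis by (simp add: Theta_om om_sg)
qed

definition RowP :: "nat \<Rightarrow> 'k set" where "RowP k = Bl k True True \<union> Bl k True False"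
definition RowM :: "nat \<Rightarrow> 'k set" where "RowM k = Bl k False True \<union> Bl k False False"
definition ColP :: "nat \<Rightarrow> 'k set" where "ColP k = Bl k True True \<union> Bl k False True"
definition ColM :: "nat \<Rightarrow> 'k set" where "ColM k = Bl k True False \<union> Bl k False False"

lemma Theta_RowP: "x \<in> RowP k \<Longrightarrow> \<Theta> x \<in> ccspan (ColM (Suc k))"
proof -
  assume "x \<in> RowP k"
  then obtain r where "x \<in> Bl k True r" unfolding RowP_def by blast
  then obtain \<phi> w where x: "x = om k \<phi> w" "R.VV (Suc k) \<phi>" "cl r k w" by (auto simp: Bl_def cl_def[of True])
  have "om (Suc k) (R.sg e \<phi>) (R.cr k (wq e w)) \<in> ccspan (ColM (Suc k))" for e
  proof -
    have "cl False (Suc k) (R.cr k (wq e w))" using wq_VV[OF cl_EE[OF x(3)]] by (auto simp: cl_def)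
    then have "om (Suc k) (R.sg e \<phi>) (R.cr k (wq e w)) \<in> cspan (ColM (Suc k))"
      unfolding ColM_def using R.EE_single[OF x(2)] by (intro om_left_split)
    then show ?thesis unfolding ccspan_def using closure_subset by blast
  qed
  then show ?thesis
    unfolding x(1) Theta_plus[OF x(2) cl_EE[OF x(3)]] by (intro csubspaceD(6)[OF csubspace_ccspan])
qed

lemma Theta_RowM: "x \<in> RowM (Suc k) \<Longrightarrow> \<Theta> x \<in> ccspan (ColP k)"
proof -
  assume "x \<in> RowM (Suc k)"
  then obtain r where "x \<in> Bl (Suc k) False r" unfolding RowM_def by blast
  then obtain \<phi> w where x: "x = om (Suc k) (R.cr k \<phi>) w" "R.VV k \<phi>" "cl r (Suc k) w" by (auto simp: Bl_def cl_def[of False])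
  have "om k (R.sg e \<phi>) (\<lambda>I. s * wq e w I) \<in> ccspan (ColP k)" for e
  proof -
    have "cl True k (\<lambda>I. s * wq e w I)" using R.VV_scale[OF wq_VV[OF cl_EE[OF x(3)]]] by (auto simp: cl_def)
    then have "om k (R.sg e \<phi>) (\<lambda>I. s * wq e w I) \<in> cspan (ColP k)"
      unfolding ColP_def using R.EE_single[OF x(2)] by (intro om_left_split)
    then show ?thesis unfolding ccspan_def using closure_subset by blast
  qed
  then show ?thesis
    unfolding x(1) Theta_minus[OF x(2) cl_EE[OF x(3)]] by (intro csubspaceD(6)[OF csubspace_ccspan])
qed

lemma RowM_0: "RowM 0 = {}"
  by (simp add: RowM_def Bl_0)

lemma Col_orth: "x \<in> ColP k \<Longrightarrow> y \<in> ColM l \<Longrightarrow> cinner x y = 0"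
    "x \<in> ColM k \<Longrightarrow> y \<in> ColP l \<Longrightarrow> cinner x y = 0"
    "k \<noteq> l \<Longrightarrow> x \<in> ColP k \<Longrightarrow> y \<in> ColP l \<Longrightarrow> cinner x y = 0"
    "k \<noteq> l \<Longrightarrow> x \<in> ColM k \<Longrightarrow> y \<in> ColM l \<Longrightarrow> cinner x y = 0"
  by (auto simp: ColP_def ColM_def intro: Bl_orth)

lemma BB_rows: "BB k = RowP k \<union> RowM k"
  by (auto simp: BB_def RowP_def RowM_def) (metis (full_types))+

lemma in_BB_E:
  assumes "x \<in> (\<Union>k. BB k)"
  obtains k p r where "x \<in> Bl k p r"
  using assms unfolding BB_def by blast

text \<open>\<Theta> sends each row into one column, and distinct rows into mutually orthogonal
  columns, so projections are carried along.\<close>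

lemma pr_Theta_RowP:
  assumes "\<xi> \<in> KK"
  shows "pr (ColM (Suc k)) (\<Theta> \<xi>) = \<Theta> (pr (RowP k) \<xi>)"
proof (rule pr_intertwine[OF Theta_bounded])
  let ?Y = "(\<Union>l\<in>- {k}. RowP l) \<union> (\<Union>l. RowM l)"
  have "(\<Union>k. BB k) = RowP k \<union> ?Y" by (auto simp: BB_rows)
  then show "\<xi> \<in> ccspan (RowP k \<union> ?Y)" using assms by (simp only: KK_BB)
  show "cinner x y = 0" if "x \<in> RowP k" "y \<in> ?Y" for x y
    using that by (auto simp: RowP_def RowM_def intro: Bl_orth)
  show "\<Theta> x \<in> ccspan (ColM (Suc k))" if "x \<in> RowP k" for x by (rule Theta_RowP[OF that])
  fix y z assume y: "y \<in> ?Y" and z: "z \<in> ColM (Suc k)"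
  from y consider l where "l \<noteq> k" "y \<in> RowP l" | l where "y \<in> RowM l" by blast
  then show "cinner z (\<Theta> y) = 0"
  proof cases
    case 1
    show ?thesis by (rule orth_ccspan[OF Theta_RowP[OF 1(2)]]) (use z 1(1) Col_orth(4)[of "Suc k" "Suc l"] in auto)
  next
    case 2
    then obtain j where "l = Suc j" using RowM_0 by (cases l) auto
    then have "\<Theta> y \<in> ccspan (ColP j)" using 2 Theta_RowM by blast
    then show ?thesis by (rule orth_ccspan) (use z Col_orth(2) in auto)
  qed
qed

lemma pr_Theta_RowM:
  assumes "\<xi> \<in> KK"
  shows "pr (ColP k) (\<Theta> \<xi>) = \<Theta> (pr (RowM (Suc k)) \<xi>)"
proof (rule pr_intertwine[OF Theta_bounded])
  let ?Y = "(\<Union>l. RowP l) \<union> (\<Union>l\<in>- {Suc k}. RowM l)"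
  have "(\<Union>k. BB k) = RowM (Suc k) \<union> ?Y" by (auto simp: BB_rows)
  then show "\<xi> \<in> ccspan (RowM (Suc k) \<union> ?Y)" using assms by (simp only: KK_BB)
  show "cinner x y = 0" if "x \<in> RowM (Suc k)" "y \<in> ?Y" for x y
    using that by (auto simp: RowP_def RowM_def intro: Bl_orth)
  show "\<Theta> x \<in> ccspan (ColP k)" if "x \<in> RowM (Suc k)" for x by (rule Theta_RowM[OF that])
  fix y z assume y: "y \<in> ?Y" and z: "z \<in> ColP k"
  from y consider l where "y \<in> RowP l" | l where "l \<noteq> Suc k" "y \<in> RowM l" by blast
  then show "cinner z (\<Theta> y) = 0"
  proof cases
    case 1
    show ?thesis by (rule orth_ccspan[OF Theta_RowP[OF 1]]) (use z Col_orth(1) in auto)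
  next
    case 2
    then obtain j where "l = Suc j" "j \<noteq> k" using RowM_0 by (cases l) auto
    then have "\<Theta> y \<in> ccspan (ColP j)" using 2 Theta_RowM by blast
    then show ?thesis by (rule orth_ccspan) (use z Col_orth(3)[of k j] \<open>j \<noteq> k\<close> in auto)
  qed
qed

end

section \<open>Square sums over orthogonal components and the scalar recursion of the block
  norms\<close>

lemma pr_UN_orthogonal:
  fixes X :: "nat \<Rightarrow> 'h::chilbert_space set"
  assumes "\<And>k l x y. k \<noteq> l \<Longrightarrow> x \<in> X k \<Longrightarrow> y \<in> X l \<Longrightarrow> cinner x y = 0"
  shows "pr (\<Union>k<n. X k) \<xi> = (\<Sum>k<n. pr (X k) \<xi>)" "(norm (pr (\<Union>k<n. X k) \<xi>))\<^sup>2 = (\<Sum>k<n. (norm (pr (X k) \<xi>))\<^sup>2)"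
proof -
  have z: "pr {} \<xi> = 0" by (rule pr_zero) simp
  have e: "(\<Union>k<Suc n. X k) = (\<Union>k<n. X k) \<union> X n" for n by (simp add: lessThan_Suc Un_commute)
  have o: "cinner x y = 0" if x: "x \<in> (\<Union>k<n. X k)" and y: "y \<in> X n" for x y n
  proof -
    obtain k where "k < n" "x \<in> X k" using x by blast
    then show ?thesis using y assms[of k n x y] by simp
  qed
  show "pr (\<Union>k<n. X k) \<xi> = (\<Sum>k<n. pr (X k) \<xi>)"
  proof (induction n)
    case 0 then show ?case by (simp add: z)
  next
    case (Suc n) then show ?case unfolding e by (subst pr_Un) (use o in auto)
  qed
  show "(norm (pr (\<Union>k<n. X k) \<xi>))\<^sup>2 = (\<Sum>k<n. (norm (pr (X k) \<xi>))\<^sup>2)"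
  proof (induction n)
    case 0 then show ?case by (simp add: z)
  next
    case (Suc n) then show ?case unfolding e by (subst pr_Un_norm) (use o in auto)
  qed
qed

lemma bessel_tendsto_0:
  fixes X :: "nat \<Rightarrow> 'h::chilbert_space set"
  assumes "\<And>k l x y. k \<noteq> l \<Longrightarrow> x \<in> X k \<Longrightarrow> y \<in> X l \<Longrightarrow> cinner x y = 0"
  shows "(\<lambda>k. (norm (pr (X k) \<xi>))\<^sup>2) \<longlonglongrightarrow> 0"
proof (rule summable_LIMSEQ_zero, rule summableI_nonneg_bounded)
  fix n
  have "(\<Sum>k<n. (norm (pr (X k) \<xi>))\<^sup>2) = (norm (pr (\<Union>k<n. X k) \<xi>))\<^sup>2"
    using pr_UN_orthogonal(2)[of X n \<xi>] assms by metis
  also have "\<dots> \<le> (norm \<xi>)\<^sup>2" by (intro power_mono pr_norm_le) simp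
  finally show "(\<Sum>k<n. (norm (pr (X k) \<xi>))\<^sup>2) \<le> (norm \<xi>)\<^sup>2" .
qed simp

text \<open>The scalar core of the injectivity argument. The shift by two in \<open>d2\<close>
  arises because E_2 maps the block (+,+) of level k and the block (-,-) of level k + 2 to the same
  level k + 1 of H.\<close>

lemma block_masses_vanish:
  fixes a b c d y :: "nat \<Rightarrow> real"
  assumes nn: "\<And>k. 0 \<le> a k" and y: "\<And>k. 1 < y k"
    and ab: "\<And>k. a k + b k = b (Suc k) + d (Suc k)" and cd: "\<And>k. c (Suc k) + d (Suc k) = a k + c k"
    and d2: "\<And>k. d (Suc (Suc k)) = a k / (y k * y (Suc k))" and 0: "d 0 = 0" "d 1 = 0" "b 0 = 0" "c 0 = 0"
    and lim: "b \<longlonglongrightarrow> 0"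
  shows "a k = 0 \<and> b k = 0 \<and> c k = 0 \<and> d k = 0"
proof -
  have yy: "1 < y k * y (Suc k)" for k using y[of k] y[of "Suc k"] by (simp add: less_1_mult)
  have dle: "d (Suc (Suc k)) \<le> a k" for k
    using mult_left_mono[of 1 "y k * y (Suc k)" "a k"] nn[of k] yy[of k] by (simp add: d2 divide_le_eq)
  have b: "b (Suc n) = a n + (\<Sum>k<n. a k - d (Suc (Suc k)))" for n
  proof (induction n)
    case 0 then show ?case using ab[of 0] \<open>b 0 = 0\<close> \<open>d 1 = 0\<close> by simp
  next
    case (Suc n) then show ?case using ab[of "Suc n"] by simp
  qed
  have a0: "a m = 0" for m
  proof -
    have le: "a m - d (Suc (Suc m)) \<le> b (Suc n)" if "m < n" for n
    proof -
      have "a m - d (Suc (Suc m)) \<le> (\<Sum>k<n. a k - d (Suc (Suc k)))"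
        using that dle by (intro member_le_sum[where f = "\<lambda>k. a k - d (Suc (Suc k))"]) auto
      then show ?thesis using nn[of n] by (simp add: b)
    qed
    have "(\<lambda>n. b (Suc n)) \<longlonglongrightarrow> 0" using lim by (rule LIMSEQ_Suc)
    then have "a m - d (Suc (Suc m)) \<le> 0"
      by (rule LIMSEQ_le_const) (use le in \<open>intro exI[of _ "Suc m"], auto\<close>)
    then have "a m * (y m * y (Suc m)) \<le> a m * 1" using yy[of m] by (simp add: d2 field_simps)
    then show ?thesis using yy[of m] nn[of m] by (metis linorder_not_le mult_le_cancel_left_pos order_le_less)
  qed
  have d0: "d k = 0" for k
    using d2 a0 0 by (cases k; cases "k - 1") (auto simp: numeral_eq_Suc)
  \<comment> \<open>With \<open>a\<close> and \<open>d\<close> zero the two balance equations make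
    \<open>b\<close> and \<open>c\<close> constant, and both start at 0.\<close>
  have "b k = 0 \<and> c k = 0"
  proof (induction k)
    case 0 then show ?case using \<open>b 0 = 0\<close> \<open>c 0 = 0\<close> by simp
  next
    case (Suc k) then show ?case using ab[of k] cd[of k] by (simp add: a0 d0)
  qed
  then show ?thesis using a0 d0 by simp
qed

context ao_group
begin

subsection \<open>The adjoints of the source and target maps\<close>

text \<open>The vector representing the counit on the span of the \<open>v a b\<close>;
  \<open>D / lam i\<close> is the inverse of the squared norm of
  \<open>\<Lambda> (v i i)\<close>.\<close>

definition ev :: 'a where
  "ev = (\<Oplus>i. complex_of_real (D / lam i) *\<^sub>C v i i)"

lemma ev_v: "cinner (\<Lambda> ev) (\<Lambda> (v a b)) = (if a = b then 1 else 0)"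
proof -
  have "cinner (\<Lambda> ev) (\<Lambda> (v a b)) = (\<Oplus>i. if i = a then (if a = b then 1 else 0) else 0)"
    unfolding ev_def \<Lambda>_simps cinner_sum_left cinner_scaleC_left cinner_vv
    using lam_pos[of a] D_gt_2 by (intro sum.cong refl) (auto simp: Nv_def)
  then show ?thesis by simp
qed

lemma ev_star_v: "cinner (\<Lambda> ev) (\<Lambda> (star (v j k))) = (if j = k then 1 else 0)"
proof -
  have "cinner (\<Lambda> ev) (\<Lambda> (star (v j k))) = (\<Oplus>c d. (s * cnj (q j c) * q d k) * (if c = d then 1 else 0))"
    by (simp add: star_v \<Lambda>_simps cinner_sum_right cinner_scaleC_right ev_v)
  also have "\<dots> = (\<Oplus>c. s * cnj (q j c) * q c k)" by (intro sum.cong refl) (simp add: if_distrib cong: if_cong)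
  also have "\<dots> = s * (\<Oplus>c. cnj (q j c) * q c k)" by (simp add: sum_distrib_left mult.assoc)
  finally show ?thesis using s(1) by (simp add: qq')
qed

lemma ev_ev: "cinner (\<Lambda> ev) (\<Lambda> ev) = complex_of_real (D\<^sup>2)"
proof -
  have "cinner (\<Lambda> ev) (\<Lambda> ev) = (\<Oplus>i. complex_of_real (D / lam i))"
    by (subst (2) ev_def) (simp add: \<Lambda>_simps cinner_sum_right cinner_scaleC_right ev_v)
  also have "\<dots> = complex_of_real (D * (\<Oplus>i. 1 / lam i))" by (simp add: sum_distrib_left)
  finally show ?thesis by (simp add: lam_inv_sum D_def power2_eq_square)
qed

text \<open>The adjoint of the source map E_1.\<close>

definition F1 :: "'h \<Rightarrow> 'k" where "F1 \<zeta> = tn \<zeta> (\<Lambda> ev)"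

lemma F1_bounded: "bounded_clinear F1"
  unfolding F1_def[abs_def] by (rule tn_bounded)

lemma F1_expand: "F1 \<zeta> = (\<Oplus>i. complex_of_real (D / lam i) *\<^sub>C tn \<zeta> (\<Lambda> (v i i)))"
  by (simp add: F1_def ev_def \<Lambda>_simps tn_simps)

lemma F1_KK: "F1 \<zeta> \<in> KK"
  unfolding F1_expand by (intro csubspaceD(6)[OF KK_sub(1)] csubspaceD(3)[OF KK_sub(1)] tn_v_KK)

lemma cinner_F1: "cinner (F1 \<zeta>) (F1 \<xi>) = complex_of_real (D\<^sup>2) * cinner \<zeta> \<xi>"
  by (simp only: F1_def cinner_tn ev_ev mult.commute)

lemma KK_E: "X \<in> KK \<Longrightarrow> \<exists>\<xi>. X = (\<Oplus>a b. tn (\<xi> a b) (\<Lambda> (v a b)))"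
  by (rule exI[of _ "\<lambda>a b. complex_of_real (1 / Nv a) *\<^sub>C sl1 a b X"], simp only: tn_simps, rule KK_expand)

text \<open>In other words E_1 \<Theta> = E_2 on the edge space: the counit applied to the adjoints
  in \<open>Theta_tn_v\<close> leaves a single term.\<close>

lemma cinner_F1_Theta: "X \<in> KK \<Longrightarrow> cinner (F1 \<zeta>) (\<Theta> X) = cinner \<zeta> (E2 X)"
proof -
  assume "X \<in> KK"
  then obtain \<xi> where X: "X = (\<Oplus>a b. tn (\<xi> a b) (\<Lambda> (v a b)))" using KK_E by blast
  have "cinner (F1 \<zeta>) (\<Theta> (tn (\<xi> a b) (\<Lambda> (v a b)))) = cinner \<zeta> (rm a b (\<xi> a b))" for a b
  proof -
    have "cinner (F1 \<zeta>) (\<Theta> (tn (\<xi> a b) (\<Lambda> (v a b)))) = (\<Oplus>k. (if k = b then 1 else 0) * cinner \<zeta> (rm a k (\<xi> a b)))"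
      unfolding Theta_tn_v cinner_sum_right F1_def cinner_tn ev_star_v by (intro sum.cong refl) auto
    then show ?thesis unfolding sum_if_mult by simp
  qed
  then show ?thesis
    by (simp add: X bounded_clinearD(7)[OF Theta_bounded] bounded_clinearD(7)[OF E2_bounded] cinner_sum_right E2_v)
qed

lemma sum_lam_star_v: "(\<Oplus>d. complex_of_real (lam d) *\<^sub>C star (v d d)) = (\<Oplus>i. complex_of_real (1 / lam i) *\<^sub>C v i i)"
proof -
  have l: "complex_of_real (lam d) * cnj (q d c) = complex_of_real (1 / lam c) * cnj (q d c)" for d c
  proof (cases "q d c = 0")
    case False
    then have "lam d = 1 / lam c" using q_lam[of d c] lam_pos[of c] by (simp add: field_simps)
    then show ?thesis by simp
  qed simp
  have "(\<Oplus>d. complex_of_real (lam d) *\<^sub>C star (v d d))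
     = (\<Oplus>d c f. (s * (complex_of_real (lam d) * cnj (q d c)) * q f d) *\<^sub>C v c f)"
    by (simp add: star_v scaleC_sum_right scaleC_scaleC mult_ac)
  also have "\<dots> = (\<Oplus>c f d. (s * (complex_of_real (1 / lam c) * cnj (q d c)) * q f d) *\<^sub>C v c f)"
    unfolding l by (rule sum_swap3)
  also have "\<dots> = (\<Oplus>c f. (s * complex_of_real (1 / lam c) * (\<Oplus>d. q f d * cnj (q d c))) *\<^sub>C v c f)"
    by (simp only: sum_distrib_left scaleC_sum_left) (simp only: mult_ac)
  also have "\<dots> = (\<Oplus>c f. (if f = c then complex_of_real (1 / lam c) else 0) *\<^sub>C v c f)"
    unfolding qq using s(1) by (intro sum.cong refl) auto
  finally show ?thesis by (simp only: sum_if_scaleC)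
qed

text \<open>The first reversal produces adjoints in the second leg, the next one another factor
  \<open>v\<close>. The two neighbouring factors contract by invariance (\<open>v_row\<close>), and
  \<open>q_row\<close> makes the remaining sum diagonal.\<close>

lemma Theta_Theta_F1: "\<Theta> (\<Theta> (F1 \<zeta>)) = F1 \<zeta>"
proof (rule bounded_clinear_eq_on[where X = "range \<Lambda>" and S = "\<lambda>\<zeta>. \<Theta> (\<Theta> (F1 \<zeta>))" and T = F1])
  show "bounded_clinear (\<lambda>\<zeta>. \<Theta> (\<Theta> (F1 \<zeta>)))"
    by (rule bounded_clinear_compose[OF Theta_bounded bounded_clinear_compose[OF Theta_bounded F1_bounded]])
  fix \<zeta> assume "\<zeta> \<in> range \<Lambda>"
  then obtain x where x: "\<zeta> = \<Lambda> x" by blast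
  have l: "complex_of_real (D / lam i) * (s * cnj (q i c) * q d k) = complex_of_real D * q d k * cnj (q c i)" for i c d k
  proof -
    have "cnj (q i c) = s * complex_of_real (lam i) * cnj (q c i)" by (subst q_sym) (simp add: s)
    then have "complex_of_real (D / lam i) * (s * cnj (q i c) * q d k) = (s * s) * (complex_of_real (D / lam i * lam i) * q d k * cnj (q c i))"
      by simp
    then show ?thesis using s(1) lam_pos[of i] by simp
  qed
  have "\<Theta> (\<Theta> (F1 \<zeta>)) = (\<Oplus>i k c d l.
      (complex_of_real (D / lam i) * (s * cnj (q i c) * q d k)) *\<^sub>C tn (\<Lambda> (x * v i k * v c l)) (\<Lambda> (star (v d l))))"
    by (simp add: x F1_expand bounded_clinearD[OF Theta_bounded] Theta_v scaleC_sum_right tn_star_v[of "\<Lambda> (x * v _ _)" ] scaleC_scaleC)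
  also have "\<dots> = (\<Oplus>i k c d l.
      (complex_of_real D * q d k) *\<^sub>C tn (\<Lambda> (x * (cnj (q c i) *\<^sub>C (v i k * v c l)))) (\<Lambda> (star (v d l))))"
    unfolding l by (simp add: scaleC_mult_right \<Lambda>_simps tn_simps scaleC_scaleC mult.assoc)
  also have "\<dots> = (\<Oplus>k i c d l.
      (complex_of_real D * q d k) *\<^sub>C tn (\<Lambda> (x * (cnj (q c i) *\<^sub>C (v i k * v c l)))) (\<Lambda> (star (v d l))))"
    by (rule sum.swap)
  also have "\<dots> = (\<Oplus>k d l i c.
      (complex_of_real D * q d k) *\<^sub>C tn (\<Lambda> (x * (cnj (q c i) *\<^sub>C (v i k * v c l)))) (\<Lambda> (star (v d l))))"
    by (intro sum.cong refl sum_swap4)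
  also have "\<dots> = (\<Oplus>k d l.
      (complex_of_real D * q d k) *\<^sub>C tn (\<Lambda> (x * (\<Oplus>i c. cnj (q c i) *\<^sub>C (v i k * v c l)))) (\<Lambda> (star (v d l))))"
    by (simp only: sum_distrib_left \<Lambda>_simps tn_simps scaleC_sum_right)
  also have "\<dots> = (\<Oplus>k d l. (complex_of_real D * (q d k * cnj (q l k))) *\<^sub>C tn (\<Lambda> x) (\<Lambda> (star (v d l))))"
    unfolding v_row by (simp add: scaleC_mult_right \<Lambda>_simps tn_simps scaleC_scaleC mult.assoc)
  also have "\<dots> = (\<Oplus>d l. (complex_of_real D * (\<Oplus>k. q d k * cnj (q l k))) *\<^sub>C tn (\<Lambda> x) (\<Lambda> (star (v d l))))"
    by (subst sum_swap3) (simp only: sum_distrib_left scaleC_sum_left)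
  also have "\<dots> = (\<Oplus>d l. (if l = d then complex_of_real (D * lam d) else 0) *\<^sub>C tn (\<Lambda> x) (\<Lambda> (star (v d l))))"
    unfolding q_row by (intro sum.cong refl) auto
  also have "\<dots> = complex_of_real D *\<^sub>C tn (\<Lambda> x) (\<Lambda> (\<Oplus>d. complex_of_real (lam d) *\<^sub>C star (v d d)))"
    unfolding sum_if_scaleC by (simp add: \<Lambda>_simps tn_simps scaleC_sum_right scaleC_scaleC)
  also have "\<dots> = F1 \<zeta>"
    unfolding sum_lam_star_v by (simp add: F1_expand x \<Lambda>_simps tn_simps scaleC_sum_right scaleC_scaleC)
  finally show "\<Theta> (\<Theta> (F1 \<zeta>)) = F1 \<zeta>" .
qed (use tot_L F1_bounded in auto)

lemma cinner_Theta_F1: "X \<in> KK \<Longrightarrow> cinner (\<Theta> (F1 \<zeta>)) X = cinner \<zeta> (E2 X)"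
  using cinner_F1_Theta[of X \<zeta>] Theta_isometric[of "\<Theta> (F1 \<zeta>)" X] by (simp add: Theta_Theta_F1)

lemma cinner_F1_E2Theta: "X \<in> KK \<Longrightarrow> cinner (F1 \<zeta>) X = cinner \<zeta> (E2 (\<Theta> X))"
  using cinner_Theta_F1[OF Theta_KK[of X], of \<zeta>] by (simp add: Theta_isometric)

lemma cinner_eqI: "(\<And>\<zeta>. cinner \<zeta> \<xi> = cinner \<zeta> \<eta>) \<Longrightarrow> \<xi> = \<eta>" for \<xi> \<eta> :: "'x::complex_inner"
proof -
  assume "\<And>\<zeta>. cinner \<zeta> \<xi> = cinner \<zeta> \<eta>"
  then have "cinner (\<xi> - \<eta>) (\<xi> - \<eta>) = 0" by (simp only: cinner_diff_right) simp
  then show ?thesis by simp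
qed

lemma E2_Theta_F1: "E2 (\<Theta> (F1 \<zeta>)) = complex_of_real (D\<^sup>2) *\<^sub>C \<zeta>"
  by (rule cinner_eqI) (simp only: cinner_F1_E2Theta[OF F1_KK, symmetric] cinner_F1 cinner_scaleC_right)

lemma E2_Theta_v: "E2 (\<Theta> (tn \<xi> (\<Lambda> (v a b)))) = (if a = b then \<xi> else 0)"
  by (rule cinner_eqI) (simp add: cinner_F1_E2Theta[OF tn_v_KK, symmetric] F1_def cinner_tn ev_v)

definition AA :: "'h \<Rightarrow> 'h" where "AA \<zeta> = E2 (F1 \<zeta>)"

lemma AA_bounded: "bounded_clinear AA"
  unfolding AA_def[abs_def] by (rule bounded_clinear_compose[OF E2_bounded F1_bounded])

text \<open>E_2 is E_1 \<Theta>, and \<Theta>, being isometric with square 1 on the range of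
  \<open>F1\<close>, is symmetric there.\<close>

lemma AA_self_adjoint: "cinner \<zeta> (AA \<xi>) = cinner (AA \<zeta>) \<xi>"
proof -
  have "cinner \<zeta> (AA \<xi>) = cinner (\<Theta> (F1 \<zeta>)) (F1 \<xi>)" by (simp add: AA_def cinner_Theta_F1 F1_KK)
  also have "\<dots> = cinner (F1 \<zeta>) (\<Theta> (F1 \<xi>))" using Theta_isometric[of "\<Theta> (F1 \<zeta>)" "F1 \<xi>"] by (simp add: Theta_Theta_F1)
  also have "\<dots> = cnj (cinner \<xi> (AA \<zeta>))" by (subst cinner_commute) (simp add: AA_def cinner_Theta_F1 F1_KK)
  finally show ?thesis by (simp flip: cinner_commute)
qed

subsection \<open>Coercivity\<close>

lemma F1_BB: "\<zeta> \<in> ccspan (LS k) \<Longrightarrow> F1 \<zeta> \<in> ccspan (BB k)"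
proof (erule bounded_clinear_maps_ccspan[OF F1_bounded, rotated])
  fix x assume "x \<in> LS k"
  then obtain \<phi> w where x: "x = \<Lambda> (R.Cc k \<phi> w)" "R.VV k \<phi>" "R.VV k w" unfolding LS_def by blast
  have "F1 x \<in> cspan (BB k)"
    unfolding F1_expand x(1) by (intro complex_vector.span_sum complex_vector.span_scale tn_BB x(2,3))
  then show "F1 x \<in> ccspan (BB k)" unfolding ccspan_def using closure_subset by blast
qed

lemma E2_Bl_orth:
  assumes x: "x \<in> Bl k p r" and z: "z \<in> LS l" and pr: "(p, r) = (True, True) \<Longrightarrow> l \<noteq> Suc k" "(p, r) = (False, False) \<Longrightarrow> Suc l \<noteq> k"
  shows "cinner z (E2 x) = 0"
proof (cases "p = r")
  case False then show ?thesis using E2_mixed x by simp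
next
  case True
  show ?thesis
  proof (cases p)
    case True
    then show ?thesis using E2_pp[of x k] x z pr(1) \<open>p = r\<close> LS_orth by auto
  next
    case False
    then obtain j where "k = Suc j" using x \<open>p = r\<close> Bl_0 by (cases k) auto
    then show ?thesis using E2_mm[of x j] x z pr(2) False \<open>p = r\<close> LS_orth by auto
  qed
qed

lemma AA_orth: "z \<in> ccspan (LS k) \<Longrightarrow> z' \<in> ccspan (LS l) \<Longrightarrow> l \<noteq> Suc k \<Longrightarrow> k \<noteq> Suc l \<Longrightarrow> cinner z' (AA z) = 0"
proof -
  assume z: "z \<in> ccspan (LS k)" and z': "z' \<in> ccspan (LS l)" and kl: "l \<noteq> Suc k" "k \<noteq> Suc l"
  have "cinner x (E2 y) = 0" if x: "x \<in> LS l" and y: "y \<in> BB k" for x y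
  proof -
    obtain p r where "y \<in> Bl k p r" using y unfolding BB_def by blast
    then show ?thesis using x kl by (intro E2_Bl_orth[of y k p r]) auto
  qed
  then have E2: "E2 y \<in> ccspan (E2 ` BB k)" if "y \<in> ccspan (BB k)" for y
    by (intro bounded_clinear_maps_ccspan[OF E2_bounded _ that] subsetD[OF ccspan_superset]) auto
  show ?thesis unfolding AA_def
    by (rule orth_ccspan2[OF z' E2[OF F1_BB[OF z]]]) (use \<open>\<And>x y. x \<in> LS l \<Longrightarrow> y \<in> BB k \<Longrightarrow> cinner x (E2 y) = 0\<close> in auto)
qed

lemma norm_Theta: "norm (\<Theta> x) = norm x"
proof -
  have "complex_of_real ((norm (\<Theta> x))\<^sup>2) = complex_of_real ((norm x)\<^sup>2)" using Theta_isometric[of x x] by (simp only: cinner_self)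
  then show ?thesis by (simp only: of_real_eq_iff power2_eq_iff_nonneg norm_ge_zero)
qed

text \<open>On the edge space E_2 \<Theta> is E_1, so this bounds the source map on the block.
  \<Theta> leads into a column of level k + 1, where E_2 sees only the block (-,-), with factor
  \<open>D * tly D k\<close>.\<close>

lemma E2_Theta_pp: "p \<in> ccspan (Bl k True True) \<Longrightarrow> (norm (E2 (\<Theta> p)))\<^sup>2 \<le> D * tly D k * (norm p)\<^sup>2"
proof -
  assume p: "p \<in> ccspan (Bl k True True)"
  let ?V = "Bl (Suc k) False False"
  have "p \<in> ccspan (RowP k)" using p ccspan_mono[of "Bl k True True" "RowP k"] by (auto simp: RowP_def)
  then have T: "\<Theta> p \<in> ccspan (ColM (Suc k))" 
    using bounded_clinear_maps_ccspan[OF Theta_bounded, of "RowP k" "ColM (Suc k)" p] Theta_RowP by blast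
  have "E2 (\<Theta> p) = E2 (pr ?V (\<Theta> p))"
  proof (rule bounded_clinear_eq_on[OF E2_bounded _ _ T, of "\<lambda>Y. E2 (pr ?V Y)"])
    show "bounded_clinear (\<lambda>Y. E2 (pr ?V Y))" by (rule bounded_clinear_compose[OF E2_bounded bounded_clinear_pr])
    fix Y assume "Y \<in> ColM (Suc k)"
    then consider "Y \<in> Bl (Suc k) True False" | "Y \<in> ?V" by (auto simp: ColM_def)
    then show "E2 Y = E2 (pr ?V Y)"
    proof cases
      case 1
      then have "pr ?V Y = 0" by (intro pr_zero) (auto intro: Bl_orth)
      then show ?thesis using E2_mixed[of True False] 1 by (simp add: bounded_clinearD[OF E2_bounded])
    next
      case 2 then show ?thesis by (simp add: pr_ident subsetD[OF ccspan_superset])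
    qed
  qed
  then have "(norm (E2 (\<Theta> p)))\<^sup>2 = D * tly D k * (norm (pr ?V (\<Theta> p)))\<^sup>2" by (simp add: E2_mm_norm)
  also have "\<dots> \<le> D * tly D k * (norm (\<Theta> p))\<^sup>2"
    using D_gt_2 y_pos(1)[of k] by (intro mult_left_mono power_mono pr_norm_le) simp_all
  finally show ?thesis by (simp only: norm_Theta)
qed

text \<open>The norms of \<open>E\<^sub>1\<close> and \<open>E\<^sub>2\<close> on a block of type \<open>(True, True)\<close> at level \<open>k\<close> are at most
  \<open>(D y\<^sub>k)\<^bsup>1/2\<^esup>\<close> and \<open>(D / y\<^sub>k)\<^bsup>1/2\<^esup>\<close>; this is where the bound \<open>D\<close> comes from.\<close>

lemma AA_bound: "z \<in> ccspan (LS k) \<Longrightarrow> z' \<in> ccspan (LS (Suc k)) \<Longrightarrow> cmod (cinner z' (AA z)) \<le> D * norm z' * norm z"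
proof -
  assume z: "z \<in> ccspan (LS k)" and z': "z' \<in> ccspan (LS (Suc k))"
  define X where "X = F1 z"
  define p where "p = pr (Bl k True True) X"
  let ?Y = "Bl k True False \<union> Bl k False True \<union> Bl k False False"
  have BB: "BB k = Bl k True True \<union> ?Y" by (auto simp: BB_def UNIV_bool)
  have "pr (LS (Suc k)) (E2 X) = E2 p"
    unfolding p_def
  proof (rule pr_intertwine[OF E2_bounded])
    show "X \<in> ccspan (Bl k True True \<union> ?Y)" using F1_BB[OF z] by (simp only: X_def BB)
    show "cinner x y = 0" if "x \<in> Bl k True True" "y \<in> ?Y" for x y using that by (auto intro: Bl_orth)
    show "E2 x \<in> ccspan (LS (Suc k))" if "x \<in> Bl k True True" for x using E2_pp[OF that] by (rule subsetD[OF ccspan_superset])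
    show "cinner z (E2 y) = 0" if "y \<in> ?Y" "z \<in> LS (Suc k)" for y z using that by (auto intro: E2_Bl_orth)
  qed
  then have 1: "cinner z' (AA z) = cinner z' (E2 p)" using pr_cinner[OF z', of "E2 X"] by (simp add: AA_def X_def)
  have pB: "p \<in> ccspan (Bl k True True)" by (simp add: p_def)
  have "Bl k True True \<subseteq> KK" using om_KK by (auto simp: Bl_def)
  then have "ccspan (Bl k True True) \<subseteq> KK" by (rule ccspan_minimal) (rule KK_sub)+
  then have pK: "p \<in> KK" using pB by blast
  have "cinner p p = cinner p X" using pr_cinner[OF pB, of X] by (simp add: p_def)
  also have "\<dots> = cnj (cinner z (E2 (\<Theta> p)))" by (subst cinner_commute) (simp add: X_def cinner_F1_E2Theta[OF pK])
  finally have "cmod (cinner p p) \<le> norm z * norm (E2 (\<Theta> p))" using cmod_cinner_le[of z "E2 (\<Theta> p)"] by simp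
  then have "(norm p)\<^sup>2 \<le> norm z * norm (E2 (\<Theta> p))" unfolding cinner_self by (simp only: norm_of_real abs_power2)
  then have "((norm p)\<^sup>2)\<^sup>2 \<le> (norm z * norm (E2 (\<Theta> p)))\<^sup>2" by (rule power_mono) simp
  also have "\<dots> \<le> (norm z)\<^sup>2 * (D * tly D k * (norm p)\<^sup>2)"
    unfolding power_mult_distrib by (intro mult_left_mono E2_Theta_pp pB) simp
  finally have "(norm p)\<^sup>2 * (norm p)\<^sup>2 \<le> (norm p)\<^sup>2 * (D * tly D k * (norm z)\<^sup>2)" by (simp add: power2_eq_square mult_ac)
  then have pn: "(norm p)\<^sup>2 \<le> D * tly D k * (norm z)\<^sup>2"
  proof (cases "p = 0")
    case True then show ?thesis using D_gt_2 y_pos(1)[of k] by simp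
  next
    case False
    then have "0 < (norm p)\<^sup>2" by simp
    with \<open>(norm p)\<^sup>2 * (norm p)\<^sup>2 \<le> _\<close> show ?thesis by (rule mult_left_le_imp_le)
  qed
  have "(norm (E2 p))\<^sup>2 \<le> D / tly D k * (D * tly D k * (norm z)\<^sup>2)"
    unfolding E2_pp_norm[OF pB] using D_gt_2 y_pos(1)[of k] by (intro mult_left_mono pn) simp
  also have "\<dots> = (D * norm z)\<^sup>2" using y_pos(1)[of k] by (simp add: power2_eq_square)
  finally have "norm (E2 p) \<le> D * norm z" by (rule power2_le_imp_le) (use D_gt_2 in simp)
  then have "norm z' * norm (E2 p) \<le> norm z' * (D * norm z)" by (intro mult_left_mono) simp_all
  then show ?thesis unfolding 1 using cmod_cinner_le[of z' "E2 p"] by (simp add: mult_ac)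
qed

text \<open>Adding level n + 1 creates a single cross term, bounded by D times the sum of the
  squared norms at levels n and n + 1. The subtracted term is the reserve that pays for level n, and
  it is renewed at level n + 1.\<close>

lemma AA_quadratic_form:
  assumes z: "\<And>k. z k \<in> ccspan (LS k)"
  shows "Re (cinner (\<Sum>k<Suc n. z k) (AA (\<Sum>k<Suc n. z k))) \<le> 2 * D * (\<Sum>k<Suc n. (norm (z k))\<^sup>2) - D * (norm (z n))\<^sup>2"
proof (induction n)
  case 0
  show ?case using AA_orth[OF z[of 0] z[of 0]] D_gt_2 by (simp add: mult_right_mono)
next
  case (Suc n)
  define Z w where "Z = (\<Sum>k<Suc n. z k)" and "w = z (Suc n)"
  have "cinner w (AA Z) = (\<Sum>k<n. cinner w (AA (z k))) + cinner w (AA (z n))"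
    by (simp add: Z_def bounded_clinearD[OF AA_bounded] cinner_sum_right cinner_add_right)
  moreover have "(\<Sum>k<n. cinner w (AA (z k))) = 0" unfolding w_def by (intro sum.neutral ballI AA_orth[OF z z]) auto
  ultimately have 1: "cinner w (AA Z) = cinner w (AA (z n))" by simp
  have 2: "cinner Z (AA w) = cnj (cinner w (AA (z n)))"
    by (simp only: AA_self_adjoint[of Z]) (subst cinner_commute, simp only: 1)
  have 3: "cinner w (AA w) = 0" using AA_orth[OF z[of "Suc n"] z[of "Suc n"]] by (simp add: w_def)
  have "cinner (Z + w) (AA (Z + w)) = cinner Z (AA Z) + cinner w (AA (z n)) + cnj (cinner w (AA (z n)))"
    by (simp add: bounded_clinearD[OF AA_bounded] cinner_simps 1 2 3)
  then have "Re (cinner (Z + w) (AA (Z + w))) = Re (cinner Z (AA Z)) + 2 * Re (cinner w (AA (z n)))" by simp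
  moreover have "Re (cinner w (AA (z n))) \<le> D * (norm w * norm (z n))"
    using AA_bound[OF z[of n] z[of "Suc n"]] complex_Re_le_cmod[of "cinner w (AA (z n))"] by (simp add: w_def mult_ac)
  moreover have "D * (norm w * norm (z n)) \<le> D * (((norm w)\<^sup>2 + (norm (z n))\<^sup>2) / 2)"
    using sum_squares_bound[of "norm w" "norm (z n)"] D_gt_2 by (intro mult_left_mono) simp_all
  ultimately have "Re (cinner (Z + w) (AA (Z + w))) \<le> Re (cinner Z (AA Z)) + D * ((norm w)\<^sup>2 + (norm (z n))\<^sup>2)"
    by simp
  moreover have "Re (cinner Z (AA Z)) \<le> 2 * D * (\<Sum>k<Suc n. (norm (z k))\<^sup>2) - D * (norm (z n))\<^sup>2"
    using Suc by (simp only: Z_def)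
  ultimately show ?case
    unfolding sum.lessThan_Suc[of _ "Suc n"] Z_def[symmetric] w_def[symmetric] by (simp add: algebra_simps)
qed

lemma L_graded: "\<exists>n. \<Lambda> x \<in> cspan (\<Union>k<n. LS k)"
proof (induction x rule: Cc_induct)
  case (add x y)
  then obtain n n' where "\<Lambda> x \<in> cspan (\<Union>k<n. LS k)" "\<Lambda> y \<in> cspan (\<Union>k<n'. LS k)" by blast
  moreover have "cspan (\<Union>k<n. LS k) \<subseteq> cspan (\<Union>k<max n n'. LS k)" "cspan (\<Union>k<n'. LS k) \<subseteq> cspan (\<Union>k<max n n'. LS k)"
    by (rule complex_vector.span_mono, fastforce)+
  ultimately show ?case by (intro exI[of _ "max n n'"]) (auto simp: \<Lambda>_simps intro!: complex_vector.span_add)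
next
  case (scale c x) then show ?case by (auto simp: \<Lambda>_simps intro!: complex_vector.span_scale)
next
  case (Cc k \<phi> w)
  have "\<Lambda> (L.Cc k \<phi> w) \<in> LS k" unfolding LS_def L_Cc_R using Cc L_R_VV by blast
  then show ?case by (intro exI[of _ "Suc k"] complex_vector.span_base) blast
qed

lemma AA_le: "Re (cinner \<zeta> (AA \<zeta>)) \<le> 2 * D * (norm \<zeta>)\<^sup>2"
proof -
  have L: "Re (cinner (\<Lambda> x) (AA (\<Lambda> x))) \<le> 2 * D * (norm (\<Lambda> x))\<^sup>2" for x
  proof -
    obtain n where n: "\<Lambda> x \<in> cspan (\<Union>k<n. LS k)" using L_graded by blast
    then have "\<Lambda> x \<in> cspan (\<Union>k<Suc n. LS k)" by (rule subsetD[OF complex_vector.span_mono, rotated]) (auto simp: lessThan_Suc)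
    then have c: "\<Lambda> x \<in> ccspan (\<Union>k<Suc n. LS k)" unfolding ccspan_def using closure_subset by blast
    define z where "z k = pr (LS k) (\<Lambda> x)" for k
    have o: "cinner x y = 0" if "k \<noteq> l" "x \<in> LS k" "y \<in> LS l" for k l x y using LS_orth that by blast
    have 1: "\<Lambda> x = (\<Sum>k<Suc n. z k)" using pr_UN_orthogonal(1)[where X = LS and n = "Suc n" and \<xi> = "\<Lambda> x", OF o] pr_ident[OF c] by (simp add: z_def)
    have 2: "(norm (\<Lambda> x))\<^sup>2 = (\<Sum>k<Suc n. (norm (z k))\<^sup>2)" using pr_UN_orthogonal(2)[where X = LS and n = "Suc n" and \<xi> = "\<Lambda> x", OF o] pr_ident[OF c] by (simp add: z_def)
    have "Re (cinner (\<Lambda> x) (AA (\<Lambda> x))) \<le> 2 * D * (norm (\<Lambda> x))\<^sup>2 - D * (norm (z n))\<^sup>2"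
      unfolding 2 unfolding 1 by (rule AA_quadratic_form) (simp add: z_def)
    moreover have "0 \<le> D * (norm (z n))\<^sup>2" using D_gt_2 by simp
    ultimately show ?thesis by linarith
  qed
  have "\<zeta> \<in> closure (range \<Lambda>)" using gnsm by (simp add: gns_map_def)
  then obtain f where f: "\<forall>n. f n \<in> range \<Lambda>" "f \<longlonglongrightarrow> \<zeta>" unfolding closure_sequential by blast
  have "(\<lambda>n. Re (cinner (f n) (AA (f n)))) \<longlonglongrightarrow> Re (cinner \<zeta> (AA \<zeta>))"
    by (intro tendsto_Re tendsto_cinner f(2) bounded_linear.tendsto[OF bounded_clinearD(1)[OF AA_bounded]])
  moreover have "(\<lambda>n. 2 * D * (norm (f n))\<^sup>2) \<longlonglongrightarrow> 2 * D * (norm \<zeta>)\<^sup>2" by (intro tendsto_intros f(2))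
  moreover have "Re (cinner (f n) (AA (f n))) \<le> 2 * D * (norm (f n))\<^sup>2" for n using f(1) L by (metis rangeE)
  ultimately show ?thesis by (intro LIMSEQ_le) auto
qed

lemma E2_right_inverse: "\<exists>B. bounded_clinear B \<and> (\<forall>\<zeta>. B \<zeta> \<in> KK \<and> \<Theta> (B \<zeta>) + B \<zeta> = 0 \<and> E2 (B \<zeta>) = \<zeta>)"
proof -
  define N where "N \<zeta> = complex_of_real (D\<^sup>2) *\<^sub>C \<zeta> - AA \<zeta>" for \<zeta>
  have Nb: "bounded_clinear N" unfolding N_def[abs_def]
    by (intro bounded_clinear_diff bounded_clinear_scaleC bounded_clinear_ident AA_bounded)
  \<comment> \<open>The coercivity constant of D^2 - A; its positivity is the condition D >
    2.\<close>
  have c: "0 < D\<^sup>2 - 2 * D" using D_gt_2 by (simp add: power2_eq_square algebra_simps mult_strict_right_mono)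
  have "(D\<^sup>2 - 2 * D) * (norm \<zeta>)\<^sup>2 \<le> Re (cinner \<zeta> (N \<zeta>))" for \<zeta>
  proof -
    have "cinner \<zeta> (N \<zeta>) = complex_of_real (D\<^sup>2 * (norm \<zeta>)\<^sup>2) - cinner \<zeta> (AA \<zeta>)"
      by (simp only: N_def cinner_simps cinner_self of_real_mult)
    then have "Re (cinner \<zeta> (N \<zeta>)) = D\<^sup>2 * (norm \<zeta>)\<^sup>2 - Re (cinner \<zeta> (AA \<zeta>))"
      by (simp only: minus_complex.sel Re_complex_of_real)
    then show ?thesis using AA_le[of \<zeta>] by (simp add: left_diff_distrib)
  qed
  then obtain Ri where Ri: "bounded_clinear Ri" "\<And>\<zeta>. N (Ri \<zeta>) = \<zeta>" using coercive_inverse[OF Nb c] by blast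
  define B where "B \<zeta> = \<Theta> (F1 (Ri \<zeta>)) - F1 (Ri \<zeta>)" for \<zeta>
  have "bounded_clinear B" unfolding B_def[abs_def]
    by (intro bounded_clinear_diff bounded_clinear_compose[OF Theta_bounded] bounded_clinear_compose[OF F1_bounded] Ri(1))
  moreover have "B \<zeta> \<in> KK" for \<zeta> unfolding B_def by (intro csubspaceD(4)[OF KK_sub(1)] Theta_KK F1_KK)
  moreover have "\<Theta> (B \<zeta>) + B \<zeta> = 0" for \<zeta> by (simp add: B_def bounded_clinearD[OF Theta_bounded] Theta_Theta_F1)
  moreover have "E2 (B \<zeta>) = \<zeta>" for \<zeta>
    using Ri(2)[of \<zeta>] by (simp add: B_def bounded_clinearD[OF E2_bounded] E2_Theta_F1 N_def AA_def)
  ultimately show ?thesis by blast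
qed

subsection \<open>Injectivity\<close>

text \<open>The blocks that E_2 maps to level \<open>k\<close> of H. At k = 0 there is no block
  (+,+), which the union over \<open>l\<close> with \<open>k = Suc l\<close> takes into
  account.\<close>

definition EB :: "nat \<Rightarrow> 'k set" where
  "EB k = (\<Union>l\<in>{l. k = Suc l}. Bl l True True) \<union> Bl (Suc k) False False"

lemma pr_E2:
  assumes "\<xi> \<in> KK"
  shows "pr (LS k) (E2 \<xi>) = E2 (pr (EB k) \<xi>)"
proof (rule pr_intertwine[OF E2_bounded])
  let ?bad = "\<lambda>l p r. \<not> (p \<and> r \<and> k = Suc l) \<and> \<not> (\<not> p \<and> \<not> r \<and> l = Suc k)"
  let ?Y = "\<Union>{Bl l p r | l p r. ?bad l p r}"
  have EB: "Bl l p r \<subseteq> EB k" if "\<not> ?bad l p r" for l p r using that by (auto simp: EB_def)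
  have "(\<Union>k. BB k) \<subseteq> EB k \<union> ?Y"
  proof
    fix x assume "x \<in> (\<Union>k. BB k)"
    then obtain l p r where x: "x \<in> Bl l p r" by (rule in_BB_E)
    show "x \<in> EB k \<union> ?Y"
    proof (cases "?bad l p r")
      case True then show ?thesis using x by blast
    next
      case False then show ?thesis using EB[OF False] x by (intro UnI1) (rule subsetD)
    qed
  qed
  then show "\<xi> \<in> ccspan (EB k \<union> ?Y)" using assms ccspan_mono[of "\<Union>k. BB k" "EB k \<union> ?Y"] by (auto simp: KK_BB)
  show "cinner x y = 0" if x: "x \<in> EB k" and y: "y \<in> ?Y" for x y
  proof -
    obtain l p r where "y \<in> Bl l p r" "?bad l p r" using y by blast
    then show ?thesis using x Bl_orth[of x _ True True y l p r] Bl_orth[of x "Suc k" False False y l p r] by (auto simp: EB_def)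
  qed
  show "E2 x \<in> ccspan (LS k)" if "x \<in> EB k" for x
    using that E2_pp E2_mm[of x k] ccspan_superset[of "LS k"] by (auto simp: EB_def)
  show "cinner z (E2 y) = 0" if y: "y \<in> ?Y" and z: "z \<in> LS k" for y z
  proof -
    obtain l p r where "y \<in> Bl l p r" "?bad l p r" using y by blast
    then show ?thesis using z by (intro E2_Bl_orth[of y l p r z k]) auto
  qed
qed

lemma EB_simps: "EB (Suc k) = Bl k True True \<union> Bl (Suc (Suc k)) False False" "EB 0 = Bl (Suc 0) False False"
  by (auto simp: EB_def)

theorem E2_injective:
  assumes \<xi>: "\<xi> \<in> KK" "\<Theta> \<xi> + \<xi> = 0" and E: "E2 \<xi> = 0"
  shows "\<xi> = 0"
proof -
  define m where "m p r k = (norm (pr (Bl k p r) \<xi>))\<^sup>2" for p r k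
  have Un: "(norm (pr (Bl k p r \<union> Bl l p' r') \<xi>))\<^sup>2 = m p r k + m p' r' l" if "(k, p, r) \<noteq> (l, p', r')" for k p r l p' r'
    unfolding m_def by (rule pr_Un_norm) (use that in \<open>auto intro: Bl_orth\<close>)
  have Th: "\<Theta> \<xi> = - \<xi>" using \<xi>(2) by (simp add: eq_neg_iff_add_eq_0)
  have "m True True k = 0 \<and> m True False k = 0 \<and> m False True k = 0 \<and> m False False k = 0" for k
  proof (rule block_masses_vanish[where y = "tly D"])
    show "0 \<le> m True True k" "1 < tly D k" for k using y_pos by (simp_all add: m_def)
    show "m True True k + m True False k = m True False (Suc k) + m False False (Suc k)" for k
    proof -
      have "(norm (pr (RowP k) \<xi>))\<^sup>2 = (norm (pr (ColM (Suc k)) \<xi>))\<^sup>2"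
        using arg_cong[OF pr_Theta_RowP[OF \<xi>(1), of k], of norm] by (simp add: norm_Theta Th pr_minus)
      then show ?thesis by (simp add: RowP_def ColM_def Un)
    qed
    show "m False True (Suc k) + m False False (Suc k) = m True True k + m False True k" for k
    proof -
      have "(norm (pr (RowM (Suc k)) \<xi>))\<^sup>2 = (norm (pr (ColP k) \<xi>))\<^sup>2"
        using arg_cong[OF pr_Theta_RowM[OF \<xi>(1), of k], of norm] by (simp add: norm_Theta Th pr_minus)
      then show ?thesis by (simp add: RowM_def ColP_def Un)
    qed
    \<comment> \<open>The two blocks mapped to level k + 1 must cancel there, so their norms are
      related by the scaling factors D / y_k and D y_(k+1).\<close>
    show "m False False (Suc (Suc k)) = m True True k / (tly D k * tly D (Suc k))" for k
    proof -
      let ?a = "pr (Bl k True True) \<xi>" and ?d = "pr (Bl (Suc (Suc k)) False False) \<xi>"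
      have "pr (LS (Suc k)) (E2 \<xi>) = 0" unfolding E by (rule pr_zero) simp
      then have "E2 (?a + ?d) = 0"
        unfolding pr_E2[OF \<xi>(1)] EB_simps by (subst (asm) pr_Un) (auto intro: Bl_orth)
      then have "E2 ?a = - E2 ?d" by (simp add: bounded_clinearD[OF E2_bounded] eq_neg_iff_add_eq_0)
      then have "(norm (E2 ?a))\<^sup>2 = (norm (E2 ?d))\<^sup>2" by simp
      then have "D / tly D k * m True True k = D * tly D (Suc k) * m False False (Suc (Suc k))"
        unfolding m_def by (simp only: E2_pp_norm[OF pr_in] E2_mm_norm[OF pr_in])
      then show ?thesis using y_pos(1)[of k] y_pos(1)[of "Suc k"] D_gt_2 by (simp add: field_simps del: tly.simps)
    qed
    show "m False False 0 = 0" "m True False 0 = 0" "m False True 0 = 0"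
      using pr_zero[of "{}" \<xi>] by (simp_all add: m_def Bl_0)
    \<comment> \<open>Level 0 of H is reached from this block alone, and E_2 does not shrink it to
      zero.\<close>
    show "m False False 1 = 0"
    proof -
      have "E2 (pr (Bl (Suc 0) False False) \<xi>) = 0" unfolding EB_simps(2)[symmetric] pr_E2[OF \<xi>(1), symmetric] E by (rule pr_zero) simp
      then have "D * tly D 0 * m False False 1 = 0"
        using E2_mm_norm[of "pr (Bl (Suc 0) False False) \<xi>" 0] by (simp add: m_def)
      then show ?thesis using D_gt_2 by simp
    qed
    show "m True False \<longlonglongrightarrow> 0"
      unfolding m_def by (rule bessel_tendsto_0) (auto intro: Bl_orth)
  qed
  then have m0: "m p r k = 0" for p r k by (cases p; cases r) auto
  then have p0: "pr (Bl k p r) \<xi> = 0" for p r k by (simp add: m_def)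
  have "cinner \<xi> x = 0" if xB: "x \<in> (\<Union>k. BB k)" for x
  proof -
    obtain k p r where x: "x \<in> Bl k p r" using in_BB_E[OF xB] .
    have "cinner x \<xi> = cinner x (pr (Bl k p r) \<xi>)" using x ccspan_superset by (intro pr_cinner[symmetric]) blast
    then have "cinner x \<xi> = 0" using p0 by simp
    then show ?thesis by (simp add: orth_commute[of \<xi> x])
  qed
  then have "cinner \<xi> \<xi> = 0" using \<xi>(1) unfolding KK_BB by (intro orth_ccspan[of \<xi> "\<Union>k. BB k"]) auto
  then show ?thesis by simp
qed

end

context ao_group
begin

subsection \<open>The path cocycle\<close>

abbreviation Kg :: "'k set" where "Kg \<equiv> geom_edge_space G {v}"

lemma Kg_iff: "\<xi> \<in> Kg \<longleftrightarrow> \<xi> \<in> KK \<and> \<Theta> \<xi> + \<xi> = 0"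
  by (simp add: geom_edge_space_def)

lemma Kg_sub: "complex_vector.subspace Kg" "closed Kg"
proof -
  show "complex_vector.subspace Kg"
    unfolding csubspace_iff
  proof (intro conjI ballI allI)
    show "0 \<in> Kg" by (simp add: Kg_iff csubspaceD(1)[OF KK_sub(1)] bounded_clinearD[OF Theta_bounded])
    fix x y assume xy: "x \<in> Kg" "y \<in> Kg"
    have "\<Theta> (x + y) + (x + y) = (\<Theta> x + x) + (\<Theta> y + y)" by (simp add: bounded_clinearD[OF Theta_bounded])
    then show "x + y \<in> Kg" using xy by (simp only: Kg_iff csubspaceD(2)[OF KK_sub(1)]) simp
  next
    fix c x assume x: "x \<in> Kg"
    have "\<Theta> (c *\<^sub>C x) + c *\<^sub>C x = c *\<^sub>C (\<Theta> x + x)" by (simp add: bounded_clinearD[OF Theta_bounded] scaleC_add_right)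
    then show "c *\<^sub>C x \<in> Kg" using x by (simp only: Kg_iff csubspaceD(3)[OF KK_sub(1)]) simp
  qed
  have "closed {\<xi>. \<Theta> \<xi> + \<xi> = 0}"
    by (intro closed_Collect_eq continuous_intros bounded_clinearD(8)[OF Theta_bounded])
  moreover have "Kg = KK \<inter> {\<xi>. \<Theta> \<xi> + \<xi> = 0}" by (auto simp: Kg_iff)
  ultimately show "closed Kg" using KK_sub(2) by (simp add: closed_Int)
qed

lemma Kg_inj: "\<xi> \<in> Kg \<Longrightarrow> \<eta> \<in> Kg \<Longrightarrow> E2 \<xi> = E2 \<eta> \<Longrightarrow> \<xi> = \<eta>"
  using E2_injective[of "\<xi> - \<eta>"] csubspaceD(4)[OF Kg_sub(1), of \<xi> \<eta>]
  by (simp add: Kg_iff bounded_clinearD(5)[OF E2_bounded])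

lemma act_Kg: "\<xi> \<in> Kg \<Longrightarrow> act x \<xi> \<in> Kg"
proof -
  assume "\<xi> \<in> Kg"
  then have \<xi>: "\<xi> \<in> KK" "\<Theta> \<xi> + \<xi> = 0" by (simp_all add: Kg_iff)
  have "\<Theta> (act x \<xi>) + act x \<xi> = act x (\<Theta> \<xi> + \<xi>)"
    by (simp only: Theta_act[OF \<xi>(1)] bounded_clinearD(2)[OF act(1)])
  then show ?thesis using \<xi> by (simp add: Kg_iff act_KK bounded_clinearD(4)[OF act(1)])
qed

lemma E2_invertible: "invertible_op Kg UNIV E2"
proof -
  obtain B where B: "bounded_clinear B" "\<And>\<zeta>. B \<zeta> \<in> KK" "\<And>\<zeta>. \<Theta> (B \<zeta>) + B \<zeta> = 0" "\<And>\<zeta>. E2 (B \<zeta>) = \<zeta>"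
    using E2_right_inverse by blast
  have BK: "B \<zeta> \<in> Kg" for \<zeta> using B by (simp add: Kg_iff)
  have "B (E2 \<xi>) = \<xi>" if "\<xi> \<in> Kg" for \<xi> using Kg_inj[OF BK that] B(4) by simp
  then show ?thesis
    unfolding invertible_op_def using E2_bounded B(1,4) BK by blast
qed

text \<open>For a generator v the identity v x - \<epsilon>(v x) = v (x - \<epsilon>(x)) +
  \<epsilon>(x) (v - \<epsilon>(v)) carries the induction; the factor in the augmentation ideal
  stays on the right.\<close>

lemma augmentation_ideal: "\<exists>X. x - \<epsilon> x *\<^sub>C 1 = (\<Oplus>a b. X a b * (v a b - (if a = b then 1 else 0)))"
proof (induction x rule: S_induct)
  case (add x y)
  then obtain X Y where "x - \<epsilon> x *\<^sub>C 1 = (\<Oplus>a b. X a b * (v a b - (if a = b then 1 else 0)))"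
    "y - \<epsilon> y *\<^sub>C 1 = (\<Oplus>a b. Y a b * (v a b - (if a = b then 1 else 0)))" by blast
  moreover have "x + y - \<epsilon> (x + y) *\<^sub>C 1 = (x - \<epsilon> x *\<^sub>C 1) + (y - \<epsilon> y *\<^sub>C 1)"
    by (simp add: clinearD[OF eps_props(1)] scaleC_add_left)
  ultimately show ?case by (intro exI[of _ "\<lambda>a b. X a b + Y a b"]) (simp only: distrib_right sum.distrib)
next
  case (scale c x)
  then obtain X where "x - \<epsilon> x *\<^sub>C 1 = (\<Oplus>a b. X a b * (v a b - (if a = b then 1 else 0)))" by blast
  moreover have "c *\<^sub>C x - \<epsilon> (c *\<^sub>C x) *\<^sub>C 1 = c *\<^sub>C (x - \<epsilon> x *\<^sub>C 1)"
    by (simp add: clinearD[OF eps_props(1)] scaleC_complex_def scaleC_diff_right scaleC_scaleC)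
  ultimately show ?case by (intro exI[of _ "\<lambda>a b. c *\<^sub>C X a b"]) (simp only: scaleC_mult_left scaleC_sum_right)
next
  case one then show ?case by (intro exI[of _ "\<lambda>_ _. 0"]) (simp add: eps_props)
next
  case (mult i j x)
  then obtain X where X: "x - \<epsilon> x *\<^sub>C 1 = (\<Oplus>a b. X a b * (v a b - (if a = b then 1 else 0)))" by blast
  have e: "\<epsilon> (v i j) = (if i = j then 1 else 0)" using eps_W[of "[i]" "[j]"] by simp
  have "v i j * x - \<epsilon> (v i j * x) *\<^sub>C 1 = v i j * (x - \<epsilon> x *\<^sub>C 1) + \<epsilon> x *\<^sub>C (v i j - (if i = j then 1 else 0))"
    by (simp add: eps_props e right_diff_distrib scaleC_mult_right scaleC_diff_right)
  also have "\<epsilon> x *\<^sub>C (v i j - (if i = j then 1 else 0))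
     = (\<Oplus>a b. if a = i then if b = j then \<epsilon> x *\<^sub>C (v i j - (if i = j then 1 else 0)) else 0 else 0)"
    by (simp only: sum_delta2)
  also have "\<dots> = (\<Oplus>a b. (if a = i \<and> b = j then \<epsilon> x *\<^sub>C 1 else 0) * (v a b - (if a = b then 1 else 0)))"
    by (intro sum.cong refl) (auto simp: scaleC_mult_left)
  finally show ?case unfolding X
    by (intro exI[of _ "\<lambda>a b. v i j * X a b + (if a = i \<and> b = j then \<epsilon> x *\<^sub>C 1 else 0)"])
      (simp only: distrib_right sum.distrib sum_distrib_left mult.assoc)
qed

text \<open>After applying E_2 the projection behaves like (1 - \<Theta>) / 2. The vectors
  \<open>F1 \<zeta> - \<Theta> (F1 \<zeta>)\<close> lie in \<open>Kg\<close>, so the defect of the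
  projection is orthogonal to them; tested against \<zeta>, this says that E_2 and E_2 \<Theta>
  agree on the defect.\<close>

lemma orth_proj_Kg: "\<omega> \<in> KK \<Longrightarrow> 2 *\<^sub>C E2 (orth_proj Kg \<omega>) = E2 \<omega> - E2 (\<Theta> \<omega>)"
proof -
  assume w: "\<omega> \<in> KK"
  define p where "p = orth_proj Kg \<omega>"
  have p: "p \<in> Kg" unfolding p_def by (rule orth_proj_in[OF Kg_sub])
  then have pK: "p \<in> KK" and pT: "\<Theta> p = - p" by (simp_all add: Kg_iff eq_neg_iff_add_eq_0)
  have wp: "\<omega> - p \<in> KK" by (rule csubspaceD(4)[OF KK_sub(1) w pK])
  have "E2 (\<Theta> (\<omega> - p)) = E2 (\<omega> - p)"
  proof (rule cinner_eqI)
    fix \<zeta>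
    have "F1 \<zeta> - \<Theta> (F1 \<zeta>) \<in> Kg"
      unfolding Kg_iff by (simp add: csubspaceD(4)[OF KK_sub(1)] F1_KK Theta_KK bounded_clinearD[OF Theta_bounded] Theta_Theta_F1)
    then have "cinner (F1 \<zeta> - \<Theta> (F1 \<zeta>)) (\<omega> - p) = 0" unfolding p_def by (rule orth_proj_orth[OF Kg_sub])
    then have "cinner (F1 \<zeta>) (\<omega> - p) = cinner (\<Theta> (F1 \<zeta>)) (\<omega> - p)" by (simp only: cinner_diff_left right_minus_eq)
    then show "cinner \<zeta> (E2 (\<Theta> (\<omega> - p))) = cinner \<zeta> (E2 (\<omega> - p))"
      by (simp only: cinner_F1_E2Theta[OF wp] cinner_Theta_F1[OF wp])
  qed
  then have "E2 (\<Theta> \<omega>) + E2 p = E2 \<omega> - E2 p"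
    by (simp add: bounded_clinearD[OF Theta_bounded] bounded_clinearD[OF E2_bounded] pT)
  moreover have "2 *\<^sub>C E2 p = E2 p + E2 p" using scaleC_add_left[of 1 1 "E2 p"] by simp
  ultimately show ?thesis by (simp add: p_def algebra_simps)
qed

lemma alg_geom_lift: "\<exists>\<xi>\<in>alg_geom_edge_space G {v}. E2 \<xi> = \<Lambda> (x - \<epsilon> x *\<^sub>C 1)"
proof -
  obtain X where X: "x - \<epsilon> x *\<^sub>C 1 = (\<Oplus>a b. X a b * (v a b - (if a = b then 1 else 0)))" using augmentation_ideal by blast
  \<comment> \<open>By \<open>E2_Theta_v\<close>, E_2 \<Theta> applies the counit to the second leg,
    so E_2 \<omega> - E_2 \<Theta> \<omega> yields the differences v_ab - \<delta>_ab; the factor 2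
    compensates the one in \<open>orth_proj_Kg\<close>.\<close>
  define \<omega> where "\<omega> = (\<Oplus>a b. tn (\<Lambda> (2 *\<^sub>C X a b)) (\<Lambda> (v a b)))"
  have w: "\<omega> \<in> KA" unfolding KA_cspan \<omega>_def KG_def by (intro complex_vector.span_sum complex_vector.span_base) blast
  have "E2 \<omega> - E2 (\<Theta> \<omega>) = (\<Oplus>a b. \<Lambda> (2 *\<^sub>C X a b * v a b) - (if a = b then \<Lambda> (2 *\<^sub>C X a b) else 0))"
    by (simp only: \<omega>_def bounded_clinearD(7)[OF Theta_bounded] bounded_clinearD(7)[OF E2_bounded] E2_v rm E2_Theta_v sum_subtractf)
  also have "\<dots> = (\<Oplus>a b. 2 *\<^sub>C \<Lambda> (X a b * (v a b - (if a = b then 1 else 0))))"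
    by (intro sum.cong refl) (auto simp: right_diff_distrib \<Lambda>_simps scaleC_mult_left scaleC_diff_right)
  also have "\<dots> = 2 *\<^sub>C \<Lambda> (x - \<epsilon> x *\<^sub>C 1)" unfolding X by (simp only: \<Lambda>_simps scaleC_sum_right)
  finally have "2 *\<^sub>C E2 (orth_proj Kg \<omega>) = 2 *\<^sub>C \<Lambda> (x - \<epsilon> x *\<^sub>C 1)"
    by (rule trans[OF orth_proj_Kg[OF subsetD[OF KA_KK w]]])
  then have "(1 / 2) *\<^sub>C 2 *\<^sub>C E2 (orth_proj Kg \<omega>) = (1 / 2) *\<^sub>C 2 *\<^sub>C \<Lambda> (x - \<epsilon> x *\<^sub>C 1)" by simp
  then have "E2 (orth_proj Kg \<omega>) = \<Lambda> (x - \<epsilon> x *\<^sub>C 1)" by (simp add: scaleC_scaleC)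
  then show ?thesis using w unfolding alg_geom_edge_space_def by blast
qed

lemma alg_geom_Kg: "alg_geom_edge_space G {v} \<subseteq> Kg"
  unfolding alg_geom_edge_space_def using orth_proj_in[OF Kg_sub] by blast

text \<open>On \<open>Kg\<close> the map E_2 is injective and commutes with the action of the
  algebra, so each identity for the cocycle can be tested after applying E_2.\<close>

theorem path_cocycles:
  "(\<exists>!c. path_cocycle G {v} c) \<and> (\<forall>c. path_cocycle G {v} c \<longrightarrow> trivial_cocycle G {v} c)"
proof -
  obtain B where B: "bounded_clinear B" "\<And>\<zeta>. B \<zeta> \<in> KK" "\<And>\<zeta>. \<Theta> (B \<zeta>) + B \<zeta> = 0" "\<And>\<zeta>. E2 (B \<zeta>) = \<zeta>"
    using E2_right_inverse by blast
  have BK: "B \<zeta> \<in> Kg" for \<zeta> using B by (simp add: Kg_iff)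
  define c where "c x = B (\<Lambda> (x - \<epsilon> x *\<^sub>C 1))" for x
  have E2c: "E2 (c x) = \<Lambda> x - \<epsilon> x *\<^sub>C \<Lambda> 1" for x by (simp add: c_def B(4) \<Lambda>_simps)
  have cK: "c x \<in> Kg" for x by (simp add: c_def BK)
  \<comment> \<open>Some projected algebraic edge has the required target; by injectivity it is
    \<open>c x\<close>.\<close>
  have cg: "c x \<in> alg_geom_edge_space G {v}" for x
  proof -
    obtain \<xi> where \<xi>: "\<xi> \<in> alg_geom_edge_space G {v}" "E2 \<xi> = \<Lambda> (x - \<epsilon> x *\<^sub>C 1)" using alg_geom_lift by blast
    then have "c x = \<xi>" using alg_geom_Kg cK by (intro Kg_inj) (auto simp: E2c \<Lambda>_simps)
    then show ?thesis using \<xi> by simp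
  qed
  have c: "path_cocycle G {v} c"
    unfolding path_cocycle_def cocycle_def
  proof (intro conjI allI)
    show "clinear c"
      by (simp add: clinear_iff c_def clinearD[OF eps_props(1)] \<Lambda>_simps bounded_clinearD[OF B(1)] scaleC_add_left scaleC_diff_right scaleC_scaleC scaleC_complex_def)
    show "range c \<subseteq> KK" using cK by (auto simp: Kg_iff)
    show "c (x * y) = act x (c y) + \<epsilon> y *\<^sub>C c x" for x y
    proof (rule Kg_inj)
      show "c (x * y) \<in> Kg" by (rule cK)
      show "act x (c y) + \<epsilon> y *\<^sub>C c x \<in> Kg" by (intro csubspaceD(2,3)[OF Kg_sub(1)] act_Kg cK)
      have "c y \<in> KK" using cK by (simp add: Kg_iff)
      then show "E2 (c (x * y)) = E2 (act x (c y) + \<epsilon> y *\<^sub>C c x)"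
        by (simp add: bounded_clinearD[OF E2_bounded] E2_act E2c bounded_clinearD[OF lm(1)] lm eps_props scaleC_diff_right scaleC_scaleC mult.commute)
    qed
    show "range c \<subseteq> alg_geom_edge_space G {v}" using cg by blast
    show "E2 (c x) = \<Lambda> x - \<epsilon> x *\<^sub>C \<Lambda> 1" for x by (rule E2c)
  qed
  have uniq: "c' = c" if "path_cocycle G {v} c'" for c'
  proof
    fix x
    have "c' x \<in> Kg" "E2 (c' x) = \<Lambda> x - \<epsilon> x *\<^sub>C \<Lambda> 1" using that alg_geom_Kg by (auto simp: path_cocycle_def)
    then show "c' x = c x" by (intro Kg_inj cK) (simp_all add: E2c)
  qed
  have "trivial_cocycle G {v} c"
    unfolding trivial_cocycle_def
  proof (intro bexI allI)
    show "B (\<Lambda> 1) \<in> KK" by (rule B(2))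
    fix x
    show "c x = act x (B (\<Lambda> 1)) - \<epsilon> x *\<^sub>C B (\<Lambda> 1)"
    proof (rule Kg_inj[OF cK])
      show "act x (B (\<Lambda> 1)) - \<epsilon> x *\<^sub>C B (\<Lambda> 1) \<in> Kg" by (intro csubspaceD(3,4)[OF Kg_sub(1)] act_Kg BK)
      show "E2 (c x) = E2 (act x (B (\<Lambda> 1)) - \<epsilon> x *\<^sub>C B (\<Lambda> 1))"
        by (simp add: bounded_clinearD[OF E2_bounded] E2_act B E2c lm)
    qed
  qed
  then show ?thesis using c uniq by blast
qed

end

text \<open>The directions enter the graph only through the span of their coefficients, which the
  change of basis does not alter; results for \<open>v\<close> thus transfer to
  \<open>u\<close>.\<close>

lemma cayley_graph_cong:
  assumes "cspan {u i j | i j. True} = cspan {v i j | i j. True}"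
  shows "dir_proj G {u} = dir_proj G {v}"
  by (rule ext) (simp only: dir_proj_def corep_proj_def assms sum.insert finite.emptyI empty_iff not_False_eq_True sum.empty)

context ao_change
begin

lemma cspan_u_v: "cspan {u i j | i j. True} = cspan {v i j | i j. True}"
proof
  have "u i j \<in> cspan {v i j | i j. True}" for i j
    unfolding fun_cong[OF fun_cong[OF u_v], of i j] sw_def
    by (intro complex_vector.span_sum complex_vector.span_scale complex_vector.span_base) blast
  then show "cspan {u i j | i j. True} \<subseteq> cspan {v i j | i j. True}"
    by (intro complex_vector.span_minimal) (auto simp: complex_vector.subspace_span)
  have "v i j \<in> cspan {u i j | i j. True}" for i j
    unfolding fun_cong[OF fun_cong[OF v_def], of i j] sw_def
    by (intro complex_vector.span_sum complex_vector.span_scale complex_vector.span_base) blast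
  then show "cspan {v i j | i j. True} \<subseteq> cspan {u i j | i j. True}"
    by (intro complex_vector.span_minimal) (auto simp: complex_vector.subspace_span)
qed

lemma comult_v:
  assumes lin: "clinear \<delta>" and u: "\<And>i j. \<delta> (u i j) = (\<Oplus>k. u i k \<otimes>\<^sub>a u k j)"
  shows "\<delta> (v i j) = (\<Oplus>k. v i k \<otimes>\<^sub>a v k j)"
proof -
  have VV: "(\<Oplus>p. V l p * cnj (V k p)) = (if k = l then 1 else 0)" for l k
    using fun_cong[OF fun_cong[OF V(2)], of l k] by (auto simp: mm_app m_app)
  have "(\<Oplus>p. v i p \<otimes>\<^sub>a v p j) = (\<Oplus>p a l k b.
      (cnj (V a i) * V b j * (V l p * cnj (V k p))) *\<^sub>C (u a l \<otimes>\<^sub>a u k b))"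
    by (simp only: v_def sw_def m_app tensor_sum_left) (simp add: tensor_sum_right tensor_scale_left tensor_scale_right scaleC_scaleC scaleC_sum_right mult_ac)
  also have "\<dots> = (\<Oplus>a l k b p.
      (cnj (V a i) * V b j * (V l p * cnj (V k p))) *\<^sub>C (u a l \<otimes>\<^sub>a u k b))"
    by (rule trans[OF sum_swap3]) (intro sum.cong refl sum_swap3)
  also have "\<dots> = (\<Oplus>a l k b. (cnj (V a i) * V b j * (if k = l then 1 else 0)) *\<^sub>C (u a l \<otimes>\<^sub>a u k b))"
    unfolding VV[symmetric] by (simp only: sum_distrib_left scaleC_sum_left)
  also have "\<dots> = (\<Oplus>a l k. (if k = l then 1 else 0) *\<^sub>C (\<Oplus>b. (cnj (V a i) * V b j) *\<^sub>C (u a l \<otimes>\<^sub>a u k b)))"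
    by (intro sum.cong refl) (simp add: scaleC_sum_right)
  also have "\<dots> = (\<Oplus>a l b. (cnj (V a i) * V b j) *\<^sub>C (u a l \<otimes>\<^sub>a u l b))"
    by (simp only: sum_if_scaleC) simp
  also have "\<dots> = (\<Oplus>a b l. (cnj (V a i) * V b j) *\<^sub>C (u a l \<otimes>\<^sub>a u l b))"
    by (intro sum.cong refl sum.swap)
  also have "\<dots> = \<delta> (v i j)"
    by (simp add: v_def sw_def m_app clinearD[OF lin] u scaleC_sum_right)
  finally show ?thesis by simp
qed

end

theorem theorem4p4:
  fixes Q :: "complex^'n^'n"
    and u :: "'n::finite \<Rightarrow> 'n \<Rightarrow> 'a::complex_star_algebra"
    and G :: "('a, 'h::chilbert_space, 'k::chilbert_space) quantum_group"
  assumes "2 \<le> CARD('n)"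
    and "invertible Q"
    and "\<exists>c. Q ** map_matrix cnj Q = mat c"
    and "\<not> (CARD('n) = 2 \<and> (\<exists>r::real. transpose (map_matrix cnj Q) ** Q = mat (complex_of_real r)))"
    and "Ao_quantum_group Q u G"
  shows "invertible_op (geom_edge_space G {u}) UNIV (target G {u}) \<and>
         (\<exists>!c. path_cocycle G {u} c) \<and>
         (\<forall>c. path_cocycle G {u} c \<longrightarrow> trivial_cocycle G {u} c)"
proof (rule ao_diagonal_form[OF assms(1-4)])
  fix V q :: "'n \<Rightarrow> 'n \<Rightarrow> complex" and r s :: complex and lam :: "'n \<Rightarrow> real"
  assume *: "mm (mcnj (mtr V)) V = mI" "mm V (mcnj (mtr V)) = mI"
    "r \<noteq> 0" "cnj r = r" "s * s = 1" "cnj s = s" "mm q (mcnj q) = ms s mI"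
    "(\<lambda>i k. Q $ i $ k) = ms r (mm V (mm q (mtr V)))"
    "(\<lambda>i k. matrix_inv Q $ i $ k) = ms (s / r) (mm (mcnj V) (mm (mcnj q) (mcnj (mtr V))))"
    "\<And>i. lam i > 0" "\<And>i j. q i j = s * lam i * q j i"
    "\<And>i j. (\<Oplus>k. q i k * cnj (q j k)) = (if i = j then complex_of_real (lam i) else 0)"
    "(\<Oplus>i. lam i) > 2" "(\<Oplus>i. 1 / lam i) = (\<Oplus>i. lam i)"
  note G = assms(5)[unfolded Ao_quantum_group_def]
  have Ao: "Ao_algebra Q u" using G by blast
  interpret C: ao_change Q u V q r s
    by (rule ao_change.intro[OF Ao *(1-9)])
  have hopf: "hopf_star_algebra G" using G by blast
  then have lin: "clinear (comult G)" by (simp add: hopf_star_algebra_def star_hom_def)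
  have fe: "\<exists>\<phi>. clinear \<phi> \<and> (\<forall>I J. length I = length J \<longrightarrow> \<phi> (wordm C.v I J) = P I J)"
    if P: "\<And>I J I' J' a b. length I = length J \<Longrightarrow>
        (\<Oplus>c d. q d c * P (I @ a # b # I') (J @ c # d # J')) = q b a * P (I @ I') (J @ J')"
      "\<And>I J I' J' c d. length I = length J \<Longrightarrow>
        (\<Oplus>a b. cnj (q b a) * P (I @ a # b # I') (J @ c # d # J')) = cnj (q d c) * P (I @ I') (J @ J')" for P
  proof -
    obtain \<phi> where "clinear \<phi>" "\<And>I J. length I = length J \<Longrightarrow> \<phi> (wordm C.v I J) = P I J"
      by (rule C.functional_exists[of P, OF P(1) P(2)], assumption, assumption, rule that)
    then show ?thesis by blast
  qed
  have qq: "(\<Oplus>k. q i k * cnj (q k j)) = (if i = j then s else 0)" for i j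
    using fun_cong[OF fun_cong[OF *(7)], of i j] by (simp add: mm_app m_app)
  have comult: "comult G (C.v i j) = (\<Oplus>k. C.v i k \<otimes>\<^sub>a C.v k j)" for i j
    using C.comult_v[OF lin] G by blast
  have hgt: "haar_state G" "gns_map G" "hilbert_tensor G" using G by blast+
  interpret A: ao_group C.v q s lam G
    by (rule ao_group.intro[OF *(5,6,10,11) qq *(13,14) C.star_v C.v_unitary C.words_span fe hopf comult hgt])
  have d: "dir_proj G {u} = dir_proj G {C.v}" by (rule cayley_graph_cong[OF C.cspan_u_v])
  have e: "edge_space G {u} = edge_space G {C.v}" "alg_edge_space G {u} = alg_edge_space G {C.v}"
    by (simp_all add: edge_space_def alg_edge_space_def d)
  have g: "geom_edge_space G {u} = geom_edge_space G {C.v}" "target G {u} = target G {C.v}"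
    by (simp_all add: geom_edge_space_def target_def d e)
  have "alg_geom_edge_space G {u} = alg_geom_edge_space G {C.v}"
    by (simp add: alg_geom_edge_space_def e g)
  then have c: "path_cocycle G {u} = path_cocycle G {C.v}" "trivial_cocycle G {u} = trivial_cocycle G {C.v}"
    by (simp_all add: fun_eq_iff path_cocycle_def cocycle_def trivial_cocycle_def e g)
  show ?thesis
    unfolding g c using A.E2_invertible A.path_cocycles by blast
qed

end
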